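(* Let $\varepsilon>0$, let $a\in C^\infty(\mathbb S)$ be positive and let $\alpha\in C^\infty((-\varepsilon,\varepsilon),C^\infty(\mathbb S))$ with $\alpha_0=a$, every $\alpha_\tau$ positive and $\int_0^{2\pi}\alpha_\tau^{-1}d\theta=2\pi$. Let $\beta=\partial\alpha_\tau/\partial\tau|_{\tau=0}$ and let $g\in C^\infty(\mathbb S)$ be the unique function with $ag'-a'g=\beta$ and $\int_0^{2\pi}g\,d\theta=0$ (${}'=d/d\theta$). Then for every $z\in\mathbb C$, $$\frac{\partial}{\partial\tau}\big(\zeta_{\alpha_\tau}(z)-2\zeta_R(z)\big)\Big|_{\tau=0}=-iz\,\mathrm{Tr}\big[(\Lambda_a+P_0)^{-z+1}(I-P_0)a^{-1/2}[\mathcal H,g]a^{-1/2}\big],$$ where $[\mathcal H,g]=\mathcal Hg-g\mathcal H$. If in addition $g=i\mathcal Ha$ (equivalently $\beta=-a(\Lambda a)+(\mathcal Ha)(Da)$), then $$\frac{\partial}{\partial\tau}\big(\zeta_{\alpha_\tau}(z)-2\zeta_R(z)\big)\Big|_{\tau=0}=z\,\mathrm{Tr}\big[(\Lambda_a+P_0)^{-z-1}(\Lambda_a^2-D_a^2)\big].$$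
   Context: $D=-i\,d/d\theta$, $\Lambda e^{in\theta}=|n|e^{in\theta}$, Hilbert transform $\mathcal H\mathbf 1=0$, $\mathcal He^{in\theta}=\mathrm{sgn}(n)e^{in\theta}$ ($n\ne0$); functions act as multiplication operators. $\Lambda_a=a^{1/2}\Lambda a^{1/2}$, $D_a=a^{1/2}Da^{1/2}$. $P_0$ is the orthogonal projection in $L^2(\mathbb S)$ onto the span of $a^{-1/2}$. Complex powers of a positive self-adjoint operator with orthonormal eigenbasis $\{\varphi_k\}$ and eigenvalues $\mu_k>0$: $A^zf=\sum\mu_k^z\langle f,\varphi_k\rangle\varphi_k$. $\zeta_b$ is the Steklov zeta function of positive $b$: $\zeta_b(z)=\sum_{k\ge1}\lambda_k(b)^{-z}$ over the positive eigenvalues of $\Lambda_b$, meromorphically continued; $\zeta_b-2\zeta_R$ is entire, $\zeta_R$ the Riemann zeta function. *)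

theory Defs
  imports "HOL-Analysis.Analysis"
begin

text \<open>Functions on the circle S are 2pi-periodic functions real => complex (or real).
  Operators act on such functions.\<close>

type_synonym cfun = "real \<Rightarrow> complex"

definition vder :: "cfun \<Rightarrow> cfun" where
  "vder f = (\<lambda>\<theta>. vector_derivative f (at \<theta>))"

definition smooth_per :: "cfun \<Rightarrow> bool" where
  "smooth_per f \<longleftrightarrow> (\<forall>\<theta>. f (\<theta> + 2 * pi) = f \<theta>) \<and>
     (\<forall>n \<theta>. (vder ^^ n) f differentiable (at \<theta>))"

definition pd1 :: "(real \<Rightarrow> real \<Rightarrow> real) \<Rightarrow> real \<Rightarrow> real \<Rightarrow> real" where
  "pd1 f = (\<lambda>t x. deriv (\<lambda>s. f s x) t)"

definition pd2 :: "(real \<Rightarrow> real \<Rightarrow> real) \<Rightarrow> real \<Rightarrow> real \<Rightarrow> real" where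
  "pd2 f = (\<lambda>t x. deriv (\<lambda>y. f t y) x)"

definition pds :: "bool list \<Rightarrow> (real \<Rightarrow> real \<Rightarrow> real) \<Rightarrow> real \<Rightarrow> real \<Rightarrow> real" where
  "pds ws f = fold (\<lambda>w h. if w then pd1 h else pd2 h) ws f"

definition smooth2_on :: "(real \<times> real) set \<Rightarrow> (real \<Rightarrow> real \<Rightarrow> real) \<Rightarrow> bool" where
  "smooth2_on U f \<longleftrightarrow> (\<forall>ws. continuous_on U (\<lambda>(t, x). pds ws f t x) \<and>
     (\<forall>(t, x) \<in> U. (\<lambda>s. pds ws f s x) differentiable (at t) \<and>
                   (\<lambda>y. pds ws f t y) differentiable (at x)))"

definition l2inner :: "cfun \<Rightarrow> cfun \<Rightarrow> complex" where
  "l2inner f h = integral {0..2*pi} (\<lambda>\<theta>. f \<theta> * cnj (h \<theta>))"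

definition expi :: "int \<Rightarrow> cfun" where
  "expi n = (\<lambda>\<theta>. exp (\<i> * of_int n * of_real \<theta>))"

definition fcoeff :: "cfun \<Rightarrow> int \<Rightarrow> complex" where
  "fcoeff f n = integral {0..2*pi} (\<lambda>\<theta>. f \<theta> * exp (- \<i> * of_int n * of_real \<theta>)) / (2 * pi)"

definition Lam :: "cfun \<Rightarrow> cfun" where
  "Lam f = (\<lambda>\<theta>. infsum (\<lambda>n::int. of_int \<bar>n\<bar> * fcoeff f n * expi n \<theta>) UNIV)"

definition Hilb :: "cfun \<Rightarrow> cfun" where
  "Hilb f = (\<lambda>\<theta>. infsum (\<lambda>n::int. of_int (sgn n) * fcoeff f n * expi n \<theta>) UNIV)"

definition Dop :: "cfun \<Rightarrow> cfun" where
  "Dop f = (\<lambda>\<theta>. - \<i> * vector_derivative f (at \<theta>))"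

definition mulop :: "cfun \<Rightarrow> cfun \<Rightarrow> cfun" where
  "mulop h f = (\<lambda>\<theta>. h \<theta> * f \<theta>)"

definition rsqrt :: "(real \<Rightarrow> real) \<Rightarrow> cfun" where
  "rsqrt b = (\<lambda>\<theta>. complex_of_real (sqrt (b \<theta>)))"

definition rinvsqrt :: "(real \<Rightarrow> real) \<Rightarrow> cfun" where
  "rinvsqrt b = (\<lambda>\<theta>. complex_of_real (1 / sqrt (b \<theta>)))"

definition Lam_w :: "(real \<Rightarrow> real) \<Rightarrow> cfun \<Rightarrow> cfun" where
  "Lam_w b f = mulop (rsqrt b) (Lam (mulop (rsqrt b) f))"

definition D_w :: "(real \<Rightarrow> real) \<Rightarrow> cfun \<Rightarrow> cfun" where
  "D_w b f = mulop (rsqrt b) (Dop (mulop (rsqrt b) f))"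

definition P0 :: "(real \<Rightarrow> real) \<Rightarrow> cfun \<Rightarrow> cfun" where
  "P0 a f = (\<lambda>\<theta>. l2inner f (rinvsqrt a) / l2inner (rinvsqrt a) (rinvsqrt a) * rinvsqrt a \<theta>)"

text \<open>An orthonormal basis of L^2(S) consisting of (smooth) eigenfunctions of A with
  eigenvalues mu. Completeness is expressed by Parseval's identity on smooth functions
  (which are dense in L^2).\<close>
definition eigenbasis :: "(cfun \<Rightarrow> cfun) \<Rightarrow> (nat \<Rightarrow> cfun) \<Rightarrow> (nat \<Rightarrow> real) \<Rightarrow> bool" where
  "eigenbasis A \<phi> \<mu> \<longleftrightarrow>
     (\<forall>k. smooth_per (\<phi> k)) \<and>
     (\<forall>k. A (\<phi> k) = (\<lambda>\<theta>. complex_of_real (\<mu> k) * \<phi> k \<theta>)) \<and>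
     (\<forall>j k. l2inner (\<phi> j) (\<phi> k) = (if j = k then 1 else 0)) \<and>
     (\<forall>f. smooth_per f \<longrightarrow>
        ((\<lambda>k. (cmod (l2inner f (\<phi> k)))\<^sup>2) has_sum Re (l2inner f f)) UNIV)"

definition op_pow :: "(cfun \<Rightarrow> cfun) \<Rightarrow> complex \<Rightarrow> cfun \<Rightarrow> cfun" where
  "op_pow A w f =
     (let p = (SOME p. eigenbasis A (fst p) (snd p) \<and> (\<forall>k. snd p k > 0)) in
      (\<lambda>\<theta>. infsum (\<lambda>k. complex_of_real (snd p k) powr w * l2inner f (fst p k) * fst p k \<theta>) UNIV))"

definition op_trace :: "(cfun \<Rightarrow> cfun) \<Rightarrow> complex" where
  "op_trace T = infsum (\<lambda>n::int.
      l2inner (T (\<lambda>\<theta>. expi n \<theta> / of_real (sqrt (2*pi)))) (\<lambda>\<theta>. expi n \<theta> / of_real (sqrt (2*pi)))) UNIV"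

definition steklov_ev :: "(real \<Rightarrow> real) \<Rightarrow> (nat \<Rightarrow> cfun) \<times> (nat \<Rightarrow> real)" where
  "steklov_ev b = (SOME p. eigenbasis (Lam_w b) (fst p) (snd p))"

definition zeta_minus_2R :: "(real \<Rightarrow> real) \<Rightarrow> complex \<Rightarrow> complex" where
  "zeta_minus_2R b = (THE F. F holomorphic_on UNIV \<and>
     (\<forall>z. 1 < Re z \<longrightarrow>
        F z = infsum (\<lambda>j. complex_of_real (snd (steklov_ev b) j) powr (- z))
                     {j. snd (steklov_ev b) j > 0}
              - 2 * infsum (\<lambda>n::nat. of_nat n powr (- z)) {1..}))"

end

theory Submission
  imports Defs "HOL-Complex_Analysis.Complex_Analysis"
begin

text \<open>Let \<open>s\<close> be the arc length parameter with \<open>s' = 1/\<alpha>\<close>, normalised modulo a constant linear in \<open>\<tau>\<close>, and expand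
  \<open>\<alpha>\<^sup>1\<^sup>/\<^sup>2 f\<close> in the exponentials \<open>E\<^sub>n = e\<^sup>i\<^sup>n\<^sup>s\<close>. In this basis \<open>\<Lambda>\<^sub>\<alpha>\<close> is \<open>diag |n|\<close> plus a
  Hermitian matrix \<open>K\<^sub>\<tau>\<close> which decays rapidly in both indices (nonstationary phase) and is differentiable in \<open>\<tau>\<close>.
  For two such operators with eigenvalues \<open>\<mu>\<^sub>j\<close>, \<open>\<nu>\<^sub>k\<close> and overlaps \<open>u\<^sub>j\<^sub>k\<close> the difference of the zeta functions is the entire function
  \<open>\<Sum> (\<mu>\<^sub>j\<^sup>-\<^sup>z - \<nu>\<^sub>k\<^sup>-\<^sup>z) |u\<^sub>j\<^sub>k|\<^sup>2\<close>, because \<open>(\<mu>\<^sub>j - \<nu>\<^sub>k) u\<^sub>j\<^sub>k\<close> is a matrix entry of the difference of the \<open>K\<close>'s.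
  Comparison with \<open>K = 0\<close> removes \<open>2 \<zeta>\<^sub>R\<close>; comparison with \<open>\<tau> = 0\<close> gives the first order perturbation formula
  \<open>- z \<Sum> \<nu>\<^sub>k\<^sup>-\<^sup>z\<^sup>-\<^sup>1 <K' \<psi>\<^sub>k, \<psi>\<^sub>k>\<close>. The matrix of \<open>K'\<close> is \<open>- \<i> m n\<close> times that of \<open>a\<^sup>-\<^sup>1\<^sup>/\<^sup>2 [H, g] a\<^sup>-\<^sup>1\<^sup>/\<^sup>2\<close>,
  and \<open>D = H \<Lambda>\<close> turns the two factors \<open>m\<close>, \<open>n\<close> into \<open>\<nu>\<^sub>k\<^sup>2\<close>, which gives the trace.\<close>

text \<open>The eigenbases behind \<open>zeta_minus_2R\<close> and \<open>op_pow\<close> are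
  arbitrary choices, made separately for every \<tau>, and eigenvalues may be multiple. So no
  eigenvalue is followed as a function of \<tau>; only overlaps of two complete systems enter. The
  price is uniformity in \<tau>: of the spectral gap, of all moments of the eigenvectors, and of a
  remainder quadratic in \<tau>. The matrix K decays because the form of D is diagonal in every
  coordinate: subtracting sgn(n) times it from the form of Lambda leaves only ordinary Fourier modes
  p of sign opposite to n, for which the phase n s - p theta has no critical point. The kernel of
  Lambda_a is simple. Adding P_0 moves its eigenvalue to 1, and the reference operator |n| gets the
  value 1 at n = 0 as well; powers then exist for all exponents and the two ones cancel. The
  constant linear in \<tau> is chosen such that ds/d\<tau> = - g/a at \<tau> = 0. To first order the
  exponentials then move along the vector field g, and since |p| = sgn(p) p, the derivative of the
  form of Lambda becomes the commutator of H and g.\<close>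

definition br :: "int => real" where
  "br m = 1 + \<bar>real_of_int m\<bar>"

lemma br_ge_1: "br m \<ge> 1"
  by (simp add: br_def)

lemma br_pos [simp]: "br m > 0"
  by (simp add: br_def add_pos_nonneg)

lemma br_nonzero [simp]: "br m \<noteq> 0"
  using br_pos[of m] by linarith

lemma br_power_ge_1: "br m ^ N \<ge> 1"
  using br_ge_1 by (simp add: one_le_power)

section \<open>Unconditional sums: comparison, Cauchy-Schwarz, dominated limits, termwise
  integration\<close>

lemma summable_on_int_iff_nat:
  fixes f :: "int => real"
  assumes "(%n::nat. f (int n)) summable_on UNIV" "(%n::nat. f (- int n)) summable_on UNIV"
  shows "f summable_on UNIV"
proof -
  have "f summable_on (range int)"
    using assms(1) by (subst summable_on_reindex) (auto simp: o_def)
  moreover have "f summable_on (range (%n. - int n))"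
    using assms(2) by (subst summable_on_reindex) (auto simp: o_def inj_def)
  ultimately have "f summable_on (range int \<union> range (%n. - int n))"
    by (rule summable_on_union)
  moreover have "range int \<union> range (%n. - int n) = UNIV"
    by (auto simp: image_iff) (metis nonneg_int_cases nle_le neg_0_le_iff_le minus_minus)
  ultimately show ?thesis by simp
qed

lemma summable_br2: "(%m. 1 / br m ^ 2) summable_on UNIV"
proof (rule summable_on_int_iff_nat)
  have *: "(%n::nat. 1 / (1 + real n) ^ 2) summable_on UNIV"
    using summable_nonneg_imp_summable_on[of "%n::nat. 1 / (1 + real n) ^ 2"]
      inverse_squares_sums by (simp add: sums_iff add.commute)
  show "(%n::nat. 1 / br (int n) ^ 2) summable_on UNIV"
    "(%n::nat. 1 / br (- int n) ^ 2) summable_on UNIV"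
    using * by (simp_all add: br_def)
qed

definition brsum :: real where
  "brsum = infsum (%m. 1 / br m ^ 2) UNIV"

lemma brsum_nonneg: "brsum \<ge> 0"
  unfolding brsum_def by (rule infsum_nonneg) auto

lemma inverse_br_power_le: "M <= N ==> 1 / br m ^ N <= 1 / br m ^ M"
  by (intro divide_left_mono power_increasing br_ge_1) auto

lemma summable_on_times:
  fixes f :: "'a => real" and g :: "'b => real"
  assumes "f summable_on A" "g summable_on B" "!!x. x \<in> A ==> f x \<ge> 0" "!!x. x \<in> B ==> g x \<ge> 0"
  shows "(%(x,y). f x * g y) summable_on (A \<times> B)"
    "infsum (%(x,y). f x * g y) (A \<times> B) = infsum f A * infsum g B"
proof -
  have 1: "((%y. (%(x,y). f x * g y) (x, y)) has_sum (f x * infsum g B)) B" for x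
    using assms by (simp add: has_sum_cmult_right)
  show *: "(%(x,y). f x * g y) summable_on (A \<times> B)"
    by (rule summable_on_SigmaI[OF 1]) (use assms in \<open>auto intro!: summable_on_cmult_left\<close>)
  have "infsum (%(x,y). f x * g y) (A \<times> B) = infsum (%x. infsum (%y. f x * g y) B) A"
    using infsum_Sigma'_banach[OF *] by simp
  also have "... = infsum f A * infsum g B"
    by (simp add: infsum_cmult_right' infsum_cmult_left')
  finally show "infsum (%(x,y). f x * g y) (A \<times> B) = infsum f A * infsum g B" .
qed

lemma summable_br_pair: "(%(m,n). 1 / (br m ^ 2 * br n ^ 2)) summable_on UNIV"
  and infsum_br_pair: "infsum (%(m,n). 1 / (br m ^ 2 * br n ^ 2)) UNIV = brsum\<^sup>2"
  using summable_on_times[OF summable_br2 summable_br2]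
  by (auto simp: brsum_def power2_eq_square case_prod_unfold)

lemma norm_infsum_le_infsum:
  fixes f :: "'a => 'b::banach"
  assumes "g summable_on A" "!!x. x \<in> A ==> norm (f x) <= g x"
  shows "f summable_on A" "norm (infsum f A) <= infsum g A"
proof -
  have "(%x. norm (f x)) summable_on A"
    by (rule Infinite_Sum.abs_summable_on_comparison_test'[OF assms])
  then show *: "f summable_on A"
    by (rule abs_summable_summable)
  show "norm (infsum f A) <= infsum g A"
    by (rule norm_infsum_le[OF has_sum_infsum[OF *] has_sum_infsum[OF assms(1)] assms(2)])
qed

lemma infsum_diff:
  fixes f g :: "'a => 'b::banach"
  assumes "f summable_on A" "g summable_on A"
  shows "(%x. f x - g x) summable_on A" "infsum (%x. f x - g x) A = infsum f A - infsum g A"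
proof -
  have "((%x. f x + - g x) has_sum (infsum f A + - infsum g A)) A"
    using assms by (intro has_sum_add) (simp_all add: has_sum_uminus)
  then show "(%x. f x - g x) summable_on A" "infsum (%x. f x - g x) A = infsum f A - infsum g A"
    by (auto simp: has_sum_iff)
qed

lemma nonneg_summable_onI:
  fixes f :: "'a => real"
  assumes "!!x. x \<in> A ==> f x \<ge> 0" "!!F. finite F ==> F \<subseteq> A ==> sum f F <= C"
  shows "f summable_on A" "infsum f A <= C"
proof -
  show *: "f summable_on A"
    by (rule nonneg_bdd_above_summable_on) (use assms in \<open>auto intro!: bdd_aboveI[where M=C]\<close>)
  show "infsum f A <= C"
    by (rule infsum_le_finite_sums[OF * assms(2)])
qed

text \<open>Every finite set of pairs lies in the rectangle of its two projections, so for
  nonnegative terms rectangular sums decide summability. The spectral estimates below come in this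
  rectangular form.\<close>

lemma nonneg_summable_pairI:
  fixes f :: "'a \<times> 'b => real"
  assumes "!!p. f p \<ge> 0" "!!J K. finite J ==> finite K ==> (\<Sum>j\<in>J. \<Sum>k\<in>K. f (j, k)) <= C"
  shows "f summable_on UNIV" "infsum f UNIV <= C"
proof -
  have *: "sum f F <= C" if "finite F" for F
  proof -
    have "sum f F <= sum f (fst ` F \<times> snd ` F)"
      by (rule sum_mono2) (use that assms(1) in \<open>force+\<close>)
    also have "... = (\<Sum>j\<in>fst ` F. \<Sum>k\<in>snd ` F. f (j, k))"
      by (simp add: sum.cartesian_product case_prod_unfold)
    also have "... <= C"
      by (rule assms(2)) (use that in auto)
    finally show ?thesis .
  qed
  show "f summable_on UNIV" "infsum f UNIV <= C"
    using nonneg_summable_onI[of UNIV f C] assms(1) * by auto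
qed

text \<open>Cauchy-Schwarz for the splitting of \<open>k i * |y i|\<close> into
  \<open>sqrt (k i)\<close> and \<open>sqrt (k i) * |y i|\<close>. Using the kernel itself as weight
  keeps it at first power next to the squares of \<open>y\<close>, the form into which Parseval sums
  can be inserted.\<close>

lemma weighted_cauchy_schwarz:
  fixes k y :: "'a => real"
  assumes "!!i. k i \<ge> 0" "k summable_on A" "(%i. k i * (y i)\<^sup>2) summable_on A"
  shows "(%i. k i * \<bar>y i\<bar>) summable_on A"
    "(infsum (%i. k i * \<bar>y i\<bar>) A)\<^sup>2 <= infsum k A * infsum (%i. k i * (y i)\<^sup>2) A"
proof -
  define C where "C = infsum k A * infsum (%i. k i * (y i)\<^sup>2) A"
  have C0: "C \<ge> 0" unfolding C_def
    by (intro mult_nonneg_nonneg infsum_nonneg) (use assms(1) in auto)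
  have *: "sum (%i. k i * \<bar>y i\<bar>) F <= sqrt C" if "finite F" "F \<subseteq> A" for F
  proof -
    have "(sum (%i. k i * \<bar>y i\<bar>) F)\<^sup>2 = (sum (%i. sqrt (k i) * (sqrt (k i) * \<bar>y i\<bar>)) F)\<^sup>2"
      using assms(1) by (simp flip: mult.assoc)
    also have "... <= (\<Sum>i\<in>F. (sqrt (k i))\<^sup>2) * (\<Sum>i\<in>F. (sqrt (k i) * \<bar>y i\<bar>)\<^sup>2)"
      by (rule Cauchy_Schwarz_ineq_sum)
    also have "... = sum k F * sum (%i. k i * (y i)\<^sup>2) F"
      using assms(1) by (simp add: power_mult_distrib)
    also have "... <= C" unfolding C_def
      by (intro mult_mono finite_sum_le_infsum sum_nonneg infsum_nonneg) (use assms that in auto)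
    finally show ?thesis
      by (rule real_le_rsqrt)
  qed
  note n = nonneg_summable_onI[of A "%i. k i * \<bar>y i\<bar>", OF _ *]
  show "(%i. k i * \<bar>y i\<bar>) summable_on A"
    by (rule n) (use assms in auto)
  have "infsum (%i. k i * \<bar>y i\<bar>) A <= sqrt C"
    by (rule n) (use assms in auto)
  moreover have "infsum (%i. k i * \<bar>y i\<bar>) A \<ge> 0"
    by (rule infsum_nonneg) (use assms in auto)
  ultimately have "(infsum (%i. k i * \<bar>y i\<bar>) A)\<^sup>2 <= (sqrt C)\<^sup>2"
    by (rule power_mono)
  then show "(infsum (%i. k i * \<bar>y i\<bar>) A)\<^sup>2 <= infsum k A * infsum (%i. k i * (y i)\<^sup>2) A"
    using C0 by (simp add: C_def)
qed

lemma norm_infsum_sq_le: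
  fixes k y :: "'a => complex"
  assumes "(%i. norm (k i)) summable_on A" "(%i. norm (k i) * (norm (y i))\<^sup>2) summable_on A"
  shows "(norm (infsum (%i. k i * y i) A))\<^sup>2
    <= infsum (%i. norm (k i)) A * infsum (%i. norm (k i) * (norm (y i))\<^sup>2) A"
proof -
  note w = weighted_cauchy_schwarz[of "%i. norm (k i)" A "%i. norm (y i)", OF _ assms]
  have "norm (infsum (%i. k i * y i) A) <= infsum (%i. norm (k i) * \<bar>norm (y i)\<bar>) A"
    by (rule norm_infsum_le_infsum(2)) (use w(1) in \<open>auto simp: norm_mult\<close>)
  then have "(norm (infsum (%i. k i * y i) A))\<^sup>2 <= (infsum (%i. norm (k i) * \<bar>norm (y i)\<bar>) A)\<^sup>2"
    by (rule power_mono) auto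
  also have "... <= infsum (%i. norm (k i)) A * infsum (%i. norm (k i) * (norm (y i))\<^sup>2) A"
    using w(2) by simp
  finally show ?thesis .
qed

text \<open>Weierstrass' test gives uniform convergence of the finite partial sums on the set
  \<open>Y\<close> where the majorant holds, and uniformity permits exchanging the two limits. The
  limit function inherits the majorant and is therefore summable.\<close>

lemma tendsto_infsum_dominated:
  fixes f :: "'a => 'b => 'c::banach"
  assumes "M summable_on A" "\<forall>\<^sub>F t in F. \<forall>x\<in>A. norm (f x t) <= M x"
    and "!!x. x \<in> A ==> (f x \<longlongrightarrow> l x) F"
  shows "((%t. infsum (%x. f x t) A) \<longlongrightarrow> infsum l A) F"
proof (cases "F = bot")
  case False
  define Y where "Y = {t. \<forall>x\<in>A. norm (f x t) <= M x}"
  have ul: "uniform_limit Y (%X y. \<Sum>x\<in>X. f x y) (%y. \<Sum>\<^sub>\<infinity>x\<in>A. f x y) (finite_subsets_at_top A)"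
    by (rule Weierstrass_m_test_general[OF _ assms(1)]) (auto simp: Y_def)
  have lM: "norm (l x) <= M x" if "x \<in> A" for x
    by (rule tendsto_upperbound[OF tendsto_norm[OF assms(3)[OF that]] _ False])
       (use assms(2) that in \<open>auto elim: eventually_mono\<close>)
  have sl: "l summable_on A"
    by (rule norm_infsum_le_infsum(1)[OF assms(1) lM])
  have Yev: "\<forall>\<^sub>F t in F. t \<in> Y"
    using assms(2) by (simp add: Y_def)
  show ?thesis
  proof (rule swap_uniform_limit')
    show "\<forall>\<^sub>F X in finite_subsets_at_top A. ((%y. \<Sum>x\<in>X. f x y) \<longlongrightarrow> sum l X) F"
      unfolding eventually_finite_subsets_at_top using assms(3)
      by (intro exI[of _ "{}"]) (auto intro!: tendsto_sum)
    show "(sum l \<longlongrightarrow> infsum l A) (finite_subsets_at_top A)"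
      using sl by (rule infsum_tendsto)
    show "uniform_limit Y (%X y. \<Sum>x\<in>X. f x y) (%y. \<Sum>\<^sub>\<infinity>x\<in>A. f x y) (finite_subsets_at_top A)"
      by (rule ul)
    show "\<forall>\<^sub>F t in F. t \<in> Y" by (rule Yev)
  qed (simp_all add: finite_subsets_at_top_neq_bot)
qed auto

lemma holomorphic_on_infsum:
  fixes f :: "'a => complex => complex"
  assumes "!!x. x \<in> A ==> f x holomorphic_on UNIV"
    and "!!r. \<exists>M. M summable_on A \<and> (\<forall>x\<in>A. \<forall>z\<in>cball 0 r. norm (f x z) <= M x)"
  shows "(%z. infsum (%x. f x z) A) holomorphic_on UNIV"
proof -
  have "(%z. infsum (%x. f x z) A) holomorphic_on ball 0 r" for r
  proof -
    obtain M where M: "M summable_on A" "!!x z. x \<in> A ==> z \<in> cball 0 r ==> norm (f x z) <= M x"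
      using assms(2)[of r] by blast
    have ul: "uniform_limit (cball 0 r) (%X z. \<Sum>x\<in>X. f x z) (%z. \<Sum>\<^sub>\<infinity>x\<in>A. f x z) (finite_subsets_at_top A)"
      by (rule Weierstrass_m_test_general[OF M(2) M(1)])
    have hol: "(%z. \<Sum>x\<in>X. f x z) holomorphic_on S" if "X \<subseteq> A" for X S
      using assms(1) that by (intro holomorphic_on_sum) (auto intro: holomorphic_on_subset)
    show ?thesis
      by (rule holomorphic_uniform_limit[OF _ ul])
         (auto simp: eventually_finite_subsets_at_top intro!: exI[of _ "{}"] hol holomorphic_on_imp_continuous_on)
  qed
  then have "(%z. infsum (%x. f x z) A) holomorphic_on (\<Union>r. ball 0 r)"
    by (subst holomorphic_on_open) (auto simp: holomorphic_on_open)
  moreover have "(\<Union>r. ball (0::complex) r) = UNIV"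
    by (auto simp: dist_norm intro: gt_ex)
  ultimately show ?thesis by simp
qed

lemma integral_infsum:
  fixes f :: "'a => real => complex"
  assumes "!!x. continuous_on {a..b} (f x)" "M summable_on A"
    and "!!x t. x \<in> A ==> t \<in> {a..b} ==> norm (f x t) <= M x"
  shows "((%x. integral {a..b} (f x)) has_sum integral {a..b} (%t. infsum (%x. f x t) A)) A"
    and "continuous_on {a..b} (%t. infsum (%x. f x t) A)"
proof -
  have ul: "uniform_limit {a..b} (%X t. \<Sum>x\<in>X. f x t) (%t. \<Sum>\<^sub>\<infinity>x\<in>A. f x t) (finite_subsets_at_top A)"
    by (rule Weierstrass_m_test_general[OF assms(3) assms(2)])
  have cont: "continuous_on {a..b} (%t. \<Sum>x\<in>X. f x t)" for X
    using assms(1) by (intro continuous_on_sum) auto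
  obtain I J where I: "!!X. ((%t. \<Sum>x\<in>X. f x t) has_integral I X) {a..b}"
    and J: "((%t. \<Sum>\<^sub>\<infinity>x\<in>A. f x t) has_integral J) {a..b}" and IJ: "(I \<longlongrightarrow> J) (finite_subsets_at_top A)"
    by (rule uniform_limit_integral[OF ul cont]) (auto simp: finite_subsets_at_top_neq_bot)
  \<comment> \<open>Infinite \<open>X\<close> is included: \<open>sum\<close> is 0 there, and so is
    the integral of the zero function. The identity is needed for all \<open>X\<close> in order to
    rewrite \<open>I\<close> as a function.\<close>
  have "I X = (\<Sum>x\<in>X. integral {a..b} (f x))" for X
  proof -
    have "integral {a..b} (%t. \<Sum>x\<in>X. f x t) = (\<Sum>x\<in>X. integral {a..b} (f x))" if "finite X"
      using assms(1) that by (intro integral_sum) (auto intro: integrable_continuous_interval)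
    then show ?thesis
      using I[of X] by (cases "finite X") (auto simp: integral_unique[symmetric] dest: integral_unique)
  qed
  then have "I = sum (%x. integral {a..b} (f x))" by auto
  then show "((%x. integral {a..b} (f x)) has_sum integral {a..b} (%t. infsum (%x. f x t) A)) A"
    using IJ J by (simp add: has_sum_def integral_unique)
  show "continuous_on {a..b} (%t. infsum (%x. f x t) A)"
    by (rule uniform_limit_theorem[OF _ ul]) (use cont in auto)
qed

section \<open>Complex powers along a segment of positive reals\<close>

text \<open>The bound uses the product of the end points because the weights
  \<open>(\<mu> j * \<nu> k) ^ P\<close> are what the overlap sums can absorb. As \<open>x\<close>,
  \<open>y\<close> and hence \<open>t\<close> are at least \<open>\<delta>\<close>, the number
  \<open>X\<close> is at least 1 and dominates \<open>t\<close>; negative exponents cost at most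
  \<open>1 / \<delta> ^ P\<close>.\<close>

lemma powr_le_on_segment:
  fixes x y t r \<delta> :: real
  assumes "0 < \<delta>" "\<delta> <= 1" "\<delta> <= x" "\<delta> <= y" "t \<in> closed_segment x y" "\<bar>r\<bar> <= real P"
  shows "t powr r <= (x * y) ^ P / \<delta> ^ (3 * P)"
proof -
  have t: "\<delta> <= t" "t <= max x y"
    using assms by (auto simp: closed_segment_eq_real_ivl split: if_splits)
  have "max x y * \<delta> <= x * y"
    using assms by (auto simp: max_def mult_left_mono mult.commute)
  then have "max x y <= x * y / \<delta>"
    using assms by (simp add: field_simps)
  with t have t2: "t <= x * y / \<delta>" by linarith
  define X where "X = x * y / \<delta>\<^sup>2"
  have "\<delta> * \<delta> <= x * y"
    using assms by (intro mult_mono) auto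
  then have X1: "X \<ge> 1"
    using assms by (simp add: X_def power2_eq_square)
  have "x * y * \<delta> <= x * y * 1"
    using assms by (intro mult_left_mono) auto
  then have "x * y / \<delta> <= X"
    using assms by (simp add: X_def power2_eq_square field_simps)
  with t2 have tX: "t <= X" by linarith
  have dP: "1 <= 1 / \<delta> ^ P"
    using assms by (simp add: power_le_one)
  \<comment> \<open>\<open>X ^ P\<close> contributes \<open>2 * P\<close> powers of
    \<open>\<delta>\<close> and the estimate for negative exponents another \<open>P\<close>; this
    is the origin of \<open>3 * P\<close>.\<close>
  have fin: "X ^ P * (1 / \<delta> ^ P) = (x * y) ^ P / \<delta> ^ (3 * P)"
    by (simp add: X_def power_divide flip: power_mult power_add)
  show ?thesis
  proof (cases "r \<ge> 0")
    case True
    have "t powr r <= X powr r"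
      using True t assms tX by (intro powr_mono2) auto
    also have "... <= X powr (real P)"
      using assms X1 by (intro powr_mono) auto
    also have "... = X ^ P"
      using X1 by (simp add: powr_realpow)
    also have "... <= X ^ P * (1 / \<delta> ^ P)"
      using mult_left_mono[OF dP, of "X ^ P"] X1 by simp
    finally show ?thesis using fin by simp
  next
    case False
    have "t powr r <= \<delta> powr r"
      using False t assms by (intro powr_mono2') auto
    also have "... <= \<delta> powr (- real P)"
      using assms False by (intro powr_mono') auto
    also have "... = 1 / \<delta> ^ P"
      using assms by (simp add: powr_minus powr_realpow divide_inverse)
    also have "... <= X ^ P * (1 / \<delta> ^ P)"
      using mult_right_mono[of 1 "X ^ P" "1 / \<delta> ^ P"] X1 assms by simp
    finally show ?thesis using fin by simp
  qed
qed

lemma norm_powr_diff_le: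
  fixes x y B :: real and w :: complex
  assumes "0 < x" "0 < y" "!!t. t \<in> closed_segment x y ==> t powr (Re w - 1) <= B"
  shows "norm (complex_of_real x powr w - complex_of_real y powr w) <= norm w * B * \<bar>x - y\<bar>"
proof -
  let ?S = "complex_of_real ` closed_segment x y"
  have pos: "t > 0" if "t \<in> closed_segment x y" for t
    using that assms by (auto simp: closed_segment_eq_real_ivl split: if_splits)
  have S: "?S = closed_segment (complex_of_real x) (complex_of_real y)"
    by (simp add: closed_segment_of_real)
  have "norm (complex_of_real x powr w - complex_of_real y powr w)
      <= norm w * B * norm (complex_of_real x - complex_of_real y)"
  proof (rule field_differentiable_bound[where S="?S" and f="%z. z powr w"
        and f'="%z. w * z powr (w - 1)"])
    show "convex ?S" by (simp add: S)
    fix z assume "z \<in> ?S"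
    then obtain t where t: "t \<in> closed_segment x y" "z = of_real t" by auto
    show "((%z. z powr w) has_field_derivative w * z powr (w - 1)) (at z within ?S)"
      by (rule has_field_derivative_at_within, rule has_field_derivative_powr)
         (use pos[OF t(1)] t in \<open>auto simp: complex_nonpos_Reals_iff\<close>)
    show "norm (w * z powr (w - 1)) <= norm w * B"
      using assms(3)[OF t(1)] pos[OF t(1)] t(2)
      by (auto simp: norm_mult norm_powr_real_powr intro!: mult_left_mono)
  qed auto
  also have "norm (complex_of_real x - complex_of_real y) = \<bar>x - y\<bar>"
    by (simp flip: of_real_diff)
  finally show ?thesis .
qed

text \<open>With the tangent at \<open>y\<close> subtracted, the derivative is \<open>w\<close>
  times a difference of powers with exponent \<open>w - 1\<close>, which
  \<open>norm_powr_diff_le\<close> bounds by a multiple of \<open>|x - y|\<close>. A second mean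
  value estimate gives the square, without the factor 1/2.\<close>

lemma norm_powr_taylor_le:
  fixes x y B :: real and w :: complex
  assumes "0 < x" "0 < y" "!!t. t \<in> closed_segment x y ==> t powr (Re w - 2) <= B"
  shows "norm (complex_of_real x powr w - complex_of_real y powr w
      - w * complex_of_real y powr (w - 1) * of_real (x - y)) <= norm w * norm (w - 1) * B * (x - y)\<^sup>2"
proof -
  let ?S = "complex_of_real ` closed_segment x y"
  let ?c = "w * complex_of_real y powr (w - 1)"
  have B0: "B \<ge> 0"
    using assms(3)[of x] by (meson ends_in_segment(1) order_trans powr_ge_zero)
  have pos: "t > 0" if "t \<in> closed_segment x y" for t
    using that assms by (auto simp: closed_segment_eq_real_ivl split: if_splits)
  have S: "?S = closed_segment (complex_of_real x) (complex_of_real y)"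
    by (simp add: closed_segment_of_real)
  let ?h = "%z::complex. z powr w - ?c * z"
  have "norm (?h (of_real x) - ?h (of_real y))
      <= norm w * norm (w - 1) * B * \<bar>x - y\<bar> * norm (complex_of_real x - complex_of_real y)"
  proof (rule field_differentiable_bound[where S="?S" and f="?h"
        and f'="%z. w * z powr (w - 1) - ?c"])
    show "convex ?S" by (simp add: S)
    fix z assume "z \<in> ?S"
    then obtain t where t: "t \<in> closed_segment x y" "z = of_real t" by auto
    have z: "z \<notin> \<real>\<^sub>\<le>\<^sub>0"
      using pos[OF t(1)] t by (auto simp: complex_nonpos_Reals_iff)
    show "(?h has_field_derivative w * z powr (w - 1) - ?c) (at z within ?S)"
      by (rule has_field_derivative_at_within, rule DERIV_diff[OF has_field_derivative_powr[OF z] DERIV_cmult_Id])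
    have sub: "closed_segment t y \<subseteq> closed_segment x y"
      using t(1) by (simp add: subset_closed_segment)
    have ty: "\<bar>t - y\<bar> <= \<bar>x - y\<bar>"
      using t(1) by (auto simp: closed_segment_eq_real_ivl split: if_splits)
    have "norm (complex_of_real t powr (w - 1) - complex_of_real y powr (w - 1))
        <= norm (w - 1) * B * \<bar>t - y\<bar>"
      by (rule norm_powr_diff_le) (use sub pos[OF t(1)] assms in auto)
    also have "... <= norm (w - 1) * B * \<bar>x - y\<bar>"
      using ty B0 by (intro mult_left_mono) auto
    finally have "norm w * norm (complex_of_real t powr (w - 1) - complex_of_real y powr (w - 1))
        <= norm w * (norm (w - 1) * B * \<bar>x - y\<bar>)"
      by (rule mult_left_mono) auto
    then show "norm (w * z powr (w - 1) - ?c) <= norm w * norm (w - 1) * B * \<bar>x - y\<bar>"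
      by (simp only: t(2) norm_mult mult.assoc flip: right_diff_distrib)
  qed auto
  also have "norm (complex_of_real x - complex_of_real y) = \<bar>x - y\<bar>"
    by (simp flip: of_real_diff)
  also have "?h (of_real x) - ?h (of_real y) = complex_of_real x powr w - complex_of_real y powr w
      - w * complex_of_real y powr (w - 1) * of_real (x - y)"
    by (simp add: algebra_simps)
  finally show ?thesis
    by (simp add: power2_eq_square mult.assoc)
qed

section \<open>Comparing two spectra through the overlaps of their eigenbases\<close>

text \<open>\<open>u j k\<close> stands for the inner products of two orthonormal bases;
  \<open>col\<close> and \<open>row\<close> are Parseval in both directions. \<open>hs\<close> says
  that the difference of the operators stays Hilbert-Schmidt when multiplied by powers of the
  operators on both sides, and \<open>nu2\<close> pays for replacing squares by first
  powers.\<close>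

locale spectral_pair =
  fixes \<mu> :: "'j => real" and \<nu> :: "'k => real" and u :: "'j => 'k => complex" and \<delta> :: real
  assumes \<delta>: "0 < \<delta>" "\<delta> <= 1"
    and \<mu>: "!!j. \<delta> <= \<mu> j" and \<nu>: "!!k. \<delta> <= \<nu> k"
    and col: "!!k. ((%j. (norm (u j k))\<^sup>2) has_sum 1) UNIV"
    and row: "!!j. ((%k. (norm (u j k))\<^sup>2) has_sum 1) UNIV"
    and hs: "!!P. (%(j,k). (\<mu> j * \<nu> k) ^ P * (\<mu> j - \<nu> k)\<^sup>2 * (norm (u j k))\<^sup>2) summable_on UNIV"
    and nu2: "(%k. 1 / (\<nu> k)\<^sup>2) summable_on UNIV"
begin

lemma \<mu>_pos: "\<mu> j > 0" and \<nu>_pos: "\<nu> k > 0"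
  using \<delta> \<mu>[of j] \<nu>[of k] by linarith+

lemma summable_col:
  fixes c :: "'k => real"
  assumes "c summable_on UNIV" "!!k. c k \<ge> 0"
  shows "(%(j,k). c k * (norm (u j k))\<^sup>2) summable_on UNIV"
proof -
  have "(%(k,j). c k * (norm (u j k))\<^sup>2) summable_on (UNIV \<times> UNIV)"
  proof (rule summable_on_SigmaI[where g=c])
    show "((%j. (%(k,j). c k * (norm (u j k))\<^sup>2) (k, j)) has_sum c k) UNIV" for k
      using has_sum_cmult_right[OF col[of k], of "c k"] by simp
  qed (use assms in auto)
  then show ?thesis
    by (subst (asm) summable_on_swap) simp
qed

text \<open>\<open>hs\<close> controls squares of differences only. The first power is reached
  through \<open>a * b <= a^2 + b^2\<close>, where \<open>b\<close> is the overlap divided by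
  \<open>\<nu> k\<close>, square summable by \<open>nu2\<close> and \<open>col\<close>.\<close>

lemma summable_weight: "(%(j,k). (\<mu> j * \<nu> k) ^ P * \<bar>\<mu> j - \<nu> k\<bar> * (norm (u j k))\<^sup>2) summable_on UNIV"
proof (rule summable_on_comparison_test)
  let ?A = "%(j,k). (1 / \<delta>\<^sup>2) * ((\<mu> j * \<nu> k) ^ (2 * P + 2) * (\<mu> j - \<nu> k)\<^sup>2 * (norm (u j k))\<^sup>2)"
  let ?B = "%(j,k). 1 / (\<nu> k)\<^sup>2 * (norm (u j k))\<^sup>2"
  have "?A summable_on UNIV"
    using summable_on_cmult_right[OF hs[of "2 * P + 2"], of "1 / \<delta>\<^sup>2"]
    by (simp add: case_prod_unfold)
  moreover have "?B summable_on UNIV"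
    by (rule summable_col[OF nu2]) auto
  ultimately show "(%p. ?A p + ?B p) summable_on UNIV"
    by (rule summable_on_add)
  fix p :: "'j \<times> 'k"
  obtain j k where p: "p = (j, k)" by (cases p)
  let ?a = "(\<mu> j * \<nu> k) ^ P * \<nu> k * \<bar>\<mu> j - \<nu> k\<bar> * norm (u j k)" and ?b = "norm (u j k) / \<nu> k"
  have "?a * ?b <= ?a\<^sup>2 + ?b\<^sup>2"
  proof -
    have "0 <= (?a - ?b)\<^sup>2 + ?a\<^sup>2 + ?b\<^sup>2" by simp
    then show ?thesis by (simp only: power2_diff)
  qed
  also have "?a * ?b = (\<mu> j * \<nu> k) ^ P * \<bar>\<mu> j - \<nu> k\<bar> * (norm (u j k))\<^sup>2"
    using \<nu>_pos[of k] by (simp add: power2_eq_square)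
  also have "?b\<^sup>2 = ?B p"
    by (simp add: p power_divide)
  also have "?a\<^sup>2 = (\<nu> k)\<^sup>2 * ((\<mu> j * \<nu> k) ^ (2 * P) * (\<mu> j - \<nu> k)\<^sup>2 * (norm (u j k))\<^sup>2)"
    by (simp add: power_mult_distrib mult_ac flip: power_mult)
  \<comment> \<open>The surplus square of \<open>\<nu> k\<close> is symmetrised to that of
    \<open>\<mu> j * \<nu> k\<close> by means of \<open>\<delta> <= \<mu> j\<close>; hence the
    exponent \<open>2 * P + 2\<close> in \<open>?A\<close>.\<close>
  also have "... <= ((\<mu> j * \<nu> k)\<^sup>2 / \<delta>\<^sup>2) * ((\<mu> j * \<nu> k) ^ (2 * P) * (\<mu> j - \<nu> k)\<^sup>2 * (norm (u j k))\<^sup>2)"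
  proof (rule mult_right_mono)
    have "(\<nu> k * \<delta>)\<^sup>2 <= (\<mu> j * \<nu> k)\<^sup>2"
      using \<delta> \<mu>[of j] \<nu>_pos[of k] by (intro power_mono) (auto simp: mult.commute intro!: mult_right_mono)
    then show "(\<nu> k)\<^sup>2 <= (\<mu> j * \<nu> k)\<^sup>2 / \<delta>\<^sup>2"
      using \<delta> by (simp add: field_simps power_mult_distrib)
  qed (use \<mu>_pos \<nu>_pos in \<open>auto intro!: mult_nonneg_nonneg less_imp_le\<close>)
  also have "... = ?A p"
    by (simp add: p power_add power2_eq_square)
  finally show "(%(j,k). (\<mu> j * \<nu> k) ^ P * \<bar>\<mu> j - \<nu> k\<bar> * (norm (u j k))\<^sup>2) p <= ?A p + ?B p"
    by (simp add: p)
  show "0 <= (%(j,k). (\<mu> j * \<nu> k) ^ P * \<bar>\<mu> j - \<nu> k\<bar> * (norm (u j k))\<^sup>2) p"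
    using less_imp_le[OF \<mu>_pos] less_imp_le[OF \<nu>_pos] by (auto simp: p)
qed

definition G :: "complex => complex" where
  "G z = infsum (%(j,k). (of_real (\<mu> j) powr (- z) - of_real (\<nu> k) powr (- z)) * of_real ((norm (u j k))\<^sup>2)) UNIV"

lemma G_term_bound:
  assumes "\<bar>Re z\<bar> + 1 <= real P"
  shows "norm ((of_real (\<mu> j) powr (- z) - of_real (\<nu> k) powr (- z)) * complex_of_real ((norm (u j k))\<^sup>2))
    <= norm z / \<delta> ^ (3 * P) * ((\<mu> j * \<nu> k) ^ P * \<bar>\<mu> j - \<nu> k\<bar> * (norm (u j k))\<^sup>2)"
proof -
  have "norm (complex_of_real (\<mu> j) powr (- z) - of_real (\<nu> k) powr (- z))
    <= norm (- z) * ((\<mu> j * \<nu> k) ^ P / \<delta> ^ (3 * P)) * \<bar>\<mu> j - \<nu> k\<bar>"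
    by (rule norm_powr_diff_le[OF \<mu>_pos \<nu>_pos], rule powr_le_on_segment[OF \<delta> \<mu> \<nu>]) (use assms in auto)
  then have "norm (complex_of_real (\<mu> j) powr (- z) - of_real (\<nu> k) powr (- z)) * (norm (u j k))\<^sup>2
    <= norm (- z) * ((\<mu> j * \<nu> k) ^ P / \<delta> ^ (3 * P)) * \<bar>\<mu> j - \<nu> k\<bar> * (norm (u j k))\<^sup>2"
    by (rule mult_right_mono) auto
  then show ?thesis
    by (simp add: norm_mult norm_power mult_ac)
qed

lemma summable_G:
  "(%(j,k). (of_real (\<mu> j) powr (- z) - of_real (\<nu> k) powr (- z)) * complex_of_real ((norm (u j k))\<^sup>2)) summable_on UNIV"
proof -
  obtain P :: nat where P: "\<bar>Re z\<bar> + 1 <= real P"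
    using real_arch_simple by blast
  show ?thesis
    by (rule norm_infsum_le_infsum(1)[OF summable_on_cmult_right[OF summable_weight[of P], of "norm z / \<delta> ^ (3 * P)"]])
       (use G_term_bound[OF P] in \<open>auto simp: case_prod_unfold\<close>)
qed

lemma G_holomorphic: "G holomorphic_on UNIV"
proof -
  have "(%z. infsum (%p. (%(j,k). (of_real (\<mu> j) powr (- z) - of_real (\<nu> k) powr (- z)) * complex_of_real ((norm (u j k))\<^sup>2)) p) UNIV) holomorphic_on UNIV"
  proof (rule holomorphic_on_infsum)
    show "(%z. (%(j,k). (of_real (\<mu> j) powr (- z) - of_real (\<nu> k) powr (- z)) * complex_of_real ((norm (u j k))\<^sup>2)) p) holomorphic_on UNIV" for p
      using \<mu>_pos \<nu>_pos by (cases p) (auto intro!: holomorphic_intros simp: less_imp_neq)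
    fix r :: real
    obtain P :: nat where P: "\<bar>r\<bar> + 1 <= real P"
      using real_arch_simple by blast
    let ?M = "%(j,k). \<bar>r\<bar> / \<delta> ^ (3 * P) * ((\<mu> j * \<nu> k) ^ P * \<bar>\<mu> j - \<nu> k\<bar> * (norm (u j k))\<^sup>2)"
    have "?M summable_on UNIV"
      using summable_on_cmult_right[OF summable_weight[of P], of "\<bar>r\<bar> / \<delta> ^ (3 * P)"]
      by (simp add: case_prod_unfold)
    moreover have "norm ((%(j,k). (of_real (\<mu> j) powr (- z) - of_real (\<nu> k) powr (- z)) * complex_of_real ((norm (u j k))\<^sup>2)) p) <= ?M p"
      if "z \<in> cball 0 r" for p z
    proof -
      obtain j k where p: "p = (j, k)" by (cases p)
      have z: "norm z <= \<bar>r\<bar>" using that by simp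
      have "\<bar>Re z\<bar> + 1 <= real P"
        using abs_Re_le_cmod[of z] z P by linarith
      from G_term_bound[OF this, of j k]
      have "norm ((of_real (\<mu> j) powr (- z) - of_real (\<nu> k) powr (- z)) * complex_of_real ((norm (u j k))\<^sup>2))
        <= norm z / \<delta> ^ (3 * P) * ((\<mu> j * \<nu> k) ^ P * \<bar>\<mu> j - \<nu> k\<bar> * (norm (u j k))\<^sup>2)" .
      also have "... <= \<bar>r\<bar> / \<delta> ^ (3 * P) * ((\<mu> j * \<nu> k) ^ P * \<bar>\<mu> j - \<nu> k\<bar> * (norm (u j k))\<^sup>2)"
        using z \<delta> \<mu>_pos[of j] \<nu>_pos[of k] by (intro mult_right_mono divide_right_mono) auto
      finally show ?thesis by (simp add: p)
    qed
    ultimately show "\<exists>M. M summable_on UNIV \<and> (\<forall>x\<in>UNIV. \<forall>z\<in>cball 0 r.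
       norm ((%(j,k). (of_real (\<mu> j) powr (- z) - of_real (\<nu> k) powr (- z)) * complex_of_real ((norm (u j k))\<^sup>2)) x) <= M x)"
      by blast
  qed
  then show ?thesis
    by (simp add: G_def[abs_def])
qed

text \<open>Where the double series of the \<open>\<nu>\<close> part converges absolutely,
  \<open>G\<close> may be split. Summing out the index that a power does not contain gives 1 by
  \<open>row\<close> or \<open>col\<close>, so the two spectral sums remain; convergence for
  \<open>\<mu>\<close> is a by-product.\<close>

lemma summable_powr:
  assumes "(%k. \<nu> k powr (- Re z)) summable_on UNIV"
  shows "(%j. \<mu> j powr (- Re z)) summable_on UNIV"
    and "infsum (%j. complex_of_real (\<mu> j) powr (- z)) UNIV
       - infsum (%k. complex_of_real (\<nu> k) powr (- z)) UNIV = G z"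
proof -
  have nb: "(%(j,k). complex_of_real (\<nu> k) powr (- w) * of_real ((norm (u j k))\<^sup>2)) summable_on UNIV"
    if "Re w = Re z" for w
    by (rule norm_infsum_le_infsum(1)[OF summable_col[OF assms]])
       (use \<nu>_pos that in \<open>auto simp: norm_mult norm_power norm_powr_real_powr less_imp_le\<close>)
  have mb: "(%(j,k). complex_of_real (\<mu> j) powr (- w) * of_real ((norm (u j k))\<^sup>2)) summable_on UNIV"
    if "Re w = Re z" for w
    using summable_on_add[OF summable_G[of w] nb[OF that]]
    by (simp add: case_prod_unfold algebra_simps)
  have inner: "infsum (%k. complex_of_real (\<mu> j) powr (- w) * of_real ((norm (u j k))\<^sup>2)) UNIV = of_real (\<mu> j) powr (- w)" for j w
    using has_sum_cmult_right[OF has_sum_of_real[OF row[of j]], of "of_real (\<mu> j) powr (- w)"]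
    by (simp add: infsumI)
  have inner': "infsum (%j. complex_of_real (\<nu> k) powr (- w) * of_real ((norm (u j k))\<^sup>2)) UNIV = of_real (\<nu> k) powr (- w)" for k w
    using has_sum_cmult_right[OF has_sum_of_real[OF col[of k]], of "of_real (\<nu> k) powr (- w)"]
    by (simp add: infsumI)
  have ms: "(%j. complex_of_real (\<mu> j) powr (- w)) summable_on UNIV" if "Re w = Re z" for w
    using summable_on_Sigma_banach[of "%j k. complex_of_real (\<mu> j) powr (- w) * of_real ((norm (u j k))\<^sup>2)" UNIV "%_. UNIV"] mb[OF that]
    by (simp add: inner del: of_real_power)
  have "(%j. norm (complex_of_real (\<mu> j) powr (- z))) summable_on UNIV"
    using ms[of z] by (simp add: summable_on_iff_abs_summable_on_complex)
  then show "(%j. \<mu> j powr (- Re z)) summable_on UNIV"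
    using \<mu>_pos by (simp add: norm_powr_real_powr less_imp_le)
  have "infsum (%j. complex_of_real (\<mu> j) powr (- z)) UNIV
      = infsum (%(j,k). complex_of_real (\<mu> j) powr (- z) * of_real ((norm (u j k))\<^sup>2)) UNIV"
    using infsum_Sigma'_banach[of "%j k. complex_of_real (\<mu> j) powr (- z) * of_real ((norm (u j k))\<^sup>2)" UNIV "%_. UNIV"] mb[of z]
    by (simp add: inner del: of_real_power)
  moreover have "infsum (%k. complex_of_real (\<nu> k) powr (- z)) UNIV
      = infsum (%(j,k). complex_of_real (\<nu> k) powr (- z) * of_real ((norm (u j k))\<^sup>2)) UNIV"
    using infsum_Sigma'_banach[of "%j k. complex_of_real (\<nu> k) powr (- z) * of_real ((norm (u j k))\<^sup>2)" UNIV "%_. UNIV"] nb[of z]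
      infsum_swap_banach[of "%j k. complex_of_real (\<nu> k) powr (- z) * of_real ((norm (u j k))\<^sup>2)" UNIV UNIV]
    by (simp add: inner' del: of_real_power)
  moreover have "infsum (%(j,k). complex_of_real (\<mu> j) powr (- z) * of_real ((norm (u j k))\<^sup>2)) UNIV
      = G z + infsum (%(j,k). complex_of_real (\<nu> k) powr (- z) * of_real ((norm (u j k))\<^sup>2)) UNIV"
    unfolding G_def using infsum_add[OF summable_G[of z] nb[of z]]
    by (simp add: case_prod_unfold algebra_simps)
  ultimately show "infsum (%j. complex_of_real (\<mu> j) powr (- z)) UNIV
       - infsum (%k. complex_of_real (\<nu> k) powr (- z)) UNIV = G z"
    by simp
qed

text \<open>The second order Taylor remainder is dominated by the weighted squares in
  \<open>hs\<close>, which are quadratic in the perturbation. In the linear term the inner sum over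
  \<open>j\<close> is, for overlaps of eigenbases, the diagonal entry of the difference of the
  operators at the \<open>k\<close>-th vector; no derivative of an eigenvalue or eigenvector is
  taken.\<close>

lemma G_first_order:
  assumes "\<bar>Re z\<bar> + 2 <= real P"
  shows "norm (G z - infsum (%k. - z * of_real (\<nu> k) powr (- z - 1)
        * infsum (%j. of_real ((\<mu> j - \<nu> k) * (norm (u j k))\<^sup>2)) UNIV) UNIV)
    <= norm z * norm (z + 1) / \<delta> ^ (3 * P)
      * infsum (%(j,k). (\<mu> j * \<nu> k) ^ P * (\<mu> j - \<nu> k)\<^sup>2 * (norm (u j k))\<^sup>2) UNIV"
proof -
  let ?L = "%j k. - z * complex_of_real (\<nu> k) powr (- z - 1) * of_real ((\<mu> j - \<nu> k) * (norm (u j k))\<^sup>2)"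
  let ?T = "%j k. (of_real (\<mu> j) powr (- z) - of_real (\<nu> k) powr (- z)) * complex_of_real ((norm (u j k))\<^sup>2)"
  let ?C = "norm z * norm (z + 1) / \<delta> ^ (3 * P)"
  let ?Q = "%j k. (\<mu> j * \<nu> k) ^ P * (\<mu> j - \<nu> k)\<^sup>2 * (norm (u j k))\<^sup>2"
  have Ls: "(%(j,k). ?L j k) summable_on UNIV"
  proof (rule norm_infsum_le_infsum(1)[OF summable_on_cmult_right[OF summable_weight[of P], of "norm z / \<delta> ^ (3 * P)"]])
    fix p :: "'j \<times> 'k"
    obtain j k where p: "p = (j, k)" by (cases p)
    have "\<nu> k powr (- Re z - 1) <= (\<mu> j * \<nu> k) ^ P / \<delta> ^ (3 * P)"
      by (rule powr_le_on_segment[OF \<delta> \<mu> \<nu>]) (use assms in auto)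
    then have "norm z * \<nu> k powr (- Re z - 1) * (\<bar>\<mu> j - \<nu> k\<bar> * (norm (u j k))\<^sup>2)
        <= norm z * ((\<mu> j * \<nu> k) ^ P / \<delta> ^ (3 * P)) * (\<bar>\<mu> j - \<nu> k\<bar> * (norm (u j k))\<^sup>2)"
      by (intro mult_right_mono mult_left_mono) auto
    then show "norm ((%(j,k). ?L j k) p) <= norm z / \<delta> ^ (3 * P) * (%(j,k). (\<mu> j * \<nu> k) ^ P * \<bar>\<mu> j - \<nu> k\<bar> * (norm (u j k))\<^sup>2) p"
      using \<nu>_pos[of k] by (simp add: p norm_mult norm_power norm_powr_real_powr abs_mult mult_ac flip: of_real_diff)
  qed
  have "infsum (%(j,k). ?L j k) UNIV = infsum (%j. infsum (%k. ?L j k) UNIV) UNIV"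
    by (rule infsum_Sigma'_banach[of ?L UNIV "%_. UNIV", unfolded UNIV_Times_UNIV, symmetric, OF Ls])
  also have "... = infsum (%k. infsum (%j. ?L j k) UNIV) UNIV"
    by (rule infsum_swap_banach) (use Ls in \<open>simp only: UNIV_Times_UNIV\<close>)
  finally have Lsum: "infsum (%(j,k). ?L j k) UNIV = infsum (%k. - z * of_real (\<nu> k) powr (- z - 1)
        * infsum (%j. of_real ((\<mu> j - \<nu> k) * (norm (u j k))\<^sup>2)) UNIV) UNIV"
    by (simp only: infsum_cmult_right')
  have "norm (infsum (%p. (%(j,k). ?T j k) p - (%(j,k). ?L j k) p) UNIV) <= infsum (%p. ?C * (%(j,k). ?Q j k) p) UNIV"
  proof (rule norm_infsum_le_infsum(2)[OF summable_on_cmult_right[OF hs]])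
    fix p :: "'j \<times> 'k"
    obtain j k where p: "p = (j, k)" by (cases p)
    have "norm (complex_of_real (\<mu> j) powr (-z) - complex_of_real (\<nu> k) powr (-z)
      - (-z) * complex_of_real (\<nu> k) powr (-z - 1) * of_real (\<mu> j - \<nu> k)) <= norm (-z) * norm (-z - 1) * ((\<mu> j * \<nu> k) ^ P / \<delta> ^ (3 * P)) * (\<mu> j - \<nu> k)\<^sup>2"
      by (rule norm_powr_taylor_le[OF \<mu>_pos \<nu>_pos], rule powr_le_on_segment[OF \<delta> \<mu> \<nu>]) (use assms in auto)
    then have "norm (complex_of_real (\<mu> j) powr (-z) - complex_of_real (\<nu> k) powr (-z)
      - (-z) * complex_of_real (\<nu> k) powr (-z - 1) * of_real (\<mu> j - \<nu> k)) * (norm (u j k))\<^sup>2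
       <= norm (-z) * norm (-z - 1) * ((\<mu> j * \<nu> k) ^ P / \<delta> ^ (3 * P)) * (\<mu> j - \<nu> k)\<^sup>2 * (norm (u j k))\<^sup>2"
      by (rule mult_right_mono) auto
    moreover have "norm (- z - 1) = norm (z + 1)"
      using norm_minus_cancel[of "z + 1"] by simp
    moreover have "?T j k - ?L j k = (complex_of_real (\<mu> j) powr (-z) - complex_of_real (\<nu> k) powr (-z)
      - (-z) * complex_of_real (\<nu> k) powr (-z - 1) * of_real (\<mu> j - \<nu> k)) * of_real ((norm (u j k))\<^sup>2)"
      by (simp add: algebra_simps)
    ultimately show "norm ((%(j,k). ?T j k) p - (%(j,k). ?L j k) p) <= ?C * (%(j,k). ?Q j k) p"
      by (simp add: p norm_mult norm_power mult_ac)
  qed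
  also have "infsum (%p. ?C * (%(j,k). ?Q j k) p) UNIV = ?C * infsum (%(j,k). ?Q j k) UNIV"
    by (rule infsum_cmult_right')
  also have "infsum (%p. (%(j,k). ?T j k) p - (%(j,k). ?L j k) p) UNIV = G z - infsum (%(j,k). ?L j k) UNIV"
    unfolding G_def by (rule infsum_diff(2)[OF summable_G Ls])
  finally show ?thesis
    unfolding Lsum .
qed

end

section \<open>Rapidly decreasing sequences and matrices over the integers\<close>

definition rapid_seq :: "(int => complex) => bool" where
  "rapid_seq x \<longleftrightarrow> (\<forall>N. \<exists>C. \<forall>m. norm (x m) <= C / br m ^ N)"

text \<open>The constants are a parameter rather than existentially quantified: one
  \<open>\<kappa>\<close> must serve all \<tau> at once, and for differences it is scaled by the
  size of \<tau>.\<close>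

definition rapid_mat :: "(nat => real) => (int => int => complex) => bool" where
  "rapid_mat \<kappa> K \<longleftrightarrow> (\<forall>N m n. norm (K m n) <= \<kappa> N / (br m ^ N * br n ^ N))"

definition sip :: "(int => complex) => (int => complex) => complex" where
  "sip x y = infsum (%m. x m * cnj (y m)) UNIV"

definition mv :: "(int => int => complex) => (int => complex) => int => complex" where
  "mv K x = (%m. infsum (%l. K m l * x l) UNIV)"

definition unit_seq :: "int => int => complex" where
  "unit_seq m = (%l. if l = m then 1 else 0)"

lemma rapid_seqD:
  assumes "rapid_seq x"
  obtains C where "C \<ge> 0" "!!m. norm (x m) * br m ^ N <= C"
proof -
  obtain C where C: "!!m. norm (x m) <= C / br m ^ N"
    using assms unfolding rapid_seq_def by blast
  have *: "norm (x m) * br m ^ N <= C" for m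
    using C[of m] by (simp add: field_simps)
  moreover have "C \<ge> 0"
    using *[of 0] by (meson mult_nonneg_nonneg norm_ge_zero order_trans zero_le_power br_pos less_imp_le)
  ultimately show ?thesis using that by blast
qed

lemma rapid_seq_bounded:
  assumes "rapid_seq x"
  obtains C where "C \<ge> 0" "!!m. norm (x m) <= C"
  using rapid_seqD[OF assms, of 0] that by (metis mult.right_neutral power_0)

lemma rapid_seq_summable:
  assumes "rapid_seq x"
  shows "(%m. br m ^ N * norm (x m)) summable_on UNIV"
proof -
  obtain C where C: "!!m. norm (x m) * br m ^ (N + 2) <= C"
    using rapid_seqD[OF assms] by metis
  show ?thesis
  proof (rule summable_on_comparison_test[OF summable_on_cmult_right[OF summable_br2, of C]])
    fix m
    have "br m ^ N * norm (x m) * br m ^ 2 <= C"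
      using C[of m] unfolding power_add by (simp only: mult_ac)
    then show "br m ^ N * norm (x m) <= C * (1 / br m ^ 2)"
      by (simp add: field_simps)
  qed (auto simp: less_imp_le)
qed

lemma rapid_seq_poly_mult:
  assumes "rapid_seq x" "!!m. norm (p m) <= C * br m ^ N"
  shows "rapid_seq (%m. p m * x m)"
  unfolding rapid_seq_def
proof
  fix M
  obtain B where B: "B \<ge> 0" "!!m. norm (x m) * br m ^ (N + M) <= B"
    using rapid_seqD[OF assms(1)] by metis
  have C0: "C \<ge> 0"
    using assms(2)[of 0] by (simp add: br_def) (meson norm_ge_zero order_trans)
  have "norm (p m * x m) <= C * B / br m ^ M" for m
  proof -
    have "norm (p m * x m) * br m ^ M <= C * br m ^ N * norm (x m) * br m ^ M"
      by (intro mult_right_mono) (use assms(2) in \<open>auto simp: norm_mult less_imp_le intro!: mult_right_mono\<close>)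
    also have "... = C * (norm (x m) * br m ^ (N + M))"
      by (simp add: power_add mult_ac)
    also have "... <= C * B"
      by (rule mult_left_mono[OF B(2) C0])
    finally show ?thesis by (simp add: field_simps)
  qed
  then show "\<exists>C. \<forall>m. norm (p m * x m) <= C / br m ^ M" by blast
qed

lemma rapid_seq_add:
  assumes "rapid_seq x" "rapid_seq y"
  shows "rapid_seq (%m. x m + y m)"
  unfolding rapid_seq_def
proof
  fix N
  obtain C D where "!!m. norm (x m) <= C / br m ^ N" "!!m. norm (y m) <= D / br m ^ N"
    using assms unfolding rapid_seq_def by metis
  then have "norm (x m + y m) <= (C + D) / br m ^ N" for m
    by (metis add_divide_distrib add_mono norm_triangle_le)
  then show "\<exists>C. \<forall>m. norm (x m + y m) <= C / br m ^ N" by blast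
qed

lemma rapid_seq_scale: "rapid_seq x ==> rapid_seq (%m. c * x m)"
  by (rule rapid_seq_poly_mult[where C="norm c" and N=0]) auto

lemma rapid_seq_unit: "rapid_seq (unit_seq m)"
  unfolding rapid_seq_def
proof
  fix N
  show "\<exists>C. \<forall>l. norm (unit_seq m l) <= C / br l ^ N"
    by (rule exI[of _ "br m ^ N"]) (auto simp: unit_seq_def less_imp_le)
qed

lemma sip_unit_left: "sip (unit_seq m) x = cnj (x m)"
proof -
  have "sip (unit_seq m) x = infsum (%l. unit_seq m l * cnj (x l)) {m}"
    unfolding sip_def by (rule infsum_cong_neutral) (auto simp: unit_seq_def)
  then show ?thesis by (simp add: unit_seq_def)
qed

lemma sip_cnj: "sip y x = cnj (sip x y)"
  unfolding sip_def by (simp add: mult.commute flip: infsum_cnj)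

lemma infsum_complex_of_real: "infsum (%x. complex_of_real (f x)) A = of_real (infsum f A)"
proof (cases "f summable_on A")
  case True
  then show ?thesis by (intro infsumI has_sum_of_real has_sum_infsum)
next
  case False
  then have "\<not> (%x. complex_of_real (f x)) summable_on A"
    using summable_on_Re by fastforce
  with False show ?thesis by (simp add: infsum_not_exists)
qed

lemma sip_self: "sip x x = of_real (infsum (%m. (norm (x m))\<^sup>2) UNIV)"
  unfolding sip_def complex_norm_square[symmetric] by (rule infsum_complex_of_real)

lemma norm_sip_commute: "norm (sip y x) = norm (sip x y)"
  by (subst sip_cnj) simp

lemma sip_summable:
  assumes "rapid_seq x" "!!m. norm (y m) <= B"
  shows "(%m. x m * cnj (y m)) summable_on UNIV"
proof -
  have "(%m. B * norm (x m)) summable_on UNIV"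
    using summable_on_cmult_right[OF rapid_seq_summable[OF assms(1), of 0], of B] by simp
  then show ?thesis
    by (rule norm_infsum_le_infsum(1))
       (use assms(2) in \<open>auto simp: norm_mult mult.commute[of B] intro!: mult_left_mono\<close>)
qed

lemma sip_summable_rapid:
  assumes "rapid_seq x" "rapid_seq y"
  shows "(%m. x m * cnj (y m)) summable_on UNIV"
  using rapid_seq_bounded[OF assms(2)] sip_summable[OF assms(1)] by metis

lemma sip_add_left:
  assumes "rapid_seq x" "rapid_seq x'" "rapid_seq y"
  shows "sip (%m. x m + x' m) y = sip x y + sip x' y"
  unfolding sip_def using infsum_add[OF sip_summable_rapid[OF assms(1,3)] sip_summable_rapid[OF assms(2,3)]]
  by (simp add: algebra_simps)

lemma sip_scale_left: "sip (%m. c * x m) y = c * sip x y"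
  unfolding sip_def by (simp add: mult.assoc infsum_cmult_right')

lemma sip_add_right:
  assumes "rapid_seq x" "rapid_seq y" "rapid_seq y'"
  shows "sip x (%m. y m + y' m) = sip x y + sip x y'"
  using sip_add_left[OF assms(2,3,1)] sip_cnj by (metis complex_cnj_add)

lemma sip_scale_right: "sip x (%m. c * y m) = cnj c * sip x y"
  using sip_scale_left[of c y x] sip_cnj by (metis complex_cnj_mult)

lemma rapid_mat_nonneg: "rapid_mat \<kappa> K ==> \<kappa> N \<ge> 0"
proof -
  assume "rapid_mat \<kappa> K"
  then have "norm (K 0 0) <= \<kappa> N / (br 0 ^ N * br 0 ^ N)"
    unfolding rapid_mat_def by blast
  then show ?thesis by (simp add: br_def) (meson norm_ge_zero order_trans)
qed

text \<open>Two of the available powers are spent on a summable factor in each index; this is where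
  the shift \<open>M + 2\<close> in later constants comes from.\<close>

lemma rapid_mat_le:
  assumes "rapid_mat \<kappa> K"
  shows "norm (K m n) * (br m ^ M * br n ^ M) <= \<kappa> (M + 2) * (1 / (br m ^ 2 * br n ^ 2))"
proof -
  have "norm (K m n) <= \<kappa> (M + 2) / (br m ^ (M + 2) * br n ^ (M + 2))"
    using assms unfolding rapid_mat_def by blast
  then have "norm (K m n) * (br m ^ (M + 2) * br n ^ (M + 2)) <= \<kappa> (M + 2)"
    by (simp add: field_simps)
  then show ?thesis
    by (simp add: field_simps power_add power2_eq_square)
qed

lemma rapid_mat_row:
  assumes "rapid_mat \<kappa> K"
  shows "(%l. norm (K m l) * br l ^ M) summable_on UNIV"
    "infsum (%l. norm (K m l) * br l ^ M) UNIV <= \<kappa> (M + 2) * brsum / br m ^ M"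
proof -
  have le: "norm (K m l) * br l ^ M <= \<kappa> (M + 2) / br m ^ M * (1 / br l ^ 2)" for l
  proof -
    have "norm (K m l) * (br m ^ M * br l ^ M) <= \<kappa> (M + 2) * (1 / (br m ^ 2 * br l ^ 2))"
      by (rule rapid_mat_le[OF assms])
    also have "... <= \<kappa> (M + 2) * (1 / br l ^ 2)"
      using rapid_mat_nonneg[OF assms] br_power_ge_1[of m 2]
      by (intro mult_left_mono divide_left_mono) (auto simp: less_imp_le)
    finally show ?thesis by (simp add: field_simps)
  qed
  have s: "(%l. \<kappa> (M + 2) / br m ^ M * (1 / br l ^ 2)) summable_on UNIV"
    by (rule summable_on_cmult_right[OF summable_br2])
  show *: "(%l. norm (K m l) * br l ^ M) summable_on UNIV"
    by (rule summable_on_comparison_test[OF s le]) (auto simp: less_imp_le)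
  have "infsum (%l. norm (K m l) * br l ^ M) UNIV <= infsum (%l. \<kappa> (M + 2) / br m ^ M * (1 / br l ^ 2)) UNIV"
    by (rule infsum_mono[OF * s le])
  also have "... = \<kappa> (M + 2) / br m ^ M * brsum"
    unfolding brsum_def by (rule infsum_cmult_right')
  finally show "infsum (%l. norm (K m l) * br l ^ M) UNIV <= \<kappa> (M + 2) * brsum / br m ^ M"
    by simp
qed

lemma mv_summable:
  assumes "rapid_mat \<kappa> K" "!!l. norm (x l) <= B"
  shows "(%l. K m l * x l) summable_on UNIV"
proof -
  have "(%l. B * norm (K m l)) summable_on UNIV"
    using summable_on_cmult_right[OF rapid_mat_row(1)[OF assms(1), of m 0], of B] by simp
  then show ?thesis
    by (rule norm_infsum_le_infsum(1))
       (use assms(2) in \<open>auto simp: norm_mult mult.commute[of B] intro!: mult_left_mono\<close>)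
qed

text \<open>The decay in the row index is supplied by the matrix alone, so a bounded argument
  suffices: these matrices are smoothing operators.\<close>

lemma rapid_seq_mv:
  assumes "rapid_mat \<kappa> K" "!!l. norm (x l) <= B"
  shows "rapid_seq (mv K x)"
  unfolding rapid_seq_def
proof
  fix M
  have B0: "B \<ge> 0" using assms(2)[of 0] by (meson norm_ge_zero order_trans)
  have "norm (mv K x m) <= B * (\<kappa> (M + 2) * brsum) / br m ^ M" for m
  proof -
    have "norm (mv K x m) <= infsum (%l. B * (norm (K m l) * br l ^ M)) UNIV"
      unfolding mv_def
    proof (rule norm_infsum_le_infsum(2)[OF summable_on_cmult_right[OF rapid_mat_row(1)[OF assms(1)]]])
      fix l
      have "norm (K m l * x l) <= norm (K m l) * B"
        using assms(2) by (auto simp: norm_mult intro!: mult_left_mono)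
      also have "... <= norm (K m l) * B * br l ^ M"
        using mult_left_mono[OF br_power_ge_1[of l M], of "norm (K m l) * B"] B0 by simp
      finally show "norm (K m l * x l) <= B * (norm (K m l) * br l ^ M)" by (simp add: mult_ac)
    qed
    also have "... = B * infsum (%l. norm (K m l) * br l ^ M) UNIV"
      by (rule infsum_cmult_right')
    also have "... <= B * (\<kappa> (M + 2) * brsum / br m ^ M)"
      by (rule mult_left_mono[OF rapid_mat_row(2)[OF assms(1)] B0])
    finally show ?thesis by simp
  qed
  then show "\<exists>C. \<forall>m. norm (mv K x m) <= C / br m ^ M" by blast
qed

lemma rapid_mat_pair:
  assumes "rapid_mat \<kappa> D"
  shows "(%(m,n). norm (D m n) * (br m ^ M * br n ^ M)) summable_on UNIV"
    "infsum (%(m,n). norm (D m n) * (br m ^ M * br n ^ M)) UNIV <= \<kappa> (M + 2) * brsum\<^sup>2"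
proof -
  have le: "(%(m,n). norm (D m n) * (br m ^ M * br n ^ M)) p <= \<kappa> (M + 2) * (%(m,n). 1 / (br m ^ 2 * br n ^ 2)) p" for p
    using rapid_mat_le[OF assms] by (cases p) auto
  note s = summable_on_cmult_right[OF summable_br_pair, of "\<kappa> (M + 2)"]
  show *: "(%(m,n). norm (D m n) * (br m ^ M * br n ^ M)) summable_on UNIV"
    by (rule summable_on_comparison_test[OF s le]) (auto simp: less_imp_le)
  have "infsum (%(m,n). norm (D m n) * (br m ^ M * br n ^ M)) UNIV <= infsum (%p. \<kappa> (M + 2) * (%(m,n). 1 / (br m ^ 2 * br n ^ 2)) p) UNIV"
    by (rule infsum_mono[OF * s le])
  also have "... = \<kappa> (M + 2) * brsum\<^sup>2"
    by (subst infsum_cmult_right') (simp only: infsum_br_pair)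
  finally show "infsum (%(m,n). norm (D m n) * (br m ^ M * br n ^ M)) UNIV <= \<kappa> (M + 2) * brsum\<^sup>2" .
qed

lemma sip_mv_pair:
  assumes "rapid_mat \<kappa> D" "!!m. norm (x m) <= B" "!!m. norm (y m) <= C"
  shows "(%(m,n). D m n * (x n * cnj (y m))) summable_on UNIV"
    "sip (mv D x) y = infsum (%(m,n). D m n * (x n * cnj (y m))) UNIV"
proof -
  have "(%p. B * C * (%(m,n). norm (D m n) * (br m ^ 0 * br n ^ 0)) p) summable_on UNIV"
    by (rule summable_on_cmult_right[OF rapid_mat_pair(1)[OF assms(1)]])
  then show *: "(%(m,n). D m n * (x n * cnj (y m))) summable_on UNIV"
  proof (rule norm_infsum_le_infsum(1))
    fix p :: "int \<times> int"
    obtain m n where p: "p = (m, n)" by (cases p)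
    have "norm (x n) * norm (y m) <= B * C"
      using assms(2)[of n] assms(3)[of m] by (intro mult_mono) (auto intro: order_trans[OF norm_ge_zero])
    then show "norm ((%(m,n). D m n * (x n * cnj (y m))) p) <= B * C * (%(m,n). norm (D m n) * (br m ^ 0 * br n ^ 0)) p"
      by (simp add: p norm_mult) (metis mult.commute mult_left_mono norm_ge_zero)
  qed
  have "sip (mv D x) y = infsum (%m. infsum (%n. D m n * (x n * cnj (y m))) UNIV) UNIV"
    unfolding sip_def mv_def by (simp add: infsum_cmult_left' flip: mult.assoc)
  also have "... = infsum (%(m,n). D m n * (x n * cnj (y m))) UNIV"
    using infsum_Sigma'_banach[of "%m n. D m n * (x n * cnj (y m))" UNIV "%_. UNIV"] *
    by (simp only: UNIV_Times_UNIV)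
  finally show "sip (mv D x) y = infsum (%(m,n). D m n * (x n * cnj (y m))) UNIV" .
qed

definition herm_mat :: "(int => int => complex) => bool" where
  "herm_mat K \<longleftrightarrow> (\<forall>m n. cnj (K m n) = K n m)"

lemma sip_mv_herm:
  assumes "rapid_mat \<kappa> K" "herm_mat K" "!!m. norm (x m) <= B" "!!m. norm (y m) <= C"
  shows "sip x (mv K y) = sip (mv K x) y"
proof -
  have "sip x (mv K y) = cnj (infsum (%(m,n). K m n * (y n * cnj (x m))) UNIV)"
    by (subst sip_cnj) (simp only: sip_mv_pair(2)[OF assms(1) assms(4,3)])
  also have "... = infsum (%(m,n). K n m * (x m * cnj (y n))) UNIV"
  proof -
    have [simp]: "cnj (K m n) = K n m" for m n
      using assms(2) by (simp add: herm_mat_def)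
    show ?thesis
      by (simp add: case_prod_unfold mult.commute mult.left_commute flip: infsum_cnj)
  qed
  also have "... = infsum (%(m,n). K m n * (x n * cnj (y m))) UNIV"
    by (rule infsum_reindex_bij_witness[where i=prod.swap and j=prod.swap]) auto
  also have "... = sip (mv K x) y"
    by (simp only: sip_mv_pair(2)[OF assms(1) assms(3,4)])
  finally show ?thesis .
qed

section \<open>Eigensystems on the lattice: Parseval and moment bounds\<close>

text \<open>Lattice version of \<open>eigenbasis\<close> for diagonal \<open>d\<close> plus
  perturbation \<open>K\<close>; completeness is again Parseval on a dense class, here the rapidly
  decreasing sequences. The index type is left open so that the reference system may be indexed by
  the integers.\<close>

definition eigsys :: "(int => real) => (int => int => complex) => ('j => int => complex) => ('j => real) => bool" where
  "eigsys d K \<Phi> \<mu> \<longleftrightarrow> (\<forall>j. rapid_seq (\<Phi> j)) \<and>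
     (\<forall>j m. of_real (\<mu> j) * \<Phi> j m = of_real (d m) * \<Phi> j m + mv K (\<Phi> j) m) \<and>
     (\<forall>i j. sip (\<Phi> i) (\<Phi> j) = (if i = j then 1 else 0)) \<and>
     (\<forall>x. rapid_seq x \<longrightarrow> ((%j. (norm (sip x (\<Phi> j)))\<^sup>2) has_sum Re (sip x x)) UNIV)"

lemma eigsys_col:
  assumes "eigsys d K \<Phi> \<mu>"
  shows "((%j. (norm (\<Phi> j m))\<^sup>2) has_sum 1) UNIV"
proof -
  have "((%j. (norm (sip (unit_seq m) (\<Phi> j)))\<^sup>2) has_sum Re (sip (unit_seq m) (unit_seq m))) UNIV"
    using assms rapid_seq_unit unfolding eigsys_def by blast
  then show ?thesis
    unfolding sip_unit_left by (simp add: unit_seq_def)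
qed

lemma eigsys_norm_le_1:
  assumes "eigsys d K \<Phi> \<mu>"
  shows "norm (\<Phi> j m) <= 1"
proof -
  have "(\<Sum>j\<in>{j}. (norm (\<Phi> j m))\<^sup>2) <= 1"
    by (rule finite_sum_le_has_sum[OF eigsys_col[OF assms]]) auto
  then show ?thesis using power2_le_imp_le[of "norm (\<Phi> j m)" 1] by simp
qed

text \<open>Completeness is available for squared norms only. Polarisation with
  \<open>x' + y\<close> and \<open>x' - y\<close> gives the real parts, and the same applied to
  \<open>- \<i> * x\<close> gives the imaginary parts.\<close>

lemma eigsys_polar:
  assumes "eigsys d K \<Phi> \<mu>" "rapid_seq x" "rapid_seq y"
  shows "((%j. sip x (\<Phi> j) * cnj (sip y (\<Phi> j))) has_sum sip x y) UNIV"
proof -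
  have \<Phi>: "rapid_seq (\<Phi> j)" for j using assms(1) unfolding eigsys_def by blast
  have re: "((%j. Re (sip x' (\<Phi> j) * cnj (sip y (\<Phi> j)))) has_sum Re (sip x' y)) UNIV"
    if x': "rapid_seq x'" for x'
  proof -
    define ym where "ym = (%m. (-1) * y m)"
    have ym: "rapid_seq ym" "sip ym z = - sip y z" "sip z ym = - sip z y" for z
      using rapid_seq_scale[OF assms(3), of "-1"] sip_scale_left[of "-1" y z] sip_scale_right[of z "-1" y]
      by (simp_all add: ym_def)
    note s = rapid_seq_add[OF x' assms(3)] rapid_seq_add[OF x' ym(1)]
    have "((%j. ((norm (sip (%m. x' m + y m) (\<Phi> j)))\<^sup>2 + - (norm (sip (%m. x' m + ym m) (\<Phi> j)))\<^sup>2) * (1/4))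
      has_sum (Re (sip (%m. x' m + y m) (%m. x' m + y m)) + - Re (sip (%m. x' m + ym m) (%m. x' m + ym m))) * (1/4)) UNIV"
      using assms(1) s unfolding eigsys_def
      by (intro has_sum_cmult_left has_sum_add) (auto simp: has_sum_uminus)
    moreover have "((norm (sip (%m. x' m + y m) (\<Phi> j)))\<^sup>2 + - (norm (sip (%m. x' m + ym m) (\<Phi> j)))\<^sup>2) * (1/4)
      = Re (sip x' (\<Phi> j) * cnj (sip y (\<Phi> j)))" for j
      unfolding sip_add_left[OF x' assms(3) \<Phi>] sip_add_left[OF x' ym(1) \<Phi>] ym(2) cmod_power2
      by (simp add: power2_eq_square algebra_simps)
    moreover have "(Re (sip (%m. x' m + y m) (%m. x' m + y m)) + - Re (sip (%m. x' m + ym m) (%m. x' m + ym m))) * (1/4) = Re (sip x' y)"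
    proof -
      have "Re (sip y x') = Re (sip x' y)" by (subst sip_cnj) simp
      then show ?thesis
        by (simp add: sip_add_left[OF x' assms(3) s(1)] sip_add_left[OF x' ym(1) s(2)]
              sip_add_right[OF x' x' assms(3)] sip_add_right[OF assms(3) x' assms(3)]
              sip_add_right[OF x' x' ym(1)] sip_add_right[OF assms(3) x' ym(1)] ym(2,3))
    qed
    ultimately show ?thesis by (simp only:)
  qed
  have i: "rapid_seq (%m. - \<i> * x m)" by (rule rapid_seq_scale[OF assms(2)])
  have "((%j. of_real (Re (sip x (\<Phi> j) * cnj (sip y (\<Phi> j)))) + \<i> * of_real (Re (sip (%m. - \<i> * x m) (\<Phi> j) * cnj (sip y (\<Phi> j)))))
     has_sum (of_real (Re (sip x y)) + \<i> * of_real (Re (sip (%m. - \<i> * x m) y)))) UNIV"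
    by (intro has_sum_add has_sum_cmult_right has_sum_of_real re assms(2) i)
  moreover have "of_real (Re w) + \<i> * of_real (Re (- \<i> * w)) = w" for w
    by (simp add: complex_eq_iff)
  ultimately show ?thesis
    unfolding sip_scale_left mult.assoc by (simp only:)
qed

text \<open>The recursion produced by the induction in \<open>eigsys_weight_bound\<close>. It
  involves only \<open>\<kappa>\<close>, neither the eigensystem nor the finite index set, which
  gives uniformity in \<tau>.\<close>

primrec eig_const :: "(nat => real) => nat => real" where
  "eig_const \<kappa> 0 = 1"
| "eig_const \<kappa> (Suc M) = 2 * eig_const \<kappa> M * (1 + \<kappa> 2 * \<kappa> (2 * M + 2) * brsum\<^sup>2)"

lemma eig_const_nonneg: "(!!N. \<kappa> N \<ge> 0) ==> eig_const \<kappa> M \<ge> 0"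
  by (induction M) (auto intro!: mult_nonneg_nonneg add_nonneg_nonneg)

lemma infsum_sum_swap:
  fixes f :: "'a => 'b => real"
  assumes "!!j. j \<in> J ==> f j summable_on A" "finite J"
  shows "(%l. \<Sum>j\<in>J. f j l) summable_on A"
    "infsum (%l. \<Sum>j\<in>J. f j l) A = (\<Sum>j\<in>J. infsum (f j) A)"
proof -
  have "((%l. \<Sum>j\<in>J. f j l) has_sum (\<Sum>j\<in>J. infsum (f j) A)) A"
    using assms(2,1) by (induction J rule: finite_induct) (auto intro!: has_sum_add)
  then show "(%l. \<Sum>j\<in>J. f j l) summable_on A"
    "infsum (%l. \<Sum>j\<in>J. f j l) A = (\<Sum>j\<in>J. infsum (f j) A)"
    by (auto simp: has_sum_iff)
qed

text \<open>In operator terms: the diagonal entry of the \<open>2 * M\<close>-th power at the unit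
  vector \<open>m\<close> is of order \<open>br m ^ (2 * M)\<close>. Two factors
  \<open>\<mu> j\<close> at a time are moved through the eigenvalue equation. The diagonal costs the
  square of \<open>br m\<close>; the smoothing part is treated by Cauchy-Schwarz with weight
  \<open>norm (K m l)\<close> and the induction hypothesis at every \<open>l\<close>.\<close>

lemma eigsys_weight_bound:
  assumes "eigsys d K \<Phi> \<mu>" "rapid_mat \<kappa> K" "!!m. \<bar>d m\<bar> <= br m" "finite J"
  shows "(\<Sum>j\<in>J. \<mu> j ^ (2 * M) * (norm (\<Phi> j m))\<^sup>2) <= eig_const \<kappa> M * br m ^ (2 * M)"
proof (induction M arbitrary: m)
  case 0
  have "(\<Sum>j\<in>J. (norm (\<Phi> j m))\<^sup>2) <= 1"
    by (rule finite_sum_le_has_sum[OF eigsys_col[OF assms(1)]]) (use assms in auto)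
  then show ?case by simp
next
  case (Suc M)
  let ?B = "eig_const \<kappa> M"
  note k0 = rapid_mat_nonneg[OF assms(2)]
  have B0: "?B \<ge> 0" using eig_const_nonneg k0 by blast
  have \<Phi>1: "norm (\<Phi> j l) <= 1" for j l by (rule eigsys_norm_le_1[OF assms(1)])
  have sK: "(%l. norm (K m l)) summable_on UNIV"
    using rapid_mat_row(1)[OF assms(2), of m 0] by simp
  have iK: "infsum (%l. norm (K m l)) UNIV <= \<kappa> 2 * brsum"
    using rapid_mat_row(2)[OF assms(2), of m 0] by (simp add: numeral_2_eq_2)
  have iK0: "infsum (%l. norm (K m l)) UNIV \<ge> 0"
    by (rule infsum_nonneg) auto
  have s2: "(%l. norm (K m l) * (norm (\<Phi> j l))\<^sup>2) summable_on UNIV" for j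
    by (rule summable_on_comparison_test[OF sK]) (use \<Phi>1 in \<open>auto intro!: mult_left_le simp: power_le_one\<close>)
  let ?S = "%j. infsum (%l. norm (K m l) * (norm (\<Phi> j l))\<^sup>2) UNIV"
  have pt: "\<mu> j ^ 2 * (norm (\<Phi> j m))\<^sup>2 <= 2 * (br m)\<^sup>2 * (norm (\<Phi> j m))\<^sup>2 + 2 * (\<kappa> 2 * brsum) * ?S j" for j
  proof -
    have eq: "of_real (\<mu> j) * \<Phi> j m = of_real (d m) * \<Phi> j m + mv K (\<Phi> j) m"
      using assms(1) unfolding eigsys_def by blast
    have "\<mu> j ^ 2 * (norm (\<Phi> j m))\<^sup>2 = (norm (of_real (\<mu> j) * \<Phi> j m))\<^sup>2"
      by (simp add: norm_mult power_mult_distrib)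
    also have "... <= (norm (of_real (d m) * \<Phi> j m) + norm (mv K (\<Phi> j) m))\<^sup>2"
      unfolding eq by (intro power_mono norm_triangle_ineq) auto
    also have "... <= 2 * (norm (of_real (d m) * \<Phi> j m))\<^sup>2 + 2 * (norm (mv K (\<Phi> j) m))\<^sup>2"
      using sum_squares_bound[of "norm (of_real (d m) * \<Phi> j m)" "norm (mv K (\<Phi> j) m)"]
      by (simp add: power2_sum)
    also have "(norm (of_real (d m) * \<Phi> j m))\<^sup>2 <= (br m)\<^sup>2 * (norm (\<Phi> j m))\<^sup>2"
      unfolding norm_mult power_mult_distrib
      by (intro mult_right_mono power_mono) (use assms(3) in auto)
    also have "(norm (mv K (\<Phi> j) m))\<^sup>2 <= infsum (%l. norm (K m l)) UNIV * ?S j"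
      unfolding mv_def by (rule norm_infsum_sq_le[OF sK s2])
    also have "... <= \<kappa> 2 * brsum * ?S j"
      by (rule mult_right_mono[OF iK]) (auto intro!: infsum_nonneg)
    finally show ?thesis by simp
  qed
  have s3: "(%l. norm (K m l) * (\<mu> j ^ (2 * M) * (norm (\<Phi> j l))\<^sup>2)) summable_on UNIV" for j
    using summable_on_cmult_right[OF s2[of j], of "\<mu> j ^ (2 * M)"] by (simp add: mult_ac)
  have "(\<Sum>j\<in>J. \<mu> j ^ (2 * M) * ?S j) = (\<Sum>j\<in>J. infsum (%l. norm (K m l) * (\<mu> j ^ (2 * M) * (norm (\<Phi> j l))\<^sup>2)) UNIV)"
    by (intro sum.cong refl) (simp add: mult_ac flip: infsum_cmult_right')
  also have "... = infsum (%l. \<Sum>j\<in>J. norm (K m l) * (\<mu> j ^ (2 * M) * (norm (\<Phi> j l))\<^sup>2)) UNIV"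
    by (rule infsum_sum_swap(2)[OF s3 assms(4), symmetric])
  also have "... <= infsum (%l. ?B * (norm (K m l) * br l ^ (2 * M))) UNIV"
  proof (rule infsum_mono)
    show "(%l. \<Sum>j\<in>J. norm (K m l) * (\<mu> j ^ (2 * M) * (norm (\<Phi> j l))\<^sup>2)) summable_on UNIV"
      by (rule infsum_sum_swap(1)[OF s3 assms(4)])
    show "(%l. ?B * (norm (K m l) * br l ^ (2 * M))) summable_on UNIV"
      by (rule summable_on_cmult_right[OF rapid_mat_row(1)[OF assms(2)]])
    show "(\<Sum>j\<in>J. norm (K m l) * (\<mu> j ^ (2 * M) * (norm (\<Phi> j l))\<^sup>2)) <= ?B * (norm (K m l) * br l ^ (2 * M))" for l
      using mult_left_mono[OF Suc.IH[of l], of "norm (K m l)"] by (simp add: mult_ac flip: sum_distrib_left)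
  qed
  also have "... = ?B * infsum (%l. norm (K m l) * br l ^ (2 * M)) UNIV"
    by (rule infsum_cmult_right')
  also have "... <= ?B * (\<kappa> (2 * M + 2) * brsum / br m ^ (2 * M))"
    by (rule mult_left_mono[OF rapid_mat_row(2)[OF assms(2)] B0])
  \<comment> \<open>The decay in \<open>br m\<close> is given away: the diagonal term already grows
    like \<open>br m ^ (2 * Suc M)\<close>.\<close>
  also have "... <= ?B * (\<kappa> (2 * M + 2) * brsum / 1)"
    using k0 brsum_nonneg br_power_ge_1[of m "2 * M"] B0
    by (intro mult_left_mono divide_left_mono mult_nonneg_nonneg) (auto simp: less_imp_le)
  also have "... = ?B * (\<kappa> (2 * M + 2) * brsum)"
    by simp
  finally have S: "(\<Sum>j\<in>J. \<mu> j ^ (2 * M) * ?S j) <= ?B * (\<kappa> (2 * M + 2) * brsum)" .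
  have even: "\<mu> j ^ (2 * M) \<ge> 0" for j by (simp add: power_mult)
  have "(\<Sum>j\<in>J. \<mu> j ^ (2 * Suc M) * (norm (\<Phi> j m))\<^sup>2) = (\<Sum>j\<in>J. \<mu> j ^ (2 * M) * (\<mu> j ^ 2 * (norm (\<Phi> j m))\<^sup>2))"
    by (intro sum.cong refl) (simp add: power2_eq_square)
  also have "... <= (\<Sum>j\<in>J. \<mu> j ^ (2 * M) * (2 * (br m)\<^sup>2 * (norm (\<Phi> j m))\<^sup>2 + 2 * (\<kappa> 2 * brsum) * ?S j))"
    by (intro sum_mono mult_left_mono pt even)
  also have "... = 2 * (br m)\<^sup>2 * (\<Sum>j\<in>J. \<mu> j ^ (2 * M) * (norm (\<Phi> j m))\<^sup>2) + 2 * (\<kappa> 2 * brsum) * (\<Sum>j\<in>J. \<mu> j ^ (2 * M) * ?S j)"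
    by (simp add: sum_distrib_left algebra_simps flip: sum.distrib)
  also have "... <= 2 * (br m)\<^sup>2 * (?B * br m ^ (2 * M)) + 2 * (\<kappa> 2 * brsum) * (?B * (\<kappa> (2 * M + 2) * brsum))"
    by (intro add_mono mult_left_mono Suc.IH S) (use k0 brsum_nonneg in auto)
  also have "... <= 2 * (br m)\<^sup>2 * (?B * br m ^ (2 * M)) + 2 * (\<kappa> 2 * brsum) * (?B * (\<kappa> (2 * M + 2) * brsum)) * br m ^ (2 * Suc M)"
    using mult_left_mono[OF br_power_ge_1[of m "2 * Suc M"], of "2 * (\<kappa> 2 * brsum) * (?B * (\<kappa> (2 * M + 2) * brsum))"]
      B0 k0 brsum_nonneg by auto
  also have "... = eig_const \<kappa> (Suc M) * br m ^ (2 * Suc M)"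
    by (simp add: power2_eq_square algebra_simps)
  finally show ?case .
qed

text \<open>Cauchy-Schwarz with \<open>norm (D m n)\<close> as weight separates the sums over
  \<open>j\<close> and \<open>k\<close> into two instances of \<open>eigsys_weight_bound\<close>,
  whose growth in \<open>m\<close> and \<open>n\<close> the decay of \<open>D\<close> absorbs. Two
  factors \<open>\<kappa>D\<close> survive, so a difference of size |\<tau>| contributes its
  square.\<close>

lemma pair_weight_bound:
  assumes "eigsys d K \<Phi> \<mu>" "rapid_mat \<kappa> K" "!!m. \<bar>d m\<bar> <= br m"
    and "eigsys d' K' \<Psi> \<nu>" "rapid_mat \<kappa>' K'" "!!m. \<bar>d' m\<bar> <= br m"
    and "rapid_mat \<kappa>D D" "finite J" "finite L"
  shows "(\<Sum>j\<in>J. \<Sum>k\<in>L. (\<mu> j * \<nu> k) ^ (2 * M) * (norm (sip (mv D (\<Psi> k)) (\<Phi> j)))\<^sup>2)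
    <= eig_const \<kappa> M * eig_const \<kappa>' M * (\<kappa>D 2 * brsum\<^sup>2) * (\<kappa>D (2 * M + 2) * brsum\<^sup>2)"
proof -
  let ?B = "eig_const \<kappa> M" and ?B' = "eig_const \<kappa>' M"
  have B0: "?B \<ge> 0" "?B' \<ge> 0"
    using eig_const_nonneg rapid_mat_nonneg[OF assms(2)] rapid_mat_nonneg[OF assms(5)] by blast+
  have \<Phi>1: "norm (\<Phi> j l) <= 1" and \<Psi>1: "norm (\<Psi> k l) <= 1" for j k l
    by (rule eigsys_norm_le_1[OF assms(1)], rule eigsys_norm_le_1[OF assms(4)])
  define T where "T = infsum (%(m,n). norm (D m n)) UNIV"
  have sD: "(%(m,n). norm (D m n)) summable_on UNIV"
    using rapid_mat_pair(1)[OF assms(7), of 0] by simp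
  have T: "T <= \<kappa>D 2 * brsum\<^sup>2" "T \<ge> 0"
    using rapid_mat_pair(2)[OF assms(7), of 0] unfolding T_def
    by (simp_all add: numeral_2_eq_2 infsum_nonneg case_prod_unfold)
  let ?f = "%(j,k) (m,n). norm (D m n) * ((\<mu> j * \<nu> k) ^ (2 * M) * ((norm (\<Psi> k n))\<^sup>2 * (norm (\<Phi> j m))\<^sup>2))"
  have even: "x ^ (2 * M) \<ge> 0" for x :: real by (simp add: power_mult)
  have s1: "(%p. norm ((%(m,n). D m n) p) * (norm ((%(m,n). \<Psi> k n * cnj (\<Phi> j m)) p))\<^sup>2) summable_on UNIV" for j k
  proof (rule summable_on_comparison_test[OF sD])
    fix p :: "int \<times> int"
    obtain m n where p: "p = (m, n)" by (cases p)
    have "(norm (\<Psi> k n) * norm (\<Phi> j m))\<^sup>2 <= 1"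
      using \<Phi>1[of j m] \<Psi>1[of k n] by (intro power_le_one mult_nonneg_nonneg mult_le_one) auto
    then show "norm ((%(m,n). D m n) p) * (norm ((%(m,n). \<Psi> k n * cnj (\<Phi> j m)) p))\<^sup>2 <= (%(m,n). norm (D m n)) p"
      by (simp add: p norm_mult mult_left_le)
  qed auto
  have s2: "?f q summable_on UNIV" for q
    using summable_on_cmult_right[OF s1[of "snd q" "fst q"], of "(\<mu> (fst q) * \<nu> (snd q)) ^ (2 * M)"]
    by (simp add: case_prod_unfold norm_mult power_mult_distrib mult_ac)
  have pt: "(\<mu> j * \<nu> k) ^ (2 * M) * (norm (sip (mv D (\<Psi> k)) (\<Phi> j)))\<^sup>2 <= T * infsum (?f (j,k)) UNIV" for j k
  proof -
    have "sip (mv D (\<Psi> k)) (\<Phi> j) = infsum (%p. (%(m,n). D m n) p * (%(m,n). \<Psi> k n * cnj (\<Phi> j m)) p) UNIV"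
      using sip_mv_pair(2)[where x="\<Psi> k" and y="\<Phi> j", OF assms(7) \<Psi>1 \<Phi>1] by (simp add: case_prod_unfold)
    then have "(norm (sip (mv D (\<Psi> k)) (\<Phi> j)))\<^sup>2 <= infsum (%p. norm ((%(m,n). D m n) p)) UNIV
        * infsum (%p. norm ((%(m,n). D m n) p) * (norm ((%(m,n). \<Psi> k n * cnj (\<Phi> j m)) p))\<^sup>2) UNIV"
      using norm_infsum_sq_le[OF _ s1[of k j]] sD by (simp add: case_prod_unfold)
    also have "infsum (%p. norm ((%(m,n). D m n) p)) UNIV = T"
      by (simp add: T_def case_prod_unfold)
    finally have "(\<mu> j * \<nu> k) ^ (2 * M) * (norm (sip (mv D (\<Psi> k)) (\<Phi> j)))\<^sup>2 <= (\<mu> j * \<nu> k) ^ (2 * M) *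
       (T * infsum (%p. norm ((%(m,n). D m n) p) * (norm ((%(m,n). \<Psi> k n * cnj (\<Phi> j m)) p))\<^sup>2) UNIV)"
      using even by (intro mult_left_mono)
    also have "... = T * infsum (%p. (\<mu> j * \<nu> k) ^ (2 * M) * (norm ((%(m,n). D m n) p) * (norm ((%(m,n). \<Psi> k n * cnj (\<Phi> j m)) p))\<^sup>2)) UNIV"
      by (subst infsum_cmult_right') (simp add: mult_ac)
    also have "... = T * infsum (?f (j,k)) UNIV"
      by (simp add: case_prod_unfold norm_mult power_mult_distrib mult_ac)
    finally show ?thesis .
  qed
  have "(\<Sum>j\<in>J. \<Sum>k\<in>L. (\<mu> j * \<nu> k) ^ (2 * M) * (norm (sip (mv D (\<Psi> k)) (\<Phi> j)))\<^sup>2)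
     <= (\<Sum>j\<in>J. \<Sum>k\<in>L. T * infsum (?f (j,k)) UNIV)"
    by (intro sum_mono pt)
  also have "... = T * (\<Sum>q\<in>J\<times>L. infsum (?f q) UNIV)"
    by (simp add: sum.cartesian_product sum_distrib_left case_prod_unfold)
  also have "(\<Sum>q\<in>J\<times>L. infsum (?f q) UNIV) = infsum (%p. \<Sum>q\<in>J\<times>L. ?f q p) UNIV"
    by (rule infsum_sum_swap(2)[OF s2, symmetric]) (use assms in auto)
  also have "... <= infsum (%p. ?B * ?B' * (%(m,n). norm (D m n) * (br m ^ (2 * M) * br n ^ (2 * M))) p) UNIV"
  proof (rule infsum_mono)
    show "(%p. \<Sum>q\<in>J\<times>L. ?f q p) summable_on UNIV"
      by (rule infsum_sum_swap(1)[OF s2]) (use assms in auto)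
    show "(%p. ?B * ?B' * (%(m,n). norm (D m n) * (br m ^ (2 * M) * br n ^ (2 * M))) p) summable_on UNIV"
      by (rule summable_on_cmult_right[OF rapid_mat_pair(1)[OF assms(7)]])
    fix p :: "int \<times> int"
    obtain m n where p: "p = (m, n)" by (cases p)
    have "(\<Sum>q\<in>J\<times>L. ?f q p) = norm (D m n) * ((\<Sum>j\<in>J. \<mu> j ^ (2 * M) * (norm (\<Phi> j m))\<^sup>2) * (\<Sum>k\<in>L. \<nu> k ^ (2 * M) * (norm (\<Psi> k n))\<^sup>2))"
      unfolding p by (subst sum_product, subst sum.cartesian_product, subst sum_distrib_left, intro sum.cong refl) (simp add: case_prod_unfold power_mult_distrib mult_ac)
    also have "... <= norm (D m n) * ((?B * br m ^ (2 * M)) * (?B' * br n ^ (2 * M)))"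
      by (intro mult_left_mono mult_mono eigsys_weight_bound[OF assms(1-3,8)] eigsys_weight_bound[OF assms(4-6,9)]
            sum_nonneg mult_nonneg_nonneg even B0) (auto simp: less_imp_le)
    finally show "(\<Sum>q\<in>J\<times>L. ?f q p) <= ?B * ?B' * (%(m,n). norm (D m n) * (br m ^ (2 * M) * br n ^ (2 * M))) p"
      by (simp add: p mult_ac)
  qed
  also have "... = ?B * ?B' * infsum (%(m,n). norm (D m n) * (br m ^ (2 * M) * br n ^ (2 * M))) UNIV"
    by (rule infsum_cmult_right')
  also have "... <= ?B * ?B' * (\<kappa>D (2 * M + 2) * brsum\<^sup>2)"
    by (intro mult_left_mono rapid_mat_pair(2)[OF assms(7)] mult_nonneg_nonneg B0)
  finally have "(\<Sum>j\<in>J. \<Sum>k\<in>L. (\<mu> j * \<nu> k) ^ (2 * M) * (norm (sip (mv D (\<Psi> k)) (\<Phi> j)))\<^sup>2)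
    <= T * (?B * ?B' * (\<kappa>D (2 * M + 2) * brsum\<^sup>2))"
    using T(2) by (simp add: mult_left_mono)
  also have "... <= (\<kappa>D 2 * brsum\<^sup>2) * (?B * ?B' * (\<kappa>D (2 * M + 2) * brsum\<^sup>2))"
    using B0 rapid_mat_nonneg[OF assms(7)] by (intro mult_right_mono T) auto
  finally show ?thesis by (simp add: mult_ac)
qed

lemma mv_diff:
  assumes "rapid_mat \<kappa> K" "rapid_mat \<kappa>' K'" "!!l. norm (x l) <= B"
  shows "mv (%m n. K m n - K' m n) x = (%m. mv K x m - mv K' x m)"
proof
  fix m
  show "mv (%m n. K m n - K' m n) x m = mv K x m - mv K' x m"
    using infsum_diff(2)[OF mv_summable[where x=x and m=m, OF assms(1,3)] mv_summable[where x=x and m=m, OF assms(2,3)]]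
    by (simp add: mv_def left_diff_distrib)
qed

text \<open>Each equation is paired with the other eigenvector. The diagonal \<open>d\<close> is
  real and common to both, so it cancels; hermiticity moves \<open>K\<close> to the side of
  \<open>\<Psi> k\<close>.\<close>

lemma eigsys_diff_sip:
  assumes "eigsys d K \<Phi> \<mu>" "rapid_mat \<kappa> K" "herm_mat K"
    and "eigsys d K' \<Psi> \<nu>" "rapid_mat \<kappa>' K'" "!!m. \<bar>d m\<bar> <= br m"
  shows "of_real (\<mu> j - \<nu> k) * sip (\<Psi> k) (\<Phi> j) = sip (mv (%m n. K m n - K' m n) (\<Psi> k)) (\<Phi> j)"
proof -
  have \<Phi>: "rapid_seq (\<Phi> j)" and \<Psi>: "rapid_seq (\<Psi> k)"
    using assms(1,4) unfolding eigsys_def by blast+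
  have \<Phi>1: "norm (\<Phi> j l) <= 1" and \<Psi>1: "norm (\<Psi> k l) <= 1" for l
    by (rule eigsys_norm_le_1[OF assms(1)], rule eigsys_norm_le_1[OF assms(4)])
  have d\<Phi>: "rapid_seq (%m. of_real (d m) * \<Phi> j m)" and d\<Psi>: "rapid_seq (%m. of_real (d m) * \<Psi> k m)"
    using assms(6) by (auto intro!: rapid_seq_poly_mult[where C=1 and N=1] \<Phi> \<Psi>)
  note K\<Phi> = rapid_seq_mv[OF assms(2) \<Phi>1] and K\<Psi> = rapid_seq_mv[OF assms(2) \<Psi>1]
    and K'\<Psi> = rapid_seq_mv[OF assms(5) \<Psi>1]
  have e1: "(%m. of_real (\<mu> j) * \<Phi> j m) = (%m. of_real (d m) * \<Phi> j m + mv K (\<Phi> j) m)"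
    and e2: "(%m. of_real (\<nu> k) * \<Psi> k m) = (%m. of_real (d m) * \<Psi> k m + mv K' (\<Psi> k) m)"
    using assms(1,4) unfolding eigsys_def by (auto simp: fun_eq_iff)
  have "of_real (\<mu> j) * sip (\<Psi> k) (\<Phi> j) = sip (\<Psi> k) (%m. of_real (\<mu> j) * \<Phi> j m)"
    by (simp add: sip_scale_right)
  also have "... = sip (\<Psi> k) (%m. of_real (d m) * \<Phi> j m) + sip (\<Psi> k) (mv K (\<Phi> j))"
    unfolding e1 by (rule sip_add_right[OF \<Psi> d\<Phi> K\<Phi>])
  also have "sip (\<Psi> k) (mv K (\<Phi> j)) = sip (mv K (\<Psi> k)) (\<Phi> j)"
    by (rule sip_mv_herm[OF assms(2,3) \<Psi>1 \<Phi>1])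
  also have "sip (\<Psi> k) (%m. of_real (d m) * \<Phi> j m) = sip (%m. of_real (d m) * \<Psi> k m) (\<Phi> j)"
    by (simp add: sip_def mult_ac)
  finally have 1: "of_real (\<mu> j) * sip (\<Psi> k) (\<Phi> j) = sip (%m. of_real (d m) * \<Psi> k m) (\<Phi> j) + sip (mv K (\<Psi> k)) (\<Phi> j)" .
  have "of_real (\<nu> k) * sip (\<Psi> k) (\<Phi> j) = sip (%m. of_real (\<nu> k) * \<Psi> k m) (\<Phi> j)"
    by (simp add: sip_scale_left)
  also have "... = sip (%m. of_real (d m) * \<Psi> k m) (\<Phi> j) + sip (mv K' (\<Psi> k)) (\<Phi> j)"
    unfolding e2 by (rule sip_add_left[OF d\<Psi> K'\<Psi> \<Phi>])
  finally have 2: "of_real (\<nu> k) * sip (\<Psi> k) (\<Phi> j) = sip (%m. of_real (d m) * \<Psi> k m) (\<Phi> j) + sip (mv K' (\<Psi> k)) (\<Phi> j)" .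
  have "sip (mv (%m n. K m n - K' m n) (\<Psi> k)) (\<Phi> j) = sip (%m. mv K (\<Psi> k) m + (-1) * mv K' (\<Psi> k) m) (\<Phi> j)"
    unfolding mv_diff[OF assms(2,5) \<Psi>1] by simp
  also have "... = sip (mv K (\<Psi> k)) (\<Phi> j) + sip (%m. (-1) * mv K' (\<Psi> k) m) (\<Phi> j)"
    by (rule sip_add_left[OF K\<Psi> rapid_seq_scale[OF K'\<Psi>] \<Phi>])
  also have "... = sip (mv K (\<Psi> k)) (\<Phi> j) - sip (mv K' (\<Psi> k)) (\<Phi> j)"
    by (subst sip_scale_left) simp
  finally show ?thesis
    using 1 2 by (simp add: algebra_simps)
qed

lemma eigsys_spectral_pair:
  assumes "eigsys d K \<Phi> \<mu>" "rapid_mat \<kappa> K" "herm_mat K"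
    and "eigsys d K' \<Psi> \<nu>" "rapid_mat \<kappa>' K'" "!!m. \<bar>d m\<bar> <= br m"
    and D: "rapid_mat \<kappa>D (%m n. K m n - K' m n)"
    and \<delta>: "0 < \<delta>" "\<delta> <= 1" "!!j. \<delta> <= \<mu> j" "!!k. \<delta> <= \<nu> k"
    and nu2: "(%k. 1 / (\<nu> k)\<^sup>2) summable_on UNIV"
  shows "spectral_pair \<mu> \<nu> (%j k. sip (\<Psi> k) (\<Phi> j)) \<delta>"
    and "infsum (%(j,k). (\<mu> j * \<nu> k) ^ (2 * M) * (\<mu> j - \<nu> k)\<^sup>2 * (norm (sip (\<Psi> k) (\<Phi> j)))\<^sup>2) UNIV
      <= eig_const \<kappa> M * eig_const \<kappa>' M * (\<kappa>D 2 * brsum\<^sup>2) * (\<kappa>D (2 * M + 2) * brsum\<^sup>2)"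
    and "infsum (%j. complex_of_real ((\<mu> j - \<nu> k) * (norm (sip (\<Psi> k) (\<Phi> j)))\<^sup>2)) UNIV
      = sip (mv (%m n. K m n - K' m n) (\<Psi> k)) (\<Psi> k)"
proof -
  note diff = eigsys_diff_sip[OF assms(1-6)]
  have sq: "(\<mu> j - \<nu> k)\<^sup>2 * (norm (sip (\<Psi> k) (\<Phi> j)))\<^sup>2 = (norm (sip (mv (%m n. K m n - K' m n) (\<Psi> k)) (\<Phi> j)))\<^sup>2" for j k
    unfolding diff[symmetric] by (simp add: norm_mult power_mult_distrib flip: of_real_diff)
  have fin: "(\<Sum>j\<in>J. \<Sum>k\<in>L. (%(j,k). (\<mu> j * \<nu> k) ^ (2 * M) * (\<mu> j - \<nu> k)\<^sup>2 * (norm (sip (\<Psi> k) (\<Phi> j)))\<^sup>2) (j,k))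
     <= eig_const \<kappa> M * eig_const \<kappa>' M * (\<kappa>D 2 * brsum\<^sup>2) * (\<kappa>D (2 * M + 2) * brsum\<^sup>2)"
    if "finite J" "finite L" for J L M
    using pair_weight_bound[OF assms(1,2,6) assms(4,5,6) D that, of M]
    by (simp add: mult.assoc sq)
  have nn: "(%(j,k). (\<mu> j * \<nu> k) ^ (2 * M) * (\<mu> j - \<nu> k)\<^sup>2 * (norm (sip (\<Psi> k) (\<Phi> j)))\<^sup>2) p \<ge> 0" for p M
    by (cases p) (simp add: power_mult)
  have hs2: "(%(j,k). (\<mu> j * \<nu> k) ^ (2 * M) * (\<mu> j - \<nu> k)\<^sup>2 * (norm (sip (\<Psi> k) (\<Phi> j)))\<^sup>2) summable_on UNIV"
    "infsum (%(j,k). (\<mu> j * \<nu> k) ^ (2 * M) * (\<mu> j - \<nu> k)\<^sup>2 * (norm (sip (\<Psi> k) (\<Phi> j)))\<^sup>2) UNIV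
      <= eig_const \<kappa> M * eig_const \<kappa>' M * (\<kappa>D 2 * brsum\<^sup>2) * (\<kappa>D (2 * M + 2) * brsum\<^sup>2)" for M
    by (rule nonneg_summable_pairI[OF nn fin], assumption+)+
  show "infsum (%(j,k). (\<mu> j * \<nu> k) ^ (2 * M) * (\<mu> j - \<nu> k)\<^sup>2 * (norm (sip (\<Psi> k) (\<Phi> j)))\<^sup>2) UNIV
      <= eig_const \<kappa> M * eig_const \<kappa>' M * (\<kappa>D 2 * brsum\<^sup>2) * (\<kappa>D (2 * M + 2) * brsum\<^sup>2)"
    by (rule hs2(2))
  have r: "rapid_seq (\<Phi> j)" "rapid_seq (\<Psi> k)" for j k
    using assms(1,4) unfolding eigsys_def by blast+
  have \<Psi>1: "norm (\<Psi> k l) <= 1" for l k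
    by (rule eigsys_norm_le_1[OF assms(4)])
  show "spectral_pair \<mu> \<nu> (%j k. sip (\<Psi> k) (\<Phi> j)) \<delta>"
  proof
    show "((%j. (norm (sip (\<Psi> k) (\<Phi> j)))\<^sup>2) has_sum 1) UNIV" for k
    proof -
      have "((%j. (norm (sip (\<Psi> k) (\<Phi> j)))\<^sup>2) has_sum Re (sip (\<Psi> k) (\<Psi> k))) UNIV"
        using assms(1) r unfolding eigsys_def by blast
      moreover have "sip (\<Psi> k) (\<Psi> k) = 1"
        using assms(4) unfolding eigsys_def by simp
      ultimately show ?thesis by simp
    qed
    show "((%k. (norm (sip (\<Psi> k) (\<Phi> j)))\<^sup>2) has_sum 1) UNIV" for j
    proof -
      have "((%k. (norm (sip (\<Phi> j) (\<Psi> k)))\<^sup>2) has_sum Re (sip (\<Phi> j) (\<Phi> j))) UNIV"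
        using assms(4) r unfolding eigsys_def by blast
      moreover have "sip (\<Phi> j) (\<Phi> j) = 1"
        using assms(1) unfolding eigsys_def by simp
      ultimately show ?thesis by (simp add: norm_sip_commute[of "\<Phi> j"])
    qed
    fix P
    show "(%(j,k). (\<mu> j * \<nu> k) ^ P * (\<mu> j - \<nu> k)\<^sup>2 * (norm (sip (\<Psi> k) (\<Phi> j)))\<^sup>2) summable_on UNIV"
    proof (rule summable_on_comparison_test[OF summable_on_cmult_right[OF hs2(1)[where M=P], of "1 / (\<delta> * \<delta>) ^ P"]])
      fix p :: "'a \<times> 'b"
      obtain j k where p: "p = (j, k)" by (cases p)
      \<comment> \<open>\<open>pair_weight_bound\<close> provides even exponents only. Since the
        product of the eigenvalues is at least \<open>\<delta> * \<delta>\<close>, the exponent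
        \<open>P\<close> is dominated by \<open>2 * P\<close> at the price of
        \<open>1 / (\<delta> * \<delta>) ^ P\<close>.\<close>
      have \<mu>\<nu>: "\<delta> * \<delta> <= \<mu> j * \<nu> k"
        using \<delta> by (intro mult_mono) (auto intro: order_trans[OF less_imp_le])
      then have "(\<delta> * \<delta>) ^ P <= (\<mu> j * \<nu> k) ^ P"
        using \<delta> by (intro power_mono) auto
      moreover have pos: "\<mu> j * \<nu> k > 0"
        using \<mu>\<nu> \<delta> by (meson less_le_trans mult_pos_pos)
      ultimately have "(\<mu> j * \<nu> k) ^ P * (\<delta> * \<delta>) ^ P <= (\<mu> j * \<nu> k) ^ P * (\<mu> j * \<nu> k) ^ P"
        by (intro mult_left_mono) auto
      then have "(\<mu> j * \<nu> k) ^ P <= (\<mu> j * \<nu> k) ^ (2 * P) / (\<delta> * \<delta>) ^ P"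
        using \<delta> by (simp add: pos_le_divide_eq mult_2 power_add)
      then have "(\<mu> j * \<nu> k) ^ P * ((\<mu> j - \<nu> k)\<^sup>2 * (norm (sip (\<Psi> k) (\<Phi> j)))\<^sup>2)
         <= (\<mu> j * \<nu> k) ^ (2 * P) / (\<delta> * \<delta>) ^ P * ((\<mu> j - \<nu> k)\<^sup>2 * (norm (sip (\<Psi> k) (\<Phi> j)))\<^sup>2)"
        by (rule mult_right_mono) auto
      then show "(%(j,k). (\<mu> j * \<nu> k) ^ P * (\<mu> j - \<nu> k)\<^sup>2 * (norm (sip (\<Psi> k) (\<Phi> j)))\<^sup>2) p
         <= 1 / (\<delta> * \<delta>) ^ P * (%(j,k). (\<mu> j * \<nu> k) ^ (2 * P) * (\<mu> j - \<nu> k)\<^sup>2 * (norm (sip (\<Psi> k) (\<Phi> j)))\<^sup>2) p"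
        by (simp add: p mult.assoc)
      show "0 <= (%(j,k). (\<mu> j * \<nu> k) ^ P * (\<mu> j - \<nu> k)\<^sup>2 * (norm (sip (\<Psi> k) (\<Phi> j)))\<^sup>2) p"
        using pos by (simp add: p)
    qed
  qed (use \<delta> nu2 in auto)
  \<comment> \<open>Both vectors are expanded in the basis \<open>\<Phi>\<close>; by
    \<open>diff\<close> the first coefficient is the overlap times \<open>\<mu> j - \<nu> k\<close>.
    This identifies the linear term of \<open>G_first_order\<close>.\<close>
  have "((%j. sip (mv (%m n. K m n - K' m n) (\<Psi> k)) (\<Phi> j) * cnj (sip (\<Psi> k) (\<Phi> j)))
      has_sum sip (mv (%m n. K m n - K' m n) (\<Psi> k)) (\<Psi> k)) UNIV"
    by (rule eigsys_polar[OF assms(1) rapid_seq_mv[OF D \<Psi>1] r(2)])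
  moreover have "sip (mv (%m n. K m n - K' m n) (\<Psi> k)) (\<Phi> j) * cnj (sip (\<Psi> k) (\<Phi> j))
      = complex_of_real ((\<mu> j - \<nu> k) * (norm (sip (\<Psi> k) (\<Phi> j)))\<^sup>2)" for j
    unfolding diff[symmetric] of_real_mult complex_norm_square by simp
  ultimately show "infsum (%j. complex_of_real ((\<mu> j - \<nu> k) * (norm (sip (\<Psi> k) (\<Phi> j)))\<^sup>2)) UNIV
      = sip (mv (%m n. K m n - K' m n) (\<Psi> k)) (\<Psi> k)"
    by (simp add: infsumI)
qed

section \<open>The unperturbed operator\<close>

text \<open>The spectrum of |n| with the zero mode moved to 1, as adding \<open>P0\<close> does for
  \<open>Lam_w\<close>. Its spectral sum is 1 plus twice the Riemann zeta sum.\<close>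

definition dref :: "int => real" where
  "dref m = max 1 \<bar>real_of_int m\<bar>"

lemma dref_le_br: "\<bar>dref m\<bar> <= br m" and dref_ge_1: "dref m \<ge> 1" and br_le_dref: "br m <= 2 * dref m"
  by (auto simp: dref_def br_def)

lemma rapid_mat_0: "rapid_mat (%_. 0) (%_ _. 0)"
  by (simp add: rapid_mat_def)

lemma sip_unit_right: "sip x (unit_seq m) = x m"
  by (subst sip_cnj) (simp add: sip_unit_left)

lemma rapid_seq_sq_summable: "rapid_seq x ==> (%m. (norm (x m))\<^sup>2) summable_on UNIV"
  using sip_summable_rapid[of x x] summable_on_iff_abs_summable_on_complex[of "%m. x m * cnj (x m)"]
  by (simp add: norm_mult power2_eq_square)

lemma eigsys_ref: "eigsys dref (%_ _. 0) unit_seq dref"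
  unfolding eigsys_def
proof (intro conjI allI impI)
  fix x assume x: "rapid_seq x"
  show "((%j. (norm (sip x (unit_seq j)))\<^sup>2) has_sum Re (sip x x)) UNIV"
    using rapid_seq_sq_summable[OF x] by (simp add: sip_unit_right sip_self)
next
  show "of_real (dref j) * unit_seq j m = of_real (dref m) * unit_seq j m + mv (%_ _. 0) (unit_seq j) m" for j m
    by (simp add: mv_def unit_seq_def)
qed (simp_all add: rapid_seq_unit sip_unit_left, simp_all add: unit_seq_def)

lemma dref_summable:
  assumes "s > 1"
  shows "(%m. dref m powr (- s)) summable_on UNIV"
proof (rule summable_on_int_iff_nat)
  have "summable (%n. real n powr (- s))"
    using assms by (simp add: summable_real_powr_iff)
  then have "summable (%n. (if n = 0 then 1 else real n powr (- s)))"
    by (subst summable_cong[where g="%n. real n powr (- s)"]) (auto simp: eventually_at_top_linorder intro!: exI[of _ 1])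
  then have "(%n. (if n = 0 then 1 else real n powr (- s))) summable_on UNIV"
    by (intro summable_nonneg_imp_summable_on) auto
  moreover have "dref (int n) powr (- s) = (if n = 0 then 1 else real n powr (- s))"
    "dref (- int n) powr (- s) = (if n = 0 then 1 else real n powr (- s))" for n
    by (auto simp: dref_def max_def)
  ultimately show "(%n. dref (int n) powr (- s)) summable_on UNIV" "(%n. dref (- int n) powr (- s)) summable_on UNIV"
    by simp_all
qed

lemma dref_summable_sq: "(%m. 1 / (dref m)\<^sup>2) summable_on UNIV"
proof -
  have "dref m powr (- 2) = 1 / (dref m)\<^sup>2" for m
    using dref_ge_1[of m] by (simp add: powr_minus divide_inverse)
  then show ?thesis using dref_summable[of 2] by simp
qed

lemma rapid_seq_sum:
  assumes "!!i. i \<in> I ==> rapid_seq (f i)"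
  shows "rapid_seq (%m. \<Sum>i\<in>I. f i m)"
proof -
  have z: "rapid_seq (%_. 0)" unfolding rapid_seq_def by (auto intro!: exI[of _ 0])
  show ?thesis
  proof (cases "finite I")
    case True
    then show ?thesis using assms
      by (induction I rule: finite_induct) (auto intro!: rapid_seq_add z)
  qed (simp add: z)
qed

lemma sip_sum_left:
  assumes "!!i. i \<in> I ==> rapid_seq (f i)" "rapid_seq y"
  shows "sip (%m. \<Sum>i\<in>I. f i m) y = (\<Sum>i\<in>I. sip (f i) y)"
proof (cases "finite I")
  case True
  then show ?thesis using assms
  proof (induction I rule: finite_induct)
    case empty
    show ?case by (simp add: sip_def)
  next
    case (insert i I)
    then show ?case by (simp add: sip_add_left rapid_seq_sum)
  qed
qed (simp add: sip_def)

section \<open>Existence of a complete eigensystem by minimisation\<close>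

lemma infsum_weighted_square_add:
  fixes c :: "'a => real" and x y :: "'a => complex"
  assumes "(%m. c m * (norm (x m))\<^sup>2) summable_on UNIV" "(%m. c m * (norm (y m))\<^sup>2) summable_on UNIV"
    and "(%m. of_real (c m) * x m * cnj (y m)) summable_on UNIV"
  shows "(%m. c m * (norm (x m + t * y m))\<^sup>2) summable_on UNIV"
    "infsum (%m. c m * (norm (x m + t * y m))\<^sup>2) UNIV = infsum (%m. c m * (norm (x m))\<^sup>2) UNIV
      + 2 * Re (cnj t * infsum (%m. of_real (c m) * x m * cnj (y m)) UNIV)
      + (norm t)\<^sup>2 * infsum (%m. c m * (norm (y m))\<^sup>2) UNIV"
proof -
  have "((%m. c m * (norm (x m))\<^sup>2 + 2 * Re (cnj t * (of_real (c m) * x m * cnj (y m))) + (norm t)\<^sup>2 * (c m * (norm (y m))\<^sup>2))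
    has_sum (infsum (%m. c m * (norm (x m))\<^sup>2) UNIV
      + 2 * Re (cnj t * infsum (%m. of_real (c m) * x m * cnj (y m)) UNIV)
      + (norm t)\<^sup>2 * infsum (%m. c m * (norm (y m))\<^sup>2) UNIV)) UNIV"
    by (intro has_sum_add has_sum_cmult_right has_sum_Re has_sum_infsum assms)
  moreover have "c m * (norm (x m))\<^sup>2 + 2 * Re (cnj t * (of_real (c m) * x m * cnj (y m))) + (norm t)\<^sup>2 * (c m * (norm (y m))\<^sup>2)
     = c m * (norm (x m + t * y m))\<^sup>2" for m
    unfolding cmod_power2 by (simp add: power2_eq_square algebra_simps)
  ultimately have "((%m. c m * (norm (x m + t * y m))\<^sup>2) has_sum (infsum (%m. c m * (norm (x m))\<^sup>2) UNIV
      + 2 * Re (cnj t * infsum (%m. of_real (c m) * x m * cnj (y m)) UNIV)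
      + (norm t)\<^sup>2 * infsum (%m. c m * (norm (y m))\<^sup>2) UNIV)) UNIV"
    by (simp only:)
  then show "(%m. c m * (norm (x m + t * y m))\<^sup>2) summable_on UNIV"
    "infsum (%m. c m * (norm (x m + t * y m))\<^sup>2) UNIV = infsum (%m. c m * (norm (x m))\<^sup>2) UNIV
      + 2 * Re (cnj t * infsum (%m. of_real (c m) * x m * cnj (y m)) UNIV)
      + (norm t)\<^sup>2 * infsum (%m. c m * (norm (y m))\<^sup>2) UNIV"
    by (auto simp: has_sum_iff)
qed

lemma nonneg_quadratic_imp_zero:
  fixes R :: complex and S :: real
  assumes "!!t. 0 <= 2 * Re (cnj t * R) + (norm t)\<^sup>2 * S"
  shows "R = 0"
proof (rule ccontr)
  assume "R \<noteq> 0"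
  then have R: "(norm R)\<^sup>2 > 0" by simp
  \<comment> \<open>The test value will be \<open>t = - s * R\<close>: the linear term is then
    negative of order \<open>s\<close>, the quadratic one of order \<open>s\<close> squared, and
    \<open>s * S < 2\<close> lets the former win.\<close>
  define s where "s = 1 / (\<bar>S\<bar> + 1)"
  have s: "s > 0" "s * S < 2"
  proof -
    show "s > 0" by (simp add: s_def)
    have "s * S <= 1"
      unfolding s_def by (auto simp: divide_simps)
    then show "s * S < 2" by simp
  qed
  have "cnj (- of_real s * R) * R = of_real (- s * (norm R)\<^sup>2)"
    unfolding of_real_mult complex_norm_square by simp
  then have A: "2 * Re (cnj (- of_real s * R) * R) = 2 * (- s * (norm R)\<^sup>2)"
    by (simp only: Re_complex_of_real)
  have B: "(norm (- of_real s * R))\<^sup>2 * S = s * s * (norm R)\<^sup>2 * S"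
    using s by (simp add: norm_mult power2_eq_square)
  have "0 <= 2 * (- s * (norm R)\<^sup>2) + s * s * (norm R)\<^sup>2 * S"
    using assms[of "- of_real s * R"] unfolding A B .
  then have "0 <= s * (norm R)\<^sup>2 * (s * S - 2)"
    by (simp add: algebra_simps)
  moreover have "s * (norm R)\<^sup>2 * (s * S - 2) < 0"
    using s R by (intro mult_pos_neg mult_pos_pos) auto
  ultimately show False by simp
qed

lemma sip_lin_right:
  assumes "!!m. norm (x m) <= B" "rapid_seq y" "finite I" "!!i. i \<in> I ==> rapid_seq (f i)"
  shows "sip x (%m. y m + (\<Sum>i\<in>I. c i * f i m)) = sip x y + (\<Sum>i\<in>I. cnj (c i) * sip x (f i))"
proof -
  have s: "(%m. x m * cnj (z m)) summable_on UNIV" if "rapid_seq z" for z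
    using sip_summable[where y=x, OF that assms(1)] summable_on_cnj_iff[of "%m. z m * cnj (x m)" UNIV]
    by (simp add: mult.commute)
  have "((%m. \<Sum>i\<in>I. cnj (c i) * (x m * cnj (f i m))) has_sum (\<Sum>i\<in>I. cnj (c i) * sip x (f i))) UNIV"
    unfolding sip_def using assms(3,4)
    by (induction I rule: finite_induct) (auto intro!: has_sum_add has_sum_cmult_right has_sum_infsum s)
  from has_sum_add[OF has_sum_infsum[OF s[OF assms(2)]] this] show ?thesis
    unfolding sip_def by (intro infsumI) (simp add: sum_distrib_left algebra_simps)
qed

text \<open>\<open>steklov_ev\<close> and \<open>op_pow\<close> select an eigenbasis by Hilbert
  choice, which says nothing unless one exists. This locale supplies it for a diagonal of size |m|
  plus a smoothing hermitian matrix.\<close>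

locale lattice_op =
  fixes d :: "int => real" and K :: "int => int => complex" and \<kappa> :: "nat => real"
  assumes K: "rapid_mat \<kappa> K" "herm_mat K" and d: "!!m. \<bar>real_of_int m\<bar> <= d m" "!!m. d m <= br m"
begin

definition Aop :: "(int => complex) => int => complex" where
  "Aop x = (%m. of_real (d m) * x m + mv K x m)"

definition n2 :: "(int => complex) => real" where
  "n2 x = infsum (%m. (norm (x m))\<^sup>2) UNIV"

text \<open>The form domain, a lattice version of the Sobolev space of order 1/2. Minimisers are
  found here before they are known to decay rapidly.\<close>

definition en :: "(int => complex) => bool" where
  "en x \<longleftrightarrow> (%m. br m * (norm (x m))\<^sup>2) summable_on UNIV"

definition q :: "(int => complex) => real" where
  "q x = infsum (%m. d m * (norm (x m))\<^sup>2) UNIV + Re (sip (mv K x) x)"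

definition CK :: real where "CK = \<kappa> 2 * brsum\<^sup>2"

lemma CK_nonneg: "CK \<ge> 0"
  using rapid_mat_nonneg[OF K(1)] by (simp add: CK_def)

lemma d_nonneg: "d m \<ge> 0"
  using d(1)[of m] by (meson abs_ge_zero order_trans)

lemma en_summable:
  assumes "en x"
  shows "(%m. (norm (x m))\<^sup>2) summable_on UNIV" "(%m. d m * (norm (x m))\<^sup>2) summable_on UNIV"
proof -
  show "(%m. (norm (x m))\<^sup>2) summable_on UNIV"
    by (rule summable_on_comparison_test[OF assms[unfolded en_def]])
       (use br_ge_1 in \<open>auto simp: mult_le_cancel_right1 not_less\<close>)
  show "(%m. d m * (norm (x m))\<^sup>2) summable_on UNIV"
    by (rule summable_on_comparison_test[OF assms[unfolded en_def]])
       (use d d_nonneg in \<open>auto intro!: mult_right_mono\<close>)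
qed

lemma en_norm_le:
  assumes "en x"
  shows "(norm (x m))\<^sup>2 <= n2 x" "norm (x m) <= sqrt (n2 x)"
proof -
  have "sum (%m. (norm (x m))\<^sup>2) {m} <= n2 x"
    unfolding n2_def by (rule finite_sum_le_infsum[OF en_summable(1)[OF assms]]) auto
  then show "(norm (x m))\<^sup>2 <= n2 x" by simp
  then show "norm (x m) <= sqrt (n2 x)" by (rule real_le_rsqrt)
qed

lemma n2_nonneg: "n2 x \<ge> 0"
  unfolding n2_def by (rule infsum_nonneg) auto

lemma rapid_en: assumes "rapid_seq x" shows "en x"
proof -
  obtain C where C: "!!m. norm (x m) <= C" "C \<ge> 0" using rapid_seq_bounded[OF assms] by metis
  show ?thesis unfolding en_def
  proof (rule summable_on_comparison_test[OF summable_on_cmult_right[OF rapid_seq_summable[OF assms, of 1], of C]])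
    fix m
    have "norm (x m) * norm (x m) <= C * norm (x m)"
      using C by (intro mult_right_mono) auto
    then show "br m * (norm (x m))\<^sup>2 <= C * (br m ^ 1 * norm (x m))"
      using br_pos[of m] by (simp add: power2_eq_square mult_ac)
  qed (auto simp: less_imp_le)
qed

lemma n2_sip: "Re (sip x x) = n2 x"
  by (simp add: sip_self n2_def)

lemma form_bound:
  assumes "en x"
  shows "\<bar>Re (sip (mv K x) x)\<bar> <= CK * n2 x"
proof -
  note b = en_norm_le(2)[OF assms]
  have "norm (sip (mv K x) x) <= infsum (%p. n2 x * (%(m,n). norm (K m n) * (br m ^ 0 * br n ^ 0)) p) UNIV"
    unfolding sip_mv_pair(2)[where x=x and y=x, OF K(1) b b]
  proof (rule norm_infsum_le_infsum(2)[OF summable_on_cmult_right[OF rapid_mat_pair(1)[OF K(1)]]])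
    fix p :: "int \<times> int"
    obtain m n where p: "p = (m, n)" by (cases p)
    have "norm (x n) * norm (x m) <= sqrt (n2 x) * sqrt (n2 x)"
      using b by (intro mult_mono) (auto simp: n2_nonneg)
    then have "norm (x n) * norm (x m) <= n2 x" by (simp add: n2_nonneg)
    then show "norm ((%(m,n). K m n * (x n * cnj (x m))) p) <= n2 x * (%(m,n). norm (K m n) * (br m ^ 0 * br n ^ 0)) p"
      by (simp add: p norm_mult mult.commute[of "n2 x"] mult_left_mono)
  qed
  also have "... = n2 x * infsum (%(m,n). norm (K m n) * (br m ^ 0 * br n ^ 0)) UNIV"
    by (rule infsum_cmult_right')
  also have "... <= n2 x * CK"
    using rapid_mat_pair(2)[OF K(1), of 0] n2_nonneg by (intro mult_left_mono) (auto simp: CK_def numeral_2_eq_2)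
  finally show ?thesis
    using abs_Re_le_cmod[of "sip (mv K x) x"] by (simp add: mult.commute)
qed

lemma q_ge: "en x ==> q x \<ge> - CK * n2 x"
  using form_bound[of x] infsum_nonneg[of UNIV "%m. d m * (norm (x m))\<^sup>2"] d_nonneg
  unfolding q_def by fastforce

lemma rapid_Aop: assumes "rapid_seq x" shows "rapid_seq (Aop x)"
proof -
  obtain C where C: "!!m. norm (x m) <= C" using rapid_seq_bounded[OF assms] by metis
  show ?thesis unfolding Aop_def
    using d d_nonneg by (intro rapid_seq_add rapid_seq_mv[OF K(1) C] rapid_seq_poly_mult[where C=1 and N=1] assms) auto
qed

lemma bounded_dx_summable:
  assumes "!!m. norm (x m) <= B" "rapid_seq y"
  shows "(%m. of_real (d m) * x m * cnj (y m)) summable_on UNIV"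
proof -
  have B: "B \<ge> 0" using assms(1)[of 0] by (meson norm_ge_zero order_trans)
  show ?thesis
  proof (rule norm_infsum_le_infsum(1)[OF summable_on_cmult_right[OF rapid_seq_summable[OF assms(2), of 1], of B]])
    fix m
    have "d m * (norm (x m) * norm (y m)) <= br m * (B * norm (y m))"
      using d d_nonneg B by (intro mult_mono mult_right_mono assms) (auto simp: less_imp_le)
    then show "norm (of_real (d m) * x m * cnj (y m)) <= B * (br m ^ 1 * norm (y m))"
      using d_nonneg[of m] by (simp add: norm_mult mult_ac)
  qed
qed

lemma sip_Aop_right:
  assumes "!!m. norm (x m) <= B" "rapid_seq y"
  shows "sip x (Aop y) = infsum (%m. of_real (d m) * x m * cnj (y m)) UNIV + sip (mv K x) y"
proof -
  obtain C where C: "!!m. norm (y m) <= C" using rapid_seq_bounded[OF assms(2)] by metis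
  note r = rapid_seq_mv[where x=y, OF K(1) C]
  have s: "(%m. x m * cnj (mv K y m)) summable_on UNIV"
    using sip_summable[OF r assms(1)] summable_on_cnj_iff[of "%m. mv K y m * cnj (x m)" UNIV] by (simp add: mult.commute)
  have "sip x (Aop y) = infsum (%m. of_real (d m) * x m * cnj (y m) + x m * cnj (mv K y m)) UNIV"
    by (simp add: sip_def Aop_def algebra_simps)
  also have "... = infsum (%m. of_real (d m) * x m * cnj (y m)) UNIV + sip x (mv K y)"
    unfolding sip_def by (rule infsum_add[OF bounded_dx_summable[OF assms] s])
  finally show ?thesis
    unfolding sip_mv_herm[where x=x and y=y, OF K assms(1) C] .
qed

lemma q_rapid:
  assumes "rapid_seq x"
  shows "q x = Re (sip (Aop x) x)"
proof -
  obtain C where C: "!!m. norm (x m) <= C" using rapid_seq_bounded[OF assms] by metis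
  have "Re (sip (Aop x) x) = Re (sip x (Aop x))" by (subst sip_cnj) simp
  also have "... = Re (infsum (%m. of_real (d m) * x m * cnj (x m)) UNIV) + Re (sip (mv K x) x)"
    by (simp add: sip_Aop_right[OF C assms])
  also have "infsum (%m. of_real (d m) * x m * cnj (x m)) UNIV = infsum (%m. complex_of_real (d m * (norm (x m))\<^sup>2)) UNIV"
    by (simp only: of_real_mult complex_norm_square mult.assoc)
  finally show ?thesis
    by (simp add: q_def infsum_complex_of_real del: of_real_mult)
qed

lemma sip_Aop_sym:
  assumes "rapid_seq x" "rapid_seq y"
  shows "sip (Aop x) y = sip x (Aop y)"
proof -
  obtain C where C: "!!m. norm (x m) <= C" using rapid_seq_bounded[OF assms(1)] by metis
  have m: "rapid_seq (mv K x)" by (rule rapid_seq_mv[OF K(1) C])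
  have dd: "rapid_seq (%m. of_real (d m) * x m)"
    using d d_nonneg by (intro rapid_seq_poly_mult[where C=1 and N=1] assms) auto
  show ?thesis
    unfolding sip_Aop_right[OF C assms(2)] unfolding Aop_def
    by (subst sip_add_left[OF dd m assms(2)]) (simp add: sip_def)
qed

lemma Aop_lin:
  assumes "rapid_seq y" "finite I" "!!i. i \<in> I ==> rapid_seq (f i)"
  shows "Aop (%m. y m + (\<Sum>i\<in>I. c i * f i m)) = (%m. Aop y m + (\<Sum>i\<in>I. c i * Aop (f i) m))"
proof
  fix m
  have mvs: "mv K z m = cnj (sip (%l. cnj (K m l)) z)" for z
    by (simp add: mv_def sip_def flip: infsum_cnj)
  have "norm (cnj (K m l)) <= \<kappa> 0" for l
    using K(1) unfolding rapid_mat_def by (metis complex_mod_cnj div_by_1 mult_1 power_0)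
  from sip_lin_right[where x="%l. cnj (K m l)" and c=c, OF this assms]
  have "mv K (%m. y m + (\<Sum>i\<in>I. c i * f i m)) m = mv K y m + (\<Sum>i\<in>I. c i * mv K (f i) m)"
    unfolding mvs by simp
  then show "Aop (%m. y m + (\<Sum>i\<in>I. c i * f i m)) m = Aop y m + (\<Sum>i\<in>I. c i * Aop (f i) m)"
    by (simp add: Aop_def algebra_simps sum.distrib sum_distrib_left)
qed

lemma mv_add_scale:
  assumes "!!m. norm (x m) <= B" "!!m. norm (y m) <= C"
  shows "mv K (%m. x m + t * y m) = (%m. mv K x m + t * mv K y m)"
proof
  fix m
  have "infsum (%l. K m l * x l + t * (K m l * y l)) UNIV = infsum (%l. K m l * x l) UNIV + infsum (%l. t * (K m l * y l)) UNIV"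
    by (rule infsum_add[OF mv_summable[where x=x, OF K(1) assms(1)]
       summable_on_cmult_right[OF mv_summable[where x=y, OF K(1) assms(2)]]])
  then show "mv K (%m. x m + t * y m) m = mv K x m + t * mv K y m"
    by (simp add: mv_def infsum_cmult_right' algebra_simps)
qed

lemma form_add_scale:
  assumes "en x" "rapid_seq y"
  shows "Re (sip (mv K (%m. x m + t * y m)) (%m. x m + t * y m))
     = Re (sip (mv K x) x) + 2 * Re (cnj t * sip (mv K x) y) + (norm t)\<^sup>2 * Re (sip (mv K y) y)"
proof -
  obtain C where C: "!!m. norm (y m) <= C" using rapid_seq_bounded[OF assms(2)] by metis
  note b = en_norm_le(2)[OF assms(1)]
  note rx = rapid_seq_mv[where x=x, OF K(1) b] and ry = rapid_seq_mv[where x=y, OF K(1) C]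
  have s: "(%m. mv K x m * cnj (x m)) summable_on UNIV" "(%m. mv K x m * cnj (y m)) summable_on UNIV"
    "(%m. mv K y m * cnj (x m)) summable_on UNIV" "(%m. mv K y m * cnj (y m)) summable_on UNIV"
    using sip_summable[OF rx b] sip_summable[OF rx C] sip_summable[OF ry b] sip_summable[OF ry C] by auto
  have "((%m. mv K x m * cnj (x m) + cnj t * (mv K x m * cnj (y m)) + t * (mv K y m * cnj (x m)) + (t * cnj t) * (mv K y m * cnj (y m)))
    has_sum (sip (mv K x) x + cnj t * sip (mv K x) y + t * sip (mv K y) x + (t * cnj t) * sip (mv K y) y)) UNIV"
    unfolding sip_def by (intro has_sum_add has_sum_cmult_right has_sum_infsum s)
  then have "sip (mv K (%m. x m + t * y m)) (%m. x m + t * y m)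
     = sip (mv K x) x + cnj t * sip (mv K x) y + t * sip (mv K y) x + (t * cnj t) * sip (mv K y) y"
    unfolding mv_add_scale[OF b C] sip_def[of "%m. mv K x m + t * mv K y m"]
    by (intro infsumI) (simp add: algebra_simps)
  moreover have "sip (mv K y) x = cnj (sip (mv K x) y)"
    by (subst sip_cnj) (simp add: sip_mv_herm[where x=x and y=y, OF K b C])
  moreover have "Re (t * cnj (sip (mv K x) y)) = Re (cnj t * sip (mv K x) y)"
    by simp
  moreover have "Re (t * cnj t * sip (mv K y) y) = (norm t)\<^sup>2 * Re (sip (mv K y) y)"
    by (simp flip: complex_norm_square)
  ultimately show ?thesis by simp
qed

lemma en_add_scale:
  assumes "en x" "rapid_seq y"
  shows "en (%m. x m + t * y m)"
proof -
  note b = en_norm_le(2)[OF assms(1)]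
  have "rapid_seq (%m. of_real (br m) * y m)"
    by (rule rapid_seq_poly_mult[where C=1 and N=1]) (auto simp: assms less_imp_le)
  then have "(%m. of_real (br m) * x m * cnj (y m)) summable_on UNIV"
    using sip_summable[where y=x and x="%m. of_real (br m) * y m", OF _ b]
      summable_on_cnj_iff[of "%m. of_real (br m) * y m * cnj (x m)" UNIV] by (simp add: mult_ac)
  then show ?thesis
    using infsum_weighted_square_add(1)[where c=br and x=x and y=y] assms rapid_en[OF assms(2)]
    unfolding en_def by blast
qed

lemma quad_add_scale:
  assumes "en x" "rapid_seq y"
  shows "q (%m. x m + t * y m) - l * n2 (%m. x m + t * y m)
    = (q x - l * n2 x) + 2 * Re (cnj t * (sip x (Aop y) - of_real l * sip x y)) + (norm t)\<^sup>2 * (q y - l * n2 y)"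
proof -
  note b = en_norm_le(2)[OF assms(1)]
  note ey = rapid_en[OF assms(2)]
  have s: "(%m. x m * cnj (y m)) summable_on UNIV"
    using sip_summable[OF assms(2) b] summable_on_cnj_iff[of "%m. y m * cnj (x m)" UNIV] by (simp add: mult.commute)
  have 1: "infsum (%m. d m * (norm (x m + t * y m))\<^sup>2) UNIV = infsum (%m. d m * (norm (x m))\<^sup>2) UNIV
      + 2 * Re (cnj t * infsum (%m. of_real (d m) * x m * cnj (y m)) UNIV)
      + (norm t)\<^sup>2 * infsum (%m. d m * (norm (y m))\<^sup>2) UNIV"
    by (rule infsum_weighted_square_add(2)[OF en_summable(2)[OF assms(1)] en_summable(2)[OF ey] bounded_dx_summable[OF b assms(2)]])
  have 2: "n2 (%m. x m + t * y m) = n2 x + 2 * Re (cnj t * sip x y) + (norm t)\<^sup>2 * n2 y"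
    using infsum_weighted_square_add(2)[where c="%_. 1" and x=x and y=y and t=t] en_summable(1)[OF assms(1)] en_summable(1)[OF ey] s
    by (simp add: n2_def sip_def)
  show ?thesis
    unfolding q_def 1 2 form_add_scale[OF assms] sip_Aop_right[OF b assms(2)]
    by (simp add: algebra_simps)
qed

lemma quad_scale: "q (%m. c * x m) = (norm c)\<^sup>2 * q x" "n2 (%m. c * x m) = (norm c)\<^sup>2 * n2 x"
proof -
  have "mv K (%m. c * x m) = (%m. c * mv K x m)"
    by (auto simp: mv_def mult.left_commute infsum_cmult_right')
  then have "sip (mv K (%m. c * x m)) (%m. c * x m) = of_real ((norm c)\<^sup>2) * sip (mv K x) x"
    unfolding complex_norm_square by (simp add: sip_scale_left sip_scale_right)
  moreover have "d m * (norm (c * x m))\<^sup>2 = (norm c)\<^sup>2 * (d m * (norm (x m))\<^sup>2)" "(norm (c * x m))\<^sup>2 = (norm c)\<^sup>2 * (norm (x m))\<^sup>2" for m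
    by (simp_all add: norm_mult power_mult_distrib)
  ultimately show "q (%m. c * x m) = (norm c)\<^sup>2 * q x" "n2 (%m. c * x m) = (norm c)\<^sup>2 * n2 x"
    by (simp_all only: q_def n2_def infsum_cmult_right' distrib_left Re_complex_of_real times_complex.sel Im_complex_of_real mult_zero_left diff_zero)
qed

text \<open>A Rellich argument: a bound on the energy confines all but \<open>R / N\<close> of the
  mass of every \<open>w k\<close> to |m| at most \<open>N\<close>, so no mass escapes under
  pointwise convergence and the limit still has norm 1. The form of \<open>K\<close> converges
  because its double series has a majorant independent of \<open>k\<close>.\<close>

lemma energy_limit:
  assumes en: "!!k. en (w k)" and n1: "!!k. n2 (w k) = 1"
    and R: "!!k. infsum (%m. br m * (norm (w k m))\<^sup>2) UNIV <= R"
    and lim: "!!m. (%k. w k m) \<longlonglongrightarrow> x m"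
  shows "en x" "n2 x = 1" "(%k. sip (mv K (w k)) (w k)) \<longlonglongrightarrow> sip (mv K x) x"
    "!!y. rapid_seq y ==> (%k. sip (w k) y) \<longlonglongrightarrow> sip x y"
proof -
  have w1: "norm (w k m) <= 1" for k m
    using en_norm_le(2)[OF en, of k m] n1 by simp
  have x1: "norm (x m) <= 1" for m
    by (rule LIMSEQ_le_const2[OF tendsto_norm[OF lim]]) (use w1 in auto)
  show enx: "en x" unfolding en_def
  proof (rule nonneg_summable_onI)
    fix F :: "int set" assume F: "finite F"
    have "(%k. \<Sum>m\<in>F. br m * (norm (w k m))\<^sup>2) \<longlonglongrightarrow> (\<Sum>m\<in>F. br m * (norm (x m))\<^sup>2)"
      by (intro tendsto_intros lim)
    moreover have "(\<Sum>m\<in>F. br m * (norm (w k m))\<^sup>2) <= R" for k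
      using finite_sum_le_infsum[OF en[unfolded en_def], of F k] F R[of k] by (auto simp: less_imp_le)
    ultimately show "(\<Sum>m\<in>F. br m * (norm (x m))\<^sup>2) <= R"
      by (intro LIMSEQ_le_const2) auto
  qed (auto simp: less_imp_le)
  have R0: "R \<ge> 0"
    using R[of 0] infsum_nonneg[of UNIV "%m. br m * (norm (w 0 m))\<^sup>2"] by (force simp: less_imp_le)
  have ul: "uniform_limit UNIV (%F k. \<Sum>m\<in>F. (norm (w k m))\<^sup>2) (%k. n2 (w k)) (finite_subsets_at_top UNIV)"
  proof (rule uniform_limitI)
    fix e :: real assume e: "e > 0"
    obtain N :: nat where N: "R / e < real N" using reals_Archimedean2 by blast
    have N0: "real N > 0" using N R0 e by (meson divide_nonneg_pos le_less_trans)
    show "\<forall>\<^sub>F F in finite_subsets_at_top UNIV. \<forall>k\<in>UNIV. dist (\<Sum>m\<in>F. (norm (w k m))\<^sup>2) (n2 (w k)) < e"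
      unfolding eventually_finite_subsets_at_top
    proof (intro exI[of _ "{- int N..int N}"] conjI allI impI ballI)
      fix F k assume F: "finite F \<and> {- int N..int N} \<subseteq> F \<and> F \<subseteq> UNIV"
      have s: "(%m. (norm (w k m))\<^sup>2) summable_on UNIV" by (rule en_summable(1)[OF en])
      have sb: "(%m. br m * (norm (w k m))\<^sup>2) summable_on UNIV" using en unfolding en_def by blast
      have "n2 (w k) = (\<Sum>m\<in>F. (norm (w k m))\<^sup>2) + infsum (%m. (norm (w k m))\<^sup>2) (UNIV - F)"
        unfolding n2_def using infsum_Un_disjoint[of "%m. (norm (w k m))\<^sup>2" F "UNIV - F"] s F
        by (simp add: summable_on_subset_banach[OF s])
      moreover have "infsum (%m. (norm (w k m))\<^sup>2) (UNIV - F) <= infsum (%m. 1 / real N * (br m * (norm (w k m))\<^sup>2)) (UNIV - F)"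
      proof (rule infsum_mono)
        show "(%m. (norm (w k m))\<^sup>2) summable_on UNIV - F"
          "(%m. 1 / real N * (br m * (norm (w k m))\<^sup>2)) summable_on UNIV - F"
          by (intro summable_on_cmult_right summable_on_subset_banach[OF s] summable_on_subset_banach[OF sb]; simp)+
        fix m assume "m \<in> UNIV - F"
        then have "m \<notin> {- int N..int N}" using F by blast
        then have "\<bar>m\<bar> > int N" by auto
        then have "real N <= br m" by (auto simp: br_def)
        then have "real N * (norm (w k m))\<^sup>2 <= br m * (norm (w k m))\<^sup>2" by (rule mult_right_mono) auto
        then show "(norm (w k m))\<^sup>2 <= 1 / real N * (br m * (norm (w k m))\<^sup>2)"
          using N0 by (simp add: field_simps)
      qed
      moreover have "... <= infsum (%m. 1 / real N * (br m * (norm (w k m))\<^sup>2)) UNIV"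
        by (rule infsum_mono2[OF summable_on_cmult_right[OF summable_on_subset_banach[OF sb]] summable_on_cmult_right[OF sb]]) (auto simp: less_imp_le)
      moreover have "... <= 1 / real N * R"
        unfolding infsum_cmult_right' using R[of k] N0 by (intro mult_left_mono) auto
      moreover have "1 / real N * R < e"
        using N N0 e by (simp add: field_simps)
      moreover have "infsum (%m. (norm (w k m))\<^sup>2) (UNIV - F) \<ge> 0" by (rule infsum_nonneg) auto
      ultimately show "dist (\<Sum>m\<in>F. (norm (w k m))\<^sup>2) (n2 (w k)) < e"
        by (simp add: dist_norm)
    qed auto
  qed
  have "(%k. n2 (w k)) \<longlonglongrightarrow> n2 x"
  proof (rule swap_uniform_limit'[OF _ _ ul])
    show "\<forall>\<^sub>F F in finite_subsets_at_top UNIV. (%k. \<Sum>m\<in>F. (norm (w k m))\<^sup>2) \<longlonglongrightarrow> (\<Sum>m\<in>F. (norm (x m))\<^sup>2)"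
      by (intro always_eventually allI tendsto_intros lim)
    show "((%F. \<Sum>m\<in>F. (norm (x m))\<^sup>2) \<longlongrightarrow> n2 x) (finite_subsets_at_top UNIV)"
      unfolding n2_def by (rule infsum_tendsto[OF en_summable(1)[OF enx]])
  qed (simp_all add: finite_subsets_at_top_neq_bot)
  then show "n2 x = 1"
    using n1 by (simp add: LIMSEQ_const_iff)
  show "(%k. sip (mv K (w k)) (w k)) \<longlonglongrightarrow> sip (mv K x) x"
    unfolding sip_mv_pair(2)[where x=x and y=x, OF K(1) x1 x1] sip_mv_pair(2)[where x="w _" and y="w _", OF K(1) w1 w1]
  proof (rule tendsto_infsum_dominated)
    show "(%(m,n). norm (K m n) * (br m ^ 0 * br n ^ 0)) summable_on UNIV"
      by (rule rapid_mat_pair(1)[OF K(1)])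
    show "\<forall>\<^sub>F k in sequentially. \<forall>p\<in>UNIV. norm ((%(m,n). K m n * (w k n * cnj (w k m))) p) <= (%(m,n). norm (K m n) * (br m ^ 0 * br n ^ 0)) p"
      using w1 by (intro always_eventually allI ballI) (auto simp: norm_mult intro!: mult_left_le mult_le_one)
    show "(%k. (%(m,n). K m n * (w k n * cnj (w k m))) p) \<longlonglongrightarrow> (%(m,n). K m n * (x n * cnj (x m))) p" for p
      by (cases p) (auto intro!: tendsto_intros lim)
  qed
  show "(%k. sip (w k) y) \<longlonglongrightarrow> sip x y" if y: "rapid_seq y" for y
    unfolding sip_def
  proof (rule tendsto_infsum_dominated)
    show "(%m. br m ^ 0 * norm (y m)) summable_on UNIV" by (rule rapid_seq_summable[OF y])
    show "\<forall>\<^sub>F k in sequentially. \<forall>m\<in>UNIV. norm (w k m * cnj (y m)) <= br m ^ 0 * norm (y m)"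
      using w1 by (intro always_eventually allI ballI) (auto simp: norm_mult intro!: mult_left_le_one_le)
    show "(%k. w k m * cnj (y m)) \<longlonglongrightarrow> x m * cnj (y m)" for m
      by (intro tendsto_intros lim)
  qed
qed

text \<open>The component orthogonal to the first \<open>n\<close> eigenvectors. It serves both as a
  source of admissible test vectors and as the error of a partial eigenfunction expansion.\<close>

definition rest :: "nat => (nat => int => complex) => (int => complex) => int => complex" where
  "rest n \<Phi> w = (%m. w m + (\<Sum>i<n. (- sip w (\<Phi> i)) * \<Phi> i m))"

context
  fixes n :: nat and \<Phi> :: "nat => int => complex" and \<mu> :: "nat => real"
  assumes \<Phi>: "!!i. i < n ==> rapid_seq (\<Phi> i)"
    and orth: "!!i j. i < n ==> j < n ==> sip (\<Phi> i) (\<Phi> j) = (if i = j then 1 else 0)"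
    and eig: "!!i. i < n ==> Aop (\<Phi> i) = (%m. of_real (\<mu> i) * \<Phi> i m)"
begin

lemma rest_rapid: "rapid_seq w ==> rapid_seq (rest n \<Phi> w)"
  unfolding rest_def by (intro rapid_seq_add rapid_seq_sum rapid_seq_scale \<Phi>) auto

lemma sip_rest:
  assumes "rapid_seq w" "rapid_seq y"
  shows "sip (rest n \<Phi> w) y = sip w y - (\<Sum>i<n. sip w (\<Phi> i) * sip (\<Phi> i) y)"
proof -
  have r: "rapid_seq (%m. (- sip w (\<Phi> i)) * \<Phi> i m)" if "i < n" for i
    by (rule rapid_seq_scale[OF \<Phi>[OF that]])
  have "sip (rest n \<Phi> w) y = sip w y + sip (%m. \<Sum>i<n. (- sip w (\<Phi> i)) * \<Phi> i m) y"
    unfolding rest_def by (rule sip_add_left) (use assms r in \<open>auto intro!: rapid_seq_sum\<close>)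
  also have "sip (%m. \<Sum>i<n. (- sip w (\<Phi> i)) * \<Phi> i m) y = (\<Sum>i<n. sip (%m. (- sip w (\<Phi> i)) * \<Phi> i m) y)"
    by (rule sip_sum_left) (use assms r in auto)
  finally show ?thesis
    by (simp only: sip_scale_left) (simp add: sum_negf)
qed

lemma rest_orth:
  assumes "rapid_seq w" "j < n"
  shows "sip (rest n \<Phi> w) (\<Phi> j) = 0" "sip (\<Phi> j) (rest n \<Phi> w) = 0"
proof -
  have "(\<Sum>i<n. sip w (\<Phi> i) * sip (\<Phi> i) (\<Phi> j)) = (\<Sum>i<n. if i = j then sip w (\<Phi> j) else 0)"
    using assms by (intro sum.cong) (auto simp: orth)
  then show "sip (rest n \<Phi> w) (\<Phi> j) = 0"
    using assms by (simp add: sip_rest \<Phi>)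
  then show "sip (\<Phi> j) (rest n \<Phi> w) = 0"
    by (subst sip_cnj) simp
qed

lemma Re_coeff: "Re (sip w y * sip y w) = (norm (sip w y))\<^sup>2"
proof -
  have "sip w y * sip y w = of_real ((norm (sip w y))\<^sup>2)"
    unfolding complex_norm_square by (subst sip_cnj[of y w]) simp
  then show ?thesis by simp
qed

lemma n2_rest:
  assumes "rapid_seq w"
  shows "n2 (rest n \<Phi> w) = n2 w - (\<Sum>i<n. (norm (sip w (\<Phi> i)))\<^sup>2)"
proof -
  let ?r = "rest n \<Phi> w"
  have "sip ?r ?r = sip w ?r"
    by (subst sip_rest) (use assms rest_rapid rest_orth in auto)
  then have "n2 ?r = Re (sip ?r w)"
    by (subst sip_cnj) (simp flip: n2_sip)
  also have "... = n2 w - (\<Sum>i<n. (norm (sip w (\<Phi> i)))\<^sup>2)"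
    by (simp add: sip_rest[OF assms assms] n2_sip Re_coeff del: times_complex.sel)
  finally show ?thesis .
qed

text \<open>Eigenvectors are orthogonal for the quadratic form as well, so the Pythagoras rule of
  \<open>n2_rest\<close> reappears with weights \<open>\<mu> i\<close>.\<close>

lemma q_rest:
  assumes "rapid_seq w"
  shows "q (rest n \<Phi> w) = q w - (\<Sum>i<n. \<mu> i * (norm (sip w (\<Phi> i)))\<^sup>2)"
proof -
  let ?r = "rest n \<Phi> w"
  note rr = rest_rapid[OF assms]
  have e: "sip (\<Phi> i) (Aop y) = of_real (\<mu> i) * sip (\<Phi> i) y" if "i < n" "rapid_seq y" for i y
    using sip_Aop_sym[OF \<Phi>[OF that(1)] that(2)] that(1) by (simp add: eig sip_scale_left)
  have "sip ?r (Aop ?r) = sip w (Aop ?r) - (\<Sum>i<n. sip w (\<Phi> i) * sip (\<Phi> i) (Aop ?r))"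
    by (rule sip_rest[OF assms rapid_Aop[OF rr]])
  also have "(\<Sum>i<n. sip w (\<Phi> i) * sip (\<Phi> i) (Aop ?r)) = 0"
    by (rule sum.neutral) (simp add: e rr rest_orth assms)
  finally have "q ?r = Re (sip w (Aop ?r))"
    by (simp add: q_rapid[OF rr] sip_Aop_sym[OF rr rr])
  also have "... = Re (sip ?r (Aop w))"
    unfolding sip_Aop_sym[OF assms rr, symmetric] by (subst sip_cnj) simp
  also have "sip ?r (Aop w) = sip w (Aop w) - (\<Sum>i<n. sip w (\<Phi> i) * sip (\<Phi> i) (Aop w))"
    by (rule sip_rest[OF assms rapid_Aop[OF assms]])
  also have "(\<Sum>i<n. sip w (\<Phi> i) * sip (\<Phi> i) (Aop w)) = (\<Sum>i<n. of_real (\<mu> i) * (sip w (\<Phi> i) * sip (\<Phi> i) w))"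
    by (intro sum.cong refl) (simp add: e assms)
  also have "Re (sip w (Aop w) - ...) = q w - (\<Sum>i<n. \<mu> i * (norm (sip w (\<Phi> i)))\<^sup>2)"
  proof -
    have "Re (of_real c * z) = c * Re z" for c z by simp
    then show ?thesis
      by (simp add: q_rapid[OF assms] sip_Aop_sym[OF assms assms] Re_coeff del: times_complex.sel)
  qed
  finally show ?thesis .
qed

lemma bessel:
  assumes "rapid_seq w"
  shows "(\<Sum>i<n. (norm (sip w (\<Phi> i)))\<^sup>2) <= n2 w"
  using n2_rest[OF assms] n2_nonneg[of "rest n \<Phi> w"] by linarith

text \<open>Finitely many square summable vectors have a summable total mass, so on the infinite
  lattice the mass at some site \<open>m\<close> is below 1; the unit vector there has a nonzero
  remainder.\<close>

lemma orth_unit_exists: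
  obtains y where "rapid_seq y" "!!i. i < n ==> sip y (\<Phi> i) = 0" "n2 y = 1"
proof -
  have "\<exists>m. (\<Sum>i<n. (norm (\<Phi> i m))\<^sup>2) < 1"
  proof (rule ccontr)
    assume "\<not> ?thesis"
    then have ge: "(\<Sum>i<n. (norm (\<Phi> i m))\<^sup>2) \<ge> 1" for m by (simp add: not_less)
    have "(%m. \<Sum>i<n. (norm (\<Phi> i m))\<^sup>2) summable_on UNIV"
      by (rule infsum_sum_swap(1)) (auto intro!: rapid_seq_sq_summable \<Phi>)
    then have "(%m::int. 1::real) summable_on UNIV"
      by (rule summable_on_comparison_test) (use ge in auto)
    then have "finite (UNIV :: int set)"
      using infsum_diverge_constant[of "UNIV :: int set" "1::real"] by (auto intro: ccontr)
    then show False by simp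
  qed
  then obtain m where m: "(\<Sum>i<n. (norm (\<Phi> i m))\<^sup>2) < 1" by blast
  let ?r = "rest n \<Phi> (unit_seq m)"
  have "n2 (unit_seq m) = 1"
    using n2_sip[of "unit_seq m"] by (simp add: sip_unit_left) (simp add: unit_seq_def)
  then have pos: "n2 ?r > 0"
    using m by (simp add: n2_rest rapid_seq_unit sip_unit_left)
  let ?c = "complex_of_real (1 / sqrt (n2 ?r))"
  show ?thesis
  proof (rule that)
    show "rapid_seq (%m. ?c * ?r m)" by (intro rapid_seq_scale rest_rapid rapid_seq_unit)
    show "sip (%m. ?c * ?r m) (\<Phi> i) = 0" if "i < n" for i
      unfolding sip_scale_left using rest_orth[OF rapid_seq_unit that] by simp
    show "n2 (%m. ?c * ?r m) = 1"
      unfolding quad_scale(2) using pos by (simp add: norm_divide power_divide)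
  qed
qed

text \<open>Direct method: the Rayleigh quotient is minimised on the complement of the eigenvectors
  found so far. The lower bound in the last conclusion is what yields completeness later.\<close>

lemma eig_step:
  obtains x l where "rapid_seq x" "n2 x = 1" "!!i. i < n ==> sip x (\<Phi> i) = 0"
    "Aop x = (%m. of_real l * x m)"
    "!!w. rapid_seq w ==> (!!i. i < n ==> sip w (\<Phi> i) = 0) ==> l * n2 w <= q w"
proof -
  define V where "V w \<longleftrightarrow> en w \<and> (\<forall>i<n. sip w (\<Phi> i) = 0)" for w
  define S where "S = q ` {w. V w \<and> n2 w = 1}"
  define l where "l = Inf S"
  have Sne: "S \<noteq> {}"
    using orth_unit_exists rapid_en unfolding S_def V_def by blast
  have bdd: "bdd_below S"
    by (rule bdd_belowI[of _ "- CK"]) (use q_ge in \<open>force simp: S_def V_def\<close>)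
  have min1: "l <= q w" if "V w" "n2 w = 1" for w
    unfolding l_def by (rule cInf_lower[OF _ bdd]) (use that in \<open>auto simp: S_def\<close>)
  have minV: "l * n2 w <= q w" if w: "V w" for w
  proof (cases "n2 w = 0")
    case True
    then have "w = (%m. 0)"
      using en_norm_le(1)[of w] w unfolding V_def by auto
    then show ?thesis by (simp add: q_def n2_def sip_def)
  next
    case False
    then have pos: "n2 w > 0" using n2_nonneg[of w] by linarith
    let ?c = "complex_of_real (1 / sqrt (n2 w))"
    have c2: "(norm ?c)\<^sup>2 = 1 / n2 w" using pos by (simp add: norm_divide power_divide)
    have "en (%m. ?c * w m)"
    proof -
      have "(%m. (norm ?c)\<^sup>2 * (br m * (norm (w m))\<^sup>2)) summable_on UNIV"
        using w unfolding V_def en_def by (intro summable_on_cmult_right) auto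
      then show ?thesis
        unfolding en_def by (simp only: norm_mult power_mult_distrib mult.left_commute)
    qed
    then have "V (%m. ?c * w m)"
      using w unfolding V_def by (simp only: sip_scale_left) simp
    moreover have "n2 (%m. ?c * w m) = 1"
      unfolding quad_scale(2) c2 using pos by simp
    ultimately have "l <= q (%m. ?c * w m)" by (rule min1)
    then show ?thesis
      unfolding quad_scale(1) c2 using pos by (simp add: field_simps)
  qed
  have "\<exists>w. V w \<and> n2 w = 1 \<and> q w < l + 1 / real (Suc k)" for k
  proof -
    have "\<exists>v\<in>S. v < l + 1 / real (Suc k)"
      using cInf_lessD[OF Sne, of "l + 1 / real (Suc k)"] unfolding l_def by auto
    then show ?thesis by (auto simp: S_def)
  qed
  then obtain w where w: "!!k. V (w k)" "!!k. n2 (w k) = 1" "!!k. q (w k) < l + 1 / real (Suc k)"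
    by metis
  have en: "en (w k)" for k using w(1) by (simp add: V_def)
  have wb: "norm (w k m) <= 1" for k m using en_norm_le(2)[OF en, of k m] w(2) by simp
  \<comment> \<open>Entries are bounded by 1 and the lattice is countable, so a diagonal subsequence
    converges pointwise; the energy bound \<open>R\<close> makes \<open>energy_limit\<close>
    applicable to it.\<close>
  obtain r where r: "strict_mono (r::nat=>nat)" and "!!m. m \<in> UNIV ==> \<exists>l. (%k. w (r k) m) \<longlonglongrightarrow> l"
    by (rule function_convergent_subsequence[of "UNIV :: int set" w 1]) (use wb in auto)
  then obtain x where lim: "!!m. (%k. w (r k) m) \<longlonglongrightarrow> x m"
    by (metis UNIV_I)
  have dle: "infsum (%m. d m * (norm (w k m))\<^sup>2) UNIV <= q (w k) - Re (sip (mv K (w k)) (w k))" for k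
    by (simp add: q_def)
  have R: "infsum (%m. br m * (norm (w k m))\<^sup>2) UNIV <= 1 + (l + 1 + CK)" for k
  proof -
    have "infsum (%m. br m * (norm (w k m))\<^sup>2) UNIV <= infsum (%m. (norm (w k m))\<^sup>2 + d m * (norm (w k m))\<^sup>2) UNIV"
    proof (rule infsum_mono)
      show "(%m. br m * (norm (w k m))\<^sup>2) summable_on UNIV" using en unfolding en_def by blast
      show "(%m. (norm (w k m))\<^sup>2 + d m * (norm (w k m))\<^sup>2) summable_on UNIV"
        by (intro summable_on_add en_summable en)
      show "br m * (norm (w k m))\<^sup>2 <= (norm (w k m))\<^sup>2 + d m * (norm (w k m))\<^sup>2" for m
        using mult_right_mono[of "br m" "1 + d m" "(norm (w k m))\<^sup>2"] d(1)[of m] by (simp add: br_def algebra_simps)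
    qed
    also have "... = n2 (w k) + infsum (%m. d m * (norm (w k m))\<^sup>2) UNIV"
      unfolding n2_def by (intro infsum_add en_summable en)
    also have "... <= 1 + (l + 1 + CK)"
    proof -
      have "1 / real (Suc k) <= 1" by simp
      moreover have "\<bar>Re (sip (mv K (w k)) (w k))\<bar> <= CK"
        using form_bound[OF en, of k] w(2)[of k] by simp
      ultimately show ?thesis
        using dle[of k] w(2,3)[of k] by linarith
    qed
    finally show ?thesis .
  qed
  note L = energy_limit[where w="%k. w (r k)" and x=x, OF en w(2) R lim]
  have Vx: "V x"
    unfolding V_def
  proof (intro conjI allI impI)
    show "en x" by (rule L(1))
    fix i assume i: "i < n"
    have "(%k. sip (w (r k)) (\<Phi> i)) \<longlonglongrightarrow> sip x (\<Phi> i)" by (rule L(4)[OF \<Phi>[OF i]])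
    moreover have "sip (w (r k)) (\<Phi> i) = 0" for k using w(1) i by (simp add: V_def)
    ultimately show "sip x (\<Phi> i) = 0" by (simp add: LIMSEQ_const_iff)
  qed
  have qx: "q x <= l"
  proof -
    \<comment> \<open>Only lower semicontinuity is available for the diagonal part: the bound passes
      to the limit on finite sets, while the form of \<open>K\<close> converges.\<close>
    have "infsum (%m. d m * (norm (x m))\<^sup>2) UNIV <= l - Re (sip (mv K x) x)"
    proof (rule infsum_le_finite_sums[OF en_summable(2)[OF L(1)]])
      fix F :: "int set" assume F: "finite F"
      show "(\<Sum>m\<in>F. d m * (norm (x m))\<^sup>2) <= l - Re (sip (mv K x) x)"
      proof (rule LIMSEQ_le)
        show "(%k. \<Sum>m\<in>F. d m * (norm (w (r k) m))\<^sup>2) \<longlonglongrightarrow> (\<Sum>m\<in>F. d m * (norm (x m))\<^sup>2)"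
          by (intro tendsto_intros lim)
        have "(%k. l + 1 / real (Suc (r k)) - Re (sip (mv K (w (r k))) (w (r k)))) \<longlonglongrightarrow> l + 0 - Re (sip (mv K x) x)"
          using LIMSEQ_subseq_LIMSEQ[OF LIMSEQ_inverse_real_of_nat r]
          by (intro tendsto_intros L(3)) (simp add: o_def inverse_eq_divide)
        then show "(%k. l + 1 / real (Suc (r k)) - Re (sip (mv K (w (r k))) (w (r k)))) \<longlonglongrightarrow> l - Re (sip (mv K x) x)" by simp
        have "(\<Sum>m\<in>F. d m * (norm (w k m))\<^sup>2) <= l + 1 / real (Suc k) - Re (sip (mv K (w k)) (w k))" for k
          using finite_sum_le_infsum[OF en_summable(2)[OF en], of F k] F dle[of k] w(3)[of k] d_nonneg by force
        then show "\<exists>N. \<forall>k\<ge>N. (\<Sum>m\<in>F. d m * (norm (w (r k) m))\<^sup>2) <= l + 1 / real (Suc (r k)) - Re (sip (mv K (w (r k))) (w (r k)))"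
          by blast
      qed
    qed
    then show ?thesis by (simp add: q_def)
  qed
  have Qx: "q x - l * n2 x = 0"
    using qx min1[OF Vx L(2)] L(2) by simp
  note bx = en_norm_le(2)[OF L(1)]
  have xs: "(%m. x m * cnj (y m)) summable_on UNIV" if "rapid_seq y" for y
    using sip_summable[where y=x, OF that bx] summable_on_cnj_iff[of "%m. y m * cnj (x m)" UNIV] by (simp add: mult.commute)
  \<comment> \<open>The Euler-Lagrange equation, so far only in admissible directions
    \<open>y\<close>. The expression in \<open>t\<close> is nonnegative because the constant term of
    the expansion is 0 by \<open>Qx\<close>.\<close>
  have EL: "sip x (Aop y) - of_real l * sip x y = 0" if y: "rapid_seq y" "!!i. i < n ==> sip y (\<Phi> i) = 0" for y
  proof (rule nonneg_quadratic_imp_zero[where S="q y - l * n2 y"])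
    fix t
    have "V (%m. x m + t * y m)"
      unfolding V_def
    proof (intro conjI allI impI)
      show "en (%m. x m + t * y m)" by (rule en_add_scale[OF L(1) y(1)])
      fix i assume i: "i < n"
      have "sip (%m. x m + t * y m) (\<Phi> i) = sip x (\<Phi> i) + t * sip y (\<Phi> i)"
        unfolding sip_def
        using infsum_add[OF xs[OF \<Phi>[OF i]] summable_on_cmult_right[OF sip_summable_rapid[OF y(1) \<Phi>[OF i]], of t]]
        by (simp add: algebra_simps infsum_cmult_right')
      then show "sip (%m. x m + t * y m) (\<Phi> i) = 0"
        using y(2)[OF i] Vx i by (simp add: V_def)
    qed
    then show "0 <= 2 * Re (cnj t * (sip x (Aop y) - of_real l * sip x y)) + (norm t)\<^sup>2 * (q y - l * n2 y)"
      using minV quad_add_scale[OF L(1) y(1), of t l] Qx by fastforce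
  qed
  \<comment> \<open>The unit vector \<open>?u\<close> itself need not be admissible. Replacing it by
    \<open>?r\<close> changes neither pairing, since \<open>x\<close> is orthogonal to every
    \<open>\<Phi> i\<close> and so to \<open>Aop (\<Phi> i)\<close>, a multiple of
    \<open>\<Phi> i\<close>.\<close>
  have eigx: "of_real (d m) * x m + mv K x m = of_real l * x m" for m
  proof -
    let ?u = "unit_seq m"
    let ?r = "rest n \<Phi> ?u"
    note ru = rapid_seq_unit[of m]
    note rr = rest_rapid[OF ru]
    have 1: "sip x ?r = sip x ?u"
      unfolding rest_def using Vx sip_lin_right[where x=x, OF bx ru, of "{..<n}" \<Phi> "%i. - sip ?u (\<Phi> i)"] \<Phi>
      by (simp add: V_def)
    have "Aop ?r = (%k. Aop ?u k + (\<Sum>i<n. (- sip ?u (\<Phi> i)) * Aop (\<Phi> i) k))"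
      unfolding rest_def by (rule Aop_lin[OF ru]) (use \<Phi> in auto)
    then have "sip x (Aop ?r) = sip x (Aop ?u) + (\<Sum>i<n. cnj (- sip ?u (\<Phi> i)) * sip x (Aop (\<Phi> i)))"
      using sip_lin_right[where x=x, OF bx rapid_Aop[OF ru], of "{..<n}" "%i. Aop (\<Phi> i)" "%i. - sip ?u (\<Phi> i)"] \<Phi> rapid_Aop
      by simp
    also have "(\<Sum>i<n. cnj (- sip ?u (\<Phi> i)) * sip x (Aop (\<Phi> i))) = 0"
      using Vx by (intro sum.neutral) (simp add: eig sip_scale_right V_def)
    finally have "sip x (Aop ?u) = of_real l * sip x ?u"
      using EL[OF rr rest_orth(1)[OF ru]] 1 by simp
    moreover have "infsum (%k. of_real (d k) * x k * cnj (?u k)) UNIV = of_real (d m) * x m"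
      using sip_unit_right[of "%k. of_real (d k) * x k" m] by (simp add: sip_def)
    ultimately show ?thesis
      by (simp add: sip_Aop_right[where x=x, OF bx ru] sip_unit_right)
  qed
  have rx: "rapid_seq x"
    unfolding rapid_seq_def
  proof
    fix N
    obtain C where C: "C \<ge> 0" "!!m. norm (mv K x m) * br m ^ N <= C"
      using rapid_seqD[OF rapid_seq_mv[where x=x, OF K(1) bx]] by metis
    \<comment> \<open>Regularity from the equation \<open>(d m - l) * x m = - mv K x m\<close>: the
      right side decays rapidly and the factor is at least 1 except at finitely many
      \<open>m\<close>, which the second summand covers.\<close>
    have "norm (x m) <= (C + (\<bar>l\<bar> + 2) ^ N) / br m ^ N" for m
    proof (cases "d m \<ge> \<bar>l\<bar> + 1")
      case True
      have "of_real (d m - l) * x m = - mv K x m"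
        using eigx[of m] by (simp add: algebra_simps add_eq_0_iff)
      then have "norm (complex_of_real (d m - l) * x m) = norm (mv K x m)"
        by simp
      then have "\<bar>d m - l\<bar> * norm (x m) = norm (mv K x m)"
        by (simp only: norm_mult norm_of_real)
      moreover have "1 * norm (x m) <= \<bar>d m - l\<bar> * norm (x m)"
        using True by (intro mult_right_mono) auto
      ultimately have "norm (x m) * br m ^ N <= norm (mv K x m) * br m ^ N"
        by (intro mult_right_mono) (auto simp: less_imp_le)
      also have "... <= C + (\<bar>l\<bar> + 2) ^ N"
        using C(2)[of m] by (smt (verit) zero_le_power abs_ge_zero)
      finally show ?thesis by (simp add: pos_le_divide_eq)
    next
      case False
      then have "br m <= \<bar>l\<bar> + 2" using d(1)[of m] by (simp add: br_def)
      then have "br m ^ N <= (\<bar>l\<bar> + 2) ^ N" by (intro power_mono) (auto simp: less_imp_le)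
      moreover have "norm (x m) * br m ^ N <= 1 * br m ^ N"
        using bx[of m] L(2) by (intro mult_right_mono) (auto simp: less_imp_le)
      ultimately have "norm (x m) * br m ^ N <= C + (\<bar>l\<bar> + 2) ^ N" using C(1) by linarith
      then show ?thesis by (simp add: pos_le_divide_eq)
    qed
    then show "\<exists>C. \<forall>m. norm (x m) <= C / br m ^ N" by blast
  qed
  show ?thesis
  proof (rule that[OF rx L(2)])
    show "sip x (\<Phi> i) = 0" if "i < n" for i using Vx that by (simp add: V_def)
    show "Aop x = (%m. of_real l * x m)" using eigx by (auto simp: Aop_def)
    show "l * n2 w <= q w" if "rapid_seq w" "!!i. i < n ==> sip w (\<Phi> i) = 0" for w
      by (rule minV) (use that rapid_en in \<open>auto simp: V_def\<close>)
  qed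
qed

end

text \<open>\<open>eig_step\<close> is iterated by dependent choice. Completeness rests on the
  eigenvalues being unbounded, since the \<open>n\<close>-th remainder is controlled by an energy
  divided by \<open>\<mu> n\<close>.\<close>

lemma eigsys_exists: "\<exists>(\<Phi> :: nat => int => complex) \<mu>. eigsys d K \<Phi> \<mu>"
proof -
  define P where "P f n r \<longleftrightarrow> rapid_seq (fst r) \<and> n2 (fst r) = 1 \<and> (\<forall>i<n. sip (fst r) (fst (f i)) = 0) \<and>
      Aop (fst r) = (%m. of_real (snd r) * fst r m) \<and>
      (\<forall>w. rapid_seq w \<longrightarrow> (\<forall>i<n. sip w (fst (f i)) = 0) \<longrightarrow> snd r * n2 w <= q w)"
    for f :: "nat => (int => complex) \<times> real" and n :: nat and r :: "(int => complex) \<times> real"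
  have sip1: "sip x x = 1" if "n2 x = 1" for x
    using that by (simp add: sip_self n2_def)
  have orthP: "sip (fst (f i)) (fst (f j)) = (if i = j then 1 else 0)"
    if "!!y. y < n ==> P f y (f y)" "i < n" "j < n" for f :: "nat => (int => complex) \<times> real" and n i j :: nat
  proof (cases i j rule: linorder_cases)
    case less
    then have "sip (fst (f j)) (fst (f i)) = 0" using that unfolding P_def by blast
    then show ?thesis using less by (subst sip_cnj) auto
  next
    case equal
    then show ?thesis using that sip1 unfolding P_def by auto
  next
    case greater
    then show ?thesis using that unfolding P_def by auto
  qed
  have "\<exists>f. \<forall>n. P f n (f n)"
  proof (rule dependent_wellorder_choice)
    show "P f n r = P g n r" if "!!y. y < n ==> f y = g y" for r f g n
      using that unfolding P_def by auto
    fix n f assume f: "!!y. y < n ==> P f y (f y)"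
    show "\<exists>r. P f n r"
    proof (rule eig_step[of n "%i. fst (f i)" "%i. snd (f i)"])
      show "rapid_seq (fst (f i))" "Aop (fst (f i)) = (%m. of_real (snd (f i)) * fst (f i) m)" if "i < n" for i
        using f[OF that] unfolding P_def by blast+
      show "sip (fst (f i)) (fst (f j)) = (if i = j then 1 else 0)" if "i < n" "j < n" for i j
        by (rule orthP[OF f that])
      fix x l assume "rapid_seq x" "n2 x = 1" "!!i. i < n ==> sip x (fst (f i)) = 0"
        "Aop x = (%m. of_real l * x m)"
        "!!w. rapid_seq w ==> (!!i. i < n ==> sip w (fst (f i)) = 0) ==> l * n2 w <= q w"
      then have "P f n (x, l)" unfolding P_def by auto
      then show "\<exists>r. P f n r" by blast
    qed
  qed
  then obtain f where f: "!!n. P f n (f n)" by blast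
  define \<Phi> where "\<Phi> = (%i. fst (f i))"
  define \<mu> where "\<mu> = (%i. snd (f i))"
  have \<Phi>: "rapid_seq (\<Phi> i)" "n2 (\<Phi> i) = 1" "Aop (\<Phi> i) = (%m. of_real (\<mu> i) * \<Phi> i m)" for i
    using f[of i] unfolding P_def \<Phi>_def \<mu>_def by blast+
  have orth: "sip (\<Phi> i) (\<Phi> j) = (if i = j then 1 else 0)" for i j
    unfolding \<Phi>_def by (rule orthP[of "Suc (max i j)"]) (use f in auto)
  have min: "\<mu> n * n2 w <= q w" if "rapid_seq w" "!!i. i < n ==> sip w (\<Phi> i) = 0" for n w
    using f[of n] that unfolding P_def \<Phi>_def \<mu>_def by blast
  note R = rest_rapid[of _ \<Phi>, OF \<Phi>(1) orth \<Phi>(3)] and RO = rest_orth(1)[of _ \<Phi>, OF \<Phi>(1) orth \<Phi>(3)]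
    and N2 = n2_rest[of _ \<Phi>, OF \<Phi>(1) orth \<Phi>(3)]
    and QR = q_rest[of _ \<Phi>, OF \<Phi>(1) orth \<Phi>(3)] and B = bessel[of _ \<Phi>, OF \<Phi>(1) orth \<Phi>(3)]
  have q\<Phi>: "q (\<Phi> i) = \<mu> i" for i
    using q_rapid[OF \<Phi>(1)] n2_sip[of "\<Phi> i"] by (simp add: \<Phi> sip_scale_left)
  have \<mu>_ge: "\<mu> i \<ge> - CK" for i
    using q_ge[OF rapid_en[OF \<Phi>(1)], of i] by (simp add: q\<Phi> \<Phi>(2))
  \<comment> \<open>If all eigenvalues were at most \<open>b\<close>, at least half the mass of
    every eigenvector would lie in one window of \<open>2 * N + 1\<close> sites. Bessel allows each
    site a total mass of 1, so only finitely many orthonormal vectors would fit.\<close>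
  have unbdd: "\<exists>n. \<mu> n > b" for b
  proof (rule ccontr)
    assume "\<not> ?thesis"
    then have ub: "\<mu> n <= b" for n by (simp add: not_less)
    have bC: "b + CK \<ge> 0" using ub[of 0] \<mu>_ge[of 0] by linarith
    obtain N :: nat where N: "2 * (b + CK) < real N" using reals_Archimedean2 by blast
    have N0: "real N > 0" by (rule le_less_trans[OF _ N]) (use bC in simp)
    let ?F = "{- int N..int N}"
    have half: "(\<Sum>m\<in>?F. (norm (\<Phi> i m))\<^sup>2) \<ge> 1 / 2" for i
    proof -
      note s = en_summable[OF rapid_en[OF \<Phi>(1)[of i]]]
      have "infsum (%m. d m * (norm (\<Phi> i m))\<^sup>2) UNIV = \<mu> i - Re (sip (mv K (\<Phi> i)) (\<Phi> i))"
        using q\<Phi>[of i] by (simp add: q_def)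
      also have "... <= b + CK"
        using form_bound[OF rapid_en[OF \<Phi>(1)], of i] ub[of i] \<Phi>(2)[of i] by (simp add: abs_le_iff)
      finally have e: "infsum (%m. d m * (norm (\<Phi> i m))\<^sup>2) UNIV <= b + CK" .
      have "1 = (\<Sum>m\<in>?F. (norm (\<Phi> i m))\<^sup>2) + infsum (%m. (norm (\<Phi> i m))\<^sup>2) (UNIV - ?F)"
        using infsum_Un_disjoint[of "%m. (norm (\<Phi> i m))\<^sup>2" ?F "UNIV - ?F"] \<Phi>(2)[of i]
        by (simp add: n2_def summable_on_subset_banach[OF s(1)])
      moreover have "infsum (%m. (norm (\<Phi> i m))\<^sup>2) (UNIV - ?F) <= infsum (%m. 1 / real N * (d m * (norm (\<Phi> i m))\<^sup>2)) (UNIV - ?F)"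
      proof (rule infsum_mono)
        show "(%m. (norm (\<Phi> i m))\<^sup>2) summable_on UNIV - ?F"
          "(%m. 1 / real N * (d m * (norm (\<Phi> i m))\<^sup>2)) summable_on UNIV - ?F"
          by (intro summable_on_cmult_right summable_on_subset_banach[OF s(1)] summable_on_subset_banach[OF s(2)]; simp)+
        fix m assume "m \<in> UNIV - ?F"
        then have "real N <= d m" using d(1)[of m] by auto
        then have "real N * (norm (\<Phi> i m))\<^sup>2 <= d m * (norm (\<Phi> i m))\<^sup>2" by (rule mult_right_mono) auto
        then show "(norm (\<Phi> i m))\<^sup>2 <= 1 / real N * (d m * (norm (\<Phi> i m))\<^sup>2)"
          using N0 by (simp add: field_simps)
      qed
      moreover have "... <= infsum (%m. 1 / real N * (d m * (norm (\<Phi> i m))\<^sup>2)) UNIV"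
        by (rule infsum_mono2[OF summable_on_cmult_right[OF summable_on_subset_banach[OF s(2)]] summable_on_cmult_right[OF s(2)]]) (use d_nonneg in auto)
      moreover have "... <= 1 / real N * (b + CK)"
        unfolding infsum_cmult_right' using e N0 by (intro mult_left_mono) auto
      moreover have "1 / real N * (b + CK) <= 1 / 2"
        using N N0 by (simp add: field_simps)
      ultimately show ?thesis by linarith
    qed
    \<comment> \<open>Half of \<open>M\<close> is \<open>2 * N + 2\<close>, one more than the number
      of sites in the window.\<close>
    define M where "M = 4 * N + 4"
    have "real M * (1 / 2) <= (\<Sum>i<M. \<Sum>m\<in>?F. (norm (\<Phi> i m))\<^sup>2)"
      using sum_mono[of "{..<M}" "%_. 1/2" "%i. \<Sum>m\<in>?F. (norm (\<Phi> i m))\<^sup>2"] half by simp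
    also have "... = (\<Sum>m\<in>?F. \<Sum>i<M. (norm (\<Phi> i m))\<^sup>2)"
      by (rule sum.swap)
    also have "... <= (\<Sum>m\<in>?F. 1)"
    proof (rule sum_mono)
      fix m
      have "n2 (unit_seq m) = 1"
        using n2_sip[of "unit_seq m"] by (simp add: sip_unit_left) (simp add: unit_seq_def)
      then show "(\<Sum>i<M. (norm (\<Phi> i m))\<^sup>2) <= 1"
        using B[OF rapid_seq_unit[of m], of M] by (simp add: sip_unit_left)
    qed
    also have "... = real (2 * N + 1)" by simp
    finally show False by (simp add: M_def)
  qed
  have "((%j. (norm (sip w (\<Phi> j)))\<^sup>2) has_sum Re (sip w w)) UNIV" if w: "rapid_seq w" for w
  proof -
    let ?c = "%j. (norm (sip w (\<Phi> j)))\<^sup>2"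
    have sB: "(\<Sum>i<n. ?c i) <= n2 w" for n by (rule B[OF w])
    have summ: "summable ?c"
      by (rule bounded_imp_summable[where B="n2 w"]) (use sB[of "Suc _"] in \<open>auto simp: lessThan_Suc_atMost\<close>)
    \<comment> \<open>The left side is the squared norm of the remainder, which is orthogonal to the
      first \<open>n\<close> eigenvectors, so minimality of \<open>\<mu> n\<close> applies. Earlier
      eigenvalues may be negative; \<open>- CK\<close> bounds them from below.\<close>
    have "n2 w - (\<Sum>i<n. ?c i) <= (q w + CK * n2 w) / \<mu> n" if n: "\<mu> n > 0" for n
    proof -
      have "\<mu> n * n2 (rest n \<Phi> w) <= q (rest n \<Phi> w)"
        by (rule min[OF R[OF w] RO[OF w]])
      also have "... = q w - (\<Sum>i<n. \<mu> i * ?c i)" by (rule QR[OF w])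
      also have "... <= q w - (\<Sum>i<n. - CK * ?c i)"
        by (intro diff_left_mono sum_mono mult_right_mono \<mu>_ge) auto
      also have "... = q w + CK * (\<Sum>i<n. ?c i)" by (simp add: sum_distrib_left sum_negf)
      also have "... <= q w + CK * n2 w"
        using mult_left_mono[OF sB[of n] CK_nonneg] by simp
      finally have "\<mu> n * (n2 w - (\<Sum>i<n. ?c i)) <= q w + CK * n2 w"
        by (simp add: N2[OF w])
      then show ?thesis using n by (simp add: field_simps)
    qed
    moreover have "(\<Sum>i<n. ?c i) <= suminf ?c" for n
      by (rule sum_le_suminf[OF summ]) auto
    ultimately have gap: "n2 w - suminf ?c <= (q w + CK * n2 w) / \<mu> n" if "\<mu> n > 0" for n
      using that by (meson diff_left_mono order_trans)
    have "n2 w <= suminf ?c"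
    proof (rule field_le_epsilon)
      fix e :: real assume e: "e > 0"
      let ?Q = "\<bar>q w + CK * n2 w\<bar>"
      obtain n where n: "\<mu> n > ?Q / e + 1" using unbdd by blast
      have "?Q / e \<ge> 0" using e by simp
      with n have pos: "\<mu> n > 0" by linarith
      have "(q w + CK * n2 w) / \<mu> n <= ?Q / \<mu> n" using pos by (simp add: divide_right_mono)
      also have "... <= e"
      proof -
        have "?Q / e <= \<mu> n" using n by linarith
        then show ?thesis using e pos by (simp add: field_simps)
      qed
      finally show "n2 w <= suminf ?c + e" using gap[OF pos] by linarith
    qed
    moreover have "suminf ?c <= n2 w"
      by (rule suminf_le_const[OF summ sB])
    ultimately have "?c sums n2 w" using summ by (simp add: sums_iff)
    then show ?thesis
      unfolding n2_sip by (rule sums_nonneg_imp_has_sum) auto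
  qed
  moreover have "of_real (\<mu> j) * \<Phi> j m = of_real (d m) * \<Phi> j m + mv K (\<Phi> j) m" for j m
    using fun_cong[OF \<Phi>(3)[of j], of m] by (simp add: Aop_def)
  ultimately have "eigsys d K \<Phi> \<mu>"
    unfolding eigsys_def using \<Phi>(1) orth by blast
  then show ?thesis by blast
qed

end

section \<open>Smooth functions on the circle, uniformly in a parameter\<close>

text \<open>Bounds on all derivatives up to order \<open>n\<close>, valid for the whole index set at
  once. Indices will contain \<tau> and pairs of Fourier modes, and this uniformity makes repeated
  integration by parts yield constants free of them.\<close>

primrec kb :: "nat => 'i set => ('i => cfun) => bool" where
  "kb 0 I f \<longleftrightarrow> (\<exists>C. \<forall>i\<in>I. \<forall>th. norm (f i th) <= C)"
| "kb (Suc n) I f \<longleftrightarrow> (\<exists>C. \<forall>i\<in>I. \<forall>th. norm (f i th) <= C) \<and>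
     (\<forall>i\<in>I. \<forall>th. f i differentiable (at th)) \<and> kb n I (%i. vder (f i))"

definition sfam :: "'i set => ('i => cfun) => bool" where
  "sfam I f \<longleftrightarrow> (\<forall>i\<in>I. \<forall>th. f i (th + 2 * pi) = f i th) \<and> (\<forall>n. kb n I f)"

lemma vder_works: "f differentiable (at th) ==> (f has_vector_derivative vder f th) (at th)"
  by (simp add: vder_def vector_derivative_works[symmetric])

lemma vder_eqI: "(f has_vector_derivative D) (at th) ==> vder f th = D"
  by (simp add: vder_def vector_derivative_at)

lemma kb_cong: "(!!i. i \<in> I ==> f i = g i) ==> kb n I f \<longleftrightarrow> kb n I g"
proof (induction n arbitrary: f g)
  case (Suc n)
  have "kb n I (%i. vder (f i)) = kb n I (%i. vder (g i))"
    by (rule Suc.IH) (simp add: Suc.prems)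
  then show ?case using Suc.prems by (simp cong: ball_cong)
qed (simp cong: ball_cong)

lemma kb_Suc_imp: "kb (Suc n) I f ==> kb n I f"
proof (induction n arbitrary: f)
  case (Suc n)
  then show ?case by (metis kb.simps(2))
qed auto

lemma kb_add: "kb n I f ==> kb n I g ==> kb n I (%i th. f i th + g i th)"
proof (induction n arbitrary: f g)
  case 0
  then obtain C D where "\<forall>i\<in>I. \<forall>th. norm (f i th) <= C" "\<forall>i\<in>I. \<forall>th. norm (g i th) <= D" by auto
  then have "\<forall>i\<in>I. \<forall>th. norm (f i th + g i th) <= C + D" by (meson add_mono norm_triangle_le)
  then show ?case by auto
next
  case (Suc n)
  obtain C D where CD: "\<forall>i\<in>I. \<forall>th. norm (f i th) <= C" "\<forall>i\<in>I. \<forall>th. norm (g i th) <= D" using Suc.prems by auto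
  then have "\<forall>i\<in>I. \<forall>th. norm (f i th + g i th) <= C + D" by (meson add_mono norm_triangle_le)
  moreover have "vder (%th. f i th + g i th) = (%th. vder (f i) th + vder (g i) th)" if "i \<in> I" for i
    using Suc.prems that by (intro ext vder_eqI has_vector_derivative_add vder_works) auto
  moreover have "kb n I (%i th. vder (f i) th + vder (g i) th)"
    using Suc by auto
  ultimately show ?case
    using Suc.prems by (auto simp: kb_cong[of I "%i. vder (%th. f i th + g i th)" "%i th. vder (f i) th + vder (g i) th"])
qed

lemma kb_mult: "kb n I f ==> kb n I g ==> kb n I (%i th. f i th * g i th)"
proof (induction n arbitrary: f g)
  case 0
  then obtain C D where "\<forall>i\<in>I. \<forall>th. norm (f i th) <= C" "\<forall>i\<in>I. \<forall>th. norm (g i th) <= D" by auto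
  then have "\<forall>i\<in>I. \<forall>th. norm (f i th * g i th) <= C * D"
    by (auto simp: norm_mult intro!: mult_mono intro: order_trans[OF norm_ge_zero])
  then show ?case by auto
next
  case (Suc n)
  obtain C D where CD: "\<forall>i\<in>I. \<forall>th. norm (f i th) <= C" "\<forall>i\<in>I. \<forall>th. norm (g i th) <= D" using Suc.prems by auto
  then have "\<forall>i\<in>I. \<forall>th. norm (f i th * g i th) <= C * D"
    by (auto simp: norm_mult intro!: mult_mono intro: order_trans[OF norm_ge_zero])
  moreover have "vder (%th. f i th * g i th) = (%th. f i th * vder (g i) th + vder (f i) th * g i th)" if "i \<in> I" for i
    using Suc.prems that by (intro ext vder_eqI has_vector_derivative_mult vder_works) auto
  moreover have "kb n I (%i th. f i th * vder (g i) th + vder (f i) th * g i th)"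
    using Suc.prems kb_Suc_imp by (intro kb_add Suc.IH) auto
  ultimately show ?case
    using Suc.prems by (auto simp: kb_cong[of I "%i. vder (%th. f i th * g i th)" "%i th. f i th * vder (g i) th + vder (f i) th * g i th"])
qed

lemma kb_const: "\<forall>i\<in>I. norm (c i) <= C ==> kb n I (%i th. c i)"
proof (induction n arbitrary: c C)
  case (Suc n)
  have "vder (%th. c i) = (%th. 0)" for i
    by (intro ext vder_eqI) auto
  moreover have "kb n I (%i th. 0)" by (rule Suc.IH[of _ 0]) auto
  ultimately show ?case using Suc.prems by auto
qed auto

lemma kb_cnj: "kb n I f ==> kb n I (%i th. cnj (f i th))"
proof (induction n arbitrary: f)
  case (Suc n)
  have "vder (%th. cnj (f i th)) = (%th. cnj (vder (f i) th))" if "i \<in> I" for i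
    using Suc.prems that by (intro ext vder_eqI has_vector_derivative_cnj vder_works) auto
  moreover have "(%th. cnj (f i th)) differentiable (at th)" if "i \<in> I" for i th
    using has_vector_derivative_cnj[OF vder_works] Suc.prems that
    by (metis kb.simps(2) differentiableI_vector)
  ultimately show ?case
    using Suc by (auto simp: kb_cong[of I "%i. vder (%th. cnj (f i th))" "%i th. cnj (vder (f i) th)"])
qed auto

lemma kb_power: "kb n I f ==> kb n I (%i th. f i th ^ k)"
proof (induction k)
  case 0
  show ?case using kb_const[of I "%_. 1" 1 n] by simp
next
  case (Suc k)
  then show ?case using kb_mult[of n I f "%i th. f i th ^ k"] by simp
qed

text \<open>Bootstrap: the equation expresses the derivative of \<open>f\<close> through
  \<open>f\<close> itself, so bounds of order \<open>n\<close> give order \<open>n + 1\<close>.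
  Reciprocals, inverse square roots, exponentials and, with \<open>k = 0\<close>, primitives are all
  obtained this way.\<close>

lemma kb_ode:
  assumes "\<forall>i\<in>I. \<forall>th. norm (f i th) <= C"
    and "!!i th. i \<in> I ==> (f i has_vector_derivative F i th * f i th ^ k) (at th)"
    and "!!n. kb n I F"
  shows "kb n I f"
proof (induction n)
  case (Suc n)
  have "vder (f i) = (%th. F i th * f i th ^ k)" if "i \<in> I" for i
    using assms(2)[OF that] by (intro ext vder_eqI)
  moreover have "kb n I (%i th. F i th * f i th ^ k)"
    by (intro kb_mult kb_power Suc assms)
  ultimately have "kb n I (%i. vder (f i))"
    by (simp add: kb_cong[of I "%i. vder (f i)" "%i th. F i th * f i th ^ k"])
  moreover have "f i differentiable (at th)" if "i \<in> I" for i th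
    by (rule differentiableI_vector[OF assms(2)[OF that]])
  ultimately show ?case
    using assms(1) by auto
qed (use assms in auto)

lemma sfam_add: "sfam I f ==> sfam I g ==> sfam I (%i th. f i th + g i th)"
  using kb_add[of _ I f g] by (simp add: sfam_def)

lemma sfam_mult: "sfam I f ==> sfam I g ==> sfam I (%i th. f i th * g i th)"
  using kb_mult[of _ I f g] by (simp add: sfam_def)

lemma sfam_const: "(!!i. i \<in> I ==> norm (c i) <= C) ==> sfam I (%i th. c i)"
  using kb_const[of I c C] by (simp add: sfam_def)

lemma sfam_cnj: "sfam I f ==> sfam I (%i th. cnj (f i th))"
  using kb_cnj[of _ I f] by (simp add: sfam_def)

lemma sfam_ode:
  assumes "\<forall>i\<in>I. \<forall>th. norm (f i th) <= C" "\<forall>i\<in>I. \<forall>th. f i (th + 2 * pi) = f i th"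
    and "!!i th. i \<in> I ==> (f i has_vector_derivative F i th * f i th ^ k) (at th)"
    and "sfam I F"
  shows "sfam I f"
  using kb_ode[OF assms(1,3)] assms(2,4) by (simp add: sfam_def)

lemma vder_periodic:
  assumes "!!th. f (th + 2 * pi) = f th" "!!th. f differentiable (at th)"
  shows "vder f (th + 2 * pi) = vder f th"
proof -
  have "(f has_vector_derivative vder f (th + 2 * pi)) (at (th + 2 * pi))"
    by (rule vder_works[OF assms(2)])
  then have "((f \<circ> (%t. t + 2 * pi)) has_vector_derivative 1 *\<^sub>R vder f (th + 2 * pi)) (at th)"
    by (intro vector_diff_chain_at) (auto intro!: derivative_eq_intros)
  moreover have "f \<circ> (%t. t + 2 * pi) = f" using assms(1) by auto
  ultimately show ?thesis by (simp add: vder_eqI)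
qed

lemma sfam_differentiable: "sfam I f ==> i \<in> I ==> f i differentiable (at th)"
  unfolding sfam_def by (drule conjunct2, drule spec[of _ "Suc 0"]) simp

lemma sfam_vder:
  assumes "sfam I f"
  shows "sfam I (%i. vder (f i))"
  unfolding sfam_def
proof (intro conjI ballI allI)
  show "vder (f i) (th + 2 * pi) = vder (f i) th" if "i \<in> I" for i th
    by (rule vder_periodic) (use assms that sfam_differentiable[OF assms that] in \<open>auto simp: sfam_def\<close>)
  show "kb n I (%i. vder (f i))" for n
  proof -
    have "kb (Suc n) I f" using assms unfolding sfam_def by blast
    then show ?thesis by simp
  qed
qed

lemma sfam_bdd: "sfam I f ==> \<exists>C. \<forall>i\<in>I. \<forall>th. norm (f i th) <= C"
  unfolding sfam_def by (drule conjunct2, drule spec[of _ 0]) simp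

lemma sfam_smooth:
  assumes "sfam I f" "i \<in> I"
  shows "smooth_per (f i)"
proof -
  have "(vder ^^ n) (f i) differentiable (at th)" for n th
  proof -
    have "sfam I (%i. (vder ^^ n) (f i))"
    proof (induction n)
      case (Suc n)
      then show ?case using sfam_vder[OF Suc] by simp
    qed (simp add: assms)
    from sfam_differentiable[OF this assms(2)] show ?thesis .
  qed
  then show ?thesis using assms unfolding smooth_per_def sfam_def by blast
qed

lemma periodic_int:
  fixes f :: "real => 'a"
  assumes "!!th. f (th + 2 * pi) = f th"
  shows "f (th + of_int k * (2 * pi)) = f th"
proof (induction k rule: int_induct[where k=0])
  case (step1 i)
  have "f (th + of_int i * (2 * pi) + 2 * pi) = f (th + of_int i * (2 * pi))" by (rule assms)
  then show ?case using step1 by (simp add: algebra_simps)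
next
  case (step2 i)
  have "f (th + of_int (i - 1) * (2 * pi) + 2 * pi) = f (th + of_int (i - 1) * (2 * pi))" by (rule assms)
  then show ?case using step2 by (simp add: algebra_simps)
qed simp

lemma period_reduce:
  obtains th' k where "th' \<in> {0..<2 * pi}" "th = th' + of_int k * (2 * pi)"
proof
  let ?k = "\<lfloor>th / (2 * pi)\<rfloor>"
  show "th = (th - of_int ?k * (2 * pi)) + of_int ?k * (2 * pi)" by simp
  have tp: "2 * pi > 0" by simp
  have "th / (2 * pi) < of_int ?k + 1" by linarith
  then have "th < (of_int ?k + 1) * (2 * pi)"
    by (rule iffD1[OF pos_divide_less_eq[OF tp]])
  moreover have "of_int ?k * (2 * pi) <= th"
    by (rule iffD1[OF pos_le_divide_eq[OF tp] of_int_floor_le])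
  ultimately show "th - of_int ?k * (2 * pi) \<in> {0..<2 * pi}"
    by (simp add: distrib_right)
qed

lemma periodic_bounded:
  fixes f :: "real => 'a::real_normed_vector"
  assumes "!!th. f (th + 2 * pi) = f th" "continuous_on {0..2*pi} f"
  obtains C where "!!th. norm (f th) <= C"
proof -
  have "compact (f ` {0..2*pi})" by (intro compact_continuous_image assms) auto
  from compact_imp_bounded[OF this] obtain C where C: "!!th. th \<in> {0..2*pi} ==> norm (f th) <= C"
    unfolding bounded_iff by blast
  have "norm (f th) <= C" for th
  proof -
    obtain th' k where "th' \<in> {0..<2 * pi}" "th = th' + of_int k * (2 * pi)" by (rule period_reduce)
    then show ?thesis using periodic_int[of f th' k] assms(1) C[of th'] by simp
  qed
  then show ?thesis using that by blast
qed

lemma smooth_per_differentiable: "smooth_per f ==> f differentiable (at th)"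
  unfolding smooth_per_def by (metis funpow_0)

lemma smooth_per_vder: assumes "smooth_per f" shows "smooth_per (vder f)"
  unfolding smooth_per_def
proof (intro conjI allI)
  show "vder f (th + 2 * pi) = vder f th" for th
    by (rule vder_periodic) (use assms smooth_per_differentiable in \<open>auto simp: smooth_per_def\<close>)
  show "(vder ^^ n) (vder f) differentiable (at th)" for n th
    using assms unfolding smooth_per_def by (metis funpow_Suc_right o_apply)
qed

lemma smooth_per_continuous: "smooth_per f ==> continuous_on S f"
  by (intro continuous_at_imp_continuous_on ballI differentiable_imp_continuous_within smooth_per_differentiable)

text \<open>A periodic continuous function is bounded, and so are all its derivatives. Regarding one
  function as a family with one member transfers every closure rule for families to
  \<open>smooth_per\<close>.\<close>

lemma smooth_per_sfam: "smooth_per f \<longleftrightarrow> sfam {()} (%_. f)"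
proof
  assume f: "smooth_per f"
  have "kb n {()} (%_. h)" if "smooth_per h" for n h
    using that
  proof (induction n arbitrary: h)
    case 0
    obtain C where "!!th. norm (h th) <= C"
      using periodic_bounded[of h] 0 smooth_per_continuous unfolding smooth_per_def by metis
    then show ?case by auto
  next
    case (Suc n)
    obtain C where "!!th. norm (h th) <= C"
      using periodic_bounded[of h] Suc.prems smooth_per_continuous unfolding smooth_per_def by metis
    then show ?case using Suc smooth_per_vder smooth_per_differentiable by auto
  qed
  then show "sfam {()} (%_. f)" using f unfolding sfam_def smooth_per_def by blast
next
  assume "sfam {()} (%_. f)"
  from sfam_smooth[OF this] show "smooth_per f" by simp
qed

lemma smooth_per_bdd: assumes "smooth_per f" obtains C where "!!th. norm (f th) <= C" "C \<ge> 0"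
proof -
  obtain C where "!!th. norm (f th) <= C"
    using assms sfam_bdd[of "{()}" "%_. f"] unfolding smooth_per_sfam by auto
  then show ?thesis using that norm_ge_zero order_trans by blast
qed

lemma smooth_per_add: "smooth_per f ==> smooth_per g ==> smooth_per (%th. f th + g th)"
  unfolding smooth_per_sfam by (rule sfam_add)

lemma smooth_per_mult: "smooth_per f ==> smooth_per g ==> smooth_per (%th. f th * g th)"
  unfolding smooth_per_sfam by (rule sfam_mult)

lemma smooth_per_const: "smooth_per (%th. c)"
  unfolding smooth_per_sfam by (rule sfam_const[where C="norm c"]) auto

lemma smooth_per_cnj: "smooth_per f ==> smooth_per (%th. cnj (f th))"
  unfolding smooth_per_sfam by (rule sfam_cnj)

lemma smooth_per_scale: "smooth_per f ==> smooth_per (%th. c * f th)"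
  by (rule smooth_per_mult[OF smooth_per_const])

lemma smooth_per_diff: "smooth_per f ==> smooth_per g ==> smooth_per (%th. f th - g th)"
  using smooth_per_add[of f "%th. -1 * g th"] smooth_per_scale[of g "-1"] by simp

lemma smooth_per_ode:
  assumes "!!th. norm (f th) <= C" "!!th. f (th + 2 * pi) = f th"
    and "!!th. (f has_vector_derivative F th * f th ^ k) (at th)" "smooth_per F"
  shows "smooth_per f"
  unfolding smooth_per_sfam by (rule sfam_ode[where C=C and F="%_. F" and k=k]) (use assms in \<open>auto simp: smooth_per_sfam\<close>)

text \<open>Families bounded away from zero are closed under inversion because \<open>(1/f)' = - f' (1/f)\<^sup>2\<close>;
  the inverse square root satisfies a similar equation.\<close>

lemma sfam_inverse:
  assumes "sfam I f" "c > 0" "!!i th. i \<in> I ==> norm (f i th) \<ge> c"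
  shows "sfam I (%i th. 1 / f i th)"
proof (rule sfam_ode[where C="1 / c" and F="%i th. (-1) * vder (f i) th" and k=2])
  show "\<forall>i\<in>I. \<forall>th. norm (1 / f i th) <= 1 / c"
    using assms(2,3) by (auto simp: norm_divide intro!: frac_le)
  show "\<forall>i\<in>I. \<forall>th. 1 / f i (th + 2 * pi) = 1 / f i th" using assms(1) by (simp add: sfam_def)
  show "sfam I (%i th. (-1) * vder (f i) th)"
    by (intro sfam_mult sfam_vder assms(1) sfam_const[where C=1]) auto
  fix i th assume i: "i \<in> I"
  have nz: "f i th \<noteq> 0" using assms(2) assms(3)[OF i, of th] by (metis norm_zero not_less)
  have "(f i has_vector_derivative vder (f i) th) (at th)"
    by (intro vder_works sfam_differentiable[OF assms(1) i])
  then have "((inverse \<circ> f i) has_vector_derivative vder (f i) th * (- (inverse (f i th) ^ Suc (Suc 0)))) (at th)"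
    using DERIV_inverse[OF nz] by (rule field_vector_diff_chain_at)
  then show "((%th. 1 / f i th) has_vector_derivative (-1) * vder (f i) th * (1 / f i th)\<^sup>2) (at th)"
    by (simp add: o_def inverse_eq_divide power2_eq_square)
qed

lemma smooth_per_inverse:
  assumes "smooth_per f" "!!th. f th \<noteq> 0"
  shows "smooth_per (%th. 1 / f th)"
proof -
  have "\<exists>c>0. \<forall>th\<in>{0..2*pi}. norm (f th) \<ge> c"
  proof -
    have "continuous_on {0..2*pi} (%th. norm (f th))"
      using smooth_per_continuous[OF assms(1)] by (rule continuous_on_norm)
    from continuous_attains_inf[OF _ _ this] obtain x where x: "\<forall>th\<in>{0..2*pi}. norm (f x) <= norm (f th)" by auto
    then show ?thesis using assms(2)[of x] by (intro exI[of _ "norm (f x)"]) auto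
  qed
  then obtain c where c: "c > 0" "!!th. th \<in> {0..2*pi} ==> norm (f th) \<ge> c" by blast
  have "norm (f th) \<ge> c" for th
  proof -
    obtain th' k where "th' \<in> {0..<2 * pi}" "th = th' + of_int k * (2 * pi)" by (rule period_reduce)
    then show ?thesis using periodic_int[of f th' k] assms(1) c(2)[of th'] by (simp add: smooth_per_def)
  qed
  then show ?thesis using sfam_inverse[of "{()}" "%_. f" c] assms(1) c(1) unfolding smooth_per_sfam by blast
qed

lemma smooth_per_real_deriv:
  assumes "smooth_per (%th. complex_of_real (b th))"
  shows "(b has_real_derivative deriv b th) (at th)" "vder (%th. complex_of_real (b th)) th = of_real (deriv b th)"
proof -
  have "((%th. complex_of_real (b th)) has_vector_derivative vder (%th. complex_of_real (b th)) th) (at th)"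
    by (intro vder_works smooth_per_differentiable assms)
  from bounded_linear.has_vector_derivative[OF bounded_linear_Re this]
  have "b field_differentiable (at th)"
    unfolding field_differentiable_def has_real_derivative_iff_has_vector_derivative by auto
  then show d: "(b has_real_derivative deriv b th) (at th)"
    by (simp add: field_differentiable_derivI)
  show "vder (%th. complex_of_real (b th)) th = of_real (deriv b th)"
    by (rule vder_eqI) (rule has_vector_derivative_of_real[OF d])
qed

lemma smooth_per_rinvsqrt:
  assumes b: "smooth_per (%th. complex_of_real (b th))" and pos: "!!th. b th > 0"
  shows "smooth_per (rinvsqrt b)" "smooth_per (rsqrt b)"
proof -
  have bper: "b (th + 2 * pi) = b th" for th
    using b unfolding smooth_per_def by (metis of_real_eq_iff)
  \<comment> \<open>Written as a factor times the cube of the function itself, to fit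
    \<open>smooth_per_ode\<close> with \<open>k = 3\<close>.\<close>
  have d: "((%th. 1 / sqrt (b th)) has_real_derivative (- 1 / 2 * deriv b th) * (1 / sqrt (b th)) ^ 3) (at th)" for th
    using pos[of th]
    by (auto intro!: derivative_eq_intros smooth_per_real_deriv(1)[OF b] simp: field_simps power3_eq_cube power2_eq_square)
  have cont: "continuous_on {0..2*pi} (rinvsqrt b)"
    unfolding rinvsqrt_def by (intro continuous_on_of_real, rule DERIV_continuous_on, rule has_field_derivative_at_within, rule d)
  have per: "rinvsqrt b (th + 2 * pi) = rinvsqrt b th" for th
    by (simp add: rinvsqrt_def bper)
  obtain C where C: "!!th. norm (rinvsqrt b th) <= C"
    using periodic_bounded[OF per cont] by blast
  show r: "smooth_per (rinvsqrt b)"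
  proof (rule smooth_per_ode[where C=C and F="%th. (- 1 / 2) * vder (%th. complex_of_real (b th)) th" and k=3])
    show "(rinvsqrt b has_vector_derivative (- 1 / 2) * vder (%th. complex_of_real (b th)) th * rinvsqrt b th ^ 3) (at th)" for th
      using has_vector_derivative_of_real[OF d[of th], where 'a=complex]
      unfolding rinvsqrt_def smooth_per_real_deriv(2)[OF b] by simp
    show "smooth_per (%th. (- 1 / 2) * vder (%th. complex_of_real (b th)) th)"
      by (intro smooth_per_scale smooth_per_vder b)
  qed (rule C per)+
  have "rsqrt b = (%th. complex_of_real (b th) * rinvsqrt b th)"
  proof
    fix th
    have "sqrt (b th) = b th * (1 / sqrt (b th))" using pos[of th] by (simp add: field_simps)
    then show "rsqrt b th = complex_of_real (b th) * rinvsqrt b th"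
      unfolding rsqrt_def rinvsqrt_def by (metis of_real_mult)
  qed
  then show "smooth_per (rsqrt b)" using smooth_per_mult[OF b r] by simp
qed

lemma smooth_per_periodic: "smooth_per f ==> f (th + 2 * pi) = f th"
  by (simp add: smooth_per_def)

lemma smooth_per_integrable: "smooth_per f ==> f integrable_on {0..2*pi}"
  by (intro integrable_continuous_interval smooth_per_continuous)

lemma integral_vder_zero:
  assumes "smooth_per f"
  shows "integral {0..2*pi} (vder f) = 0"
proof -
  have "(vder f has_integral (f (2*pi) - f 0)) {0..2*pi}"
    by (rule fundamental_theorem_of_calculus)
       (auto intro!: has_vector_derivative_at_within vder_works smooth_per_differentiable assms)
  then show ?thesis using smooth_per_periodic[OF assms, of 0] by (simp add: integral_unique)
qed

text \<open>Sums over the integers are unordered limits here, whereas the inversion formula is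
  computed on symmetric partial sums; this links the two.\<close>

lemma symmetric_intervals_filterlim:
  "filterlim (%N. {- int N..int N}) (finite_subsets_at_top UNIV) sequentially"
  unfolding filterlim_finite_subsets_at_top
proof (intro allI impI)
  fix F :: "int set" assume F: "finite F \<and> F \<subseteq> UNIV"
  define M where "M = nat (Max (insert 0 (abs ` F)))"
  have "F \<subseteq> {- int N..int N}" if "N \<ge> M" for N
  proof
    fix x assume "x \<in> F"
    then have "\<bar>x\<bar> <= Max (insert 0 (abs ` F))" using F by (intro Max_ge) auto
    moreover have "Max (insert 0 (abs ` F)) <= int N" using that unfolding M_def by linarith
    ultimately show "x \<in> {- int N..int N}" by auto
  qed
  then show "\<forall>\<^sub>F N in sequentially. finite {- int N..int N} \<and> F \<subseteq> {- int N..int N} \<and> {- int N..int N} \<subseteq> UNIV"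
    unfolding eventually_at_top_linorder by auto
qed

lemma integral_complex_of_real:
  "f integrable_on A ==> integral A (%x. complex_of_real (f x)) = of_real (integral A f)"
  using integral_linear[of f A complex_of_real] bounded_linear_of_real by (simp add: o_def)

lemma vector_derivative_quotient:
  fixes f :: cfun
  assumes "(f has_vector_derivative D) (at x)"
  shows "((%y. (f y - f x) / of_real (y - x)) \<longlongrightarrow> D) (at x)"
proof -
  have "((%y. norm (f y - f x - (y - x) *\<^sub>R D) / norm (y - x)) \<longlongrightarrow> 0) (at x)"
    using assms unfolding has_vector_derivative_def has_derivative_iff_norm by blast
  then have "((%y. norm ((f y - f x) / of_real (y - x) - D)) \<longlongrightarrow> 0) (at x)"
  proof (rule Lim_transform_eventually)
    show "\<forall>\<^sub>F y in at x. norm (f y - f x - (y - x) *\<^sub>R D) / norm (y - x) = norm ((f y - f x) / of_real (y - x) - D)"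
    proof (rule eventually_mono[OF eventually_neq_at_within[of x]])
      fix y :: real assume "y \<noteq> x"
      then have nz: "complex_of_real (y - x) \<noteq> 0" by simp
      have "(f y - f x) / of_real (y - x) - D = (f y - f x - (y - x) *\<^sub>R D) / of_real (y - x)"
        unfolding scaleR_conv_of_real using nz by (simp add: diff_divide_distrib del: of_real_diff)
      then show "norm (f y - f x - (y - x) *\<^sub>R D) / norm (y - x) = norm ((f y - f x) / of_real (y - x) - D)"
        by (simp only: norm_divide norm_of_real real_norm_def)
    qed
  qed
  then show ?thesis by (simp add: tendsto_norm_zero_iff LIM_zero_iff)
qed

section \<open>Fourier analysis in a changed coordinate\<close>

text \<open>\<open>s\<close> is a lift of an orientation preserving diffeomorphism of the circle.
  Coefficients \<open>fc\<close> are taken with respect to the measure of density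
  \<open>\<sigma>\<close>, for which the \<open>E n\<close> are orthogonal.\<close>

locale coord =
  fixes s \<sigma> :: "real => real"
  assumes ds: "!!th. (s has_real_derivative \<sigma> th) (at th)"
    and s_per: "!!th. s (th + 2 * pi) = s th + 2 * pi"
    and \<sigma>_pos: "!!th. \<sigma> th > 0"
    and \<sigma>_smooth: "smooth_per (%th. complex_of_real (\<sigma> th))"
begin

definition E :: "int => cfun" where
  "E n = (%th. exp (\<i> * of_int n * of_real (s th)))"

definition fc :: "cfun => int => complex" where
  "fc f n = integral {0..2*pi} (%th. f th * cnj (E n th) * of_real (\<sigma> th)) / (2 * pi)"

definition syn :: "(int => complex) => cfun" where
  "syn x = (%th. infsum (%n. x n * E n th) UNIV)"

lemma E_norm [simp]: "norm (E n th) = 1"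
  by (simp add: E_def norm_exp_eq_Re)

lemma E_deriv: "(E n has_vector_derivative \<i> * of_int n * of_real (\<sigma> th) * E n th) (at th)"
proof -
  have "((%th. complex_of_real (s th)) has_vector_derivative of_real (\<sigma> th)) (at th)"
    by (rule has_vector_derivative_of_real[OF ds])
  then have "((%th. (\<i> * of_int n) * complex_of_real (s th)) has_vector_derivative (\<i> * of_int n) * of_real (\<sigma> th)) (at th)"
    by (rule has_vector_derivative_mult_right)
  then have "((exp \<circ> (%th. (\<i> * of_int n) * complex_of_real (s th))) has_vector_derivative
     (\<i> * of_int n) * of_real (\<sigma> th) * exp ((\<i> * of_int n) * complex_of_real (s th))) (at th)"
    by (rule field_vector_diff_chain_at) (rule DERIV_exp)
  then show ?thesis by (simp add: E_def o_def)
qed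

lemma E_periodic: "E n (th + 2 * pi) = E n th"
proof -
  have "E n (th + 2 * pi) = E n th * exp (\<i> * of_int n * (2 * pi))"
    unfolding E_def s_per by (simp add: algebra_simps exp_add)
  also have "exp (\<i> * of_int n * (2 * pi)) = 1"
    using exp_eq_1[of "\<i> * of_int n * (2 * pi)"] by (auto simp: algebra_simps)
  finally show ?thesis by simp
qed

lemma E_smooth: "smooth_per (E n)"
proof (rule smooth_per_ode[where C=1 and F="%th. (\<i> * of_int n) * of_real (\<sigma> th)" and k=1])
  show "(E n has_vector_derivative (\<i> * of_int n) * of_real (\<sigma> th) * E n th ^ 1) (at th)" for th
    using E_deriv[of n th] by simp
  show "smooth_per (%th. (\<i> * of_int n) * of_real (\<sigma> th))"
    by (rule smooth_per_scale[OF \<sigma>_smooth])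
qed (auto simp: E_periodic)

lemma E_vder: "vder (E n) = (%th. \<i> * of_int n * of_real (\<sigma> th) * E n th)"
  by (intro ext vder_eqI E_deriv)

lemma E_mult: "E m th * E n th = E (m + n) th"
  unfolding E_def by (simp add: algebra_simps flip: exp_add)

lemma E_cnj: "cnj (E n th) = E (- n) th"
  unfolding E_def by (simp add: exp_cnj)

lemma E_0: "E 0 th = 1"
  by (simp add: E_def)

lemma E_cont: "continuous_on S (E n)"
  by (rule smooth_per_continuous[OF E_smooth])

lemma \<sigma>_cont: "continuous_on S (%th. complex_of_real (\<sigma> th))"
  by (rule smooth_per_continuous[OF \<sigma>_smooth])

lemma \<sigma>_real_cont: "continuous_on S \<sigma>"
  using continuous_on_Re[OF \<sigma>_cont] by simp

lemma integral_E: "integral {0..2*pi} (%th. E n th * of_real (\<sigma> th)) = (if n = 0 then 2 * pi else 0)"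
proof (cases "n = 0")
  case True
  have "((%th. complex_of_real (\<sigma> th)) has_integral (complex_of_real (s (2*pi)) - of_real (s 0))) {0..2*pi}"
    by (rule fundamental_theorem_of_calculus)
       (auto intro!: has_vector_derivative_of_real has_field_derivative_at_within ds)
  then show ?thesis using True s_per[of 0] by (simp add: E_0 integral_unique)
next
  case False
  have "0 = integral {0..2*pi} (%th. (\<i> * of_int n) * (E n th * of_real (\<sigma> th)))"
    using integral_vder_zero[OF E_smooth[of n]] by (simp add: E_vder mult_ac)
  also have "... = (\<i> * of_int n) * integral {0..2*pi} (%th. E n th * of_real (\<sigma> th))"
    by (rule integral_mult_right)
  finally show ?thesis using False by simp
qed

lemma E_orth: "integral {0..2*pi} (%th. E n th * cnj (E m th) * of_real (\<sigma> th)) = (if n = m then 2 * pi else 0)"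
  using integral_E[of "n - m"] by (simp add: E_cnj E_mult)

lemma fc_E: "fc (E n) m = (if n = m then 1 else 0)"
  unfolding fc_def E_orth by auto

lemma fc_integrable:
  assumes "continuous_on {0..2*pi} f"
  shows "(%th. f th * cnj (E n th) * of_real (\<sigma> th)) integrable_on {0..2*pi}"
  by (intro integrable_continuous_interval continuous_intros assms E_cont \<sigma>_cont)

lemma \<sigma>_bdd: obtains C where "!!th. \<sigma> th <= C" "C > 0"
proof -
  obtain C where C: "!!th. norm (complex_of_real (\<sigma> th)) <= C" using smooth_per_bdd[OF \<sigma>_smooth] by blast
  have *: "\<sigma> th <= C" for th using C[of th] \<sigma>_pos[of th] by simp
  then show ?thesis using that \<sigma>_pos[of 0] by (meson less_le_trans)
qed

lemma fc_bound:
  assumes "continuous_on {0..2*pi} f" "!!th. th \<in> {0..2*pi} ==> norm (f th) <= B" "!!th. \<sigma> th <= C"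
  shows "norm (fc f n) <= B * C"
proof -
  have B: "B \<ge> 0" using assms(2)[of 0] pi_ge_zero by (meson atLeastAtMost_iff mult_nonneg_nonneg norm_ge_zero order_refl order_trans zero_le_numeral)
  have "norm (integral {0..2*pi} (%th. f th * cnj (E n th) * of_real (\<sigma> th))) <= (B * C) * (2 * pi - 0)"
  proof (rule integral_bound)
    show "continuous_on {0..2*pi} (%th. f th * cnj (E n th) * of_real (\<sigma> th))"
      by (intro continuous_intros assms E_cont \<sigma>_cont)
    show "norm (f th * cnj (E n th) * of_real (\<sigma> th)) <= B * C" if "th \<in> {0..2*pi}" for th
      using assms(2)[OF that] assms(3)[of th] \<sigma>_pos[of th] B by (auto simp: norm_mult intro!: mult_mono)
  qed auto
  then show ?thesis by (simp add: fc_def norm_divide norm_mult field_simps)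
qed

lemma fc_by_parts:
  assumes "smooth_per f"
  shows "\<i> * of_int n * fc f n = fc (%th. vder f th * (1 / of_real (\<sigma> th))) n"
proof -
  have sE: "smooth_per (%th. cnj (E n th))" by (rule smooth_per_cnj[OF E_smooth])
  have vE: "vder (%th. cnj (E n th)) th = - \<i> * of_int n * of_real (\<sigma> th) * cnj (E n th)" for th
    using has_vector_derivative_cnj[OF E_deriv[of n th]] by (intro vder_eqI) simp
  have prod: "vder (%th. f th * cnj (E n th)) = (%th. f th * vder (%th. cnj (E n th)) th + vder f th * cnj (E n th))"
    by (intro ext vder_eqI has_vector_derivative_mult vder_works smooth_per_differentiable assms sE)
  have i1: "(%th. f th * vder (%th. cnj (E n th)) th) integrable_on {0..2*pi}"
    by (intro smooth_per_integrable smooth_per_mult smooth_per_vder assms sE)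
  have i2: "(%th. vder f th * cnj (E n th)) integrable_on {0..2*pi}"
    by (intro smooth_per_integrable smooth_per_mult smooth_per_vder assms sE)
  have "0 = integral {0..2*pi} (%th. f th * vder (%th. cnj (E n th)) th) + integral {0..2*pi} (%th. vder f th * cnj (E n th))"
    using integral_vder_zero[OF smooth_per_mult[OF assms sE]] integral_add[OF i1 i2] unfolding prod by simp
  also have "(%th. f th * vder (%th. cnj (E n th)) th) = (%th. (- \<i> * of_int n) * (f th * cnj (E n th) * of_real (\<sigma> th)))"
    by (auto simp: vE)
  also have "integral {0..2*pi} ... = (- \<i> * of_int n) * integral {0..2*pi} (%th. f th * cnj (E n th) * of_real (\<sigma> th))"
    by (rule integral_mult_right)
  also have "(%th. vder f th * cnj (E n th)) = (%th. vder f th * (1 / of_real (\<sigma> th)) * cnj (E n th) * of_real (\<sigma> th))"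
  proof
    show "vder f th * cnj (E n th) = vder f th * (1 / of_real (\<sigma> th)) * cnj (E n th) * of_real (\<sigma> th)" for th
      using \<sigma>_pos[of th] by simp
  qed
  finally show ?thesis by (simp add: fc_def divide_simps)
qed

lemma inv_\<sigma>_smooth: "smooth_per (%th. 1 / complex_of_real (\<sigma> th))"
  by (rule smooth_per_inverse[OF \<sigma>_smooth]) (use \<sigma>_pos in \<open>auto simp: less_imp_neq[symmetric]\<close>)

lemma fc_rapid: "smooth_per f ==> rapid_seq (fc f)"
proof -
  have "\<exists>C. \<forall>n. norm (fc f n) * br n ^ N <= C" if "smooth_per f" for N f
    using that
  proof (induction N arbitrary: f)
    case 0
    obtain B where "!!th. norm (f th) <= B" using smooth_per_bdd[OF 0] by blast
    moreover obtain C where "!!th. \<sigma> th <= C" using \<sigma>_bdd by blast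
    ultimately have "norm (fc f n) <= B * C" for n
      by (intro fc_bound smooth_per_continuous 0)
    then show ?case by auto
  next
    case (Suc N)
    let ?g = "%th. vder f th * (1 / of_real (\<sigma> th))"
    have g: "smooth_per ?g" by (intro smooth_per_mult smooth_per_vder Suc.prems inv_\<sigma>_smooth)
    obtain C D where C: "!!n. norm (fc f n) * br n ^ N <= C" and D: "!!n. norm (fc ?g n) * br n ^ N <= D"
      using Suc.IH[OF Suc.prems] Suc.IH[OF g] by blast
    have "norm (fc f n) * br n ^ Suc N <= C + D" for n
    proof -
      have "\<bar>real_of_int n\<bar> * norm (fc f n) = norm (fc ?g n)"
        using arg_cong[OF fc_by_parts[OF Suc.prems, of n], of norm] by (simp add: norm_mult)
      then have "norm (fc f n) * br n ^ Suc N = norm (fc f n) * br n ^ N + norm (fc ?g n) * br n ^ N"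
        by (simp add: br_def algebra_simps)
      then show ?thesis using C[of n] D[of n] by linarith
    qed
    then show ?case by blast
  qed
  moreover assume "smooth_per f"
  ultimately show ?thesis unfolding rapid_seq_def by (metis br_pos pos_le_divide_eq zero_less_power)
qed

lemma fc_diff: "continuous_on {0..2*pi} f ==> continuous_on {0..2*pi} g ==> fc (%th. f th - g th) n = fc f n - fc g n"
  unfolding fc_def using integral_diff[OF fc_integrable fc_integrable, of f g n n]
  by (simp add: left_diff_distrib diff_divide_distrib)

lemma fc_scale: "fc (%th. c * f th) n = c * fc f n"
  unfolding fc_def by (simp add: mult.assoc)

lemma fc_cong: "(!!th. th \<in> {0..2*pi} ==> f th = g th) ==> fc f n = fc g n"
  unfolding fc_def by (metis (no_types, lifting) integral_cong)

lemma fc_shift: "fc (%th. E k th * f th) n = fc f (n - k)"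
proof -
  have "E k th * f th * cnj (E n th) = f th * cnj (E (n - k) th)" for th
    using E_mult[of k th "- n"] by (simp add: E_cnj algebra_simps)
  then show ?thesis unfolding fc_def by (simp only:)
qed

lemma bessel_fc:
  assumes h: "continuous_on {0..2*pi} h" and F: "finite F"
  shows "(\<Sum>n\<in>F. (norm (fc h n))\<^sup>2) <= Re (integral {0..2*pi} (%th. h th * cnj (h th) * of_real (\<sigma> th))) / (2 * pi)"
proof -
  define p where "p = (%th. \<Sum>n\<in>F. fc h n * E n th)"
  have pc: "continuous_on {0..2*pi} p"
    unfolding p_def by (intro continuous_intros E_cont)
  let ?I = "%f g. integral {0..2*pi} (%th. f th * cnj (g th) * of_real (\<sigma> th))"
  have int: "(%th. f th * cnj (g th) * of_real (\<sigma> th)) integrable_on {0..2*pi}"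
    if "continuous_on {0..2*pi} f" "continuous_on {0..2*pi} g" for f g
    by (intro integrable_continuous_interval continuous_intros that \<sigma>_cont)
  have Ip: "?I f p = (\<Sum>n\<in>F. cnj (fc h n) * (2 * pi * fc f n))" if f: "continuous_on {0..2*pi} f" for f
  proof -
    have "?I f p = integral {0..2*pi} (%th. \<Sum>n\<in>F. cnj (fc h n) * (f th * cnj (E n th) * of_real (\<sigma> th)))"
      unfolding p_def by (simp add: sum_distrib_left sum_distrib_right mult_ac)
    also have "... = (\<Sum>n\<in>F. integral {0..2*pi} (%th. cnj (fc h n) * (f th * cnj (E n th) * of_real (\<sigma> th))))"
      by (intro integral_sum F integrable_on_mult_right fc_integrable f)
    also have "... = (\<Sum>n\<in>F. cnj (fc h n) * (2 * pi * fc f n))"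
      by (intro sum.cong refl) (simp add: fc_def)
    finally show ?thesis .
  qed
  have fcp: "fc p n = fc h n" if "n \<in> F" for n
  proof -
    have "fc p n = integral {0..2*pi} (%th. \<Sum>k\<in>F. fc h k * (E k th * cnj (E n th) * of_real (\<sigma> th))) / (2 * pi)"
      unfolding p_def fc_def[of "%th. \<Sum>k\<in>F. fc h k * E k th"] by (simp add: sum_distrib_right sum_distrib_left mult_ac)
    also have "integral {0..2*pi} (%th. \<Sum>k\<in>F. fc h k * (E k th * cnj (E n th) * of_real (\<sigma> th)))
       = (\<Sum>k\<in>F. fc h k * (if k = n then 2 * pi else 0))"
      by (subst integral_sum) (auto intro!: F integrable_on_mult_right fc_integrable E_cont simp: E_orth)
    also have "... = fc h n * (2 * pi)" using F that by (simp add: if_distrib sum.delta cong: if_cong)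
    finally show ?thesis by simp
  qed
  have S: "(\<Sum>n\<in>F. cnj (fc h n) * (2 * pi * fc h n)) = of_real (2 * pi * (\<Sum>n\<in>F. (norm (fc h n))\<^sup>2))"
    unfolding sum_distrib_left of_real_sum of_real_mult complex_norm_square by (simp add: mult_ac)
  have hp: "?I h p = of_real (2 * pi * (\<Sum>n\<in>F. (norm (fc h n))\<^sup>2))"
    using Ip[OF h] S by simp
  have pp: "?I p p = of_real (2 * pi * (\<Sum>n\<in>F. (norm (fc h n))\<^sup>2))"
    using Ip[OF pc] S fcp by (simp cong: sum.cong)
  have ph: "?I p h = of_real (2 * pi * (\<Sum>n\<in>F. (norm (fc h n))\<^sup>2))"
  proof -
    have "?I p h = cnj (?I h p)" unfolding Henstock_Kurzweil_Integration.integral_cnj by (simp add: mult_ac)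
    then show ?thesis unfolding hp by simp
  qed
  have "?I (%th. h th - p th) (%th. h th - p th) = ?I h h - ?I h p - (?I p h - ?I p p)"
  proof -
    have "(%th. (h th - p th) * cnj (h th - p th) * of_real (\<sigma> th)) =
       (%th. (h th * cnj (h th) * of_real (\<sigma> th) - h th * cnj (p th) * of_real (\<sigma> th)) - (p th * cnj (h th) * of_real (\<sigma> th) - p th * cnj (p th) * of_real (\<sigma> th)))"
      by (simp add: algebra_simps)
    then show ?thesis
      by (simp only: integral_diff integrable_diff int h pc)
  qed
  moreover have "Re (?I (%th. h th - p th) (%th. h th - p th)) \<ge> 0"
  proof -
    have "?I (%th. h th - p th) (%th. h th - p th) = integral {0..2*pi} (%th. of_real ((norm (h th - p th))\<^sup>2 * \<sigma> th))"
      unfolding of_real_mult complex_norm_square by simp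
    also have "... = of_real (integral {0..2*pi} (%th. (norm (h th - p th))\<^sup>2 * \<sigma> th))"
      by (rule integral_complex_of_real, intro integrable_continuous_interval continuous_intros h pc \<sigma>_real_cont)
    finally have "Re (?I (%th. h th - p th) (%th. h th - p th)) = integral {0..2*pi} (%th. (norm (h th - p th))\<^sup>2 * \<sigma> th)"
      by simp
    moreover have "... \<ge> 0"
    proof (rule integral_nonneg)
      show "(%th. (norm (h th - p th))\<^sup>2 * \<sigma> th) integrable_on {0..2*pi}"
        by (intro integrable_continuous_interval continuous_intros h pc \<sigma>_real_cont)
    qed (auto intro!: mult_nonneg_nonneg less_imp_le[OF \<sigma>_pos])
    ultimately show ?thesis by simp
  qed
  ultimately have "0 <= Re (?I h h) - 2 * pi * (\<Sum>n\<in>F. (norm (fc h n))\<^sup>2)"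
    unfolding hp ph pp by simp
  then show ?thesis by (simp add: field_simps)
qed

text \<open>Riemann-Lebesgue from Bessel: square summable coefficients tend to 0. The two index
  sequences are those of the boundary terms in \<open>inversion_interior\<close>.\<close>

lemma fc_tendsto_0:
  assumes "continuous_on {0..2*pi} h"
  shows "(%N. fc h (int N)) \<longlonglongrightarrow> 0" "(%N. fc h (- int N - 1)) \<longlonglongrightarrow> 0"
proof -
  have S: "(%n. (norm (fc h n))\<^sup>2) summable_on UNIV"
    by (rule nonneg_summable_onI(1)[OF _ bessel_fc[OF assms]]) auto
  have *: "(%N. fc h (k N)) \<longlonglongrightarrow> 0" if "inj k" for k :: "nat => int"
  proof -
    have "(%N. (norm (fc h (k N)))\<^sup>2) summable_on UNIV"
      using summable_on_reindex[OF that, of "%n. (norm (fc h n))\<^sup>2"] summable_on_subset_banach[OF S, of "range k"]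
      by (simp add: o_def)
    then have "(%N. (norm (fc h (k N)))\<^sup>2) \<longlonglongrightarrow> 0"
      by (intro summable_LIMSEQ_zero summable_on_imp_summable)
    from tendsto_real_sqrt[OF this] have "(%N. norm (fc h (k N))) \<longlonglongrightarrow> 0" by simp
    then show ?thesis by (simp add: tendsto_norm_zero_iff)
  qed
  show "(%N. fc h (int N)) \<longlonglongrightarrow> 0" "(%N. fc h (- int N - 1)) \<longlonglongrightarrow> 0"
    by (rule *, auto simp: inj_def)+
qed

lemma s_strict: "x < y ==> s x < s y"
  using DERIV_pos_imp_increasing[of x y s] ds \<sigma>_pos by blast

lemma E1_inj:
  assumes "th0 \<in> {0<..<2*pi}" "th \<in> {0..2*pi}" "E 1 th = E 1 th0"
  shows "th = th0"
proof -
  obtain k :: int where "\<i> * of_real (s th) = \<i> * of_real (s th0) + of_int (2 * k) * pi * \<i>"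
    using assms(3) unfolding E_def by (auto simp: exp_eq)
  then have "\<i> * of_real (s th) = \<i> * of_real (s th0 + of_int (2 * k) * pi)" by (simp add: algebra_simps)
  then have k: "s th = s th0 + of_int k * (2 * pi)"
    by (metis complex_i_not_zero mult_cancel_left of_real_eq_iff mult.commute mult.assoc of_int_mult of_int_numeral)
  have "s 0 < s th0" "s th0 < s 0 + 2 * pi"
    using s_strict[of 0 th0] s_strict[of th0 "2*pi"] s_per[of 0] assms(1) by auto
  moreover have "s 0 <= s th" "s th <= s 0 + 2 * pi"
    using s_strict[of 0 th] s_strict[of th "2*pi"] s_per[of 0] assms(2) by (auto simp: le_less)
  ultimately have h: "real_of_int k * (2 * pi) < 1 * (2 * pi)" "(-1) * (2 * pi) < real_of_int k * (2 * pi)" using k by linarith+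
  have "real_of_int k < 1" by (rule mult_right_less_imp_less[OF h(1)]) simp
  moreover have "-1 < real_of_int k" by (rule mult_right_less_imp_less[OF h(2)]) simp
  ultimately have "k = 0" by linarith
  then have "s th = s th0" using k by simp
  then show ?thesis using s_strict[of th th0] s_strict[of th0 th] by (cases th th0 rule: linorder_cases) auto
qed

text \<open>The difference quotient \<open>h\<close> of \<open>f\<close> against \<open>E 1\<close>
  at \<open>th0\<close> is continuous, and multiplication by \<open>E 1\<close> shifts coefficients.
  Hence \<open>fc f n * E n th0\<close> telescopes, apart from the term \<open>f th0\<close> at
  \<open>n = 0\<close>, and the boundary terms vanish by Riemann-Lebesgue.\<close>

lemma inversion_interior:
  assumes f: "smooth_per f" and th0: "th0 \<in> {0<..<2*pi}"
  shows "infsum (%n. fc f n * E n th0) UNIV = f th0"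
proof -
  let ?e = "\<i> * of_int 1 * of_real (\<sigma> th0) * E 1 th0"
  have e0: "?e \<noteq> 0" using \<sigma>_pos[of th0] by (auto simp: E_def)
  define h where "h th = (if th = th0 then vder f th0 / ?e else (f th - f th0) / (E 1 th - E 1 th0))" for th
  have ne: "E 1 th \<noteq> E 1 th0" if "th \<in> {0..2*pi}" "th \<noteq> th0" for th
    using E1_inj[OF th0 that(1)] that(2) by blast
  have hc: "continuous_on {0..2*pi} h"
    unfolding continuous_on_eq_continuous_within
  proof
    fix th assume th: "th \<in> {0..2*pi}"
    show "continuous (at th within {0..2*pi}) h"
    proof (cases "th = th0")
      case True
      have "((%y. ((f y - f th0) / of_real (y - th0)) / ((E 1 y - E 1 th0) / of_real (y - th0))) \<longlongrightarrow> vder f th0 / ?e) (at th0)"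
        by (intro tendsto_divide vector_derivative_quotient vder_works smooth_per_differentiable f E_deriv e0)
      then have "(h \<longlongrightarrow> vder f th0 / ?e) (at th0)"
      proof (rule Lim_transform_eventually)
        show "\<forall>\<^sub>F y in at th0. ((f y - f th0) / of_real (y - th0)) / ((E 1 y - E 1 th0) / of_real (y - th0)) = h y"
          by (rule eventually_mono[OF eventually_neq_at_within[of th0]]) (auto simp: h_def divide_simps simp flip: of_real_diff)
      qed
      then have "(h \<longlongrightarrow> h th0) (at th0 within {0..2*pi})"
        using tendsto_within_subset[of h _ th0 UNIV] by (auto simp: h_def)
      then show ?thesis unfolding True continuous_within .
    next
      case False
      have "continuous (at th within {0..2*pi}) (%th. (f th - f th0) / (E 1 th - E 1 th0))"
      proof (rule continuous_at_imp_continuous_at_within)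
        have "isCont f th" "isCont (E 1) th"
          using smooth_per_continuous[OF f, of UNIV] E_cont[of UNIV 1] by (auto simp: continuous_on_eq_continuous_at)
        then show "isCont (%th. (f th - f th0) / (E 1 th - E 1 th0)) th"
          using ne[OF th False] by (intro isCont_divide isCont_diff) auto
      qed
      then show ?thesis
      proof (rule continuous_transform_within)
        show "\<bar>th - th0\<bar> > 0" using False by simp
        show "(f y - f th0) / (E 1 y - E 1 th0) = h y" if "dist y th < \<bar>th - th0\<bar>" for y
          using that by (auto simp: h_def dist_real_def abs_minus_commute)
      qed (use th in auto)
    qed
  qed
  have fh: "f th = f th0 * E 0 th - (E 1 th0 * h th - E 1 th * h th)" if "th \<in> {0..2*pi}" for th
  proof (cases "th = th0")
    case False
    then have "(E 1 th - E 1 th0) * h th = f th - f th0"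
      using ne[OF that False] by (simp add: h_def)
    then show ?thesis by (simp add: E_0 algebra_simps)
  qed (simp add: E_0)
  have fcf: "fc f n = (if n = 0 then f th0 else 0) - (E 1 th0 * fc h n - fc h (n - 1))" for n
  proof -
    have "fc f n = fc (%th. f th0 * E 0 th - (E 1 th0 * h th - E 1 th * h th)) n"
      by (rule fc_cong[OF fh])
    also have "... = fc (%th. f th0 * E 0 th) n - (fc (%th. E 1 th0 * h th) n - fc (%th. E 1 th * h th) n)"
    proof -
      have c: "continuous_on {0..2*pi} (%th. f th0 * E 0 th)" "continuous_on {0..2*pi} (%th. E 1 th0 * h th)"
        "continuous_on {0..2*pi} (%th. E 1 th * h th)"
        by (intro continuous_intros E_cont hc)+
      show ?thesis using fc_diff[OF c(1) continuous_on_diff[OF c(2,3)]] fc_diff[OF c(2,3)] by simp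
    qed
    finally show ?thesis by (simp add: fc_scale fc_E fc_shift)
  qed
  have tm: "fc f n * E n th0 = (if n = 0 then f th0 else 0) + (E n th0 * fc h (n - 1) - E (n + 1) th0 * fc h ((n + 1) - 1))" for n
  proof -
    have "E (n + 1) th0 = E n th0 * E 1 th0" by (simp add: E_mult)
    then show ?thesis unfolding fcf by (cases "n = 0") (simp_all add: E_0 algebra_simps)
  qed
  have tele: "(\<Sum>n=-int N..int N. fc f n * E n th0) = f th0 + (E (- int N) th0 * fc h (- int N - 1) - E (int N + 1) th0 * fc h (int N))" for N
  proof (induction N)
    case 0
    show ?case using tm[of 0] by (simp add: E_0)
  next
    case (Suc N)
    have e: "- int (Suc N) = - int N - 1" "int (Suc N) = int N + 1" by simp_all
    have "{- int N - 1..int N + 1} = insert (- int N - 1) (insert (int N + 1) {- int N..int N})" by auto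
    then have "(\<Sum>n=- int N - 1..int N + 1. fc f n * E n th0)
       = fc f (- int N - 1) * E (- int N - 1) th0 + (fc f (int N + 1) * E (int N + 1) th0 + (\<Sum>n=-int N..int N. fc f n * E n th0))"
      by (simp only:) (subst sum.insert; simp)+
    then show ?case unfolding e Suc tm[of "- int N - 1"] tm[of "int N + 1"] by (simp add: add.commute[of 1 "int N"])
  qed
  have z: "(%N. E (a N) th0 * x N) \<longlonglongrightarrow> 0" if "x \<longlonglongrightarrow> 0" for a :: "nat => int" and x
    using that by (simp add: tendsto_norm_zero_iff[symmetric, where f="%N. E (a N) th0 * x N"] norm_mult tendsto_norm_zero)
  have "(%N. \<Sum>n=-int N..int N. fc f n * E n th0) \<longlonglongrightarrow> f th0 + (0 - 0)"
    unfolding tele by (intro tendsto_intros z fc_tendsto_0 hc)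
  moreover have "(%n. fc f n * E n th0) summable_on UNIV"
    by (rule norm_infsum_le_infsum(1)[OF rapid_seq_summable[OF fc_rapid[OF f], of 0]]) (simp add: norm_mult)
  then have "(%N. \<Sum>n=-int N..int N. fc f n * E n th0) \<longlonglongrightarrow> infsum (%n. fc f n * E n th0) UNIV"
    by (rule filterlim_compose[OF infsum_tendsto symmetric_intervals_filterlim])
  ultimately show ?thesis using LIMSEQ_unique by fastforce
qed

lemma syn_summable: "rapid_seq x ==> (%n. x n * E n th) summable_on UNIV"
  by (rule norm_infsum_le_infsum(1)[OF rapid_seq_summable[of x 0]]) (simp_all add: norm_mult)

lemma syn_cont: assumes "rapid_seq x" shows "continuous_on {a..b} (syn x)"
  unfolding syn_def
  by (rule integral_infsum(2)[OF _ rapid_seq_summable[OF assms, of 0]])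
     (auto simp: norm_mult intro!: continuous_intros E_cont)

lemma syn_periodic: "syn x (th + 2 * pi) = syn x th"
  by (simp add: syn_def E_periodic)

text \<open>\<open>inversion_interior\<close> leaves out 0 and \<open>2 * pi\<close>, where
  \<open>E 1 th - E 1 th0\<close> has two zeros in the closed period interval. Both sides are
  continuous, so the identity extends to the closure and from there by periodicity.\<close>

theorem inversion:
  assumes f: "smooth_per f"
  shows "syn (fc f) = f"
proof
  fix th
  obtain th' k where th': "th' \<in> {0..<2 * pi}" "th = th' + of_int k * (2 * pi)" by (rule period_reduce)
  have cl: "closure {0<..<2*pi} = {0..2*pi}" by (rule closure_greaterThanLessThan) simp
  have "syn (fc f) th' - f th' = 0"
  proof (rule continuous_constant_on_closure[where S="{0<..<2*pi}" and f="%th. syn (fc f) th - f th"])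
    show "continuous_on (closure {0<..<2*pi}) (%th. syn (fc f) th - f th)"
      unfolding cl by (intro continuous_intros syn_cont fc_rapid smooth_per_continuous f)
    show "syn (fc f) th - f th = 0" if "th \<in> {0<..<2*pi}" for th
      using inversion_interior[OF f that] by (simp add: syn_def)
    show "th' \<in> closure {0<..<2*pi}" unfolding cl using th'(1) by auto
  qed
  then show "syn (fc f) th = f th"
    using periodic_int[of "syn (fc f)" th' k, OF syn_periodic] periodic_int[of f th' k, OF smooth_per_periodic[OF f]]
    unfolding th'(2) by simp
qed

lemma inversion_has_sum:
  assumes "smooth_per f"
  shows "((%n. fc f n * E n th) has_sum f th) UNIV"
  using has_sum_infsum[OF syn_summable[OF fc_rapid[OF assms], of th]] inversion[OF assms]
  by (metis syn_def)

lemma syn_pair: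
  assumes x: "rapid_seq x" and g: "continuous_on {0..2*pi} g"
  shows "((%n. x n * cnj (fc g n)) has_sum (integral {0..2*pi} (%th. syn x th * cnj (g th) * of_real (\<sigma> th)) / (2 * pi))) UNIV"
proof -
  have "compact ((%th. cnj (g th) * of_real (\<sigma> th)) ` {0..2*pi})"
    by (intro compact_continuous_image continuous_intros g \<sigma>_cont) auto
  from compact_imp_bounded[OF this] obtain B where B: "!!th. th \<in> {0..2*pi} ==> norm (cnj (g th) * of_real (\<sigma> th)) <= B"
    unfolding bounded_iff by blast
  let ?f = "%n th. x n * E n th * (cnj (g th) * of_real (\<sigma> th))"
  have "((%n. integral {0..2*pi} (?f n)) has_sum integral {0..2*pi} (%th. infsum (%n. ?f n th) UNIV)) UNIV"
  proof (rule integral_infsum(1))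
    show "(%n. B * (br n ^ 0 * norm (x n))) summable_on UNIV"
      by (rule summable_on_cmult_right[OF rapid_seq_summable[OF x]])
    show "continuous_on {0..2*pi} (?f n)" for n
      by (intro continuous_intros g E_cont \<sigma>_cont)
    show "norm (?f n th) <= B * (br n ^ 0 * norm (x n))" if "th \<in> {0..2*pi}" for n th
      using mult_left_mono[OF B[OF that], of "norm (x n)"] by (simp add: norm_mult mult.commute[of B])
  qed
  moreover have "infsum (%n. ?f n th) UNIV = syn x th * cnj (g th) * of_real (\<sigma> th)" for th
    unfolding syn_def infsum_cmult_left' by (simp add: mult.assoc)
  moreover have "integral {0..2*pi} (?f n) = x n * cnj (fc g n) * (2 * pi)" for n
  proof -
    have "integral {0..2*pi} (?f n) = x n * integral {0..2*pi} (%th. cnj (g th * cnj (E n th) * of_real (\<sigma> th)))"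
      by (subst integral_mult_right[symmetric]) (simp add: mult_ac)
    also have "... = x n * cnj (integral {0..2*pi} (%th. g th * cnj (E n th) * of_real (\<sigma> th)))"
      by (simp only: Henstock_Kurzweil_Integration.integral_cnj)
    finally show ?thesis by (simp add: fc_def)
  qed
  ultimately have "((%n. x n * cnj (fc g n) * (2 * pi)) has_sum integral {0..2*pi} (%th. syn x th * cnj (g th) * of_real (\<sigma> th))) UNIV"
    by simp
  from has_sum_cmult_left[OF this, of "1 / (2 * pi)"] show ?thesis by simp
qed

theorem parseval:
  assumes "smooth_per f" "continuous_on {0..2*pi} g"
  shows "((%n. fc f n * cnj (fc g n)) has_sum (integral {0..2*pi} (%th. f th * cnj (g th) * of_real (\<sigma> th)) / (2 * pi))) UNIV"
  using syn_pair[OF fc_rapid[OF assms(1)] assms(2)] by (simp add: inversion[OF assms(1)])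

lemma fc_syn:
  assumes x: "rapid_seq x"
  shows "fc (syn x) n = x n"
proof -
  have "((%k. x k * cnj (fc (E n) k)) has_sum fc (syn x) n) UNIV"
    using syn_pair[OF x E_cont[of _ n]] by (simp add: fc_def[of "syn x"])
  moreover have "((%k. x k * cnj (fc (E n) k)) has_sum x n) UNIV"
    by (rule has_sum_finite_neutralI[where B="{n}"]) (auto simp: fc_E)
  ultimately show ?thesis by (rule has_sum_unique)
qed

text \<open>The series of derivatives has a summable majorant, so it can be integrated term by term
  from the left end of a window around \<open>th\<close>; the fundamental theorem then
  differentiates the result.\<close>

lemma syn_deriv:
  assumes x: "rapid_seq x"
  shows "(syn x has_vector_derivative of_real (\<sigma> th) * syn (%n. \<i> * of_int n * x n) th) (at th)"
proof -
  let ?x' = "%n. \<i> * of_int n * x n"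
  have x': "rapid_seq ?x'"
    by (rule rapid_seq_poly_mult[where C=1 and N=1]) (auto simp: x br_def norm_mult)
  define a where "a = th - 1"
  define b where "b = th + 1"
  define D where "D = (%t. of_real (\<sigma> t) * syn ?x' t)"
  have Dc: "continuous_on {a..b} D" unfolding D_def by (intro continuous_intros \<sigma>_cont syn_cont x')
  obtain C where C: "!!th. \<sigma> th <= C" "C > 0" using \<sigma>_bdd by blast
  have eq: "syn x u = syn x a + integral {a..u} D" if u: "u \<in> {a..b}" for u
  proof -
    let ?f = "%n t. x n * (\<i> * of_int n * of_real (\<sigma> t) * E n t)"
    have "((%n. integral {a..u} (?f n)) has_sum integral {a..u} (%t. infsum (%n. ?f n t) UNIV)) UNIV"
    proof (rule integral_infsum(1))
      show "(%n. C * (br n ^ 1 * norm (x n))) summable_on UNIV"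
        by (rule summable_on_cmult_right[OF rapid_seq_summable[OF x]])
      show "continuous_on {a..u} (?f n)" for n
        by (intro continuous_intros E_cont \<sigma>_cont)
      show "norm (?f n t) <= C * (br n ^ 1 * norm (x n))" for n t
      proof -
        have "\<bar>real_of_int n\<bar> * \<sigma> t <= br n * C"
          using C(1)[of t] \<sigma>_pos[of t] by (intro mult_mono) (auto simp: br_def)
        then have "\<bar>real_of_int n\<bar> * \<sigma> t * norm (x n) <= br n * C * norm (x n)" by (rule mult_right_mono) auto
        then show ?thesis using \<sigma>_pos[of t] by (simp add: norm_mult mult_ac)
      qed
    qed
    moreover have "infsum (%n. ?f n t) UNIV = D t" for t
      unfolding D_def syn_def infsum_cmult_right'[symmetric] by (rule infsum_cong) (simp add: mult_ac)
    moreover have "integral {a..u} (?f n) = x n * E n u - x n * E n a" for n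
    proof -
      have "((%t. \<i> * of_int n * of_real (\<sigma> t) * E n t) has_integral (E n u - E n a)) {a..u}"
        using u by (intro fundamental_theorem_of_calculus) (auto intro!: has_vector_derivative_at_within E_deriv)
      from integral_unique[OF has_integral_mult_right[OF this, of "x n"]] show ?thesis by (simp only: right_diff_distrib)
    qed
    ultimately have "((%n. x n * E n u - x n * E n a) has_sum integral {a..u} D) UNIV" by simp
    moreover have "((%n. x n * E n u - x n * E n a) has_sum (syn x u - syn x a)) UNIV"
      unfolding syn_def using infsum_diff[OF syn_summable[OF x, of u] syn_summable[OF x, of a]] by (simp add: has_sum_iff)
    ultimately have "integral {a..u} D = syn x u - syn x a" by (rule has_sum_unique)
    then show ?thesis by simp
  qed
  have main: "((%u. syn x a + integral {a..u} D) has_vector_derivative D th) (at th within {a..b})"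
    using has_vector_derivative_add[OF has_vector_derivative_const integral_has_vector_derivative[OF Dc, of th], of "syn x a"]
    by (simp add: a_def b_def)
  have "th \<in> {a..b}" by (simp add: a_def b_def)
  from has_vector_derivative_transform[OF this eq main]
  have "(syn x has_vector_derivative D th) (at th within {a..b})" by simp
  moreover have "at th within {a..b} = at th"
    by (rule at_within_Icc_at) (simp_all add: a_def b_def)
  ultimately show ?thesis by (simp add: D_def)
qed

lemma syn_smooth:
  assumes "rapid_seq x"
  shows "smooth_per (syn x)"
proof -
  have "kb k {()} (%_. syn x)" if "rapid_seq x" for k x
    using that
  proof (induction k arbitrary: x)
    case 0
    obtain C where "!!th. norm (syn x th) <= C"
      using periodic_bounded[of "syn x", OF syn_periodic syn_cont[OF 0]] by blast
    then show ?case by auto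
  next
    case (Suc k)
    obtain C where "!!th. norm (syn x th) <= C"
      using periodic_bounded[of "syn x", OF syn_periodic syn_cont[OF Suc.prems]] by blast
    moreover have "vder (syn x) = (%th. of_real (\<sigma> th) * syn (%n. \<i> * of_int n * x n) th)"
      by (intro ext vder_eqI syn_deriv Suc.prems)
    moreover have "rapid_seq (%n. \<i> * of_int n * x n)"
      by (rule rapid_seq_poly_mult[where C=1 and N=1]) (auto simp: Suc.prems br_def norm_mult)
    then have "kb k {()} (%_ th. of_real (\<sigma> th) * syn (%n. \<i> * of_int n * x n) th)"
      using \<sigma>_smooth by (intro kb_mult Suc.IH) (auto simp: smooth_per_sfam sfam_def)
    moreover have "syn x differentiable (at th)" for th
      by (rule differentiableI_vector[OF syn_deriv[OF Suc.prems]])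
    ultimately show ?case by auto
  qed
  then show ?thesis using assms by (simp add: smooth_per_sfam sfam_def syn_periodic)
qed

end

section \<open>The identity coordinate: ordinary Fourier coefficients, and non-stationary
  phase\<close>

interpretation idc: coord "%th. th" "%_. 1"
  by unfold_locales (auto intro!: derivative_eq_intros smooth_per_const[of 1, simplified] simp: smooth_per_const)

lemma idc_E: "idc.E n = expi n"
  by (simp add: idc.E_def expi_def)

lemma idc_fc: "idc.fc f n = fcoeff f n"
proof -
  have "cnj (idc.E n th) = exp (- \<i> * of_int n * of_real th)" for th
    unfolding idc.E_cnj by (simp add: idc.E_def)
  then show ?thesis by (simp add: idc.fc_def fcoeff_def)
qed

text \<open>Non-stationary phase: integrating by parts against \<open>e' = \<i> \<rho> q e\<close> with \<open>q\<close> bounded away from zero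
  gains a factor \<open>1/\<rho>\<close> and replaces the amplitude \<open>b\<close> by \<open>- (b/q)'\<close>, which ranges over a bounded family again.\<close>

lemma nonstationary_phase:
  assumes "sfam J b" "sfam J q" "c > 0" "!!j th. j \<in> J ==> c <= norm (q j th)" "!!j. j \<in> J ==> \<rho> j > 0"
    and e1: "!!j th. j \<in> J ==> norm (e j th) <= 1" and ep: "!!j. j \<in> J ==> e j (2 * pi) = e j 0"
    and ed: "!!j th. j \<in> J ==> (e j has_vector_derivative \<i> * of_real (\<rho> j) * q j th * e j th) (at th)"
  shows "\<exists>C. \<forall>j\<in>J. norm (integral {0..2*pi} (%th. b j th * e j th)) * \<rho> j ^ N <= C"
  using assms(1)
proof (induction N arbitrary: b)
  have ec: "continuous_on S (e j)" if "j \<in> J" for j S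
    using ed[OF that] by (intro continuous_at_imp_continuous_on ballI) (meson has_vector_derivative_continuous)
  {
    case 0
    obtain C where C: "\<forall>j\<in>J. \<forall>th. norm (b j th) <= C" using sfam_bdd[OF 0] by blast
    have "norm (integral {0..2*pi} (%th. b j th * e j th)) <= C * (2 * pi - 0)" if j: "j \<in> J" for j
    proof (rule integral_bound)
      show "continuous_on {0..2*pi} (%th. b j th * e j th)"
        by (intro continuous_intros smooth_per_continuous sfam_smooth[OF 0 j] ec j)
      show "norm (b j th * e j th) <= C" for th
        using mult_mono[of "norm (b j th)" C "norm (e j th)" 1] C j e1[OF j, of th]
        by (auto simp: norm_mult intro: order_trans[OF norm_ge_zero])
    qed auto
    then show ?case by auto
  next
    case (Suc N)
    let ?r = "%j th. b j th * (1 / q j th)"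
    have r: "sfam J ?r" by (intro sfam_mult Suc.prems sfam_inverse[OF assms(2-4)])
    have r': "sfam J (%j. vder (?r j))" by (rule sfam_vder[OF r])
    obtain C where C: "\<forall>j\<in>J. norm (integral {0..2*pi} (%th. vder (?r j) th * e j th)) * \<rho> j ^ N <= C"
      using Suc.IH[OF r'] by blast
    have "norm (integral {0..2*pi} (%th. b j th * e j th)) * \<rho> j ^ Suc N <= C" if j: "j \<in> J" for j
    proof -
      have q0: "q j th \<noteq> 0" for th using assms(3) assms(4)[OF j, of th] by (metis norm_zero not_less)
      have i1: "(%th. vder (?r j) th * e j th) integrable_on {0..2*pi}"
        by (intro integrable_continuous_interval continuous_intros smooth_per_continuous sfam_smooth[OF r' j] ec j)
      have i2: "(%th. b j th * e j th) integrable_on {0..2*pi}"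
        by (intro integrable_continuous_interval continuous_intros smooth_per_continuous sfam_smooth[OF Suc.prems j] ec j)
      have d: "((%th. ?r j th * e j th) has_vector_derivative (\<i> * of_real (\<rho> j)) * (b j th * e j th) + vder (?r j) th * e j th) (at th)" for th
        using has_vector_derivative_mult[OF vder_works[OF sfam_differentiable[OF r j, of th]] ed[OF j, of th]] q0[of th]
        by (simp add: mult_ac)
      have "((%th. (\<i> * of_real (\<rho> j)) * (b j th * e j th) + vder (?r j) th * e j th) has_integral
         (?r j (2*pi) * e j (2*pi) - ?r j 0 * e j 0)) {0..2*pi}"
        by (rule fundamental_theorem_of_calculus, simp, rule has_vector_derivative_at_within[OF d])
      moreover have "?r j (2*pi) = ?r j 0"
        using smooth_per_periodic[OF sfam_smooth[OF r j], of 0] by simp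
      ultimately have "0 = integral {0..2*pi} (%th. (\<i> * of_real (\<rho> j)) * (b j th * e j th) + vder (?r j) th * e j th)"
        unfolding ep[OF j] by (simp only: integral_unique diff_self)
      also have "... = (\<i> * of_real (\<rho> j)) * integral {0..2*pi} (%th. b j th * e j th) + integral {0..2*pi} (%th. vder (?r j) th * e j th)"
        by (subst integral_add[OF integrable_on_mult_right[OF i2] i1]) simp
      finally have "(\<i> * of_real (\<rho> j)) * integral {0..2*pi} (%th. b j th * e j th) = - integral {0..2*pi} (%th. vder (?r j) th * e j th)"
        by (simp only: eq_neg_iff_add_eq_0)
      from arg_cong[OF this, of norm] have h: "\<rho> j * norm (integral {0..2*pi} (%th. b j th * e j th)) = norm (integral {0..2*pi} (%th. vder (?r j) th * e j th))"
        using assms(5)[OF j] by (simp only: norm_mult norm_ii norm_of_real norm_minus_cancel abs_of_pos mult_1_left)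
      have "norm (integral {0..2*pi} (%th. b j th * e j th)) * \<rho> j ^ Suc N = (\<rho> j * norm (integral {0..2*pi} (%th. b j th * e j th))) * \<rho> j ^ N"
        by (simp only: power_Suc mult_ac)
      then show ?thesis using C[rule_format, OF j] unfolding h by (simp only:)
    qed
    then show ?case by blast
  }
qed

lemma sfam_pull:
  assumes "sfam T f" "!!j. j \<in> J ==> g j \<in> T"
  shows "sfam J (%j. f (g j))"
proof -
  have "kb k J (%j. f (g j))" if "kb k T f" for k f
    using that
  proof (induction k arbitrary: f)
    case 0
    then show ?case using assms(2) by (simp only: kb.simps) blast
  next
    case (Suc k)
    then have "kb k J (%j. vder (f (g j)))" using Suc.IH[of "%t. vder (f t)"] by simp
    then show ?case using Suc.prems assms(2) by (simp only: kb.simps) blast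
  qed
  then show ?thesis using assms by (auto simp: sfam_def)
qed

text \<open>The bound for the entry \<open>(m, n)\<close> is multiplied with that for
  \<open>(n, m)\<close>, which has the same modulus, and a square root is taken; decay in one index
  becomes decay in both. The odd exponent \<open>2 * M + 1\<close> leaves one power to cancel the
  permitted growth \<open>br m\<close>.\<close>

lemma rapid_mat_of_one_sided:
  fixes K :: "'t => int => int => complex" and w :: "'t => real"
  assumes herm: "!!t. t \<in> T ==> herm_mat (K t)" and w: "!!t. t \<in> T ==> w t \<ge> 0"
    and b: "!!N. \<exists>A. \<forall>t\<in>T. \<forall>m n. norm (K t m n) * br n ^ N <= A * w t * br m"
  shows "\<exists>\<kappa>. \<forall>t\<in>T. rapid_mat (%N. \<kappa> N * w t) (K t)"
proof -
  obtain A where A: "!!N t m n. t \<in> T ==> norm (K t m n) * br n ^ N <= A N * w t * br m"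
    using b by metis
  have "rapid_mat (%N. \<bar>A (2 * N + 1)\<bar> * w t) (K t)" if t: "t \<in> T" for t
    unfolding rapid_mat_def
  proof (intro allI)
    fix M :: nat and m n :: int
    let ?N = "2 * M + 1" and ?x = "norm (K t m n)"
    have "cnj (K t m n) = K t n m" using herm[OF t] by (simp add: herm_mat_def)
    then have sym: "norm (K t n m) = ?x" by (metis complex_mod_cnj)
    have a: "?x * br n ^ ?N <= \<bar>A ?N\<bar> * w t * br m" "?x * br m ^ ?N <= \<bar>A ?N\<bar> * w t * br n"
    proof -
      have "A ?N * w t * br k <= \<bar>A ?N\<bar> * w t * br k" for k
        using w[OF t] by (intro mult_right_mono) (auto simp: less_imp_le)
      then show "?x * br n ^ ?N <= \<bar>A ?N\<bar> * w t * br m" "?x * br m ^ ?N <= \<bar>A ?N\<bar> * w t * br n"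
        using A[OF t, of m n ?N] A[OF t, of n m ?N] unfolding sym by (meson order_trans)+
    qed
    have "(?x * br n ^ ?N) * (?x * br m ^ ?N) <= (\<bar>A ?N\<bar> * w t * br m) * (\<bar>A ?N\<bar> * w t * br n)"
      by (rule mult_mono[OF a]) (use w[OF t] in \<open>auto simp: less_imp_le\<close>)
    then have "(?x * (br m ^ M * br n ^ M))\<^sup>2 * (br m * br n) <= (\<bar>A ?N\<bar> * w t)\<^sup>2 * (br m * br n)"
      unfolding mult_2 power_add power2_eq_square power_one_right by (simp only: mult_ac)
    then have "(?x * (br m ^ M * br n ^ M))\<^sup>2 <= (\<bar>A ?N\<bar> * w t)\<^sup>2"
      by (rule mult_right_le_imp_le) (simp add: mult_pos_pos)
    then have "?x * (br m ^ M * br n ^ M) <= \<bar>A ?N\<bar> * w t"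
      by (rule power2_le_imp_le) (use w[OF t] in auto)
    then show "?x <= \<bar>A ?N\<bar> * w t / (br m ^ M * br n ^ M)"
      by (simp add: pos_le_divide_eq)
  qed
  then show ?thesis by (intro exI[of _ "%N. \<bar>A (2 * N + 1)\<bar>"]) auto
qed

section \<open>The matrix of Lambda in the exponentials of a coordinate\<close>

context coord
begin

definition c :: "int => int => complex" where
  "c n p = fcoeff (E n) p"

text \<open>The form of \<open>Lam\<close> at \<open>E n\<close> and \<open>E m\<close>, divided by
  \<open>2 * pi\<close>, read off from ordinary Fourier coefficients. For the weight
  \<open>1 / \<sigma>\<close> it is the matrix of the weighted operator in the basis that
  corresponds to the \<open>E n\<close>.\<close>

definition Lm :: "int => int => complex" where
  "Lm m n = infsum (%p. of_int \<bar>p\<bar> * (c n p * cnj (c m p))) UNIV"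

definition Km :: "int => int => complex" where
  "Km m n = Lm m n - (if m = n then of_int \<bar>n\<bar> else 0)"

lemma c_rapid: "rapid_seq (c n)"
  using idc.fc_rapid[OF E_smooth[of n]] by (simp add: c_def[abs_def] idc_fc[abs_def])

lemma c_le_1: "norm (c n p) <= 1"
  using idc.fc_bound[OF E_cont[of _ n], of 1 1 p] by (simp add: idc_fc c_def)

lemma cc_summable: "(%p. of_int \<bar>p\<bar> * (c n p * cnj (c m p))) summable_on UNIV"
  "(%p. of_int p * (c n p * cnj (c m p))) summable_on UNIV"
  by (rule norm_infsum_le_infsum(1)[OF rapid_seq_summable[OF c_rapid[of n], of 1]],
      auto simp: norm_mult br_def intro!: mult_mono mult_left_le c_le_1)+

lemma Lm_herm: "cnj (Lm m n) = Lm n m"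
  unfolding Lm_def by (simp add: mult.commute flip: infsum_cnj)

lemma Km_herm: "herm_mat Km"
  by (auto simp: herm_mat_def Km_def Lm_herm)

text \<open>Integrating the conjugate of \<open>E m\<close> against the differential of
  \<open>E n\<close> does not depend on the coordinate, so \<open>D\<close> is diagonal in every one
  of them. By Parseval this becomes a sum rule for the coefficients \<open>c\<close>.\<close>

lemma D_form: "infsum (%p. of_int p * (c n p * cnj (c m p))) UNIV = (if m = n then of_int n else 0)"
proof -
  have fcv: "idc.fc (vder (E n)) p = \<i> * of_int p * c n p" for p
    using idc.fc_by_parts[OF E_smooth[of n], of p] by (simp add: idc_fc c_def)
  have "((%p. idc.fc (vder (E n)) p * cnj (idc.fc (E m) p)) has_sum
     (integral {0..2*pi} (%th. vder (E n) th * cnj (E m th) * of_real 1) / (2 * pi))) UNIV"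
    by (rule idc.parseval[OF smooth_per_vder[OF E_smooth] E_cont])
  also have "(%th. vder (E n) th * cnj (E m th) * of_real 1) = (%th. (\<i> * of_int n) * (E n th * cnj (E m th) * of_real (\<sigma> th)))"
    by (simp add: E_vder mult_ac)
  also have "integral {0..2*pi} ... = (\<i> * of_int n) * (if n = m then 2 * pi else 0)"
    unfolding integral_mult_right E_orth ..
  finally have "((%p. \<i> * (of_int p * (c n p * cnj (c m p)))) has_sum (\<i> * (if m = n then of_int n else 0))) UNIV"
  proof -
    assume h: "((%p. idc.fc (vder (E n)) p * cnj (idc.fc (E m) p)) has_sum (\<i> * of_int n) * (if n = m then 2 * pi else 0) / (2 * pi)) UNIV"
    have "idc.fc (vder (E n)) p * cnj (idc.fc (E m) p) = \<i> * (of_int p * (c n p * cnj (c m p)))" for p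
      unfolding fcv by (simp add: idc_fc c_def)
    moreover have "(\<i> * of_int n) * (if n = m then 2 * pi else 0) / (2 * pi) = \<i> * (if m = n then of_int n else 0)"
      by auto
    ultimately show ?thesis using h by (simp only:)
  qed
  from has_sum_cmult_right[OF this, of "- \<i>"]
  have "((%p. of_int p * (c n p * cnj (c m p))) has_sum (if m = n then of_int n else 0)) UNIV"
    by (simp flip: mult.assoc)
  then show ?thesis by (rule infsumI)
qed

text \<open>For nonzero \<open>n\<close>, the diagonal |n| is \<open>sgn n\<close> times that of
  \<open>D\<close>, and \<open>|p| - sgn n * p\<close> vanishes unless \<open>p\<close> and
  \<open>n\<close> have opposite signs. Subtracting the sum rule \<open>D_form\<close> keeps only
  the coefficients that decay rapidly. For \<open>n = 0\<close> everything vanishes, because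
  \<open>E 0\<close> is constant.\<close>

lemma Km_formula:
  "Km m n = infsum (%p. (if p * n < 0 then 2 * of_int \<bar>p\<bar> * (c n p * cnj (c m p)) else 0)) UNIV"
proof (cases "n = 0")
  case True
  have c0: "c 0 p = (if p = 0 then 1 else 0)" for p
  proof -
    have "E 0 = idc.E 0" by (auto simp: E_0 idc.E_0)
    then show ?thesis using idc.fc_E[of 0 p] by (auto simp: c_def idc_fc)
  qed
  have "Lm m 0 = 0"
    unfolding Lm_def by (rule infsum_0) (auto simp: c0)
  then show ?thesis using True by (simp add: Km_def)
next
  case False
  have sgnn: "(if m = n then of_int \<bar>n\<bar> else 0) = of_int (sgn n) * (if m = n then of_int n else (0::complex))"
    by (auto simp: abs_if sgn_if)
  have "Km m n = Lm m n - infsum (%p. of_int (sgn n) * (of_int p * (c n p * cnj (c m p)))) UNIV"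
    unfolding Km_def sgnn infsum_cmult_right' D_form ..
  also have "... = infsum (%p. of_int \<bar>p\<bar> * (c n p * cnj (c m p)) - of_int (sgn n) * (of_int p * (c n p * cnj (c m p)))) UNIV"
    unfolding Lm_def by (rule infsum_diff(2)[symmetric, OF cc_summable(1) summable_on_cmult_right[OF cc_summable(2)]])
  also have "... = infsum (%p. (if p * n < 0 then 2 * of_int \<bar>p\<bar> * (c n p * cnj (c m p)) else 0)) UNIV"
  proof (rule infsum_cong)
    fix p :: int
    have "of_int \<bar>p\<bar> - of_int (sgn n) * of_int p = (if p * n < 0 then 2 * of_int \<bar>p\<bar> else (0::complex))"
      using False by (auto simp: abs_if sgn_if mult_less_0_iff not_less split: if_splits)
    from arg_cong[OF this, of "%z. z * (c n p * cnj (c m p))"]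
    show "of_int \<bar>p\<bar> * (c n p * cnj (c m p)) - of_int (sgn n) * (of_int p * (c n p * cnj (c m p)))
       = (if p * n < 0 then 2 * of_int \<bar>p\<bar> * (c n p * cnj (c m p)) else 0)"
      by (auto simp: algebra_simps split: if_splits)
  qed
  finally show ?thesis .
qed

end

section \<open>Families of coordinates: uniform decay and differentiability in the parameter\<close>

locale coord_family =
  fixes \<delta> :: real and s \<sigma> sd :: "real => real => real" and c0 :: real
  assumes \<delta>: "\<delta> > 0" and coord: "!!\<tau>. \<tau> \<in> {-\<delta><..<\<delta>} ==> coord (s \<tau>) (\<sigma> \<tau>)"
    and \<sigma>_fam: "sfam {-\<delta><..<\<delta>} (%\<tau> th. complex_of_real (\<sigma> \<tau> th))"
    and c0: "c0 > 0" "!!\<tau> th. \<tau> \<in> {-\<delta><..<\<delta>} ==> c0 <= \<sigma> \<tau> th"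
    and sd_fam: "sfam {-\<delta><..<\<delta>} (%\<tau> th. complex_of_real (sd \<tau> th))"
    and s_deriv: "!!\<tau> th. \<tau> \<in> {-\<delta><..<\<delta>} ==> th \<in> {0..2*pi} ==> ((%\<tau>. s \<tau> th) has_real_derivative sd \<tau> th) (at \<tau>)"
    and s_cont: "continuous_on ({-\<delta><..<\<delta>} \<times> {0..2*pi}) (%(\<tau>,th). s \<tau> th)"
    and sd_cont: "continuous_on ({-\<delta><..<\<delta>} \<times> {0..2*pi}) (%(\<tau>,th). sd \<tau> th)"
begin

abbreviation "T \<equiv> {-\<delta><..<\<delta>}"

definition e :: "real => int => cfun" where "e \<tau> n = coord.E (s \<tau>) n"

definition cf :: "real => int => int => complex" where "cf \<tau> n p = fcoeff (e \<tau> n) p"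

definition cd :: "real => int => int => complex" where
  "cd \<tau> n p = \<i> * of_int n * fcoeff (%th. of_real (sd \<tau> th) * e \<tau> n th) p"

definition KF :: "real => int => int => complex" where "KF \<tau> = coord.Km (s \<tau>)"

lemma e_norm: "\<tau> \<in> T ==> norm (e \<tau> n th) = 1"
  unfolding e_def by (rule coord.E_norm[OF coord])

lemma e_deriv: "\<tau> \<in> T ==> (e \<tau> n has_vector_derivative \<i> * of_int n * of_real (\<sigma> \<tau> th) * e \<tau> n th) (at th)"
  unfolding e_def by (rule coord.E_deriv[OF coord])

lemma e_smooth: "\<tau> \<in> T ==> smooth_per (e \<tau> n)"
  unfolding e_def by (rule coord.E_smooth[OF coord])

lemma cf_c: "\<tau> \<in> T ==> cf \<tau> n p = coord.c (s \<tau>) n p"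
  by (simp add: cf_def e_def coord.c_def[OF coord])

lemma fcoeff_e: "fcoeff (%th. b th * e \<tau> n th) p = integral {0..2*pi} (%th. b th * (e \<tau> n th * idc.E (- p) th)) / (2 * pi)"
  by (simp add: fcoeff_def idc.E_def mult_ac)

text \<open>The phase \<open>n * s - p * th\<close> has derivative \<open>n * \<sigma> - p\<close>,
  a sum of two terms of equal sign when \<open>p * n < 0\<close>. Divided by \<open>\<rho>\<close>,
  that is |n| + |p|, it has modulus at least \<open>min c0 1\<close> for all indices, so
  \<open>nonstationary_phase\<close> applies uniformly.\<close>

lemma opposite_decay:
  assumes b: "sfam T b"
  shows "\<exists>C. \<forall>\<tau>\<in>T. \<forall>n p. p * n < 0 \<longrightarrow> norm (fcoeff (%th. b \<tau> th * e \<tau> n th) p) * (br n * br p) ^ N <= C"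
proof -
  define J where "J = {(\<tau>, n, p). \<tau> \<in> T \<and> p * n < (0::int)}"
  define \<rho> where "\<rho> = (%(\<tau>::real, n, p). \<bar>real_of_int n\<bar> + \<bar>real_of_int p\<bar>)"
  define q where "q = (%(\<tau>, n, p) th. complex_of_real (of_int n / \<rho> (\<tau>,n,p)) * of_real (\<sigma> \<tau> th) + complex_of_real (- of_int p / \<rho> (\<tau>,n,p)))"
  have \<rho>pos: "\<rho> j > 0" if "j \<in> J" for j
    using that by (auto simp: J_def \<rho>_def mult_less_0_iff)
  have pull: "sfam J (%(\<tau>, n, p). f \<tau>)" if "sfam T f" for f :: "real => cfun"
    using sfam_pull[OF that, of J fst] by (auto simp: J_def case_prod_unfold)
  have "sfam J q"
  proof -
    have "sfam J (%j th. complex_of_real (of_int (fst (snd j)) / \<rho> j) * (%(\<tau>, n, p) th. complex_of_real (\<sigma> \<tau> th)) j th + complex_of_real (- of_int (snd (snd j)) / \<rho> j))"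
    proof (intro sfam_add sfam_mult)
      show "sfam J (%j th. complex_of_real (of_int (fst (snd j)) / \<rho> j))"
        by (rule sfam_const[where C=1]) (use \<rho>pos in \<open>auto simp: \<rho>_def norm_divide\<close>)
      show "sfam J (%j th. complex_of_real (- of_int (snd (snd j)) / \<rho> j))"
        by (rule sfam_const[where C=1]) (use \<rho>pos in \<open>auto simp: \<rho>_def norm_divide\<close>)
      show "sfam J (%j. (%(\<tau>, n, p) th. complex_of_real (\<sigma> \<tau> th)) j)"
        using pull[OF \<sigma>_fam] by simp
    qed
    then show ?thesis by (simp add: q_def case_prod_unfold)
  qed
  moreover have "min c0 1 <= norm (q j th)" if j: "j \<in> J" for j th
  proof -
    obtain \<tau> n p where jj: "j = (\<tau>, n, p)" by (cases j)
    have \<tau>: "\<tau> \<in> T" and np: "p * n < 0" using j by (auto simp: J_def jj)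
    have "q j th = of_real ((of_int n * \<sigma> \<tau> th - of_int p) / \<rho> j)"
      by (simp add: q_def jj diff_divide_distrib)
    then have "norm (q j th) = \<bar>of_int n * \<sigma> \<tau> th - of_int p\<bar> / \<rho> j"
      using \<rho>pos[OF j] by (simp only: norm_of_real abs_divide abs_of_pos)
    also have "\<bar>of_int n * \<sigma> \<tau> th - of_int p\<bar> = \<bar>real_of_int n\<bar> * \<sigma> \<tau> th + \<bar>real_of_int p\<bar>"
    proof -
      have \<sigma>0: "\<sigma> \<tau> th > 0" using c0 \<tau> by (meson less_le_trans)
      consider "n > 0" "p < 0" | "n < 0" "p > 0" using np by (auto simp: mult_less_0_iff)
      then show ?thesis
      proof cases
        case 1
        then have "real_of_int n * \<sigma> \<tau> th > 0" using \<sigma>0 by simp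
        then show ?thesis using 1 by simp
      next
        case 2
        then have "real_of_int n * \<sigma> \<tau> th < 0" using \<sigma>0 by (simp add: mult_neg_pos)
        then show ?thesis using 2 by simp
      qed
    qed
    finally have 1: "norm (q j th) = (\<bar>real_of_int n\<bar> * \<sigma> \<tau> th + \<bar>real_of_int p\<bar>) / \<rho> j" .
    have "min c0 1 * \<rho> j <= \<bar>real_of_int n\<bar> * \<sigma> \<tau> th + \<bar>real_of_int p\<bar>"
    proof -
      have "\<bar>real_of_int n\<bar> * min c0 1 <= \<bar>real_of_int n\<bar> * \<sigma> \<tau> th"
        using c0(2)[OF \<tau>, of th] by (intro mult_left_mono) auto
      moreover have "\<bar>real_of_int p\<bar> * min c0 1 <= \<bar>real_of_int p\<bar> * 1" by (intro mult_left_mono) auto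
      ultimately show ?thesis by (simp add: jj \<rho>_def algebra_simps)
    qed
    then show ?thesis unfolding 1 using \<rho>pos[OF j] by (simp add: pos_le_divide_eq)
  qed
  moreover have ed: "((%th. e \<tau> n th * idc.E (- p) th) has_vector_derivative \<i> * of_real (\<rho> (\<tau>,n,p)) * q (\<tau>,n,p) th * (e \<tau> n th * idc.E (- p) th)) (at th)"
    if "(\<tau>,n,p) \<in> J" for \<tau> n p th
  proof -
    have \<tau>: "\<tau> \<in> T" using that by (auto simp: J_def)
    have "of_real (\<rho> (\<tau>,n,p)) * q (\<tau>,n,p) th = of_int n * of_real (\<sigma> \<tau> th) - of_int p"
      using \<rho>pos[OF that] by (simp add: q_def field_simps)
    then show ?thesis
      using has_vector_derivative_mult[OF e_deriv[OF \<tau>, of n th] idc.E_deriv[of "- p" th]]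
      by (simp add: mult.assoc) (simp add: algebra_simps)
  qed
  ultimately have "\<exists>C. \<forall>j\<in>J. norm (integral {0..2*pi} (%th. (%(\<tau>,n,p). b \<tau>) j th * (%(\<tau>,n,p) th. e \<tau> n th * idc.E (- p) th) j th)) * \<rho> j ^ (2 * N) <= C"
    using c0(1)
  proof (intro nonstationary_phase[where q=q and c="min c0 1"])
    show "sfam J (%(\<tau>,n,p). b \<tau>)" by (rule pull[OF b])
    show "\<rho> j > 0" if "j \<in> J" for j by (rule \<rho>pos[OF that])
    fix j assume "j \<in> J"
    then obtain \<tau> n p where j: "j = (\<tau>,n,p)" "(\<tau>,n,p) \<in> J" and \<tau>: "\<tau> \<in> T" by (cases j) (auto simp: J_def)
    show "norm ((%(\<tau>,n,p) th. e \<tau> n th * idc.E (- p) th) j th) <= 1" for th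
      by (simp add: j e_norm[OF \<tau>] norm_mult)
    show "(%(\<tau>,n,p) th. e \<tau> n th * idc.E (- p) th) j (2 * pi) = (%(\<tau>,n,p) th. e \<tau> n th * idc.E (- p) th) j 0"
      using smooth_per_periodic[OF e_smooth[OF \<tau>, of n], of 0] idc.E_periodic[of "-p" 0] by (simp add: j)
    show "((%(\<tau>,n,p) th. e \<tau> n th * idc.E (- p) th) j has_vector_derivative \<i> * of_real (\<rho> j) * q j th * (%(\<tau>,n,p) th. e \<tau> n th * idc.E (- p) th) j th) (at th)" for th
      using ed[OF j(2)] by (simp add: j(1))
  qed auto
  then obtain C where C: "!!j. j \<in> J ==> norm (integral {0..2*pi} (%th. (%(\<tau>,n,p). b \<tau>) j th * (%(\<tau>,n,p) th. e \<tau> n th * idc.E (- p) th) j th)) * \<rho> j ^ (2 * N) <= C"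
    by blast
  have "norm (fcoeff (%th. b \<tau> th * e \<tau> n th) p) * (br n * br p) ^ N <= C" if "\<tau> \<in> T" "p * n < 0" for \<tau> n p
  proof -
    have j: "(\<tau>,n,p) \<in> J" using that by (simp add: J_def)
    let ?I = "norm (integral {0..2*pi} (%th. b \<tau> th * (e \<tau> n th * idc.E (- p) th)))"
    have "1 <= \<bar>n\<bar>" "1 <= \<bar>p\<bar>" using that(2) by (auto simp: mult_less_0_iff)
    then have n1: "1 <= \<bar>real_of_int n\<bar>" "1 <= \<bar>real_of_int p\<bar>" by linarith+
    \<comment> \<open>Both indices are nonzero here, so each \<open>br\<close> costs a factor 2, and
      four times |n| |p| is at most the square of |n| + |p|. Two powers of \<open>\<rho>\<close> pay
      for one power of the product; hence \<open>2 * N\<close> above.\<close>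
    then have "br n * br p <= (2 * \<bar>real_of_int n\<bar>) * (2 * \<bar>real_of_int p\<bar>)"
      by (intro mult_mono) (auto simp: br_def)
    also have "... <= (\<rho> (\<tau>,n,p))\<^sup>2"
      using sum_squares_bound[of "\<bar>real_of_int n\<bar>" "\<bar>real_of_int p\<bar>"] by (simp add: \<rho>_def power2_sum)
    finally have "(br n * br p) ^ N <= ((\<rho> (\<tau>,n,p))\<^sup>2) ^ N" by (intro power_mono) (auto simp: less_imp_le)
    then have le: "(br n * br p) ^ N <= \<rho> (\<tau>,n,p) ^ (2 * N)" by (simp add: power_mult)
    have "norm (fcoeff (%th. b \<tau> th * e \<tau> n th) p) <= ?I"
      unfolding fcoeff_e using pi_ge_two by (auto simp: norm_divide norm_mult divide_le_eq mult_le_cancel_left1 intro!: mult_left_le)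
    then have "norm (fcoeff (%th. b \<tau> th * e \<tau> n th) p) * (br n * br p) ^ N <= ?I * \<rho> (\<tau>,n,p) ^ (2 * N)"
      using le by (intro mult_mono) (auto simp: less_imp_le)
    also have "... <= C" using C[OF j] by simp
    finally show ?thesis .
  qed
  then show ?thesis by blast
qed

text \<open>A crude bound for all pairs of modes: each integration by parts in theta costs one
  factor \<open>br n\<close>. The amplitude may depend on \<open>n\<close> because the new amplitude
  \<open>?b\<close> does, once \<open>br n\<close> is divided out.\<close>

lemma poly_decay:
  assumes "sfam (T \<times> UNIV) b"
  shows "\<exists>C. \<forall>\<tau>\<in>T. \<forall>n p. norm (fcoeff (%th. b (\<tau>, n) th * e \<tau> n th) p) * br p ^ N <= C * br n ^ N"
  using assms
proof (induction N arbitrary: b)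
  case 0
  obtain C where C: "\<forall>j\<in>T\<times>UNIV. \<forall>th. norm (b j th) <= C" using sfam_bdd[OF 0] by blast
  have "norm (fcoeff (%th. b (\<tau>, n) th * e \<tau> n th) p) <= C" if \<tau>: "\<tau> \<in> T" for \<tau> n p
  proof -
    have "norm (idc.fc (%th. b (\<tau>, n) th * e \<tau> n th) p) <= C * 1"
    proof (rule idc.fc_bound)
      show "continuous_on {0..2*pi} (%th. b (\<tau>, n) th * e \<tau> n th)"
        using sfam_smooth[OF 0, of "(\<tau>, n)"] \<tau> by (intro continuous_intros smooth_per_continuous e_smooth) auto
    qed (use C \<tau> in \<open>auto simp: norm_mult e_norm\<close>)
    then show ?thesis by (simp add: idc_fc)
  qed
  then show ?case by (intro exI[of _ C]) auto
next
  case (Suc N)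
  let ?b = "%(\<tau>, n) th. complex_of_real (1 / br n) * vder (b (\<tau>, n)) th + (\<i> * complex_of_real (of_int n / br n)) * of_real (\<sigma> \<tau> th) * b (\<tau>, n) th"
  have "sfam (T \<times> UNIV) (%j th. complex_of_real (1 / br (snd j)) * vder (b j) th + (\<i> * complex_of_real (of_int (snd j) / br (snd j))) * of_real (\<sigma> (fst j) th) * b j th)"
  proof (intro sfam_add sfam_mult sfam_vder Suc.prems)
    show "sfam (T \<times> UNIV) (%j th. complex_of_real (1 / br (snd j)))"
      by (rule sfam_const[where C=1]) (use br_ge_1 in \<open>auto simp: norm_divide less_imp_le\<close>)
    show "sfam (T \<times> (UNIV::int set)) (%j th. \<i>)"
      by (rule sfam_const[where C=1]) simp
    show "sfam (T \<times> UNIV) (%j th. complex_of_real (of_int (snd j) / br (snd j)))"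
      by (rule sfam_const[where C=1]) (simp only: norm_of_real, simp add: br_def)
    show "sfam (T \<times> (UNIV::int set)) (%j th. complex_of_real (\<sigma> (fst j) th))"
      using sfam_pull[OF \<sigma>_fam, of "T \<times> (UNIV::int set)" fst] by auto
  qed
  then have b': "sfam (T \<times> UNIV) ?b" by (simp add: case_prod_unfold)
  obtain C D where C: "!!\<tau> n p. \<tau> \<in> T ==> norm (fcoeff (%th. b (\<tau>, n) th * e \<tau> n th) p) * br p ^ N <= C * br n ^ N"
    and D: "!!\<tau> n p. \<tau> \<in> T ==> norm (fcoeff (%th. ?b (\<tau>, n) th * e \<tau> n th) p) * br p ^ N <= D * br n ^ N"
    using Suc.IH[OF Suc.prems] Suc.IH[OF b'] by blast
  have "norm (fcoeff (%th. b (\<tau>, n) th * e \<tau> n th) p) * br p ^ Suc N <= (\<bar>C\<bar> + D) * br n ^ Suc N" if \<tau>: "\<tau> \<in> T" for \<tau> n p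
  proof -
    let ?f = "%th. b (\<tau>, n) th * e \<tau> n th"
    have sb: "smooth_per (b (\<tau>, n))" using sfam_smooth[OF Suc.prems, of "(\<tau>, n)"] \<tau> by simp
    have sf: "smooth_per ?f" by (intro smooth_per_mult sb e_smooth \<tau>)
    have "vder ?f th = of_real (br n) * (?b (\<tau>, n) th * e \<tau> n th)" for th
    proof (rule vder_eqI)
      have "(?f has_vector_derivative b (\<tau>, n) th * (\<i> * of_int n * of_real (\<sigma> \<tau> th) * e \<tau> n th) + vder (b (\<tau>, n)) th * e \<tau> n th) (at th)"
        by (intro has_vector_derivative_mult vder_works smooth_per_differentiable sb e_deriv \<tau>)
      then show "(?f has_vector_derivative of_real (br n) * (?b (\<tau>, n) th * e \<tau> n th)) (at th)"
        by (simp add: algebra_simps)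
    qed
    then have "\<i> * of_int p * idc.fc ?f p = of_real (br n) * idc.fc (%th. ?b (\<tau>, n) th * e \<tau> n th) p"
      using idc.fc_by_parts[OF sf, of p] unfolding idc.fc_scale[symmetric] by simp
    then have "norm (\<i> * of_int p * idc.fc ?f p) = norm (of_real (br n) * idc.fc (%th. ?b (\<tau>, n) th * e \<tau> n th) p)" by simp
    then have abs: "\<bar>real_of_int p\<bar> * norm (fcoeff ?f p) = br n * norm (fcoeff (%th. ?b (\<tau>, n) th * e \<tau> n th) p)"
      by (simp add: norm_mult idc_fc less_imp_le)
    have "norm (fcoeff ?f p) * br p ^ Suc N = norm (fcoeff ?f p) * br p ^ N + (\<bar>real_of_int p\<bar> * norm (fcoeff ?f p)) * br p ^ N"
      by (simp add: br_def[of p] algebra_simps)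
    also have "... = norm (fcoeff ?f p) * br p ^ N + br n * (norm (fcoeff (%th. ?b (\<tau>, n) th * e \<tau> n th) p) * br p ^ N)"
      unfolding abs by simp
    also have "... <= \<bar>C\<bar> * br n ^ Suc N + br n * (D * br n ^ N)"
    proof (intro add_mono mult_left_mono D \<tau>)
      have "C * br n ^ N <= \<bar>C\<bar> * br n ^ Suc N"
        using br_ge_1[of n] by (intro mult_mono power_increasing) (auto simp: less_imp_le)
      then show "norm (fcoeff ?f p) * br p ^ N <= \<bar>C\<bar> * br n ^ Suc N" using C[OF \<tau>, of n p] by linarith
    qed (simp add: less_imp_le)
    finally show ?thesis by (simp add: algebra_simps)
  qed
  then show ?case by blast
qed

end

lemma vector_mean_value_bound:
  fixes f :: "real => 'a::real_normed_vector"
  assumes "!!x. x \<in> S ==> (f has_vector_derivative f' x) (at x within S)" "convex S"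
    and "!!x. x \<in> S ==> norm (f' x) <= B" "x \<in> S" "y \<in> S"
  shows "norm (f x - f y) <= B * \<bar>x - y\<bar>"
proof -
  have "norm (f x - f y) <= B * norm (x - y)"
  proof (rule differentiable_bound[where f'="%x h. h *\<^sub>R f' x" and S=S])
    show "(f has_derivative (%h. h *\<^sub>R f' x)) (at x within S)" if "x \<in> S" for x
      using assms(1)[OF that] by (simp add: has_vector_derivative_def)
    show "onorm (%h. h *\<^sub>R f' x) <= B" if "x \<in> S" for x
      using assms(3)[OF that] by (intro onorm_le) (simp add: mult.commute[of B] mult_left_mono)
  qed (use assms in auto)
  then show ?thesis by simp
qed

context coord_family
begin

lemma T0: "0 \<in> T"
  using \<delta> by auto

lemma cf_one: "cf \<tau> n p = fcoeff (%th. 1 * e \<tau> n th) p"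
  by (simp add: cf_def)

lemma cf_opp: "\<exists>C. \<forall>\<tau>\<in>T. \<forall>n p. p * n < 0 \<longrightarrow> norm (cf \<tau> n p) * (br n * br p) ^ N <= C"
  using opposite_decay[of "%_ _. 1" N] sfam_const[of T "%_. 1" 1] unfolding cf_one by simp

lemma cd_norm: "norm (cd \<tau> n p) = \<bar>real_of_int n\<bar> * norm (fcoeff (%th. of_real (sd \<tau> th) * e \<tau> n th) p)"
  by (simp add: cd_def norm_mult)

lemma cd_opp: "\<exists>C. \<forall>\<tau>\<in>T. \<forall>n p. p * n < 0 \<longrightarrow> norm (cd \<tau> n p) * (br n * br p) ^ N <= C"
proof -
  obtain C where C: "!!\<tau> n p. \<tau> \<in> T ==> p * n < 0 ==> norm (fcoeff (%th. of_real (sd \<tau> th) * e \<tau> n th) p) * (br n * br p) ^ Suc N <= C"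
    using opposite_decay[OF sd_fam, of "Suc N"] by blast
  have "norm (cd \<tau> n p) * (br n * br p) ^ N <= C" if "\<tau> \<in> T" "p * n < 0" for \<tau> n p
  proof -
    let ?x = "norm (fcoeff (%th. of_real (sd \<tau> th) * e \<tau> n th) p)"
    have "\<bar>real_of_int n\<bar> <= br n * 1" by (simp add: br_def)
    also have "... <= br n * br p" using br_ge_1[of p] by (intro mult_left_mono) (auto simp: less_imp_le)
    finally have "\<bar>real_of_int n\<bar> * (?x * (br n * br p) ^ N) <= (br n * br p) * (?x * (br n * br p) ^ N)"
      by (rule mult_right_mono) (auto simp: less_imp_le)
    then have "norm (cd \<tau> n p) * (br n * br p) ^ N <= ?x * (br n * br p) ^ Suc N"
      by (simp only: cd_norm power_Suc mult_ac)
    then show ?thesis using C[OF that] by linarith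
  qed
  then show ?thesis by blast
qed

lemma cf_poly: "\<exists>C. \<forall>\<tau>\<in>T. \<forall>n p. norm (cf \<tau> n p) * br p ^ N <= C * br n ^ N"
  using poly_decay[of "%_ _. 1" N] sfam_const[of "T \<times> (UNIV::int set)" "%_. 1" 1] unfolding cf_one by simp

lemma cd_poly: "\<exists>C. \<forall>\<tau>\<in>T. \<forall>n p. norm (cd \<tau> n p) * br p ^ N <= C * br n ^ Suc N"
proof -
  have "sfam (T \<times> (UNIV::int set)) (%j th. complex_of_real (sd (fst j) th))"
    using sfam_pull[OF sd_fam, of "T \<times> (UNIV::int set)" fst] by auto
  from poly_decay[OF this, of N]
  have "\<exists>C. \<forall>\<tau>\<in>T. \<forall>n p. norm (fcoeff (%th. of_real (sd \<tau> th) * e \<tau> n th) p) * br p ^ N <= C * br n ^ N"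
    by (simp only: fst_conv)
  then obtain C where C: "!!\<tau> n p. \<tau> \<in> T ==> norm (fcoeff (%th. of_real (sd \<tau> th) * e \<tau> n th) p) * br p ^ N <= C * br n ^ N"
    by blast
  have "norm (cd \<tau> n p) * br p ^ N <= C * br n ^ Suc N" if "\<tau> \<in> T" for \<tau> n p
  proof -
    let ?x = "norm (fcoeff (%th. of_real (sd \<tau> th) * e \<tau> n th) p)"
    have "\<bar>real_of_int n\<bar> * (?x * br p ^ N) <= br n * (?x * br p ^ N)"
      by (rule mult_right_mono) (auto simp: less_imp_le br_def)
    also have "... <= br n * (C * br n ^ N)"
      by (rule mult_left_mono[OF C[OF that]]) (simp add: less_imp_le)
    finally show ?thesis by (simp only: cd_norm power_Suc mult_ac)
  qed
  then show ?thesis by blast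
qed

lemma cf_deriv:
  assumes \<tau>: "\<tau> \<in> T"
  shows "((%\<tau>. cf \<tau> n p) has_vector_derivative cd \<tau> n p) (at \<tau>)"
proof -
  let ?f = "%\<tau> th. exp (\<i> * of_int n * of_real (s \<tau> th)) * exp (- \<i> * of_int p * of_real th)"
  let ?fx = "%\<tau> th. (\<i> * of_int n * of_real (sd \<tau> th)) * exp (\<i> * of_int n * of_real (s \<tau> th)) * exp (- \<i> * of_int p * of_real th)"
  have ee: "e \<tau> n th = exp (\<i> * of_int n * of_real (s \<tau> th))" if "\<tau> \<in> T" for \<tau> th
    by (simp add: e_def coord.E_def[OF coord[OF that]])
  have "((%\<tau>. integral (cbox 0 (2*pi)) (?f \<tau>)) has_vector_derivative integral (cbox 0 (2*pi)) (?fx \<tau>)) (at \<tau> within T)"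
  proof (rule leibniz_rule_vector_derivative)
    show "((%\<tau>. ?f \<tau> th) has_vector_derivative ?fx \<tau> th) (at \<tau> within T)" if "\<tau> \<in> T" "th \<in> cbox 0 (2*pi)" for \<tau> th
    proof -
      have "((%\<tau>. complex_of_real (s \<tau> th)) has_vector_derivative of_real (sd \<tau> th)) (at \<tau>)"
        by (rule has_vector_derivative_of_real[OF s_deriv]) (use that in auto)
      then have "((%\<tau>. (\<i> * of_int n) * complex_of_real (s \<tau> th)) has_vector_derivative (\<i> * of_int n) * of_real (sd \<tau> th)) (at \<tau>)"
        by (rule has_vector_derivative_mult_right)
      then have "((exp \<circ> (%\<tau>. (\<i> * of_int n) * complex_of_real (s \<tau> th))) has_vector_derivative
         (\<i> * of_int n) * of_real (sd \<tau> th) * exp ((\<i> * of_int n) * complex_of_real (s \<tau> th))) (at \<tau>)"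
        by (rule field_vector_diff_chain_at) (rule DERIV_exp)
      from has_vector_derivative_mult_left[OF this, of "exp (- \<i> * of_int p * of_real th)"]
      have "((%\<tau>. ?f \<tau> th) has_vector_derivative ?fx \<tau> th) (at \<tau>)" by (simp add: o_def)
      then show ?thesis by (rule has_vector_derivative_at_within)
    qed
    show "?f \<tau> integrable_on cbox 0 (2*pi)" if "\<tau> \<in> T" for \<tau>
    proof -
      have "continuous_on {0..2*pi} (%th. e \<tau> n th * exp (- \<i> * of_int p * of_real th))"
        by (intro continuous_intros smooth_per_continuous e_smooth that)
      then have "(%th. e \<tau> n th * exp (- \<i> * of_int p * of_real th)) integrable_on {0..2*pi}"
        by (rule integrable_continuous_interval)
      then show ?thesis by (simp add: ee[OF that])
    qed
    show "continuous_on (T \<times> cbox 0 (2*pi)) (%(\<tau>,th). ?fx \<tau> th)"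
      using s_cont sd_cont unfolding case_prod_unfold cbox_interval by (intro continuous_intros) auto
    show "\<tau> \<in> T" by (rule \<tau>)
    show "convex T" by simp
  qed
  then have "((%\<tau>. integral {0..2*pi} (?f \<tau>) / (2 * pi)) has_vector_derivative integral {0..2*pi} (?fx \<tau>) / (2 * pi)) (at \<tau> within T)"
    unfolding cbox_interval by (rule has_vector_derivative_divide)
  moreover have "integral {0..2*pi} (?fx \<tau>) / (2 * pi) = cd \<tau> n p"
  proof -
    have "?fx \<tau> = (%th. (\<i> * of_int n) * (of_real (sd \<tau> th) * e \<tau> n th * exp (- \<i> * of_int p * of_real th)))"
      by (auto simp: ee[OF \<tau>] mult_ac)
    then show ?thesis unfolding cd_def fcoeff_def by (simp only: integral_mult_right times_divide_eq_right)
  qed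
  moreover have "at \<tau> within T = at \<tau>"
    by (rule at_within_open[OF \<tau>]) simp
  ultimately have "((%\<tau>. integral {0..2*pi} (?f \<tau>) / (2 * pi)) has_vector_derivative cd \<tau> n p) (at \<tau>)"
    by (simp only:)
  then show ?thesis
  proof (rule has_vector_derivative_transform_within_open)
    show "integral {0..2*pi} (?f \<tau>) / (2 * pi) = cf \<tau> n p" if "\<tau> \<in> T" for \<tau>
      by (simp add: cf_def fcoeff_def ee[OF that])
  qed (use \<tau> in auto)
qed

lemma cf_diff:
  assumes "\<tau> \<in> T" "!!t. t \<in> T ==> norm (cd t n p) <= B"
  shows "norm (cf \<tau> n p - cf 0 n p) <= B * \<bar>\<tau>\<bar>"
proof -
  have "norm (cf \<tau> n p - cf 0 n p) <= B * \<bar>\<tau> - 0\<bar>"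
    by (rule vector_mean_value_bound[where S=T and f="%\<tau>. cf \<tau> n p" and f'="%\<tau>. cd \<tau> n p", OF has_vector_derivative_at_within[OF cf_deriv] _ assms(2) assms(1) T0])
       auto
  then show ?thesis by simp
qed

lemma cf_le_1: "\<tau> \<in> T ==> norm (cf \<tau> n p) <= 1"
  by (simp add: cf_c coord.c_le_1[OF coord])

lemma KF_herm: "\<tau> \<in> T ==> herm_mat (KF \<tau>)"
  unfolding KF_def by (rule coord.Km_herm[OF coord])

lemma KF_formula:
  assumes "\<tau> \<in> T"
  shows "KF \<tau> m n = infsum (%p. (if p * n < 0 then 2 * of_int \<bar>p\<bar> * (cf \<tau> n p * cnj (cf \<tau> m p)) else 0)) UNIV"
  by (simp only: KF_def coord.Km_formula[OF coord[OF assms]] cf_c[OF assms])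

text \<open>Of the three surplus powers one pays for the factor |p| and two for summability over
  \<open>p\<close>.\<close>

lemma opp_sum_bound:
  fixes x :: "int => complex"
  assumes "!!p. p * n < 0 ==> norm (x p) * (br n * br p) ^ (N + 3) <= A"  "A \<ge> 0"
  shows "(%p. (if p * n < 0 then 2 * of_int \<bar>p\<bar> * x p else 0)) summable_on UNIV"
    "norm (infsum (%p. (if p * n < 0 then 2 * of_int \<bar>p\<bar> * x p else 0)) UNIV) * br n ^ N <= 2 * A * brsum"
proof -
  have le: "norm (if p * n < 0 then 2 * of_int \<bar>p\<bar> * x p else 0) <= 2 * A / br n ^ N * (1 / br p ^ 2)" for p
  proof (cases "p * n < 0")
    case True
    have "\<bar>real_of_int p\<bar> * (norm (x p) * (br n ^ N * br p ^ 2)) <= br p * (norm (x p) * (br n ^ N * br p ^ 2))"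
      by (rule mult_right_mono) (auto simp: br_def less_imp_le)
    also have "... = norm (x p) * (br n ^ N * br p ^ 3)" by (simp add: power3_eq_cube power2_eq_square)
    also have "... <= norm (x p) * (br n ^ (N + 3) * br p ^ (N + 3))"
      using br_ge_1 by (intro mult_left_mono mult_mono power_increasing) (auto simp: less_imp_le)
    also have "... <= A" using assms(1)[OF True] by (simp only: power_mult_distrib)
    finally show ?thesis using True by (simp add: norm_mult field_simps)
  qed (use assms(2) in \<open>auto simp: less_imp_le\<close>)
  note sm = summable_on_cmult_right[OF summable_br2, of "2 * A / br n ^ N"]
  show "(%p. (if p * n < 0 then 2 * of_int \<bar>p\<bar> * x p else 0)) summable_on UNIV"
    by (rule norm_infsum_le_infsum(1)[OF sm le])
  have "norm (infsum (%p. (if p * n < 0 then 2 * of_int \<bar>p\<bar> * x p else 0)) UNIV) <= 2 * A / br n ^ N * brsum"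
    using norm_infsum_le_infsum(2)[OF sm le] unfolding brsum_def by (simp only: infsum_cmult_right')
  then show "norm (infsum (%p. (if p * n < 0 then 2 * of_int \<bar>p\<bar> * x p else 0)) UNIV) * br n ^ N <= 2 * A * brsum"
    by (simp add: field_simps)
qed

lemma KF_rapid: "\<exists>\<kappa>. \<forall>\<tau>\<in>T. rapid_mat \<kappa> (KF \<tau>)"
proof -
  have "\<exists>\<kappa>. \<forall>\<tau>\<in>T. rapid_mat (%N. \<kappa> N * (%_. 1) \<tau>) (KF \<tau>)"
  proof (rule rapid_mat_of_one_sided)
    fix N
    obtain C where C: "!!\<tau> n p. \<tau> \<in> T ==> p * n < 0 ==> norm (cf \<tau> n p) * (br n * br p) ^ (N + 3) <= C"
      using cf_opp by blast
    have "norm (KF \<tau> m n) * br n ^ N <= (2 * \<bar>C\<bar> * brsum) * 1 * br m" if \<tau>: "\<tau> \<in> T" for \<tau> m n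
    proof -
      have "norm (KF \<tau> m n) * br n ^ N <= 2 * \<bar>C\<bar> * brsum"
        unfolding KF_formula[OF \<tau>]
      proof (rule opp_sum_bound(2))
        fix p assume p: "p * n < 0"
        have "norm (cf \<tau> n p * cnj (cf \<tau> m p)) <= norm (cf \<tau> n p)"
          using cf_le_1[OF \<tau>] by (simp add: norm_mult mult_left_le)
        then have "norm (cf \<tau> n p * cnj (cf \<tau> m p)) * (br n * br p) ^ (N + 3) <= norm (cf \<tau> n p) * (br n * br p) ^ (N + 3)"
          by (rule mult_right_mono) (auto simp: less_imp_le)
        then show "norm (cf \<tau> n p * cnj (cf \<tau> m p)) * (br n * br p) ^ (N + 3) <= \<bar>C\<bar>"
          using C[OF \<tau> p] by linarith
      qed auto
      also have "... <= (2 * \<bar>C\<bar> * brsum) * br m"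
        using mult_left_mono[OF br_ge_1[of m], of "2 * \<bar>C\<bar> * brsum"] brsum_nonneg by simp
      finally show ?thesis by simp
    qed
    then show "\<exists>A. \<forall>\<tau>\<in>T. \<forall>m n. norm (KF \<tau> m n) * br n ^ N <= A * (%_. 1) \<tau> * br m" by blast
  qed (use KF_herm in auto)
  then show ?thesis by simp
qed

text \<open>In the difference of products either the coefficient with index \<open>n\<close>
  changes, with rapid decay by \<open>cd_opp\<close>, or the one with index \<open>m\<close>, whose
  derivative is only bounded by a multiple of \<open>br m\<close>. This is why
  \<open>rapid_mat_of_one_sided\<close> tolerates such a factor. The mean value theorem supplies
  |\<tau>|.\<close>

lemma KF_diff_rapid: "\<exists>\<kappa>. \<forall>\<tau>\<in>T. rapid_mat (%N. \<kappa> N * \<bar>\<tau>\<bar>) (%m n. KF \<tau> m n - KF 0 m n)"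
proof (rule rapid_mat_of_one_sided)
  show "herm_mat (%m n. KF \<tau> m n - KF 0 m n)" if "\<tau> \<in> T" for \<tau>
    using KF_herm[OF that] KF_herm[OF T0] by (simp add: herm_mat_def)
  fix N
  obtain C where C: "!!\<tau> n p. \<tau> \<in> T ==> p * n < 0 ==> norm (cf \<tau> n p) * (br n * br p) ^ (N + 3) <= C"
    using cf_opp by blast
  obtain D where D: "!!\<tau> n p. \<tau> \<in> T ==> p * n < 0 ==> norm (cd \<tau> n p) * (br n * br p) ^ (N + 3) <= D"
    using cd_opp by blast
  have "\<exists>B. \<forall>\<tau>\<in>T. \<forall>n p. norm (cd \<tau> n p) <= B * br n"
    using cd_poly[of 0] by simp
  then obtain B where B: "!!\<tau> n p. \<tau> \<in> T ==> norm (cd \<tau> n p) <= B * br n"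
    by blast
  have "norm (KF \<tau> m n - KF 0 m n) * br n ^ N <= (2 * (\<bar>D\<bar> + \<bar>C\<bar> * \<bar>B\<bar>) * brsum) * \<bar>\<tau>\<bar> * br m" if \<tau>: "\<tau> \<in> T" for \<tau> m n
  proof -
    let ?x = "%\<tau> p. cf \<tau> n p * cnj (cf \<tau> m p)"
    let ?A = "(\<bar>D\<bar> + \<bar>C\<bar> * \<bar>B\<bar>) * \<bar>\<tau>\<bar> * br m"
    have A0: "?A \<ge> 0" by (auto simp: less_imp_le)
    have sm: "(%p. (if p * n < 0 then 2 * of_int \<bar>p\<bar> * ?x t p else 0)) summable_on UNIV" if t: "t \<in> T" for t
    proof (rule opp_sum_bound(1)[where A="\<bar>C\<bar>" and N=N])
      fix p assume p: "p * n < 0"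
      have "norm (?x t p) <= norm (cf t n p)"
        using cf_le_1[OF t] by (simp add: norm_mult mult_left_le)
      then have "norm (?x t p) * (br n * br p) ^ (N + 3) <= norm (cf t n p) * (br n * br p) ^ (N + 3)"
        by (rule mult_right_mono) (auto simp: less_imp_le)
      then show "norm (?x t p) * (br n * br p) ^ (N + 3) <= \<bar>C\<bar>" using C[OF t p] by linarith
    qed auto
    have "KF \<tau> m n - KF 0 m n = infsum (%p. (if p * n < 0 then 2 * of_int \<bar>p\<bar> * ?x \<tau> p else 0) - (if p * n < 0 then 2 * of_int \<bar>p\<bar> * ?x 0 p else 0)) UNIV"
      unfolding KF_formula[OF \<tau>] KF_formula[OF T0] by (rule infsum_diff(2)[OF sm[OF \<tau>] sm[OF T0], symmetric])
    also have "... = infsum (%p. (if p * n < 0 then 2 * of_int \<bar>p\<bar> * (?x \<tau> p - ?x 0 p) else 0)) UNIV"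
      by (rule infsum_cong) (simp add: right_diff_distrib)
    finally have "norm (KF \<tau> m n - KF 0 m n) * br n ^ N = norm (infsum (%p. (if p * n < 0 then 2 * of_int \<bar>p\<bar> * (?x \<tau> p - ?x 0 p) else 0)) UNIV) * br n ^ N"
      by simp
    also have "... <= 2 * ?A * brsum"
    proof (rule opp_sum_bound(2)[OF _ A0])
      fix p assume p: "p * n < 0"
      let ?w = "(br n * br p) ^ (N + 3)"
      have w0: "?w > 0" by simp
      have 1: "norm (cf \<tau> n p - cf 0 n p) * ?w <= \<bar>D\<bar> * \<bar>\<tau>\<bar>"
      proof -
        have "norm (cf \<tau> n p - cf 0 n p) <= (\<bar>D\<bar> / ?w) * \<bar>\<tau>\<bar>"
        proof (rule cf_diff[OF \<tau>])
          fix t assume "t \<in> T"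
          then have "norm (cd t n p) * ?w <= \<bar>D\<bar>" using D[of t p n] p by force
          then show "norm (cd t n p) <= \<bar>D\<bar> / ?w" using w0 by (simp only: pos_le_divide_eq)
        qed
        then show ?thesis using w0 by (simp only: times_divide_eq_left pos_le_divide_eq)
      qed
      have 2: "norm (cf 0 n p) * ?w <= \<bar>C\<bar>" using C[OF T0 p] by linarith
      have 3: "norm (cf \<tau> m p - cf 0 m p) <= \<bar>B\<bar> * br m * \<bar>\<tau>\<bar>"
      proof (rule cf_diff[OF \<tau>])
        fix t assume "t \<in> T"
        have "B * br m <= \<bar>B\<bar> * br m" by (rule mult_right_mono) (auto simp: less_imp_le)
        then show "norm (cd t m p) <= \<bar>B\<bar> * br m" using B[OF \<open>t \<in> T\<close>, of m p] by linarith
      qed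
      have "?x \<tau> p - ?x 0 p = (cf \<tau> n p - cf 0 n p) * cnj (cf \<tau> m p) + cf 0 n p * cnj (cf \<tau> m p - cf 0 m p)"
        by (simp add: algebra_simps)
      then have "norm (?x \<tau> p - ?x 0 p) <= norm (cf \<tau> n p - cf 0 n p) * norm (cf \<tau> m p) + norm (cf 0 n p) * norm (cf \<tau> m p - cf 0 m p)"
        by (metis norm_triangle_ineq norm_mult complex_mod_cnj)
      also have "... <= norm (cf \<tau> n p - cf 0 n p) * 1 + norm (cf 0 n p) * (\<bar>B\<bar> * br m * \<bar>\<tau>\<bar>)"
        by (intro add_mono mult_left_mono 3 cf_le_1 \<tau>) auto
      finally have "norm (?x \<tau> p - ?x 0 p) * ?w <= (norm (cf \<tau> n p - cf 0 n p) * 1 + norm (cf 0 n p) * (\<bar>B\<bar> * br m * \<bar>\<tau>\<bar>)) * ?w"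
        by (intro mult_right_mono less_imp_le[OF w0])
      also have "... = norm (cf \<tau> n p - cf 0 n p) * ?w + (norm (cf 0 n p) * ?w) * (\<bar>B\<bar> * br m * \<bar>\<tau>\<bar>)"
        by (simp add: algebra_simps)
      also have "... <= \<bar>D\<bar> * \<bar>\<tau>\<bar> + \<bar>C\<bar> * (\<bar>B\<bar> * br m * \<bar>\<tau>\<bar>)"
        by (intro add_mono mult_right_mono 1 2) (auto simp: less_imp_le)
      also have "... <= \<bar>D\<bar> * \<bar>\<tau>\<bar> * br m + \<bar>C\<bar> * (\<bar>B\<bar> * br m * \<bar>\<tau>\<bar>)"
        using mult_left_mono[OF br_ge_1[of m], of "\<bar>D\<bar> * \<bar>\<tau>\<bar>"] by simp
      also have "... = ?A" by (simp add: algebra_simps)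
      finally show "norm (?x \<tau> p - ?x 0 p) * ?w <= ?A" .
    qed
    also have "... = (2 * (\<bar>D\<bar> + \<bar>C\<bar> * \<bar>B\<bar>) * brsum) * \<bar>\<tau>\<bar> * br m" by (simp add: mult_ac)
    finally show ?thesis .
  qed
  then show "\<exists>A. \<forall>\<tau>\<in>T. \<forall>m n. norm (KF \<tau> m n - KF 0 m n) * br n ^ N <= A * \<bar>\<tau>\<bar> * br m" by blast
qed auto

text \<open>The termwise derivative of \<open>Lm\<close> at \<tau> = 0, and also that of
  \<open>KF\<close>, since the subtracted diagonal does not move.\<close>

definition Ld :: "int => int => complex" where
  "Ld m n = infsum (%p. of_int \<bar>p\<bar> * (cd 0 n p * cnj (cf 0 m p) + cf 0 n p * cnj (cd 0 m p))) UNIV"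

text \<open>For fixed \<open>m\<close>, \<open>n\<close> the unrestricted series over
  \<open>p\<close> is used: \<open>cf_poly\<close> and \<open>cd_poly\<close> leave three powers of
  \<open>br p\<close>, enough to dominate the difference quotients with weight |p|. In this form the
  limit can be summed by Parseval later.\<close>

lemma KF_limit: "((%\<tau>. (KF \<tau> m n - KF 0 m n) / of_real \<tau>) \<longlongrightarrow> Ld m n) (at 0)"
proof -
  let ?x = "%\<tau> p. cf \<tau> n p * cnj (cf \<tau> m p)"
  let ?f = "%p \<tau>. of_int \<bar>p\<bar> * ((?x \<tau> p - ?x 0 p) / of_real \<tau>)"
  obtain C where C: "!!\<tau> n p. \<tau> \<in> T ==> norm (cf \<tau> n p) * br p ^ 3 <= C * br n ^ 3"
    using cf_poly[of 3] by blast
  obtain D where D: "!!\<tau> n p. \<tau> \<in> T ==> norm (cd \<tau> n p) * br p ^ 3 <= D * br n ^ 4"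
  proof -
    have "Suc 3 = 4" by simp
    then show ?thesis using that cd_poly[of 3] by (simp only:) blast
  qed
  have evT: "\<forall>\<^sub>F \<tau> in at 0. \<tau> \<in> T \<and> \<tau> \<noteq> 0"
    using eventually_at_in_open[of T 0] T0 by (auto elim: eventually_mono)
  have KL: "KF \<tau> m n - KF 0 m n = infsum (%p. of_int \<bar>p\<bar> * (?x \<tau> p - ?x 0 p)) UNIV" if "\<tau> \<in> T" for \<tau>
  proof -
    note c = coord[OF that] and c0 = coord[OF T0]
    have sm: "(%p. of_int \<bar>p\<bar> * ?x t p) summable_on UNIV" if "t \<in> T" for t
      using coord.cc_summable(1)[OF coord[OF that], of n m] by (simp add: cf_c[OF that])
    have "KF \<tau> m n - KF 0 m n = infsum (%p. of_int \<bar>p\<bar> * ?x \<tau> p) UNIV - infsum (%p. of_int \<bar>p\<bar> * ?x 0 p) UNIV"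
      unfolding KF_def coord.Km_def[OF c] coord.Km_def[OF c0] coord.Lm_def[OF c] coord.Lm_def[OF c0]
      by (simp add: cf_c[OF that] cf_c[OF T0])
    also have "... = infsum (%p. of_int \<bar>p\<bar> * ?x \<tau> p - of_int \<bar>p\<bar> * ?x 0 p) UNIV"
      by (rule infsum_diff(2)[OF sm[OF that] sm[OF T0], symmetric])
    finally show ?thesis by (simp only: right_diff_distrib)
  qed
  define M where "M = \<bar>D\<bar> * br n ^ 4 + \<bar>C\<bar> * br n ^ 3 * (\<bar>D\<bar> * br m ^ 4)"
  have "((%\<tau>. infsum (%p. ?f p \<tau>) UNIV) \<longlongrightarrow> Ld m n) (at 0)"
    unfolding Ld_def
  proof (rule tendsto_infsum_dominated)
    show "(%p. M * (1 / br p ^ 2)) summable_on UNIV"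
      by (rule summable_on_cmult_right[OF summable_br2])
    show "\<forall>\<^sub>F \<tau> in at 0. \<forall>p\<in>UNIV. norm (?f p \<tau>) <= M * (1 / br p ^ 2)"
    proof (rule eventually_mono[OF evT], intro ballI)
      fix \<tau> p assume \<tau>: "\<tau> \<in> T \<and> \<tau> \<noteq> 0"
      have d: "norm (cf \<tau> k p - cf 0 k p) <= (\<bar>D\<bar> * br k ^ 4 / br p ^ 3) * \<bar>\<tau>\<bar>" for k
      proof (rule cf_diff)
        fix t assume t: "t \<in> T"
        have "D * br k ^ 4 <= \<bar>D\<bar> * br k ^ 4" by (rule mult_right_mono) (auto simp: less_imp_le)
        then have "norm (cd t k p) * br p ^ 3 <= \<bar>D\<bar> * br k ^ 4" using D[OF t, of k p] by linarith
        then show "norm (cd t k p) <= \<bar>D\<bar> * br k ^ 4 / br p ^ 3" by (simp add: pos_le_divide_eq)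
      qed (use \<tau> in auto)
      have c3: "norm (cf 0 n p) <= \<bar>C\<bar> * br n ^ 3"
      proof -
        have "norm (cf 0 n p) * 1 <= norm (cf 0 n p) * br p ^ 3" by (intro mult_left_mono br_power_ge_1) auto
        also have "... <= C * br n ^ 3" by (rule C[OF T0])
        also have "... <= \<bar>C\<bar> * br n ^ 3" by (rule mult_right_mono) (auto simp: less_imp_le)
        finally show ?thesis by simp
      qed
      have "?x \<tau> p - ?x 0 p = (cf \<tau> n p - cf 0 n p) * cnj (cf \<tau> m p) + cf 0 n p * cnj (cf \<tau> m p - cf 0 m p)"
        by (simp add: algebra_simps)
      then have "norm (?x \<tau> p - ?x 0 p) <= norm (cf \<tau> n p - cf 0 n p) * norm (cf \<tau> m p) + norm (cf 0 n p) * norm (cf \<tau> m p - cf 0 m p)"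
        by (metis norm_triangle_ineq norm_mult complex_mod_cnj)
      also have "... <= (\<bar>D\<bar> * br n ^ 4 / br p ^ 3) * \<bar>\<tau>\<bar> * 1 + \<bar>C\<bar> * br n ^ 3 * ((\<bar>D\<bar> * br m ^ 4 / br p ^ 3) * \<bar>\<tau>\<bar>)"
        by (intro add_mono mult_mono d c3 cf_le_1) (use \<tau> in \<open>auto simp: less_imp_le\<close>)
      also have "... = M / br p ^ 3 * \<bar>\<tau>\<bar>"
        by (simp add: M_def add_divide_distrib algebra_simps)
      finally have "norm (?x \<tau> p - ?x 0 p) / \<bar>\<tau>\<bar> <= M / br p ^ 3"
        using \<tau> by (simp add: divide_le_eq)
      then have "\<bar>real_of_int p\<bar> * (norm (?x \<tau> p - ?x 0 p) / \<bar>\<tau>\<bar>) <= br p * (M / br p ^ 3)"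
        by (intro mult_mono) (auto simp: br_def)
      also have "... = M * (1 / br p ^ 2)" by (simp add: power3_eq_cube power2_eq_square)
      finally show "norm (?f p \<tau>) <= M * (1 / br p ^ 2)"
        by (simp only: norm_mult norm_divide norm_of_real norm_of_int abs_abs of_int_abs)
    qed
    show "((%\<tau>. ?f p \<tau>) \<longlongrightarrow> of_int \<bar>p\<bar> * (cd 0 n p * cnj (cf 0 m p) + cf 0 n p * cnj (cd 0 m p))) (at 0)" for p
    proof -
      have "((%\<tau>. ?x \<tau> p) has_vector_derivative cf 0 n p * cnj (cd 0 m p) + cd 0 n p * cnj (cf 0 m p)) (at 0)"
        by (intro has_vector_derivative_mult has_vector_derivative_cnj cf_deriv T0)
      from vector_derivative_quotient[OF this] have "((%\<tau>. (?x \<tau> p - ?x 0 p) / of_real \<tau>) \<longlongrightarrow> cf 0 n p * cnj (cd 0 m p) + cd 0 n p * cnj (cf 0 m p)) (at 0)"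
        by simp
      from tendsto_mult_left[OF this, of "of_int \<bar>p\<bar>"] show ?thesis by (simp add: add.commute)
    qed
  qed
  then show ?thesis
  proof (rule Lim_transform_eventually)
    show "\<forall>\<^sub>F \<tau> in at 0. infsum (%p. ?f p \<tau>) UNIV = (KF \<tau> m n - KF 0 m n) / of_real \<tau>"
    proof (rule eventually_mono[OF evT])
      fix \<tau> assume "\<tau> \<in> T \<and> \<tau> \<noteq> 0"
      then have "(KF \<tau> m n - KF 0 m n) / of_real \<tau> = infsum (%p. of_int \<bar>p\<bar> * (?x \<tau> p - ?x 0 p)) UNIV * (1 / of_real \<tau>)"
        using KL by simp
      also have "... = infsum (%p. of_int \<bar>p\<bar> * (?x \<tau> p - ?x 0 p) * (1 / of_real \<tau>)) UNIV"
        by (rule infsum_cmult_left'[symmetric])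
      finally show "infsum (%p. ?f p \<tau>) UNIV = (KF \<tau> m n - KF 0 m n) / of_real \<tau>" by simp
    qed
  qed
qed

end

section \<open>The weighted operator in its arc length coordinate\<close>

lemma Lam_syn: "Lam f = idc.syn (%n. of_int \<bar>n\<bar> * fcoeff f n)"
  by (simp add: Lam_def idc.syn_def idc_E)

lemma abs_int_complex: "complex_of_real \<bar>real_of_int m\<bar> = of_int \<bar>m\<bar>"
  by (metis of_int_abs of_real_of_int_eq)

lemma fcoeff_rapid: "smooth_per f ==> rapid_seq (fcoeff f)"
  using idc.fc_rapid[of f] by (simp add: idc_fc[abs_def])

lemma abs_fcoeff_rapid: "smooth_per f ==> rapid_seq (%n. of_int \<bar>n\<bar> * fcoeff f n)"
  by (rule rapid_seq_poly_mult[where C=1 and N=1]) (auto simp: fcoeff_rapid br_def)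

lemma Lam_smooth: "smooth_per f ==> smooth_per (Lam f)"
  unfolding Lam_syn by (rule idc.syn_smooth[OF abs_fcoeff_rapid])

lemma fcoeff_Lam: "smooth_per f ==> fcoeff (Lam f) n = of_int \<bar>n\<bar> * fcoeff f n"
  unfolding Lam_syn using idc.fc_syn[OF abs_fcoeff_rapid] by (simp add: idc_fc)

lemma parseval_id:
  assumes "smooth_per f" "continuous_on {0..2*pi} g"
  shows "((%n. fcoeff f n * cnj (fcoeff g n)) has_sum (l2inner f g / (2 * pi))) UNIV"
  using idc.parseval[OF assms] by (simp add: idc_fc l2inner_def)

context coord
begin

lemma parseval_sq:
  assumes "smooth_per f"
  shows "((%n. (norm (fc f n))\<^sup>2) has_sum (integral {0..2*pi} (%th. (norm (f th))\<^sup>2 * \<sigma> th) / (2 * pi))) UNIV"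
proof -
  have "((%n. fc f n * cnj (fc f n)) has_sum (integral {0..2*pi} (%th. f th * cnj (f th) * of_real (\<sigma> th)) / (2 * pi))) UNIV"
    by (rule parseval[OF assms smooth_per_continuous[OF assms]])
  moreover have "integral {0..2*pi} (%th. f th * cnj (f th) * of_real (\<sigma> th)) = of_real (integral {0..2*pi} (%th. (norm (f th))\<^sup>2 * \<sigma> th))"
  proof -
    have "integral {0..2*pi} (%th. f th * cnj (f th) * of_real (\<sigma> th)) = integral {0..2*pi} (%th. complex_of_real ((norm (f th))\<^sup>2 * \<sigma> th))"
      unfolding of_real_mult complex_norm_square ..
    also have "... = of_real (integral {0..2*pi} (%th. (norm (f th))\<^sup>2 * \<sigma> th))"
      by (rule integral_complex_of_real, intro integrable_continuous_interval continuous_intros smooth_per_continuous[OF assms] \<sigma>_real_cont)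
    finally show ?thesis .
  qed
  ultimately have "((%n. complex_of_real ((norm (fc f n))\<^sup>2)) has_sum of_real (integral {0..2*pi} (%th. (norm (f th))\<^sup>2 * \<sigma> th) / (2 * pi))) UNIV"
    unfolding complex_norm_square by simp
  from has_sum_Re[OF this] show ?thesis by simp
qed

lemma fc_add: "continuous_on {0..2*pi} f ==> continuous_on {0..2*pi} g ==> fc (%th. f th + g th) n = fc f n + fc g n"
  unfolding fc_def using integral_add[OF fc_integrable fc_integrable, of f g n n]
  by (simp add: distrib_right add_divide_distrib)

text \<open>The test function \<open>idc.E p\<close> divided by \<open>\<sigma>\<close> undoes the
  density of the coordinate, so its coefficients are the conjugates of the \<open>c m p\<close>, and
  \<open>syn_pair\<close> gives the expansion.\<close>

lemma fcoeff_expand: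
  assumes x: "rapid_seq x"
  shows "((%m. x m * c m p) has_sum fcoeff (syn x) p) UNIV"
proof -
  let ?g = "%th. idc.E p th * (1 / of_real (\<sigma> th))"
  have gs: "smooth_per ?g" by (intro smooth_per_mult idc.E_smooth inv_\<sigma>_smooth)
  have nz: "complex_of_real (\<sigma> th) \<noteq> 0" for th using \<sigma>_pos[of th] by simp
  have fg: "cnj (fc ?g m) = c m p" for m
  proof -
    have "cnj (fc ?g m) = integral {0..2*pi} (%th. cnj (?g th * cnj (E m th) * of_real (\<sigma> th))) / (2 * pi)"
      unfolding fc_def Henstock_Kurzweil_Integration.integral_cnj[symmetric] by simp
    also have "(%th. cnj (?g th * cnj (E m th) * of_real (\<sigma> th))) = (%th. E m th * cnj (idc.E p th) * of_real 1)"
      using nz by auto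
    finally show ?thesis unfolding c_def idc_fc[symmetric] idc.fc_def .
  qed
  have "((%m. x m * cnj (fc ?g m)) has_sum (integral {0..2*pi} (%th. syn x th * cnj (?g th) * of_real (\<sigma> th)) / (2 * pi))) UNIV"
    by (rule syn_pair[OF x smooth_per_continuous[OF gs]])
  moreover have "(%th. syn x th * cnj (?g th) * of_real (\<sigma> th)) = (%th. syn x th * cnj (idc.E p th) * of_real 1)"
    using nz by auto
  ultimately show ?thesis unfolding fg idc_fc[symmetric] idc.fc_def by simp
qed

end

text \<open>The weight is the reciprocal of \<open>\<sigma>\<close>, so \<open>s\<close> is its arc
  length, and multiplication by the square root of \<open>b\<close> is an isometry from the plain
  L^2 norm to the one with density \<open>\<sigma>\<close>.\<close>

locale wcoord = coord s \<sigma> for s \<sigma> +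
  fixes b :: "real => real" and \<kappa> :: "nat => real"
  assumes b: "!!th. b th = 1 / \<sigma> th" and Krapid: "rapid_mat \<kappa> Km"
begin

lemma b_pos: "b th > 0"
  using \<sigma>_pos[of th] by (simp add: b)

lemma b_smooth: "smooth_per (%th. complex_of_real (b th))"
  using inv_\<sigma>_smooth by (simp add: b)

lemma ri_smooth: "smooth_per (rinvsqrt b)" and rq_smooth: "smooth_per (rsqrt b)"
  using smooth_per_rinvsqrt[OF b_smooth b_pos] by auto

lemma rq_ri: "rsqrt b th * rinvsqrt b th = 1" "rinvsqrt b th * rsqrt b th = 1"
  using b_pos[of th] by (auto simp: rsqrt_def rinvsqrt_def simp flip: of_real_mult)

lemma ri_ri: "rinvsqrt b th * rinvsqrt b th = of_real (\<sigma> th)"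
proof -
  have "1 / sqrt (b th) * (1 / sqrt (b th)) = \<sigma> th"
    using b_pos[of th] \<sigma>_pos[of th] by (simp add: b real_sqrt_mult[symmetric])
  then show ?thesis unfolding rinvsqrt_def by (metis of_real_mult)
qed

lemma rq_\<sigma>: "rsqrt b th * of_real (\<sigma> th) = rinvsqrt b th"
  unfolding ri_ri[symmetric] by (simp add: rq_ri(1) flip: mult.assoc)

lemma b\<sigma>: "complex_of_real (b th) * of_real (\<sigma> th) = 1"
  using \<sigma>_pos[of th] by (simp add: b)

lemma cnj_ri: "cnj (rinvsqrt b th) = rinvsqrt b th" and cnj_rq: "cnj (rsqrt b th) = rsqrt b th"
  by (simp_all add: rinvsqrt_def rsqrt_def)

definition ww :: "cfun => cfun" where "ww \<phi> = mulop (rsqrt b) \<phi>"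

text \<open>The factor \<open>sqrt (2 * pi)\<close> makes the passage to coordinates isometric, see
  \<open>l2inner_sip\<close>.\<close>

definition coords :: "cfun => int => complex" where
  "coords \<phi> n = of_real (sqrt (2 * pi)) * fc (ww \<phi>) n"

definition uncoords :: "(int => complex) => cfun" where
  "uncoords x = (%th. rinvsqrt b th * (of_real (1 / sqrt (2 * pi)) * syn x th))"

lemma ww_smooth: "smooth_per \<phi> ==> smooth_per (ww \<phi>)"
  unfolding ww_def mulop_def by (rule smooth_per_mult[OF rq_smooth])

lemma \<phi>_ww: "\<phi> th = rinvsqrt b th * ww \<phi> th"
  by (simp add: ww_def mulop_def rq_ri flip: mult.assoc)

lemma uncoords_smooth: "rapid_seq x ==> smooth_per (uncoords x)"
  unfolding uncoords_def by (intro smooth_per_mult ri_smooth smooth_per_scale syn_smooth)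

lemma ww_uncoords: "ww (uncoords x) = (%th. of_real (1 / sqrt (2 * pi)) * syn x th)"
  by (auto simp: ww_def mulop_def uncoords_def rq_ri simp flip: mult.assoc)

lemma coords_uncoords: "rapid_seq x ==> coords (uncoords x) = x"
  by (rule ext) (simp only: coords_def ww_uncoords fc_scale fc_syn mult.assoc[symmetric] of_real_mult[symmetric], simp)

lemma coords_rapid: "smooth_per \<phi> ==> rapid_seq (coords \<phi>)"
  unfolding coords_def[abs_def] by (intro rapid_seq_scale fc_rapid ww_smooth)

lemma l2inner_ww: "l2inner \<phi> \<psi> = integral {0..2*pi} (%th. ww \<phi> th * cnj (ww \<psi> th) * of_real (\<sigma> th))"
proof -
  have "\<phi> th * cnj (\<psi> th) = ww \<phi> th * cnj (ww \<psi> th) * of_real (\<sigma> th)" for th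
    by (subst (1) \<phi>_ww, subst (2) \<phi>_ww) (simp add: cnj_ri ri_ri[symmetric] mult_ac)
  then show ?thesis by (simp add: l2inner_def)
qed

lemma l2inner_sip:
  assumes "smooth_per \<phi>" "smooth_per \<psi>"
  shows "l2inner \<phi> \<psi> = sip (coords \<phi>) (coords \<psi>)"
proof -
  have "((%n. fc (ww \<phi>) n * cnj (fc (ww \<psi>) n)) has_sum (l2inner \<phi> \<psi> / (2 * pi))) UNIV"
    unfolding l2inner_ww by (rule parseval[OF ww_smooth[OF assms(1)] smooth_per_continuous[OF ww_smooth[OF assms(2)]]])
  from has_sum_cmult_right[OF this, of "2 * pi"]
  have "((%n. 2 * pi * (fc (ww \<phi>) n * cnj (fc (ww \<psi>) n))) has_sum l2inner \<phi> \<psi>) UNIV" by simp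
  moreover have "2 * pi * (fc (ww \<phi>) n * cnj (fc (ww \<psi>) n)) = coords \<phi> n * cnj (coords \<psi> n)" for n
  proof -
    have "complex_of_real (sqrt (2 * pi)) * of_real (sqrt (2 * pi)) = 2 * pi"
      by (simp flip: of_real_mult)
    then have "2 * pi * (fc (ww \<phi>) n * cnj (fc (ww \<psi>) n)) = (complex_of_real (sqrt (2 * pi)) * of_real (sqrt (2 * pi))) * (fc (ww \<phi>) n * cnj (fc (ww \<psi>) n))"
      by simp
    then show ?thesis by (simp only: coords_def complex_cnj_mult complex_cnj_complex_of_real mult_ac)
  qed
  ultimately show ?thesis unfolding sip_def by (simp add: infsumI)
qed

text \<open>As \<open>b\<close> cancels \<open>\<sigma>\<close>, the left side is a plain pairing of
  \<open>Lam w\<close> with \<open>E n\<close>. Parseval in ordinary coefficients and the expansion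
  of \<open>w\<close> in the \<open>E m\<close> produce the row \<open>n\<close> of
  \<open>Lm\<close>, that is |n| plus \<open>Km\<close>.\<close>

lemma lam_pair:
  assumes w: "smooth_per w"
  shows "fc (%th. of_real (b th) * Lam w th) n = of_int \<bar>n\<bar> * fc w n + mv Km (fc w) n"
proof -
  let ?x = "fc w"
  have x: "rapid_seq ?x" by (rule fc_rapid[OF w])
  obtain B where B: "!!m. norm (?x m) <= B" using rapid_seq_bounded[OF x] by blast
  have "fc (%th. of_real (b th) * Lam w th) n = l2inner (Lam w) (E n) / (2 * pi)"
  proof -
    have "of_real (b th) * Lam w th * cnj (E n th) * of_real (\<sigma> th) = Lam w th * cnj (E n th)" for th
      using b\<sigma>[of th] by (simp add: mult_ac)
    then show ?thesis by (simp only: fc_def l2inner_def)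
  qed
  also have "... = infsum (%p. of_int \<bar>p\<bar> * fcoeff w p * cnj (c n p)) UNIV"
    using parseval_id[OF Lam_smooth[OF w] E_cont[of _ n]] fcoeff_Lam[OF w] by (simp add: c_def infsumI)
  also have "... = infsum (%p. infsum (%m. of_int \<bar>p\<bar> * (?x m * c m p) * cnj (c n p)) UNIV) UNIV"
  proof (rule infsum_cong)
    fix p
    have "fcoeff w p = infsum (%m. ?x m * c m p) UNIV"
      using infsumI[OF fcoeff_expand[OF x, of p]] by (simp add: inversion[OF w])
    then show "of_int \<bar>p\<bar> * fcoeff w p * cnj (c n p) = infsum (%m. of_int \<bar>p\<bar> * (?x m * c m p) * cnj (c n p)) UNIV"
      by (simp only: infsum_cmult_left' infsum_cmult_right')
  qed
  also have "... = infsum (%m. infsum (%p. of_int \<bar>p\<bar> * (?x m * c m p) * cnj (c n p)) UNIV) UNIV"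
  proof (rule infsum_swap_banach)
    have s: "(%(p, m). (br p ^ 1 * norm (c n p)) * (br m ^ 0 * norm (?x m))) summable_on (UNIV \<times> UNIV)"
      by (rule summable_on_times(1)[OF rapid_seq_summable[OF c_rapid] rapid_seq_summable[OF x]]) (auto simp: less_imp_le)
    show "(%(p, m). of_int \<bar>p\<bar> * (?x m * c m p) * cnj (c n p)) summable_on (UNIV \<times> UNIV)"
    proof (rule norm_infsum_le_infsum(1)[OF s])
      fix q :: "int \<times> int"
      obtain p m where q: "q = (p, m)" by (cases q)
      have "\<bar>real_of_int p\<bar> * (norm (?x m) * norm (c m p)) * norm (c n p) <= br p * (norm (?x m) * 1) * norm (c n p)"
        using c_le_1[of m p] by (intro mult_right_mono mult_mono mult_left_mono) (auto simp: br_def)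
      then show "norm ((%(p, m). of_int \<bar>p\<bar> * (?x m * c m p) * cnj (c n p)) q) <= (%(p, m). (br p ^ 1 * norm (c n p)) * (br m ^ 0 * norm (?x m))) q"
        by (simp add: q norm_mult mult_ac)
    qed
  qed
  also have "... = infsum (%m. Km n m * ?x m + (if m = n then of_int \<bar>n\<bar> * ?x n else 0)) UNIV"
  proof (rule infsum_cong)
    fix m
    have "infsum (%p. of_int \<bar>p\<bar> * (?x m * c m p) * cnj (c n p)) UNIV = infsum (%p. ?x m * (of_int \<bar>p\<bar> * (c m p * cnj (c n p)))) UNIV"
      by (rule infsum_cong) (simp only: mult_ac)
    also have "... = ?x m * Lm n m"
      unfolding Lm_def by (rule infsum_cmult_right')
    finally show "infsum (%p. of_int \<bar>p\<bar> * (?x m * c m p) * cnj (c n p)) UNIV = Km n m * ?x m + (if m = n then of_int \<bar>n\<bar> * ?x n else 0)"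
      by (auto simp: Km_def algebra_simps)
  qed
  also have "... = mv Km ?x n + infsum (%m. if m = n then of_int \<bar>n\<bar> * ?x n else 0) UNIV"
    unfolding mv_def
    by (rule infsum_add[OF mv_summable[where x="?x", OF Krapid B]]) (rule finite_nonzero_values_imp_summable_on, auto)
  also have "infsum (%m. if m = n then of_int \<bar>n\<bar> * ?x n else 0) UNIV = of_int \<bar>n\<bar> * ?x n"
    by (rule infsumI, rule has_sum_finite_neutralI[where B="{n}"]) auto
  finally show ?thesis by simp
qed

text \<open>The eigenvalue equation of \<open>Lam_w\<close> plus \<open>k\<close> times
  \<open>P0\<close>, divided by the square root of \<open>b\<close> and written for
  \<open>w = ww \<phi>\<close>. The value \<open>k = 0\<close> belongs to the operator whose
  spectrum defines zeta, \<open>k = 1\<close> to the one whose powers are taken.\<close>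

definition frm :: "complex => complex => cfun => cfun" where
  "frm k \<mu> w = (%th. Lam w th + k * fc w 0 * of_real (\<sigma> th) - \<mu> * w th * of_real (\<sigma> th))"

lemma frm_smooth: "smooth_per w ==> smooth_per (frm k \<mu> w)"
  unfolding frm_def by (intro smooth_per_diff smooth_per_add smooth_per_mult smooth_per_const Lam_smooth \<sigma>_smooth)

lemma frm_fc:
  assumes w: "smooth_per w"
  shows "fc (%th. of_real (b th) * frm k \<mu> w th) n = of_int \<bar>n\<bar> * fc w n + mv Km (fc w) n + (if n = 0 then k * fc w 0 else 0) - \<mu> * fc w n"
proof -
  have "(%th. of_real (b th) * frm k \<mu> w th) = (%th. of_real (b th) * Lam w th + (k * fc w 0) * E 0 th - \<mu> * w th)"
  proof
    fix th
    have "of_real (b th) * frm k \<mu> w th = of_real (b th) * Lam w th + k * fc w 0 * (of_real (b th) * of_real (\<sigma> th)) - \<mu> * w th * (of_real (b th) * of_real (\<sigma> th))"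
      unfolding frm_def by (simp add: algebra_simps)
    then show "of_real (b th) * frm k \<mu> w th = of_real (b th) * Lam w th + (k * fc w 0) * E 0 th - \<mu> * w th"
      unfolding b\<sigma> by (simp add: E_0)
  qed
  moreover have c: "continuous_on {0..2*pi} (%th. of_real (b th) * Lam w th)" "continuous_on {0..2*pi} (%th. (k * fc w 0) * E 0 th)"
    "continuous_on {0..2*pi} (%th. \<mu> * w th)"
    by (intro continuous_intros smooth_per_continuous smooth_per_mult b_smooth Lam_smooth w E_smooth)+
  ultimately show ?thesis
    using fc_diff[OF continuous_on_add[OF c(1,2)] c(3)] fc_add[OF c(1,2)]
    by (cases "n = 0") (simp_all add: fc_scale fc_E lam_pair[OF w])
qed

lemma frm_zero_iff:
  assumes w: "smooth_per w"
  shows "(\<forall>th. frm k \<mu> w th = 0) \<longleftrightarrow> (\<forall>n. \<mu> * fc w n = of_int \<bar>n\<bar> * fc w n + (if n = 0 then k * fc w 0 else 0) + mv Km (fc w) n)"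
proof -
  let ?y = "%th. of_real (b th) * frm k \<mu> w th"
  have ys: "smooth_per ?y" by (intro smooth_per_mult b_smooth frm_smooth w)
  have bn: "complex_of_real (b th) \<noteq> 0" for th using b_pos[of th] by simp
  have "(\<forall>th. frm k \<mu> w th = 0) \<longleftrightarrow> ?y = (%_. 0)" using bn by (auto simp: fun_eq_iff)
  also have "... \<longleftrightarrow> (\<forall>n. fc ?y n = 0)"
  proof
    assume "?y = (%_. 0)" then show "\<forall>n. fc ?y n = 0" by (simp only:) (simp add: fc_def)
  next
    assume "\<forall>n. fc ?y n = 0"
    then have "fc ?y = (%_. 0)" by auto
    then have "?y = syn (%_. 0)" using inversion[OF ys] by simp
    then show "?y = (%_. 0)" by (simp add: syn_def)
  qed
  also have "... \<longleftrightarrow> (\<forall>n. \<mu> * fc w n = of_int \<bar>n\<bar> * fc w n + (if n = 0 then k * fc w 0 else 0) + mv Km (fc w) n)"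
    unfolding frm_fc[OF w] by (auto simp: algebra_simps)
  finally show ?thesis .
qed

lemma l2_ri: "l2inner \<phi> (rinvsqrt b) = 2 * pi * fc (ww \<phi>) 0" "l2inner (rinvsqrt b) (rinvsqrt b) = 2 * pi"
proof -
  have w1: "ww (rinvsqrt b) = (%_. 1)" by (auto simp: ww_def mulop_def rq_ri)
  show "l2inner \<phi> (rinvsqrt b) = 2 * pi * fc (ww \<phi>) 0"
    unfolding l2inner_ww w1 fc_def E_0 by simp
  show "l2inner (rinvsqrt b) (rinvsqrt b) = 2 * pi"
    unfolding l2inner_ww w1 using integral_E[of 0] by (simp add: E_0)
qed

lemma P0_eq: "P0 b \<phi> = (%th. fc (ww \<phi>) 0 * rinvsqrt b th)"
  unfolding P0_def l2_ri(2) unfolding l2_ri(1) by simp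

lemma frm_op: "rsqrt b th * frm k \<mu> (ww \<phi>) th = Lam_w b \<phi> th + k * P0 b \<phi> th - \<mu> * \<phi> th"
proof -
  have "rsqrt b th * frm k \<mu> (ww \<phi>) th = rsqrt b th * Lam (ww \<phi>) th + k * fc (ww \<phi>) 0 * (rsqrt b th * of_real (\<sigma> th)) - \<mu> * ((rsqrt b th * of_real (\<sigma> th)) * ww \<phi> th)"
    unfolding frm_def by (simp add: algebra_simps)
  then show ?thesis
    unfolding rq_\<sigma> by (simp add: Lam_w_def mulop_def P0_eq ww_def rq_ri flip: mult.assoc)
qed

lemma eig_iff:
  assumes \<phi>: "smooth_per \<phi>"
  shows "(\<forall>th. Lam_w b \<phi> th + k * P0 b \<phi> th = \<mu> * \<phi> th) \<longleftrightarrow>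
    (\<forall>n. \<mu> * coords \<phi> n = (of_int \<bar>n\<bar> + (if n = 0 then k else 0)) * coords \<phi> n + mv Km (coords \<phi>) n)"
proof -
  have rn: "rsqrt b th \<noteq> 0" for th using rq_ri(1)[of th] by auto
  have "(\<forall>th. Lam_w b \<phi> th + k * P0 b \<phi> th = \<mu> * \<phi> th) \<longleftrightarrow> (\<forall>th. frm k \<mu> (ww \<phi>) th = 0)"
    using frm_op[of _ k \<mu> \<phi>] rn by (metis eq_iff_diff_eq_0 mult_eq_0_iff)
  also have "... \<longleftrightarrow> (\<forall>n. \<mu> * fc (ww \<phi>) n = of_int \<bar>n\<bar> * fc (ww \<phi>) n + (if n = 0 then k * fc (ww \<phi>) 0 else 0) + mv Km (fc (ww \<phi>)) n)"
    by (rule frm_zero_iff[OF ww_smooth[OF \<phi>]])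
  also have "... \<longleftrightarrow> (\<forall>n. \<mu> * coords \<phi> n = (of_int \<bar>n\<bar> + (if n = 0 then k else 0)) * coords \<phi> n + mv Km (coords \<phi>) n)"
  proof -
    let ?r = "complex_of_real (sqrt (2 * pi))"
    have r: "?r \<noteq> 0" by simp
    have "mv Km (coords \<phi>) n = ?r * mv Km (fc (ww \<phi>)) n" for n
      unfolding mv_def coords_def infsum_cmult_right'[symmetric] by (rule infsum_cong) (simp only: mult_ac)
    then have "(\<mu> * coords \<phi> n = (of_int \<bar>n\<bar> + (if n = 0 then k else 0)) * coords \<phi> n + mv Km (coords \<phi>) n) \<longleftrightarrow>
       ?r * (\<mu> * fc (ww \<phi>) n) = ?r * (of_int \<bar>n\<bar> * fc (ww \<phi>) n + (if n = 0 then k * fc (ww \<phi>) 0 else 0) + mv Km (fc (ww \<phi>)) n)" for n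
      by (cases "n = 0") (simp_all only: coords_def distrib_left distrib_right mult_ac if_True if_False mult_zero_right mult_zero_left add_0_right simp_thms)
    then show ?thesis using r by simp
  qed
  finally show ?thesis .
qed

lemma eigenbasis_eigsys:
  assumes "eigenbasis (%h th. Lam_w b h th + P0 b h th) \<phi> \<mu>"
  shows "eigsys dref Km (%j. coords (\<phi> j)) \<mu>"
proof -
  have \<phi>: "smooth_per (\<phi> j)" and on: "l2inner (\<phi> i) (\<phi> j) = (if i = j then 1 else 0)" for i j
    using assms unfolding eigenbasis_def by blast+
  have ev: "\<forall>th. Lam_w b (\<phi> j) th + 1 * P0 b (\<phi> j) th = of_real (\<mu> j) * \<phi> j th" for j
    using assms unfolding eigenbasis_def fun_eq_iff by simp
  show ?thesis unfolding eigsys_def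
  proof (intro conjI allI impI)
    show "rapid_seq (coords (\<phi> j))" for j by (rule coords_rapid[OF \<phi>])
    show "of_real (\<mu> j) * coords (\<phi> j) m = of_real (dref m) * coords (\<phi> j) m + mv Km (coords (\<phi> j)) m" for j m
    proof -
      have "complex_of_real (dref m) = of_int \<bar>m\<bar> + (if m = 0 then 1 else 0)"
        by (auto simp: dref_def max_def abs_int_complex)
      then show ?thesis using eig_iff[where \<phi>="\<phi> j" and k=1 and \<mu>="of_real (\<mu> j)", OF \<phi>] ev[of j] by simp
    qed
    show "sip (coords (\<phi> i)) (coords (\<phi> j)) = (if i = j then 1 else 0)" for i j
      using on[of i j] l2inner_sip[OF \<phi> \<phi>, of i j] by simp
    fix x assume x: "rapid_seq x"
    have "((%k. (cmod (l2inner (uncoords x) (\<phi> k)))\<^sup>2) has_sum Re (l2inner (uncoords x) (uncoords x))) UNIV"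
      using assms uncoords_smooth[OF x] unfolding eigenbasis_def by blast
    then show "((%j. (cmod (sip x (coords (\<phi> j))))\<^sup>2) has_sum Re (sip x x)) UNIV"
      by (simp add: l2inner_sip uncoords_smooth[OF x] \<phi> coords_uncoords[OF x])
  qed
qed

lemma eigsys_eigenbasis:
  assumes "eigsys (%m. \<bar>real_of_int m\<bar>) Km \<Phi> \<mu>"
  shows "eigenbasis (Lam_w b) (%j. uncoords (\<Phi> j)) \<mu>"
proof -
  have \<Phi>: "rapid_seq (\<Phi> j)" for j using assms unfolding eigsys_def by blast
  note bs = uncoords_smooth[OF \<Phi>]
  show ?thesis unfolding eigenbasis_def
  proof (intro conjI allI impI)
    show "smooth_per (uncoords (\<Phi> j))" for j by (rule bs)
    show "Lam_w b (uncoords (\<Phi> j)) = (%th. of_real (\<mu> j) * uncoords (\<Phi> j) th)" for j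
    proof -
      have "\<forall>n. of_real (\<mu> j) * \<Phi> j n = (of_int \<bar>n\<bar> + (if n = 0 then 0 else 0)) * \<Phi> j n + mv Km (\<Phi> j) n"
        using assms unfolding eigsys_def abs_int_complex by simp
      then show ?thesis
        using eig_iff[where \<phi>="uncoords (\<Phi> j)" and k=0 and \<mu>="of_real (\<mu> j)", OF bs] by (simp add: coords_uncoords[OF \<Phi>] fun_eq_iff)
    qed
    show "l2inner (uncoords (\<Phi> i)) (uncoords (\<Phi> j)) = (if i = j then 1 else 0)" for i j
      using assms unfolding eigsys_def by (simp add: l2inner_sip bs coords_uncoords[OF \<Phi>])
    fix f assume f: "smooth_per f"
    then show "((%k. (cmod (l2inner f (uncoords (\<Phi> k))))\<^sup>2) has_sum Re (l2inner f f)) UNIV"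
      using assms coords_rapid[OF f] unfolding eigsys_def by (simp add: l2inner_sip f bs coords_uncoords[OF \<Phi>])
  qed
qed

lemma eigenbasis_exists: "\<exists>\<phi> \<mu>. eigenbasis (Lam_w b) \<phi> \<mu>"
proof -
  interpret lattice_op "%m. \<bar>real_of_int m\<bar>" Km \<kappa>
    by unfold_locales (auto simp: Krapid Km_herm br_def)
  show ?thesis using eigsys_exists eigsys_eigenbasis by blast
qed

end

lemma infsum_dref_powr:
  fixes z :: complex
  assumes "Re z > 1"
  shows "(%n. complex_of_real (dref n) powr (- z)) summable_on UNIV"
    "infsum (%n. complex_of_real (dref n) powr (- z)) UNIV = 1 + 2 * infsum (%n::nat. of_nat n powr (- z)) {1..}"
proof -
  let ?f = "%n. complex_of_real (dref n) powr (- z)"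
  have "norm (?f n) = dref n powr (- Re z)" for n
    using dref_ge_1[of n] by (simp add: norm_powr_real_powr)
  then show s: "?f summable_on UNIV"
    by (intro norm_infsum_le_infsum(1)[OF dref_summable[OF assms]]) simp
  let ?P = "int ` {1..}" and ?N = "(%n. - int n) ` {1..}"
  have U: "UNIV = {0} \<union> (?P \<union> ?N)"
  proof -
    have "n \<in> {0} \<union> (?P \<union> ?N)" for n
    proof (cases n rule: int_cases3)
      case (pos k) then show ?thesis by auto
    next
      case (neg k) then show ?thesis by auto
    qed auto
    then show ?thesis by blast
  qed
  have sub: "?f summable_on A" for A by (rule summable_on_subset_banach[OF s]) simp
  have P: "infsum ?f ?P = infsum (%n::nat. of_nat n powr (- z)) {1..}"
    by (subst infsum_reindex) (auto intro!: infsum_cong simp: dref_def max_def)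
  have N: "infsum ?f ?N = infsum (%n::nat. of_nat n powr (- z)) {1..}"
    by (subst infsum_reindex) (auto intro!: infsum_cong simp: dref_def max_def inj_on_def)
  have "infsum ?f UNIV = infsum ?f {0} + (infsum ?f ?P + infsum ?f ?N)"
  proof -
    have "infsum ?f ({0} \<union> (?P \<union> ?N)) = infsum ?f {0} + infsum ?f (?P \<union> ?N)"
      by (rule infsum_Un_disjoint[OF sub sub]) auto
    also have "infsum ?f (?P \<union> ?N) = infsum ?f ?P + infsum ?f ?N"
      by (rule infsum_Un_disjoint[OF sub sub]) auto
    finally show ?thesis using U by simp
  qed
  then show "infsum ?f UNIV = 1 + 2 * infsum (%n::nat. of_nat n powr (- z)) {1..}"
    unfolding P N by (simp add: dref_def)
qed

section \<open>Kernel, spectral gap and the zeta function of one weight\<close>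

lemma entire_eqI:
  assumes "f holomorphic_on UNIV" "g holomorphic_on UNIV" "!!z. Re z > 1 ==> f z = g z"
  shows "f z = g z"
  by (rule analytic_continuation_open[of "{z. Re z > 1}" UNIV f g])
     (use assms in \<open>auto simp: open_halfspace_Re_gt intro!: exI[of _ 2]\<close>)

context wcoord
begin

lemma lam_quad:
  assumes w: "smooth_per w"
  shows "((%p. \<bar>real_of_int p\<bar> * (norm (fcoeff w p))\<^sup>2) has_sum Re (l2inner (Lam w) w) / (2 * pi)) UNIV"
proof -
  have "((%p. of_int \<bar>p\<bar> * fcoeff w p * cnj (fcoeff w p)) has_sum (l2inner (Lam w) w / (2 * pi))) UNIV"
    using parseval_id[OF Lam_smooth[OF w] smooth_per_continuous[OF w]] by (simp add: fcoeff_Lam[OF w])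
  moreover have "of_int \<bar>p\<bar> * fcoeff w p * cnj (fcoeff w p) = complex_of_real (\<bar>real_of_int p\<bar> * (norm (fcoeff w p))\<^sup>2)" for p
    unfolding of_real_mult complex_norm_square abs_int_complex by simp
  ultimately have "((%p. complex_of_real (\<bar>real_of_int p\<bar> * (norm (fcoeff w p))\<^sup>2)) has_sum (l2inner (Lam w) w / (2 * pi))) UNIV"
    by (simp only:)
  from has_sum_Re[OF this] show ?thesis by (simp add: Re_divide_of_real flip: of_real_mult)
qed

lemma Lam_w_inner: "l2inner (Lam_w b \<phi>) \<psi> = l2inner (Lam (ww \<phi>)) (ww \<psi>)"
  unfolding l2inner_def Lam_w_def ww_def mulop_def by (simp add: cnj_rq mult_ac)

lemma Lam_mean: "smooth_per w ==> l2inner (Lam w) (%_. 1) = 0"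
  using fcoeff_Lam[of w 0] by (simp add: l2inner_def fcoeff_def)

lemma ww_ri: "ww (rinvsqrt b) = (%_. 1)"
  by (auto simp: ww_def mulop_def rq_ri)

lemma Lam_w_ri: "smooth_per \<phi> ==> l2inner (Lam_w b \<phi>) (rinvsqrt b) = 0"
  by (simp add: Lam_w_inner ww_ri Lam_mean ww_smooth)

lemma l2inner_scale: "l2inner (%th. q * \<phi> th) \<psi> = q * l2inner \<phi> \<psi>"
  by (simp add: l2inner_def mult.assoc)

context
  fixes \<phi> :: cfun and l :: real
  assumes \<phi>: "smooth_per \<phi>" and ev: "Lam_w b \<phi> = (%th. of_real l * \<phi> th)" and n1: "l2inner \<phi> \<phi> = 1"
begin

lemma ev_sum: "((%p. \<bar>real_of_int p\<bar> * (norm (fcoeff (ww \<phi>) p))\<^sup>2) has_sum l / (2 * pi)) UNIV"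
proof -
  have "l2inner (Lam (ww \<phi>)) (ww \<phi>) = of_real l"
    using Lam_w_inner[of \<phi> \<phi>] unfolding ev l2inner_scale n1 by simp
  then show ?thesis using lam_quad[OF ww_smooth[OF \<phi>]] by simp
qed

lemma ev_nonneg: "l \<ge> 0"
  using has_sum_nonneg[OF ev_sum] pi_gt_zero by (auto simp: zero_le_divide_iff)

lemma ev_nonzero: "l \<noteq> 0 ==> fc (ww \<phi>) 0 = 0"
proof -
  assume l: "l \<noteq> 0"
  have "of_real l * l2inner \<phi> (rinvsqrt b) = 0"
    using Lam_w_ri[OF \<phi>] unfolding ev l2inner_scale .
  then show ?thesis using l by (simp add: l2_ri)
qed

text \<open>Zero energy kills every ordinary Fourier coefficient of \<open>ww \<phi>\<close> except
  the mean, so \<open>ww \<phi>\<close> is constant.\<close>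

lemma ev_zero: "l = 0 ==> \<phi> = (%th. fcoeff (ww \<phi>) 0 * rinvsqrt b th)"
proof -
  assume l: "l = 0"
  have "\<bar>real_of_int p\<bar> * (norm (fcoeff (ww \<phi>) p))\<^sup>2 = 0" for p
    using nonneg_has_sum_le_0D[OF ev_sum, of p] l by simp
  then have z: "fcoeff (ww \<phi>) p = 0" if "p \<noteq> 0" for p using that by (metis abs_eq_0 mult_eq_0_iff of_int_eq_0_iff power_eq_0_iff norm_eq_zero)
  have "ww \<phi> th = fcoeff (ww \<phi>) 0" for th
  proof -
    have "((%n. fcoeff (ww \<phi>) n * idc.E n th) has_sum ww \<phi> th) UNIV"
      using idc.inversion_has_sum[OF ww_smooth[OF \<phi>], of th] by (simp add: idc_fc)
    moreover have "((%n. fcoeff (ww \<phi>) n * idc.E n th) has_sum fcoeff (ww \<phi>) 0) UNIV"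
      by (rule has_sum_finite_neutralI[where B="{0}"]) (auto simp: z idc.E_0)
    ultimately show ?thesis by (rule has_sum_unique)
  qed
  then show ?thesis using \<phi>_ww[of \<phi>] by (simp add: fun_eq_iff mult.commute)
qed

lemma ev_P0: "P0 b \<phi> = (if l = 0 then \<phi> else (%_. 0))"
proof (cases "l = 0")
  case True
  let ?c = "fcoeff (ww \<phi>) 0"
  have "ww \<phi> = (%th. ?c * 1)"
  proof
    fix th
    have "ww \<phi> th = rsqrt b th * \<phi> th" by (simp add: ww_def mulop_def)
    also have "... = rsqrt b th * (?c * rinvsqrt b th)" using fun_cong[OF ev_zero[OF True], of th] by simp
    finally show "ww \<phi> th = ?c * 1" using rq_ri(1)[of th] by (simp add: mult.left_commute)
  qed
  then have "ww \<phi> = (%th. ?c * E 0 th)" by (simp add: E_0)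
  then have "fc (ww \<phi>) 0 = ?c * fc (E 0) 0" using fc_scale[of ?c "E 0" 0] by simp
  then have "fc (ww \<phi>) 0 = ?c" by (simp add: fc_E)
  then have "P0 b \<phi> = (%th. ?c * rinvsqrt b th)" by (simp add: P0_eq)
  then show ?thesis using ev_zero[OF True] True by simp
next
  case False
  then show ?thesis by (simp add: P0_eq ev_nonzero)
qed

text \<open>A Poincare inequality with explicit constant, so that the gap is uniform over a family.
  \<open>v\<close> is \<open>ww \<phi>\<close> minus its plain mean. Since \<open>ww \<phi>\<close>
  has mean zero for the density \<open>\<sigma>\<close>, this subtraction cannot decrease its norm
  there; that norm squared is at most \<open>C\<close> times the plain one, in which every nonzero
  mode has energy at least its mass.\<close>

lemma ev_lower:
  assumes f0: "fc (ww \<phi>) 0 = 0" and C: "!!th. \<sigma> th <= C" "C > 0"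
  shows "l \<ge> 1 / C"
proof -
  let ?w = "ww \<phi>" and ?c = "fcoeff (ww \<phi>) 0"
  define v where "v = (%th. ?w th - ?c * E 0 th)"
  note ws = ww_smooth[OF \<phi>]
  have vs: "smooth_per v" unfolding v_def by (intro smooth_per_diff smooth_per_scale ws E_smooth)
  have fv: "fc v n = fc ?w n - (if n = 0 then ?c else 0)" for n
    unfolding v_def by (subst fc_diff) (auto intro!: smooth_per_continuous smooth_per_scale ws E_smooth simp: fc_scale fc_E)
  have fcv: "fcoeff v p = (if p = 0 then 0 else fcoeff ?w p)" for p
  proof -
    have "E 0 = idc.E 0" by (auto simp: E_0 idc.E_0)
    then have "idc.fc v p = idc.fc ?w p - ?c * (if 0 = p then 1 else 0)"
      unfolding v_def by (subst idc.fc_diff) (auto intro!: smooth_per_continuous smooth_per_scale ws idc.E_smooth simp: idc.fc_scale idc.fc_E)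
    then show ?thesis by (auto simp: idc_fc)
  qed
  have "integral {0..2*pi} (%th. (norm (?w th))\<^sup>2 * \<sigma> th) / (2 * pi) <= integral {0..2*pi} (%th. (norm (v th))\<^sup>2 * \<sigma> th) / (2 * pi)"
    by (rule has_sum_mono[OF parseval_sq[OF ws] parseval_sq[OF vs]]) (auto simp: fv f0)
  moreover have "integral {0..2*pi} (%th. (norm (?w th))\<^sup>2 * \<sigma> th) = 1"
  proof -
    have "1 = integral {0..2*pi} (%th. complex_of_real ((norm (?w th))\<^sup>2 * \<sigma> th))"
      using n1 unfolding l2inner_ww of_real_mult complex_norm_square by simp
    also have "... = of_real (integral {0..2*pi} (%th. (norm (?w th))\<^sup>2 * \<sigma> th))"
      by (rule integral_complex_of_real, intro integrable_continuous_interval continuous_intros smooth_per_continuous ws \<sigma>_real_cont)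
    finally show ?thesis by (metis of_real_eq_1_iff)
  qed
  moreover have "integral {0..2*pi} (%th. (norm (v th))\<^sup>2 * \<sigma> th) <= integral {0..2*pi} (%th. C * ((norm (v th))\<^sup>2 * 1))"
  proof (rule integral_le)
    show "(%th. (norm (v th))\<^sup>2 * \<sigma> th) integrable_on {0..2*pi}" "(%th. C * ((norm (v th))\<^sup>2 * 1)) integrable_on {0..2*pi}"
      by (intro integrable_continuous_interval continuous_intros smooth_per_continuous vs \<sigma>_real_cont)+
    show "(norm (v th))\<^sup>2 * \<sigma> th <= C * ((norm (v th))\<^sup>2 * 1)" for th
      using mult_left_mono[OF C(1)[of th], of "(norm (v th))\<^sup>2"] by (simp add: mult.commute)
  qed
  moreover have "integral {0..2*pi} (%th. C * ((norm (v th))\<^sup>2 * 1)) = C * integral {0..2*pi} (%th. (norm (v th))\<^sup>2 * 1)"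
    by (rule integral_mult_right)
  moreover have "integral {0..2*pi} (%th. (norm (v th))\<^sup>2 * 1) / (2 * pi) <= l / (2 * pi)"
  proof (rule has_sum_mono[OF idc.parseval_sq[OF vs] ev_sum])
    fix p :: int
    have "1 <= \<bar>real_of_int p\<bar>" if "p \<noteq> 0" using that by linarith
    then show "(norm (idc.fc v p))\<^sup>2 <= \<bar>real_of_int p\<bar> * (norm (fcoeff ?w p))\<^sup>2"
      using mult_right_mono[of 1 "\<bar>real_of_int p\<bar>" "(norm (fcoeff ?w p))\<^sup>2"] by (auto simp: idc_fc fcv)
  qed
  then have "integral {0..2*pi} (%th. (norm (v th))\<^sup>2 * 1) <= l" by (simp add: divide_le_cancel)
  then have "C * integral {0..2*pi} (%th. (norm (v th))\<^sup>2 * 1) <= C * l" using C by (intro mult_left_mono) auto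
  ultimately have "1 <= C * l" by (simp add: divide_le_cancel)
  then show ?thesis using C by (simp add: field_simps)
qed

end

text \<open>\<open>Lam\<close> maps into functions of mean zero, so integrating the equation
  isolates the zero mode, which vanishes unless \<open>\<nu>\<close> is 1. In both cases the
  \<open>P0\<close> term can be given the factor \<open>\<nu>\<close>, which leads to the second
  formula.\<close>

lemma P0_eig:
  assumes \<psi>: "smooth_per \<psi>" and ev: "(%th. Lam_w b \<psi> th + P0 b \<psi> th) = (%th. of_real \<nu> * \<psi> th)"
  shows "of_real \<nu> * fc (ww \<psi>) 0 = fc (ww \<psi>) 0"
    "Lam (ww \<psi>) th = of_real \<nu> * ((ww \<psi> th - fc (ww \<psi>) 0) * of_real (\<sigma> th))"
proof -
  let ?w = "ww \<psi>"
  have "\<forall>th. Lam_w b \<psi> th + 1 * P0 b \<psi> th = of_real \<nu> * \<psi> th" using ev by (simp add: fun_eq_iff)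
  then have z: "frm 1 (of_real \<nu>) ?w th = 0" for th
    using frm_op[of th 1 "of_real \<nu>" \<psi>] rq_ri(2)[of th] by auto
  have L: "Lam ?w th = of_real \<nu> * (?w th * of_real (\<sigma> th)) - fc ?w 0 * of_real (\<sigma> th)" for th
    using z[of th] by (simp add: frm_def algebra_simps add_eq_0_iff2)
  have "0 = l2inner (Lam ?w) (%_. 1)" using Lam_mean[OF ww_smooth[OF \<psi>]] by simp
  also have "... = integral {0..2*pi} (%th. of_real \<nu> * (?w th * of_real (\<sigma> th)) - fc ?w 0 * of_real (\<sigma> th))"
    unfolding l2inner_def by (simp add: L)
  also have "... = of_real \<nu> * integral {0..2*pi} (%th. ?w th * of_real (\<sigma> th)) - fc ?w 0 * integral {0..2*pi} (%th. of_real (\<sigma> th))"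
    by (subst integral_diff) (auto intro!: smooth_per_integrable smooth_per_scale smooth_per_mult ww_smooth \<psi> \<sigma>_smooth)
  also have "... = of_real \<nu> * (2 * pi * fc ?w 0) - fc ?w 0 * (2 * pi)"
    using integral_E[of 0] by (simp add: fc_def E_0)
  finally show 1: "of_real \<nu> * fc ?w 0 = fc ?w 0" by simp
  show "Lam ?w th = of_real \<nu> * ((?w th - fc ?w 0) * of_real (\<sigma> th))"
    unfolding L using arg_cong[OF 1, of "%z. z * of_real (\<sigma> th)"] by (simp add: algebra_simps)
qed

lemma P0_eig_lower:
  assumes \<psi>: "smooth_per \<psi>" and ev: "(%th. Lam_w b \<psi> th + P0 b \<psi> th) = (%th. of_real \<nu> * \<psi> th)"
    and n1: "l2inner \<psi> \<psi> = 1" and C: "!!th. \<sigma> th <= C" "C > 0"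
  shows "\<nu> \<ge> min 1 (1 / C)"
proof (cases "fc (ww \<psi>) 0 = 0")
  case True
  then have "Lam_w b \<psi> = (%th. of_real \<nu> * \<psi> th)" using ev by (simp add: P0_eq)
  from ev_lower[OF \<psi> this n1 True C] show ?thesis by simp
next
  case False
  then have "complex_of_real \<nu> = 1" using P0_eig(1)[OF \<psi> ev] by simp
  then show ?thesis by simp
qed

text \<open>Without a zero eigenvalue \<open>rinvsqrt b\<close> would be orthogonal to a complete
  system; with two there would be two orthonormal multiples of it. On eigenfunctions
  \<open>P0\<close> is the identity or 0, so adding it only turns the eigenvalue 0 into 1.\<close>

lemma eigenbasis_P0:
  assumes "eigenbasis (Lam_w b) \<phi> l"
  shows "eigenbasis (%h th. Lam_w b h th + P0 b h th) \<phi> (%j. if l j = 0 then 1 else l j)"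
    and "\<exists>!j. l j = 0" and "!!j. l j \<ge> 0"
proof -
  have \<phi>: "smooth_per (\<phi> j)" and ev: "Lam_w b (\<phi> j) = (%th. of_real (l j) * \<phi> j th)"
    and on: "l2inner (\<phi> i) (\<phi> j) = (if i = j then 1 else 0)" for i j
    using assms unfolding eigenbasis_def by blast+
  have n1: "l2inner (\<phi> j) (\<phi> j) = 1" for j using on[of j j] by simp
  show "l j \<ge> 0" for j by (rule ev_nonneg[OF \<phi> ev n1])
  have "(%th. Lam_w b (\<phi> j) th + P0 b (\<phi> j) th) = (%th. of_real (if l j = 0 then 1 else l j) * \<phi> j th)" for j
    unfolding ev ev_P0[OF \<phi> ev n1] by auto
  then show "eigenbasis (%h th. Lam_w b h th + P0 b h th) \<phi> (%j. if l j = 0 then 1 else l j)"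
    using assms unfolding eigenbasis_def by blast
  show "\<exists>!j. l j = 0"
  proof (rule ex_ex1I)
    show "\<exists>j. l j = 0"
    proof (rule ccontr)
      assume "\<nexists>j. l j = 0"
      then have "l2inner (\<phi> j) (rinvsqrt b) = 0" for j
        using ev_nonzero[OF \<phi> ev n1, of j] by (simp add: l2_ri)
      then have "l2inner (rinvsqrt b) (\<phi> j) = 0" for j
        by (simp add: l2inner_sip[OF ri_smooth \<phi>] l2inner_sip[OF \<phi> ri_smooth]) (subst sip_cnj, simp)
      moreover have "((%k. (cmod (l2inner (rinvsqrt b) (\<phi> k)))\<^sup>2) has_sum Re (l2inner (rinvsqrt b) (rinvsqrt b))) UNIV"
        using assms ri_smooth unfolding eigenbasis_def by blast
      ultimately have "((%k::nat. 0) has_sum (2 * pi)) UNIV" by (simp add: l2_ri(2))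
      then show False using has_sum_unique[of "%k::nat. 0" UNIV "2 * pi" 0] by simp
    qed
    fix i j assume z: "l i = 0" "l j = 0"
    show "i = j"
    proof (rule ccontr)
      assume ij: "i \<noteq> j"
      let ?ci = "fcoeff (ww (\<phi> i)) 0" and ?cj = "fcoeff (ww (\<phi> j)) 0"
      note ei = ev_zero[OF \<phi> ev n1 z(1)] and ej = ev_zero[OF \<phi> ev n1 z(2)]
      have li: "l2inner (\<phi> i) h = ?ci * l2inner (rinvsqrt b) h" for h
        by (subst (1) ei) (rule l2inner_scale)
      have lj: "l2inner h (\<phi> j) = cnj ?cj * l2inner h (rinvsqrt b)" for h
        by (subst (1) ej) (simp add: l2inner_def mult_ac flip: integral_mult_right)
      have "?ci * (cnj ?cj * (2 * pi)) = 0" using on[of i j] ij unfolding li lj l2_ri(2) by auto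
      moreover have "?ci \<noteq> 0" using n1[of i] li[of "\<phi> i"] by auto
      moreover have "?cj \<noteq> 0" using n1[of j] lj[of "\<phi> j"] by auto
      ultimately show False by simp
    qed
  qed
qed

text \<open>The definite description in \<open>zeta_minus_2R\<close> is resolved by
  \<open>SP.G\<close> for the pair \<open>\<mu>\<close>, \<open>dref\<close>; uniqueness is analytic
  continuation. The kernel index \<open>j0\<close> contributes 1 to the sum over
  \<open>\<mu>\<close> and the zero mode 1 to that over \<open>dref\<close>, and these
  cancel.\<close>

theorem zeta_wcoord:
  obtains \<Phi> :: "nat => int => complex" and \<mu> :: "nat => real" where "eigsys dref Km \<Phi> \<mu>"
    "!!C j. (!!th. \<sigma> th <= C) ==> C > 0 ==> \<mu> j \<ge> min 1 (1 / C)"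
    "zeta_minus_2R b holomorphic_on UNIV"
    "!!z. Re z > 1 ==> (%j. \<mu> j powr (- Re z)) summable_on UNIV"
    "!!z. Re z > 1 ==> zeta_minus_2R b z = infsum (%j. complex_of_real (\<mu> j) powr (- z)) UNIV
       - infsum (%n. complex_of_real (dref n) powr (- z)) UNIV"
proof -
  define \<phi> where "\<phi> = fst (steklov_ev b)"
  define l where "l = snd (steklov_ev b)"
  have eb: "eigenbasis (Lam_w b) \<phi> l"
  proof -
    obtain \<phi>' l' where "eigenbasis (Lam_w b) \<phi>' l'" using eigenbasis_exists by blast
    then have "eigenbasis (Lam_w b) (fst (\<phi>', l')) (snd (\<phi>', l'))" by simp
    then show ?thesis unfolding \<phi>_def l_def steklov_ev_def by (rule someI)
  qed
  define \<mu> where "\<mu> = (%j. if l j = 0 then 1 else l j)"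
  note ebP = eigenbasis_P0[OF eb, folded \<mu>_def]
  note es = eigenbasis_eigsys[OF ebP(1)]
  have low: "\<mu> j \<ge> min 1 (1 / C)" if C: "!!th. \<sigma> th <= C" "C > 0" for C j
  proof -
    have "smooth_per (\<phi> j)" "(%th. Lam_w b (\<phi> j) th + P0 b (\<phi> j) th) = (%th. of_real (\<mu> j) * \<phi> j th)" "l2inner (\<phi> j) (\<phi> j) = 1"
      using ebP(1) unfolding eigenbasis_def by auto
    from P0_eig_lower[OF this C] show ?thesis .
  qed
  obtain C where C: "!!th. \<sigma> th <= C" "C > 0" using \<sigma>_bdd by blast
  define \<delta> where "\<delta> = min 1 (1 / C)"
  have \<delta>: "0 < \<delta>" "\<delta> <= 1" using C by (auto simp: \<delta>_def)
  have D: "rapid_mat \<kappa> (%m n. Km m n - (%_ _. 0) m n)" using Krapid by simp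
  have lo1: "\<delta> <= \<mu> j" for j unfolding \<delta>_def by (rule low[OF C])
  have lo2: "\<delta> <= dref m" for m using \<delta>(2) dref_ge_1 by (rule order_trans)
  interpret SP: spectral_pair \<mu> dref "%j k. sip (unit_seq k) (coords (\<phi> j))" \<delta>
    by (rule eigsys_spectral_pair(1)[OF es Krapid Km_herm eigsys_ref rapid_mat_0 dref_le_br D \<delta> lo1 lo2 dref_summable_sq])
  have sum: "(%j. \<mu> j powr (- Re z)) summable_on UNIV"
    "infsum (%j. complex_of_real (\<mu> j) powr (- z)) UNIV - infsum (%n. complex_of_real (dref n) powr (- z)) UNIV = SP.G z"
    if "Re z > 1" for z
    using SP.summable_powr[of z] dref_summable[OF that] by auto
  obtain j0 where j0: "l j0 = 0" and uniq: "!!j. l j = 0 ==> j = j0" using ebP(2) by blast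
  have val: "infsum (%j. complex_of_real (l j) powr (- z)) {j. l j > 0} - 2 * infsum (%n::nat. of_nat n powr (- z)) {1..} = SP.G z"
    if z: "Re z > 1" for z
  proof -
    let ?f = "%j. complex_of_real (\<mu> j) powr (- z)"
    have "(%j. norm (?f j)) summable_on UNIV"
      using sum(1)[OF z] SP.\<mu>_pos by (simp add: norm_powr_real_powr less_imp_le)
    then have fs: "?f summable_on UNIV" by (rule abs_summable_summable)
    have set: "{j. l j > 0} = UNIV - {j0}"
    proof (intro set_eqI)
      fix j show "j \<in> {j. l j > 0} \<longleftrightarrow> j \<in> UNIV - {j0}" using j0 uniq[of j] ebP(3)[of j] by (cases "j = j0") (auto simp: less_le)
    qed
    have "infsum ?f UNIV = infsum ?f {j0} + infsum ?f (UNIV - {j0})"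
    proof -
      have "infsum ?f ({j0} \<union> (UNIV - {j0})) = infsum ?f {j0} + infsum ?f (UNIV - {j0})"
        by (rule infsum_Un_disjoint) (auto intro: summable_on_subset_banach[OF fs])
      then show ?thesis by simp
    qed
    also have "infsum ?f {j0} = 1" using j0 by (simp add: \<mu>_def)
    also have "infsum ?f (UNIV - {j0}) = infsum (%j. complex_of_real (l j) powr (- z)) {j. l j > 0}"
      unfolding set[symmetric] by (rule infsum_cong) (simp add: \<mu>_def)
    finally show ?thesis using sum(2)[OF z] infsum_dref_powr(2)[OF z] by simp
  qed
  have zeta: "zeta_minus_2R b = SP.G"
    unfolding zeta_minus_2R_def
  proof (rule the_equality)
    show "SP.G holomorphic_on UNIV \<and> (\<forall>z. 1 < Re z \<longrightarrow> SP.G z = infsum (%j. complex_of_real (snd (steklov_ev b) j) powr (- z))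
                     {j. snd (steklov_ev b) j > 0} - 2 * infsum (%n::nat. of_nat n powr (- z)) {1..})"
      using SP.G_holomorphic val unfolding l_def by simp
    fix F :: "complex => complex"
    assume F: "F holomorphic_on UNIV \<and> (\<forall>z. 1 < Re z \<longrightarrow> F z = infsum (%j. complex_of_real (snd (steklov_ev b) j) powr (- z))
                     {j. snd (steklov_ev b) j > 0} - 2 * infsum (%n::nat. of_nat n powr (- z)) {1..})"
    show "F = SP.G"
      by (rule ext, rule entire_eqI[OF _ SP.G_holomorphic]) (use F val in \<open>auto simp: l_def\<close>)
  qed
  show ?thesis
  proof (rule that[OF es])
    show "min 1 (1 / C) <= \<mu> j" if "!!th. \<sigma> th <= C" "0 < C" for C j using that by (rule low)
    show "zeta_minus_2R b holomorphic_on UNIV" unfolding zeta by (rule SP.G_holomorphic)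
    show "(%j. \<mu> j powr - Re z) summable_on UNIV" if "1 < Re z" for z by (rule sum(1)[OF that])
    show "zeta_minus_2R b z = infsum (%j. complex_of_real (\<mu> j) powr (- z)) UNIV
       - infsum (%n. complex_of_real (dref n) powr (- z)) UNIV" if "1 < Re z" for z
      unfolding zeta by (rule sum(2)[OF that, symmetric])
  qed
qed

end

section \<open>The Hilbert transform, its commutators and multiplier identities\<close>

lemma has_sum_minus:
  fixes f g :: "'a => 'b::real_normed_vector"
  assumes "(f has_sum x) A" "(g has_sum y) A"
  shows "((%i. f i - g i) has_sum (x - y)) A"
  using has_sum_add[OF assms(1), of "%i. - g i" "- y"] assms(2) by (simp add: has_sum_uminus)

lemma has_sum_zeroD:
  fixes f :: "'a => 'b::real_normed_vector"
  assumes "(f has_sum x) A" "!!i. f i = 0"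
  shows "x = 0"
  using assms(1) has_sum_0[of A f] assms(2) has_sum_unique by blast

lemma Hilb_syn: "Hilb f = idc.syn (%n. of_int (sgn n) * fcoeff f n)"
  by (simp add: Hilb_def idc.syn_def idc_E)

lemma sgn_fcoeff_rapid: "smooth_per f ==> rapid_seq (%n. of_int (sgn n) * fcoeff f n)"
  by (rule rapid_seq_poly_mult[where C=1 and N=0]) (auto simp: fcoeff_rapid sgn_if)

lemma Hilb_smooth: "smooth_per f ==> smooth_per (Hilb f)"
  unfolding Hilb_syn by (rule idc.syn_smooth[OF sgn_fcoeff_rapid])

lemma fcoeff_Hilb: "smooth_per f ==> fcoeff (Hilb f) n = of_int (sgn n) * fcoeff f n"
  unfolding Hilb_syn using idc.fc_syn[OF sgn_fcoeff_rapid] by (simp add: idc_fc)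

lemma Dop_vder: "Dop f = (%th. - \<i> * vder f th)"
  by (simp add: Dop_def vder_def)

lemma Dop_smooth: "smooth_per f ==> smooth_per (Dop f)"
  unfolding Dop_vder by (rule smooth_per_scale[OF smooth_per_vder])

lemma fcoeff_Dop: "smooth_per f ==> fcoeff (Dop f) n = of_int n * fcoeff f n"
proof -
  assume f: "smooth_per f"
  have "idc.fc (Dop f) n = - \<i> * idc.fc (vder f) n" unfolding Dop_vder by (rule idc.fc_scale)
  also have "idc.fc (vder f) n = \<i> * of_int n * idc.fc f n" using idc.fc_by_parts[OF f, of n] by simp
  finally show ?thesis by (simp add: idc_fc mult.assoc[symmetric])
qed

lemma fcoeff_eqI:
  assumes "smooth_per f" "smooth_per h" "!!n. fcoeff f n = fcoeff h n"
  shows "f = h"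
proof -
  have "idc.fc f = idc.fc h" using assms(3) by (simp add: idc_fc fun_eq_iff)
  then have "idc.syn (idc.fc f) = idc.syn (idc.fc h)" by (rule arg_cong)
  then show ?thesis unfolding idc.inversion[OF assms(1)] idc.inversion[OF assms(2)] .
qed

lemma Dop_Hilb_Lam: "smooth_per f ==> Dop f = Hilb (Lam f)"
proof (rule fcoeff_eqI)
  assume f: "smooth_per f"
  have "complex_of_int (sgn n) * of_int \<bar>n\<bar> = of_int n" for n by (metis mult_sgn_abs of_int_mult)
  then show "fcoeff (Dop f) n = fcoeff (Hilb (Lam f)) n" for n
    by (simp only: fcoeff_Dop[OF f] fcoeff_Hilb[OF Lam_smooth[OF f]] fcoeff_Lam[OF f] mult.assoc[symmetric])
qed (auto intro: Dop_smooth Hilb_smooth Lam_smooth)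

lemma Hilb_Hilb: "smooth_per v ==> fcoeff v 0 = 0 ==> Hilb (Hilb v) = v"
proof (rule fcoeff_eqI)
  assume v: "smooth_per v" "fcoeff v 0 = 0"
  then show "fcoeff (Hilb (Hilb v)) n = fcoeff v n" for n
    by (cases "n = 0") (auto simp: fcoeff_Hilb Hilb_smooth sgn_if)
qed (auto intro: Hilb_smooth)

lemma multiplier_sym:
  assumes "smooth_per f" "smooth_per h" "smooth_per F" "smooth_per H"
    and "!!p. fcoeff F p = of_int (l p) * fcoeff f p" "!!p. fcoeff H p = of_int (l p) * fcoeff h p"
  shows "l2inner F h = l2inner f H"
proof -
  have "((%n. fcoeff F n * cnj (fcoeff h n)) has_sum (l2inner F h / (2 * pi))) UNIV"
    by (rule parseval_id[OF assms(3) smooth_per_continuous[OF assms(2)]])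
  moreover have "((%n. fcoeff f n * cnj (fcoeff H n)) has_sum (l2inner f H / (2 * pi))) UNIV"
    by (rule parseval_id[OF assms(1) smooth_per_continuous[OF assms(4)]])
  moreover have "fcoeff f n * cnj (fcoeff H n) = fcoeff F n * cnj (fcoeff h n)" for n
    by (simp add: assms(5,6))
  ultimately have "l2inner F h / (2 * pi) = l2inner f H / (2 * pi)"
    using has_sum_unique by fastforce
  then show ?thesis by simp
qed

lemma Hilb_sym: "smooth_per f ==> smooth_per h ==> l2inner (Hilb f) h = l2inner f (Hilb h)"
  by (rule multiplier_sym[where l=sgn]) (simp_all add: Hilb_smooth fcoeff_Hilb)

lemma Lam_sym: "smooth_per f ==> smooth_per h ==> l2inner (Lam f) h = l2inner f (Lam h)"
  by (rule multiplier_sym[where l=abs]) (simp_all add: Lam_smooth fcoeff_Lam)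

lemma Dop_sym: "smooth_per f ==> smooth_per h ==> l2inner (Dop f) h = l2inner f (Dop h)"
  by (rule multiplier_sym[where l="%n. n"]) (simp_all add: Dop_smooth fcoeff_Dop)

lemma l2_integrable: "smooth_per f ==> smooth_per h ==> (%th. f th * cnj (h th)) integrable_on {0..2*pi}"
  by (intro smooth_per_integrable smooth_per_mult smooth_per_cnj)

lemma l2inner_diff_left:
  "smooth_per f ==> smooth_per f' ==> smooth_per h ==> l2inner (%th. f th - f' th) h = l2inner f h - l2inner f' h"
  unfolding l2inner_def using integral_diff[OF l2_integrable l2_integrable, of f h f' h] by (simp add: left_diff_distrib)

lemma l2inner_diff_right:
  "smooth_per f ==> smooth_per h ==> smooth_per h' ==> l2inner f (%th. h th - h' th) = l2inner f h - l2inner f h'"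
  unfolding l2inner_def using integral_diff[OF l2_integrable l2_integrable, of f h f h'] by (simp add: right_diff_distrib)

lemma l2inner_scale_left: "l2inner (%th. q * f th) h = q * l2inner f h"
  by (simp add: l2inner_def mult.assoc)

lemma l2inner_scale_right: "l2inner f (%th. q * h th) = cnj q * l2inner f h"
  by (simp add: l2inner_def mult_ac flip: integral_mult_right)

lemma l2inner_mulop_real: "l2inner (mulop (%t. complex_of_real (g t)) f) h = l2inner f (mulop (%t. complex_of_real (g t)) h)"
  by (simp add: l2inner_def mulop_def mult_ac)

lemma smooth_mulop: "smooth_per g ==> smooth_per f ==> smooth_per (mulop g f)"
  unfolding mulop_def by (rule smooth_per_mult)

definition Hcomm :: "(real => real) => cfun => cfun" where
  "Hcomm g v = (%th. Hilb (mulop (%t. complex_of_real (g t)) v) th - mulop (%t. complex_of_real (g t)) (Hilb v) th)"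

lemma Hcomm_smooth: "smooth_per (%t. complex_of_real (g t)) ==> smooth_per v ==> smooth_per (Hcomm g v)"
  unfolding Hcomm_def by (intro smooth_per_diff Hilb_smooth smooth_mulop)

text \<open>\<open>Hilb\<close> and multiplication by a real function are both symmetric, so their
  commutator is skew.\<close>

lemma Hcomm_adj:
  assumes g: "smooth_per (%t. complex_of_real (g t))" and f: "smooth_per f" and h: "smooth_per h"
  shows "l2inner (Hcomm g f) h = - l2inner f (Hcomm g h)"
  unfolding Hcomm_def
  by (simp add: l2inner_diff_left l2inner_diff_right Hilb_smooth smooth_mulop g f h Hilb_sym l2inner_mulop_real)

text \<open>On functions of mean zero the Hilbert transform is an involution, so conjugation by it
  exchanges the two products in the commutator. This sign turns \<open>- \<i>\<close> into
  \<open>\<i>\<close> in \<open>Ld_diag\<close>.\<close>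

lemma Hcomm_Hilb:
  assumes g: "smooth_per (%t. complex_of_real (g t))" and v: "smooth_per v" "fcoeff v 0 = 0"
  shows "l2inner (Hcomm g (Hilb v)) (Hilb v) = - l2inner (Hcomm g v) v"
proof -
  let ?g = "mulop (%t. complex_of_real (g t))"
  note s = Hilb_smooth smooth_mulop g v(1)
  have "l2inner (Hcomm g (Hilb v)) (Hilb v) = l2inner (Hilb (?g (Hilb v))) (Hilb v) - l2inner (?g v) (Hilb v)"
    unfolding Hcomm_def Hilb_Hilb[OF v] by (rule l2inner_diff_left) (intro s)+
  also have "l2inner (Hilb (?g (Hilb v))) (Hilb v) = l2inner (?g (Hilb v)) v"
    using Hilb_sym[of "?g (Hilb v)" "Hilb v"] by (simp add: Hilb_Hilb[OF v] s)
  also have "l2inner (?g v) (Hilb v) = l2inner (Hilb (?g v)) v"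
    by (rule Hilb_sym[symmetric]) (intro s)+
  also have "l2inner (?g (Hilb v)) v - l2inner (Hilb (?g v)) v = - l2inner (Hcomm g v) v"
    unfolding Hcomm_def by (subst l2inner_diff_left) (auto intro: s)
  finally show ?thesis .
qed

text \<open>Parseval for \<open>h\<close> against the conjugate of \<open>f\<close> times an
  exponential, which shifts the frequencies of \<open>f\<close> and so produces the
  convolution.\<close>

lemma fcoeff_mult:
  assumes f: "smooth_per f" and h: "smooth_per h"
  shows "((%q. fcoeff f (p - q) * fcoeff h q) has_sum fcoeff (%th. f th * h th) p) UNIV"
proof -
  let ?y = "%th. cnj (f th) * idc.E p th"
  have y: "smooth_per ?y" by (intro smooth_per_mult smooth_per_cnj f idc.E_smooth)
  have E: "cnj (idc.E p th) = exp (- \<i> * of_int p * of_real th)" for p th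
    by (simp add: idc.E_def exp_cnj)
  have "cnj (fcoeff ?y q) = fcoeff f (p - q)" for q
  proof -
    have "cnj (fcoeff ?y q) = integral {0..2*pi} (%th. cnj (?y th * exp (- \<i> * of_int q * of_real th))) / (2 * pi)"
      unfolding fcoeff_def by (simp add: integral_cnj)
    moreover have "cnj (?y th * exp (- \<i> * of_int q * of_real th)) = f th * exp (- \<i> * of_int (p - q) * of_real th)" for th
    proof -
      have "cnj (exp (- \<i> * of_int q * of_real th)) = exp (\<i> * of_int q * of_real th)" by (simp add: exp_cnj)
      then have "cnj (?y th * exp (- \<i> * of_int q * of_real th)) = f th * (exp (- \<i> * of_int p * of_real th) * exp (\<i> * of_int q * of_real th))"
        using E[of p th] by simp
      then show ?thesis unfolding exp_add[symmetric] by (simp add: algebra_simps)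
    qed
    ultimately show ?thesis unfolding fcoeff_def[of f] by (simp only:)
  qed
  moreover have "l2inner h ?y / (2 * pi) = fcoeff (%th. f th * h th) p"
    unfolding l2inner_def fcoeff_def using E[of p] by (simp add: mult_ac)
  ultimately show ?thesis
    using parseval_id[OF h smooth_per_continuous[OF y]] by (simp add: mult.commute)
qed

text \<open>The symbol of the difference of both sides is
  \<open>1 - sgn p sgn q - sgn (p - q) (sgn p - sgn q)\<close>, which vanishes for nonzero \<open>p\<close>, \<open>q\<close>.\<close>

lemma Hilb_pair_identity:
  assumes A: "smooth_per A" and v: "smooth_per v" "fcoeff v 0 = 0"
  shows "l2inner (mulop A v) v - l2inner (mulop A (Hilb v)) (Hilb v)
    = l2inner (Hilb (mulop (Hilb A) v)) v - l2inner (mulop (Hilb A) (Hilb v)) v"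
proof -
  note s = Hilb_smooth smooth_mulop A v(1)
  define X1 X2 X3 X4 where "X1 = mulop A v" and "X2 = Hilb (mulop A (Hilb v))"
    and "X3 = Hilb (mulop (Hilb A) v)" and "X4 = mulop (Hilb A) (Hilb v)"
  have sX: "smooth_per X1" "smooth_per X2" "smooth_per X3" "smooth_per X4"
    unfolding X1_def X2_def X3_def X4_def by (intro s)+
  define Y where "Y = (%th. (X1 th - X2 th) - (X3 th - X4 th))"
  have sY: "smooth_per Y" unfolding Y_def by (intro smooth_per_diff sX)
  have fd: "fcoeff (%th. f th - h th) p = fcoeff f p - fcoeff h p" if "smooth_per f" "smooth_per h" for f h p
    using idc.fc_diff[of f h p] that smooth_per_continuous by (simp add: idc_fc)
  \<comment> \<open>Nothing is claimed about the mode \<open>p = 0\<close> of \<open>Y\<close>: it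
    is paired with the mean of \<open>v\<close>, which is 0. For the same reason the terms with
    \<open>q = 0\<close> drop out.\<close>
  have Y0: "fcoeff Y p = 0" if p: "p \<noteq> 0" for p
  proof -
    have "fcoeff Y p = (fcoeff X1 p - fcoeff X2 p) - (fcoeff X3 p - fcoeff X4 p)"
      unfolding Y_def by (simp add: fd smooth_per_diff sX)
    also have "... = 0"
    proof (rule has_sum_zeroD)
    show "((%q. (fcoeff A (p - q) * fcoeff v q - of_int (sgn p) * (fcoeff A (p - q) * fcoeff (Hilb v) q))
       - (of_int (sgn p) * (fcoeff (Hilb A) (p - q) * fcoeff v q) - fcoeff (Hilb A) (p - q) * fcoeff (Hilb v) q))
      has_sum ((fcoeff X1 p - fcoeff X2 p) - (fcoeff X3 p - fcoeff X4 p))) UNIV"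
      unfolding X1_def X2_def X3_def X4_def fcoeff_Hilb[OF smooth_mulop[OF A Hilb_smooth[OF v(1)]]] fcoeff_Hilb[OF smooth_mulop[OF Hilb_smooth[OF A] v(1)]]
      unfolding mulop_def by (intro has_sum_minus has_sum_cmult_right fcoeff_mult s)
    show "(fcoeff A (p - q) * fcoeff v q - of_int (sgn p) * (fcoeff A (p - q) * fcoeff (Hilb v) q))
       - (of_int (sgn p) * (fcoeff (Hilb A) (p - q) * fcoeff v q) - fcoeff (Hilb A) (p - q) * fcoeff (Hilb v) q) = 0" for q
    proof (cases "q = 0")
      case False
      have "1 - sgn p * sgn q - (sgn p * sgn (p - q) - sgn (p - q) * sgn q) = 0"
        using False p by (cases "p = q") (auto simp: sgn_if)
      then have "complex_of_int (1 - sgn p * sgn q - (sgn p * sgn (p - q) - sgn (p - q) * sgn q)) = 0" by simp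
      then have "fcoeff A (p - q) * fcoeff v q * complex_of_int (1 - sgn p * sgn q - (sgn p * sgn (p - q) - sgn (p - q) * sgn q)) = 0" by simp
      then show ?thesis by (simp add: fcoeff_Hilb A v(1) algebra_simps)
    qed (simp add: fcoeff_Hilb v)
    qed
    finally show ?thesis .
  qed
  have "((%n. fcoeff Y n * cnj (fcoeff v n)) has_sum (l2inner Y v / (2 * pi))) UNIV"
    by (rule parseval_id[OF sY smooth_per_continuous[OF v(1)]])
  moreover have "fcoeff Y n * cnj (fcoeff v n) = 0" for n using Y0[of n] v(2) by (cases "n = 0") auto
  ultimately have "l2inner Y v / (2 * pi) = 0" by (rule has_sum_zeroD)
  then have "l2inner Y v = 0" by simp
  moreover have "l2inner Y v = (l2inner X1 v - l2inner X2 v) - (l2inner X3 v - l2inner X4 v)"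
    unfolding Y_def by (simp add: l2inner_diff_left smooth_per_diff sX v(1))
  moreover have "l2inner X2 v = l2inner (mulop A (Hilb v)) (Hilb v)" unfolding X2_def by (rule Hilb_sym) (intro s)+
  ultimately show ?thesis unfolding X1_def X3_def X4_def by simp
qed

lemma rapid_mat_adj: "rapid_mat \<kappa> K ==> rapid_mat \<kappa> (%m n. cnj (K n m))"
  unfolding rapid_mat_def by (metis complex_mod_cnj mult.commute)

lemma sip_mv_adj:
  assumes K: "rapid_mat \<kappa> K" and x: "!!m. norm (x m) <= B" and y: "!!m. norm (y m) <= C"
  shows "sip (mv K x) y = sip x (mv (%m n. cnj (K n m)) y)"
proof -
  have "sip x (mv (%m n. cnj (K n m)) y) = cnj (infsum (%(m,n). cnj (K n m) * (y n * cnj (x m))) UNIV)"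
    by (subst sip_cnj) (simp only: sip_mv_pair(2)[OF rapid_mat_adj[OF K] y x])
  also have "... = infsum (%(m,n). K n m * (x m * cnj (y n))) UNIV"
    by (simp add: case_prod_unfold mult.commute mult.left_commute flip: infsum_cnj)
  also have "... = infsum (%(m,n). K m n * (x n * cnj (y m))) UNIV"
    by (rule infsum_reindex_bij_witness[where i=prod.swap and j=prod.swap]) auto
  also have "... = sip (mv K x) y"
    by (simp only: sip_mv_pair(2)[OF K x y])
  finally show ?thesis by simp
qed

section \<open>Bounds on eigenfunctions, and traces computed in an eigenbasis\<close>

lemma mv_bound:
  assumes K: "rapid_mat \<kappa> K" and x: "!!l. norm (x l) <= 1"
  shows "norm (mv K x m) * br m ^ M <= \<kappa> (M + 2) * brsum"
proof -
  have "norm (mv K x m) <= infsum (%l. norm (K m l) * br l ^ M) UNIV"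
    unfolding mv_def
  proof (rule norm_infsum_le_infsum(2)[OF rapid_mat_row(1)[OF K]])
    fix l
    have "norm (x l) <= br l ^ M" using x[of l] br_power_ge_1[of l M] by linarith
    then show "norm (K m l * x l) <= norm (K m l) * br l ^ M" unfolding norm_mult by (intro mult_left_mono) auto
  qed
  also have "... <= \<kappa> (M + 2) * brsum / br m ^ M" by (rule rapid_mat_row(2)[OF K])
  finally show ?thesis by (simp add: field_simps)
qed

text \<open>Comparison with the reference system transfers convergence from \<open>dref\<close>;
  this replaces an asymptotic law for the eigenvalues.\<close>

lemma eigsys_powr_summable:
  assumes es: "eigsys dref K \<Phi> \<mu>" and K: "rapid_mat \<kappa> K" "herm_mat K" and \<delta>: "0 < \<delta>" "\<delta> <= 1" "!!j. \<delta> <= \<mu> j"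
    and s: "s > 1"
  shows "(%j. \<mu> j powr (- s)) summable_on UNIV"
proof -
  have D: "rapid_mat \<kappa> (%m n. K m n - (%_ _. 0) m n)" using K by simp
  have lo2: "\<delta> <= dref m" for m using \<delta>(2) dref_ge_1 by (rule order_trans)
  interpret SP: spectral_pair \<mu> dref "%j k. sip (unit_seq k) (\<Phi> j)" \<delta>
    by (rule eigsys_spectral_pair(1)[OF es K eigsys_ref rapid_mat_0 dref_le_br D \<delta> lo2 dref_summable_sq])
  show ?thesis using SP.summable_powr(1)[of "of_real s"] dref_summable[OF s] by simp
qed

text \<open>Each use of the eigenvalue equation trades a factor \<open>br m\<close> for a factor
  \<open>\<mu> j\<close>; two uses make the coefficients summable over \<open>m\<close>.\<close>

lemma eigsys_coeff_bound:
  assumes es: "eigsys dref K \<Phi> \<mu>" and K: "rapid_mat \<kappa> K" and \<delta>: "0 < \<delta>" "!!j. \<delta> <= \<mu> j"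
  obtains C where "C \<ge> 0" "!!j m. norm (\<Phi> j m) <= C * (\<mu> j)\<^sup>2 * (1 / br m ^ 2)"
proof -
  define k0 k1 where "k0 = \<kappa> 2 * brsum" and "k1 = \<kappa> 3 * brsum"
  have k: "k0 \<ge> 0" "k1 \<ge> 0" unfolding k0_def k1_def using rapid_mat_nonneg[OF K] brsum_nonneg by auto
  have \<Phi>1: "norm (\<Phi> j m) <= 1" for j m by (rule eigsys_norm_le_1[OF es])
  have K0: "norm (mv K (\<Phi> j) m) <= k0" and K1: "norm (mv K (\<Phi> j) m) * br m <= k1" for j m
    using mv_bound[where x="\<Phi> j" and m=m and M=0, OF K \<Phi>1] mv_bound[where x="\<Phi> j" and m=m and M=1, OF K \<Phi>1] by (simp_all add: k0_def k1_def numeral_eq_Suc)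
  have step: "br m * norm (\<Phi> j m) <= 2 * (\<mu> j * norm (\<Phi> j m) + norm (mv K (\<Phi> j) m))" for j m
  proof -
    have "of_real (\<mu> j) * \<Phi> j m = of_real (dref m) * \<Phi> j m + mv K (\<Phi> j) m" using es unfolding eigsys_def by blast
    then have "of_real (dref m) * \<Phi> j m = of_real (\<mu> j) * \<Phi> j m - mv K (\<Phi> j) m" by simp
    then have "norm (of_real (dref m) * \<Phi> j m) <= norm (of_real (\<mu> j) * \<Phi> j m) + norm (mv K (\<Phi> j) m)"
      by (metis norm_triangle_ineq4)
    then have *: "dref m * norm (\<Phi> j m) <= \<mu> j * norm (\<Phi> j m) + norm (mv K (\<Phi> j) m)"
      using dref_ge_1[of m] \<delta>(1) \<delta>(2)[of j] by (simp add: norm_mult)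
    have "br m * norm (\<Phi> j m) <= 2 * (dref m * norm (\<Phi> j m))"
      using mult_right_mono[OF br_le_dref[of m], of "norm (\<Phi> j m)"] by simp
    also have "... <= 2 * (\<mu> j * norm (\<Phi> j m) + norm (mv K (\<Phi> j) m))" by (rule mult_left_mono[OF *]) simp
    finally show ?thesis .
  qed
  \<comment> \<open>Collects the terms of degree 2, 1 and 0 in \<open>\<mu> j\<close>; the lower
    ones are raised to degree 2 by \<open>1 <= \<mu> j / \<delta>\<close>.\<close>
  define C where "C = 4 + 4 * k0 / \<delta> + 2 * k1 / \<delta>\<^sup>2"
  have C0: "C \<ge> 0" using k \<delta>(1) by (simp add: C_def)
  have "norm (\<Phi> j m) <= C * (\<mu> j)\<^sup>2 * (1 / br m ^ 2)" for j m
  proof -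
    let ?x = "norm (\<Phi> j m)" and ?y = "\<mu> j" and ?z = "norm (mv K (\<Phi> j) m)"
    have y: "?y > 0" "1 <= ?y / \<delta>" using \<delta>(1) \<delta>(2)[of j] by (auto simp: field_simps)
    have "br m * ?x <= 2 * (?y + k0)"
    proof -
      have "?y * ?x <= ?y" using mult_left_mono[OF \<Phi>1[of j m], of ?y] y by simp
      then show ?thesis using step[of m j] K0[of j m] unfolding distrib_left by linarith
    qed
    then have "?y * (br m * ?x) <= ?y * (2 * (?y + k0))" using y by (intro mult_left_mono) auto
    moreover have "br m * (br m * ?x) <= br m * (2 * (?y * ?x + ?z))" by (intro mult_left_mono step) (simp add: less_imp_le)
    moreover have "br m * (2 * (?y * ?x + ?z)) = 2 * (?y * (br m * ?x)) + 2 * (?z * br m)" by (simp add: algebra_simps)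
    ultimately have "br m * (br m * ?x) <= 2 * (?y * (2 * (?y + k0))) + 2 * k1"
      using K1[of j m] unfolding distrib_left by linarith
    also have "... = 4 * ?y\<^sup>2 + 4 * k0 * (?y * 1) + 2 * k1 * 1" by (simp add: power2_eq_square algebra_simps)
    also have "... <= 4 * ?y\<^sup>2 + 4 * k0 * (?y * (?y / \<delta>)) + 2 * k1 * (?y / \<delta>)\<^sup>2"
    proof -
      have "?y * 1 <= ?y * (?y / \<delta>)" using y by (intro mult_left_mono) auto
      moreover have "1 <= (?y / \<delta>)\<^sup>2" by (rule one_le_power[OF y(2)])
      ultimately show ?thesis using k y by (intro add_mono mult_left_mono order_refl) auto
    qed
    also have "... = C * ?y\<^sup>2" using \<delta>(1) by (simp add: C_def power2_eq_square field_simps)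
    finally show ?thesis by (simp add: power2_eq_square field_simps)
  qed
  then show ?thesis using that[OF C0] by blast
qed

definition ebasis :: "int => cfun" where
  "ebasis n = (%th. expi n th / of_real (sqrt (2*pi)))"

lemma ebasis_smooth: "smooth_per (ebasis n)"
  using smooth_per_scale[OF idc.E_smooth, of "1 / of_real (sqrt (2*pi))" n] by (simp add: ebasis_def idc_E divide_inverse mult.commute)

lemma l2inner_cnj: "l2inner f h = cnj (l2inner h f)"
  unfolding l2inner_def integral_cnj by (simp add: mult.commute)

lemma l2inner_ebasis: "l2inner f (ebasis n) = of_real (sqrt (2*pi)) * fcoeff f n"
proof -
  have "cnj (expi n th) = exp (- \<i> * of_int n * of_real th)" for th by (simp add: expi_def exp_cnj)
  then have "l2inner f (ebasis n) = integral {0..2*pi} (%th. (1 / of_real (sqrt (2*pi))) * (f th * exp (- \<i> * of_int n * of_real th)))"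
    unfolding l2inner_def ebasis_def by simp
  also have "... = (1 / of_real (sqrt (2*pi))) * (2 * pi * fcoeff f n)"
    unfolding fcoeff_def by simp
  also have "... = of_real (sqrt (2*pi)) * fcoeff f n"
  proof -
    have "complex_of_real (2 * pi) = of_real (sqrt (2*pi)) * of_real (sqrt (2*pi))" unfolding of_real_mult[symmetric] by simp
    then show ?thesis by simp
  qed
  finally show ?thesis .
qed

lemma ebasis_parseval:
  assumes f: "smooth_per f" and h: "smooth_per h"
  shows "((%n. l2inner f (ebasis n) * l2inner (ebasis n) h) has_sum l2inner f h) UNIV"
proof -
  have "l2inner f (ebasis n) * l2inner (ebasis n) h = 2 * pi * (fcoeff f n * cnj (fcoeff h n))" for n
  proof -
    have "complex_of_real (2 * pi) = of_real (sqrt (2*pi)) * of_real (sqrt (2*pi))" unfolding of_real_mult[symmetric] by simp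
    then show ?thesis unfolding l2inner_cnj[of "ebasis n" h] l2inner_ebasis by simp
  qed
  then show ?thesis using has_sum_cmult_right[OF parseval_id[OF f smooth_per_continuous[OF h]], of "2 * pi"] by simp
qed

lemma ebasis_parseval_sq:
  assumes h: "smooth_per h"
  shows "((%n. (norm (l2inner (ebasis n) h))\<^sup>2) has_sum Re (l2inner h h)) UNIV"
proof -
  have "l2inner h (ebasis n) * l2inner (ebasis n) h = of_real ((norm (l2inner (ebasis n) h))\<^sup>2)" for n
    unfolding complex_norm_square by (subst (1) l2inner_cnj) (rule mult.commute)
  then show ?thesis using has_sum_Re[OF ebasis_parseval[OF h h]] by simp
qed

text \<open>The eigenbasis is a parameter, to be instantiated with the one that
  \<open>op_pow\<close> selects.\<close>

locale eigen_wcoord = wcoord +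
  fixes \<psi> :: "nat => cfun" and \<nu> :: "nat => real" and \<delta> :: real
  assumes eb: "eigenbasis (%h th. Lam_w b h th + P0 b h th) \<psi> \<nu>"
    and \<delta>: "0 < \<delta>" "\<delta> <= 1" "!!k. \<delta> <= \<nu> k"
begin

abbreviation "\<Psi> k \<equiv> coords (\<psi> k)"

lemma \<psi>_smooth: "smooth_per (\<psi> k)" and \<psi>_ev: "(%th. Lam_w b (\<psi> k) th + P0 b (\<psi> k) th) = (%th. of_real (\<nu> k) * \<psi> k th)"
  and \<psi>_norm: "l2inner (\<psi> k) (\<psi> k) = 1"
  using eb unfolding eigenbasis_def by auto

lemma \<Psi>_eigsys: "eigsys dref Km \<Psi> \<nu>"
  by (rule eigenbasis_eigsys[OF eb])

lemma \<Psi>_le_1: "norm (\<Psi> k m) <= 1"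
  by (rule eigsys_norm_le_1[OF \<Psi>_eigsys])

lemma \<nu>_pos: "\<nu> k > 0"
  using \<delta>(1) \<delta>(3)[of k] by linarith

lemma \<nu>_powr_summable: "r > 1 ==> (%k. \<nu> k powr (- r)) summable_on UNIV"
  by (rule eigsys_powr_summable[OF \<Psi>_eigsys Krapid Km_herm \<delta>])

lemma \<nu>_summable: "(%k. 1 / (\<nu> k)\<^sup>2) summable_on UNIV"
proof -
  have "\<nu> k powr (- 2) = 1 / (\<nu> k)\<^sup>2" for k
    using \<nu>_pos[of k] by (simp add: powr_minus divide_inverse)
  then show ?thesis using \<nu>_powr_summable[of 2] by simp
qed

text \<open>\<open>op_pow\<close> is a pointwise series in theta. Integrating it term by term
  requires sup norms of the eigenfunctions that grow at most polynomially in the eigenvalue.\<close>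

lemma sup_bound: obtains C where "C \<ge> 0" "!!k th. norm (\<psi> k th) <= C * (\<nu> k)\<^sup>2"
proof -
  obtain C where C: "C \<ge> 0" "!!k m. norm (\<Psi> k m) <= C * (\<nu> k)\<^sup>2 * (1 / br m ^ 2)"
    using eigsys_coeff_bound[OF \<Psi>_eigsys Krapid \<delta>(1,3)] by metis
  obtain R where R: "!!th. norm (rinvsqrt b th) <= R" using smooth_per_bdd[OF ri_smooth] by blast
  have R0: "R \<ge> 0" using R[of 0] norm_ge_zero order_trans by blast
  have "norm (\<psi> k th) <= R * C * brsum * (\<nu> k)\<^sup>2" for k th
  proof -
    have le: "norm (fc (ww (\<psi> k)) n * E n th) <= C * (\<nu> k)\<^sup>2 * (1 / br n ^ 2)" for n
    proof -
      have "1 <= sqrt (2 * pi)" using pi_gt3 by simp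
      then have "norm (fc (ww (\<psi> k)) n) <= sqrt (2 * pi) * norm (fc (ww (\<psi> k)) n)" by (simp add: mult_le_cancel_right1)
      then show ?thesis using C(2)[of k n] by (simp add: coords_def norm_mult)
    qed
    have "norm (infsum (%n. fc (ww (\<psi> k)) n * E n th) UNIV) <= infsum (%n. C * (\<nu> k)\<^sup>2 * (1 / br n ^ 2)) UNIV"
      by (rule norm_infsum_le_infsum(2)[OF summable_on_cmult_right[OF summable_br2] le])
    also have "... = C * (\<nu> k)\<^sup>2 * brsum" unfolding brsum_def by (rule infsum_cmult_right')
    finally have "norm (ww (\<psi> k) th) <= C * (\<nu> k)\<^sup>2 * brsum"
      using infsumI[OF inversion_has_sum[OF ww_smooth[OF \<psi>_smooth], of k th]] by simp
    then have "norm (rinvsqrt b th) * norm (ww (\<psi> k) th) <= R * (C * (\<nu> k)\<^sup>2 * brsum)"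
      by (rule mult_mono[OF R]) (use R0 in auto)
    then show ?thesis by (subst \<phi>_ww) (simp add: norm_mult mult_ac)
  qed
  moreover have "R * C * brsum \<ge> 0" using R0 C(1) brsum_nonneg by simp
  ultimately show ?thesis using that by blast
qed

text \<open>With \<open>eigsys_ref\<close> as one of the two systems,
  \<open>pair_weight_bound\<close> becomes a Hilbert-Schmidt bound for \<open>D\<close> composed
  with a power of the operator; the weights \<open>dref m\<close>, being at least 1, are
  dropped.\<close>

lemma weighted_mv_summable:
  assumes D: "rapid_mat \<kappa>D D"
  shows "(%k. \<nu> k ^ (2 * M) * Re (sip (mv D (\<Psi> k)) (mv D (\<Psi> k)))) summable_on UNIV"
proof -
  let ?f = "%k m. \<nu> k ^ (2 * M) * (norm (mv D (\<Psi> k) m))\<^sup>2"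
  have "(%(k,m). ?f k m) summable_on UNIV"
  proof (rule nonneg_summable_pairI(1))
    fix J :: "nat set" and L :: "int set" assume fin: "finite J" "finite L"
    have "(\<Sum>k\<in>J. \<Sum>m\<in>L. ?f k m) = (\<Sum>m\<in>L. \<Sum>k\<in>J. ?f k m)" by (rule sum.swap)
    also have "... <= (\<Sum>m\<in>L. \<Sum>k\<in>J. (dref m * \<nu> k) ^ (2 * M) * (norm (sip (mv D (\<Psi> k)) (unit_seq m)))\<^sup>2)"
    proof (intro sum_mono)
      fix m k
      have "1 * \<nu> k ^ (2 * M) <= dref m ^ (2 * M) * \<nu> k ^ (2 * M)"
        by (intro mult_right_mono one_le_power dref_ge_1) (use \<nu>_pos[of k] in auto)
      then show "?f k m <= (dref m * \<nu> k) ^ (2 * M) * (norm (sip (mv D (\<Psi> k)) (unit_seq m)))\<^sup>2"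
        unfolding sip_unit_right power_mult_distrib by (intro mult_right_mono) auto
    qed
    also have "... <= eig_const (%_. 0) M * eig_const \<kappa> M * (\<kappa>D 2 * brsum\<^sup>2) * (\<kappa>D (2 * M + 2) * brsum\<^sup>2)"
      by (rule pair_weight_bound[OF eigsys_ref rapid_mat_0 dref_le_br \<Psi>_eigsys Krapid dref_le_br D fin(2,1)])
    finally show "(\<Sum>k\<in>J. \<Sum>m\<in>L. (%(k,m). ?f k m) (k, m)) <= eig_const (%_. 0) M * eig_const \<kappa> M * (\<kappa>D 2 * brsum\<^sup>2) * (\<kappa>D (2 * M + 2) * brsum\<^sup>2)"
      by simp
  qed (auto simp: power_mult)
  then have "(%k. infsum (?f k) UNIV) summable_on UNIV"
    using summable_on_Sigma_banach[of ?f UNIV "%_. UNIV"] by simp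
  moreover have "infsum (?f k) UNIV = \<nu> k ^ (2 * M) * Re (sip (mv D (\<Psi> k)) (mv D (\<Psi> k)))" for k
    unfolding sip_self by (simp add: infsum_cmult_right')
  ultimately show ?thesis by simp
qed

lemma \<nu>_powr_le: "\<bar>Re w\<bar> <= real P ==> norm (complex_of_real (\<nu> k) powr w) <= \<nu> k ^ (2 * P) / \<delta> ^ (3 * P)"
  using powr_le_on_segment[OF \<delta>(1,2,3,3), of "\<nu> k" k k "Re w" P] \<nu>_pos[of k]
  by (simp add: norm_powr_real_powr power_mult power2_eq_square)

text \<open>\<open>op_trace\<close> sums over the exponentials, while the power is diagonal in
  \<open>\<psi>\<close>. As \<open>KS\<close> is smoothing, its adjoint sends the eigenvectors to
  functions \<open>h k\<close> whose norms are square summable against every power of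
  \<open>\<nu> k\<close>. The double series over \<open>n\<close> and \<open>k\<close> then
  converges absolutely, and Parseval sums it over \<open>n\<close>.\<close>

theorem trace_formula:
  assumes Ss: "!!f. smooth_per f ==> smooth_per (S f)"
    and Sc: "!!f. smooth_per f ==> coords (S f) = mv KS (coords f)" and KS: "rapid_mat \<kappa>S KS"
    and op: "!!f. Opw f = (%th. infsum (%k. complex_of_real (\<nu> k) powr w * l2inner f (\<psi> k) * \<psi> k th) UNIV)"
  shows "op_trace (%f. Opw (S f)) = infsum (%k. of_real (\<nu> k) powr w * sip (mv KS (\<Psi> k)) (\<Psi> k)) UNIV"
proof -
  define KA where "KA = (%m n. cnj (KS n m))"
  have KA: "rapid_mat \<kappa>S KA" unfolding KA_def by (rule rapid_mat_adj[OF KS])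
  define h where "h = (%k. uncoords (mv KA (\<Psi> k)))"
  have hr: "rapid_seq (mv KA (\<Psi> k))" for k by (rule rapid_seq_mv[OF KA \<Psi>_le_1])
  have hs: "smooth_per (h k)" and hc: "coords (h k) = mv KA (\<Psi> k)" for k
    unfolding h_def by (rule uncoords_smooth[OF hr], rule coords_uncoords[OF hr])
  have adj: "sip (mv KS (coords f)) (\<Psi> k) = l2inner f (h k)" if f: "smooth_per f" for f k
  proof -
    obtain B where B: "!!m. norm (coords f m) <= B" using rapid_seq_bounded[OF coords_rapid[OF f]] by blast
    show ?thesis unfolding l2inner_sip[OF f hs] hc KA_def by (rule sip_mv_adj[OF KS B \<Psi>_le_1])
  qed
  define B where "B = (%n k. l2inner (ebasis n) (h k))"
  define L where "L = (%n k. l2inner (\<psi> k) (ebasis n))"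
  have Bk: "l2inner (S (ebasis n)) (\<psi> k) = B n k" for n k
    unfolding B_def l2inner_sip[OF Ss[OF ebasis_smooth] \<psi>_smooth] Sc[OF ebasis_smooth] by (rule adj[OF ebasis_smooth])
  define \<beta> where "\<beta> = (%k. Re (l2inner (h k) (h k)))"
  have \<beta>sum: "(%k. \<nu> k ^ (2 * M) * \<beta> k) summable_on UNIV" for M
    using weighted_mv_summable[OF KA, of M] unfolding \<beta>_def l2inner_sip[OF hs hs] hc .
  have Bsum: "((%n. (norm (B n k))\<^sup>2) has_sum \<beta> k) UNIV" for k
    unfolding B_def \<beta>_def by (rule ebasis_parseval_sq[OF hs])
  have Lsum: "((%n. (norm (L n k))\<^sup>2) has_sum 1) UNIV" for k
  proof -
    have "norm (L n k) = norm (l2inner (ebasis n) (\<psi> k))" for n unfolding L_def by (subst l2inner_cnj) simp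
    then show ?thesis using ebasis_parseval_sq[OF \<psi>_smooth[of k]] by (simp add: \<psi>_norm)
  qed
  have B\<beta>: "(norm (B n k))\<^sup>2 <= \<beta> k" for n k
    using finite_sum_le_has_sum[OF Bsum[of k], of "{n}"] by simp
  obtain P :: nat where P: "\<bar>Re w\<bar> <= real P" using real_arch_simple by blast
  define q where "q = 1 / \<delta> ^ (3 * P)"
  have q: "q \<ge> 0" "norm (complex_of_real (\<nu> k) powr w) <= q * \<nu> k ^ (2 * P)" for k
    using \<delta> \<nu>_powr_le[OF P, of k] by (auto simp: q_def)
  \<comment> \<open>Products are converted into squares, which Parseval controls. The factor
    \<open>1 / (\<nu> k)^2\<close> is summable and is paid for by a higher exponent on the other
    square.\<close>
  have amgm: "\<nu> k ^ (N) * x * y <= \<nu> k ^ (2 * (N + 1)) * x\<^sup>2 + 1 / (\<nu> k)\<^sup>2 * y\<^sup>2" if "x \<ge> 0" "y \<ge> 0" for N k x y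
  proof -
    let ?a = "\<nu> k ^ (N + 1) * x" and ?b = "y / \<nu> k"
    have "?a * ?b <= ?a\<^sup>2 + ?b\<^sup>2"
    proof -
      have "0 <= ?a * ?b" using \<nu>_pos[of k] that by (intro mult_nonneg_nonneg divide_nonneg_pos) auto
      then show ?thesis using sum_squares_bound[of ?a ?b] by linarith
    qed
    moreover have "?a * ?b = \<nu> k ^ N * x * y" using \<nu>_pos[of k] by simp
    moreover have "(\<nu> k ^ (N + 1))\<^sup>2 = \<nu> k ^ (2 * (N + 1))" by (metis power_mult mult.commute)
    ultimately show ?thesis by (simp add: power_mult_distrib power_divide)
  qed
  define F where "F = (%k n. of_real (\<nu> k) powr w * B n k * L n k)"
  have Fsum: "(%(k,n). F k n) summable_on UNIV \<times> UNIV"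
  proof (rule norm_infsum_le_infsum(1))
    let ?G = "%(k,n). q * (\<nu> k ^ (2 * (2 * P + 1)) * (norm (B n k))\<^sup>2 + 1 / (\<nu> k)\<^sup>2 * (norm (L n k))\<^sup>2)"
    show "?G summable_on UNIV \<times> UNIV"
    proof (rule summable_on_SigmaI)
      show "((%n. ?G (k, n)) has_sum (q * (\<nu> k ^ (2 * (2 * P + 1)) * \<beta> k + 1 / (\<nu> k)\<^sup>2 * 1))) UNIV" for k
        unfolding prod.case by (intro has_sum_cmult_right has_sum_add Bsum Lsum)
      show "(%k. q * (\<nu> k ^ (2 * (2 * P + 1)) * \<beta> k + 1 / (\<nu> k)\<^sup>2 * 1)) summable_on UNIV"
        using \<nu>_summable by (intro summable_on_cmult_right summable_on_add \<beta>sum) simp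
    qed (use q \<nu>_pos in \<open>auto simp: less_imp_le intro!: mult_nonneg_nonneg add_nonneg_nonneg\<close>)
    fix p :: "nat \<times> int"
    obtain k n where p: "p = (k, n)" by (cases p)
    have "norm (F k n) <= q * \<nu> k ^ (2 * P) * norm (B n k) * norm (L n k)"
      unfolding F_def norm_mult by (intro mult_right_mono q) auto
    also have "... = q * (\<nu> k ^ (2 * P) * norm (B n k) * norm (L n k))" by simp
    also have "... <= q * (\<nu> k ^ (2 * (2 * P + 1)) * (norm (B n k))\<^sup>2 + 1 / (\<nu> k)\<^sup>2 * (norm (L n k))\<^sup>2)"
      by (intro mult_left_mono amgm q) auto
    finally show "norm ((%(k,n). F k n) p) <= ?G p" by (simp add: p)
  qed
  obtain C where C: "C \<ge> 0" "!!k th. norm (\<psi> k th) <= C * (\<nu> k)\<^sup>2" using sup_bound by blast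
  \<comment> \<open>Here the pointwise definition of the power meets the integral. \<open>?M\<close>
    is a majorant independent of theta; \<open>sup_bound\<close> adds two powers of
    \<open>\<nu> k\<close>, hence the exponent \<open>2 * P + 2 + 1\<close>.\<close>
  have T: "l2inner (Opw (S (ebasis n))) (ebasis n) = infsum (%k. F k n) UNIV" for n
  proof -
    let ?f = "%k th. of_real (\<nu> k) powr w * B n k * \<psi> k th * cnj (ebasis n th)"
    let ?M = "%k. q * C * (\<nu> k ^ (2 * (2 * P + 2 + 1)) * \<beta> k + 1 / (\<nu> k)\<^sup>2)"
    have e1: "norm (ebasis n th) <= 1" for th
    proof -
      have "1 <= sqrt (2 * pi)" using pi_gt3 by simp
      then show ?thesis using idc.E_norm[of n th] by (simp add: ebasis_def norm_divide idc_E)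
    qed
    have cont: "continuous_on {0..2*pi} (?f k)" for k
      by (intro smooth_per_continuous smooth_per_mult smooth_per_const \<psi>_smooth smooth_per_cnj ebasis_smooth)
    have M: "?M summable_on UNIV"
      by (intro summable_on_cmult_right summable_on_add \<beta>sum \<nu>_summable)
    have le: "norm (?f k th) <= ?M k" for k th
    proof -
      have "norm (?f k th) <= (q * \<nu> k ^ (2 * P)) * norm (B n k) * (C * (\<nu> k)\<^sup>2) * 1"
        unfolding norm_mult by (intro mult_mono q C) (use q C e1 \<nu>_pos[of k] in auto)
      also have "... = q * C * (\<nu> k ^ (2 * P + 2) * norm (B n k) * 1)" by (simp add: power_add power2_eq_square mult_ac)
      also have "... <= q * C * (\<nu> k ^ (2 * (2 * P + 2 + 1)) * (norm (B n k))\<^sup>2 + 1 / (\<nu> k)\<^sup>2 * 1\<^sup>2)"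
        by (intro mult_left_mono amgm) (use q C in auto)
      also have "... <= ?M k"
        by (intro mult_left_mono add_mono B\<beta>) (use q C \<nu>_pos[of k] in auto)
      finally show ?thesis .
    qed
    have "((%k. integral {0..2*pi} (?f k)) has_sum integral {0..2*pi} (%th. infsum (%k. ?f k th) UNIV)) UNIV"
      by (rule integral_infsum(1)[OF cont M le])
    moreover have "integral {0..2*pi} (?f k) = F k n" for k
      unfolding F_def L_def l2inner_def by (simp add: mult.assoc)
    moreover have "(%th. infsum (%k. ?f k th) UNIV) = (%th. Opw (S (ebasis n)) th * cnj (ebasis n th))"
      unfolding op Bk infsum_cmult_left' ..
    ultimately show ?thesis unfolding l2inner_def by (simp add: infsumI)
  qed
  have "op_trace (%f. Opw (S f)) = infsum (%n. infsum (%k. F k n) UNIV) UNIV"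
    unfolding op_trace_def ebasis_def[symmetric] T ..
  also have "... = infsum (%k. infsum (%n. F k n) UNIV) UNIV"
    by (rule infsum_swap_banach[OF Fsum, symmetric])
  also have "... = infsum (%k. of_real (\<nu> k) powr w * sip (mv KS (\<Psi> k)) (\<Psi> k)) UNIV"
  proof (rule infsum_cong)
    fix k
    have "((%n. of_real (\<nu> k) powr w * (L n k * B n k)) has_sum (of_real (\<nu> k) powr w * l2inner (\<psi> k) (h k))) UNIV"
      unfolding L_def B_def by (intro has_sum_cmult_right ebasis_parseval \<psi>_smooth hs)
    then show "infsum (%n. F k n) UNIV = of_real (\<nu> k) powr w * sip (mv KS (\<Psi> k)) (\<Psi> k)"
      unfolding F_def adj[OF \<psi>_smooth] by (simp add: infsumI mult_ac)
  qed
  finally show ?thesis .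
qed

end

lemma Hilb_scale: "smooth_per f ==> Hilb (%th. q * f th) = (%th. q * Hilb f th)"
proof (rule fcoeff_eqI)
  assume f: "smooth_per f"
  have sc: "fcoeff (%th. q * h th) n = q * fcoeff h n" for h n using idc.fc_scale[of q h n] by (simp add: idc_fc)
  show "fcoeff (Hilb (%th. q * f th)) n = fcoeff (%th. q * Hilb f th) n" for n
    by (simp add: sc fcoeff_Hilb f smooth_per_scale)
qed (auto intro: Hilb_smooth smooth_per_scale)

lemma Hcomm_scale:
  assumes "smooth_per (%t. complex_of_real (g t))" "smooth_per f"
  shows "Hcomm g (%th. q * f th) = (%th. q * Hcomm g f th)"
proof -
  have "mulop (%t. complex_of_real (g t)) (%th. q * f th) = (%th. q * mulop (%t. complex_of_real (g t)) f th)"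
    by (auto simp: mulop_def)
  then show ?thesis unfolding Hcomm_def by (simp add: Hilb_scale assms smooth_mulop) (auto simp: mulop_def algebra_simps)
qed

lemma rapid_mat_prod:
  assumes K: "rapid_mat \<kappa> K" and L: "rapid_mat \<kappa>' L"
  shows "rapid_mat (%N. \<kappa> (N + 2) * \<kappa>' (N + 2) * brsum) (%m n. mv K (%l. L l n) m)"
    and "(!!l. norm (x l) <= B) ==> mv (%m n. mv K (%l. L l n) m) x = mv K (mv L x)"
proof -
  have le: "norm (K m l * L l n) <= \<kappa> (N + 2) * \<kappa>' (N + 2) / (br m ^ N * br n ^ N) * (1 / br l ^ 2 * (1 / br n ^ 2))" for N m l n
  proof -
    have 1: "norm (K m l) <= \<kappa> (N + 2) / (br m ^ N * br l ^ 2)"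
    proof -
      have "norm (K m l) <= \<kappa> (N + 2) / (br m ^ (N + 2) * br l ^ (N + 2))" using K unfolding rapid_mat_def by blast
      also have "... <= \<kappa> (N + 2) / (br m ^ N * br l ^ 2)"
        by (intro divide_left_mono mult_mono power_increasing br_ge_1 rapid_mat_nonneg[OF K]) (auto simp: less_imp_le)
      finally show ?thesis .
    qed
    have 2: "norm (L l n) <= \<kappa>' (N + 2) / (br n ^ (N + 2))"
    proof -
      have "norm (L l n) <= \<kappa>' (N + 2) / (br l ^ (N + 2) * br n ^ (N + 2))" using L unfolding rapid_mat_def by blast
      also have "... <= \<kappa>' (N + 2) / (1 * br n ^ (N + 2))"
        by (intro divide_left_mono mult_mono br_power_ge_1 order_refl rapid_mat_nonneg[OF L]) (auto simp: less_imp_le)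
      finally show ?thesis by simp
    qed
    have "norm (K m l * L l n) <= \<kappa> (N + 2) / (br m ^ N * br l ^ 2) * (\<kappa>' (N + 2) / (br n ^ (N + 2)))"
      unfolding norm_mult by (rule mult_mono[OF 1 2]) (auto intro!: divide_nonneg_nonneg rapid_mat_nonneg[OF K] simp: less_imp_le)
    then show ?thesis by (simp add: power_add power2_eq_square mult_ac)
  qed
  show "rapid_mat (%N. \<kappa> (N + 2) * \<kappa>' (N + 2) * brsum) (%m n. mv K (%l. L l n) m)"
    unfolding rapid_mat_def
  proof (intro allI)
    fix N m n
    let ?c = "\<kappa> (N + 2) * \<kappa>' (N + 2) / (br m ^ N * br n ^ N)"
    have c0: "?c \<ge> 0" using rapid_mat_nonneg[OF K] rapid_mat_nonneg[OF L] by (simp add: less_imp_le)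
    have le': "norm (K m l * L l n) <= ?c * (1 / br l ^ 2)" for l
    proof -
      have "1 / br l ^ 2 * (1 / br n ^ 2) <= 1 / br l ^ 2 * 1"
        by (intro mult_left_mono) (auto simp: less_imp_le br_power_ge_1)
      then have "?c * (1 / br l ^ 2 * (1 / br n ^ 2)) <= ?c * (1 / br l ^ 2 * 1)" using c0 by (rule mult_left_mono)
      then show ?thesis using le[of m l n N] by simp
    qed
    have "norm (mv K (%l. L l n) m) <= infsum (%l. ?c * (1 / br l ^ 2)) UNIV"
      unfolding mv_def by (rule norm_infsum_le_infsum(2)[OF summable_on_cmult_right[OF summable_br2] le'])
    also have "... = ?c * brsum" unfolding brsum_def by (rule infsum_cmult_right')
    finally show "norm (mv K (%l. L l n) m) <= \<kappa> (N + 2) * \<kappa>' (N + 2) * brsum / (br m ^ N * br n ^ N)" by simp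
  qed
  assume x: "!!l. norm (x l) <= B"
  show "mv (%m n. mv K (%l. L l n) m) x = mv K (mv L x)"
  proof
    fix m
    let ?c = "\<kappa> 2 * \<kappa>' 2 * B"
    have s: "(%(n,l). K m l * L l n * x n) summable_on UNIV \<times> UNIV"
    proof (rule norm_infsum_le_infsum(1))
      show "(%p. ?c * (%(n,l). 1 / (br n ^ 2 * br l ^ 2)) p) summable_on UNIV \<times> UNIV"
        using summable_on_cmult_right[OF summable_br_pair, of ?c] by simp
      fix p :: "int \<times> int"
      obtain n l where p: "p = (n, l)" by (cases p)
      have "norm (K m l * L l n * x n) <= \<kappa> 2 * \<kappa>' 2 * (1 / br l ^ 2 * (1 / br n ^ 2)) * B"
        unfolding norm_mult[of "K m l * L l n"] using le[of m l n 0] x[of n] rapid_mat_nonneg[OF K, of 2] rapid_mat_nonneg[OF L, of 2]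
        by (intro mult_mono) (auto simp: numeral_2_eq_2)
      then show "norm ((%(n,l). K m l * L l n * x n) p) <= ?c * (%(n,l). 1 / (br n ^ 2 * br l ^ 2)) p" by (simp add: p mult_ac)
    qed
    have "mv (%m n. mv K (%l. L l n) m) x m = infsum (%n. infsum (%l. K m l * L l n * x n) UNIV) UNIV"
      by (simp add: mv_def infsum_cmult_left')
    also have "... = infsum (%l. infsum (%n. K m l * L l n * x n) UNIV) UNIV"
      by (rule infsum_swap_banach[OF s])
    also have "... = mv K (mv L x) m" by (simp add: mv_def mult.assoc infsum_cmult_right')
    finally show "mv (%m n. mv K (%l. L l n) m) x m = mv K (mv L x) m" .
  qed
qed

lemma rapid_mat_poly:
  assumes K: "rapid_mat \<kappa> K"
  shows "rapid_mat (%N. 2 * \<kappa> (N + 1)) (%m n. of_int (\<bar>m\<bar> + \<bar>n\<bar>) * K m n)"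
  unfolding rapid_mat_def
proof (intro allI)
  fix N m n
  have "norm (of_int (\<bar>m\<bar> + \<bar>n\<bar>) * K m n) <= (2 * (br m * br n)) * (\<kappa> (N + 1) / (br m ^ (N + 1) * br n ^ (N + 1)))"
    unfolding norm_mult
  proof (rule mult_mono)
    have "\<bar>real_of_int m\<bar> * \<bar>real_of_int n\<bar> \<ge> 0" by simp
    then have "\<bar>real_of_int m\<bar> + \<bar>real_of_int n\<bar> <= 2 * (br m * br n)" unfolding br_def by (simp add: algebra_simps)
    then show "norm (of_int (\<bar>m\<bar> + \<bar>n\<bar>) :: complex) <= 2 * (br m * br n)" by (simp only: norm_of_int)
    show "norm (K m n) <= \<kappa> (N + 1) / (br m ^ (N + 1) * br n ^ (N + 1))" using K unfolding rapid_mat_def by blast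
  qed (auto simp: less_imp_le)
  then show "norm (of_int (\<bar>m\<bar> + \<bar>n\<bar>) * K m n) <= 2 * \<kappa> (N + 1) / (br m ^ N * br n ^ N)" by (simp add: field_simps)
qed

lemma rapid_mat_add: "rapid_mat \<kappa> K ==> rapid_mat \<kappa>' L ==> rapid_mat (%N. \<kappa> N + \<kappa>' N) (%m n. K m n + L m n)"
  unfolding rapid_mat_def by (metis add_divide_distrib add_mono norm_triangle_le)

lemma mv_scale: "mv K (%n. q * x n) = (%m. q * mv K x m)"
  unfolding mv_def by (simp add: mult.left_commute infsum_cmult_right')

section \<open>The matrices of the commutator and of the difference of squares\<close>

context coord
begin

definition sE :: "int => cfun" where "sE n = (%th. of_real (\<sigma> th) * E n th)"

lemma sE_smooth: "smooth_per (sE n)"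
  unfolding sE_def by (intro smooth_per_mult \<sigma>_smooth E_smooth)

lemma fc_l2: "fc f n = l2inner f (sE n) / (2 * pi)"
  unfolding fc_def l2inner_def sE_def by (simp add: mult_ac)

text \<open>With \<open>\<sigma> = 1 / a\<close>, this is the matrix of
  \<open>a^(-1/2) [H, g] a^(-1/2)\<close> in the orthonormal basis
  \<open>a^(-1/2) E n / sqrt (2 * pi)\<close>.\<close>

definition Qm :: "(real => real) => int => int => complex" where
  "Qm g m n = fc (Hcomm g (sE n)) m"

lemma sw_smooth: "smooth_per w ==> smooth_per (%th. of_real (\<sigma> th) * w th)"
  by (rule smooth_per_mult[OF \<sigma>_smooth])

context
  fixes g :: "real => real"
  assumes g: "smooth_per (%t. complex_of_real (g t))"
begin

lemma Qm_skew: "Qm g m n = - cnj (Qm g n m)"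
  unfolding Qm_def fc_l2 Hcomm_adj[OF g sE_smooth sE_smooth, of n m] l2inner_cnj[of "sE n"] by simp

text \<open>Skew symmetry moves the commutator onto the fixed smooth function \<open>sE m\<close>,
  so that Parseval only has to expand \<open>w\<close>.\<close>

lemma Hcomm_fc:
  assumes w: "smooth_per w"
  shows "((%n. Qm g m n * fc w n) has_sum fc (Hcomm g (%th. of_real (\<sigma> th) * w th)) m) UNIV"
proof -
  let ?h = "Hcomm g (sE m)"
  have hs: "smooth_per ?h" by (rule Hcomm_smooth[OF g sE_smooth])
  have "((%n. fc w n * cnj (fc ?h n)) has_sum (integral {0..2*pi} (%th. w th * cnj (?h th) * of_real (\<sigma> th)) / (2 * pi))) UNIV"
    by (rule parseval[OF w smooth_per_continuous[OF hs]])
  then have "((%n. - (fc w n * cnj (fc ?h n))) has_sum - (integral {0..2*pi} (%th. w th * cnj (?h th) * of_real (\<sigma> th)) / (2 * pi))) UNIV"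
    unfolding has_sum_uminus by simp
  moreover have "- (fc w n * cnj (fc ?h n)) = Qm g m n * fc w n" for n
    unfolding Qm_skew[of m n] by (simp add: Qm_def)
  moreover have "- (integral {0..2*pi} (%th. w th * cnj (?h th) * of_real (\<sigma> th)) / (2 * pi)) = fc (Hcomm g (%th. of_real (\<sigma> th) * w th)) m"
    unfolding fc_l2 Hcomm_adj[OF g sw_smooth[OF w] sE_smooth] by (simp add: l2inner_def mult_ac)
  ultimately show ?thesis by simp
qed

lemma Hcomm_pair:
  assumes w: "smooth_per w" and u: "smooth_per u"
  shows "infsum (%m. fc (Hcomm g (%th. of_real (\<sigma> th) * w th)) m * cnj (fc u m)) UNIV
    = l2inner (Hcomm g (%th. of_real (\<sigma> th) * w th)) (%th. of_real (\<sigma> th) * u th) / (2 * pi)"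
  using infsumI[OF parseval[OF Hcomm_smooth[OF g sw_smooth[OF w]] smooth_per_continuous[OF u]]]
  by (simp add: l2inner_def mult_ac)

end

lemma syn_fc_Dop:
  assumes w: "smooth_per w"
  shows "Dop w = (%th. of_real (\<sigma> th) * syn (%n. of_int n * fc w n) th)" and "rapid_seq (%n. of_int n * fc w n)"
proof -
  show "rapid_seq (%n. of_int n * fc w n)"
    by (rule rapid_seq_poly_mult[where C=1 and N=1]) (auto simp: fc_rapid[OF w] br_def)
  have "vder w th = of_real (\<sigma> th) * syn (%n. \<i> * of_int n * fc w n) th" for th
    using vector_derivative_at[OF syn_deriv[OF fc_rapid[OF w], of th]] unfolding inversion[OF w] by (simp add: vder_def)
  moreover have "syn (%n. \<i> * of_int n * fc w n) th = \<i> * syn (%n. of_int n * fc w n) th" for th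
    unfolding syn_def by (simp add: mult.assoc infsum_cmult_right')
  moreover have ii: "- \<i> * (q * (\<i> * x)) = q * x" for q x :: complex
  proof -
    have "- \<i> * (q * (\<i> * x)) = - (\<i> * \<i>) * (q * x)" by (simp only: mult.left_commute mult.assoc minus_mult_left)
    then show ?thesis by simp
  qed
  ultimately show "Dop w = (%th. of_real (\<sigma> th) * syn (%n. of_int n * fc w n) th)"
    unfolding Dop_vder by (simp only: ii)
qed

end

context wcoord
begin

lemma rq_rq: "rsqrt b th * rsqrt b th = of_real (b th)"
  using b_pos[of th] by (simp add: rsqrt_def flip: of_real_mult)

lemma ww_Lam_w: "ww (Lam_w b f) = mulop (%th. of_real (b th)) (Lam (ww f))"
  by (auto simp: ww_def Lam_w_def mulop_def rq_rq mult.assoc[symmetric])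

lemma ww_D_w: "ww (D_w b f) = mulop (%th. of_real (b th)) (Dop (ww f))"
  by (auto simp: ww_def D_w_def mulop_def rq_rq mult.assoc[symmetric])

lemma Lam_w_smooth: "smooth_per f ==> smooth_per (Lam_w b f)"
  unfolding Lam_w_def by (intro smooth_mulop rq_smooth Lam_smooth)

lemma D_w_smooth: "smooth_per f ==> smooth_per (D_w b f)"
  unfolding D_w_def by (intro smooth_mulop rq_smooth Dop_smooth)

lemma coords_Lam_w: "smooth_per f ==> coords (Lam_w b f) n = of_int \<bar>n\<bar> * coords f n + mv Km (coords f) n"
  unfolding coords_def[abs_def] ww_Lam_w mulop_def mv_scale by (simp only: lam_pair ww_smooth) (simp add: algebra_simps)

lemma coords_D_w: "smooth_per f ==> coords (D_w b f) n = of_int n * coords f n"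
proof -
  assume f: "smooth_per f"
  have "mulop (%th. of_real (b th)) (Dop (ww f)) = (%th. - \<i> * (vder (ww f) th * (1 / of_real (\<sigma> th))))"
    by (auto simp: mulop_def Dop_vder b)
  then have "fc (mulop (%th. of_real (b th)) (Dop (ww f))) n = - \<i> * (\<i> * of_int n * fc (ww f) n)"
    by (simp only: fc_by_parts[OF ww_smooth[OF f]] fc_scale)
  then show ?thesis unfolding coords_def ww_D_w by (simp add: mult.assoc[symmetric])
qed

lemma coords_diff: "smooth_per f ==> smooth_per h ==> coords (%th. f th - h th) n = coords f n - coords h n"
proof -
  assume f: "smooth_per f" and h: "smooth_per h"
  have "ww (%th. f th - h th) = (%th. ww f th - ww h th)" by (auto simp: ww_def mulop_def algebra_simps)
  then show ?thesis unfolding coords_def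
    using fc_diff[of "ww f" "ww h" n] smooth_per_continuous[OF ww_smooth] f h by (simp add: right_diff_distrib)
qed

text \<open>In the expansion of the square of \<open>|m| + Km\<close> minus the square of
  \<open>m\<close> the diagonals cancel, and every remaining term contains the smoothing factor
  \<open>Km\<close>.\<close>

definition KS2 :: "int => int => complex" where
  "KS2 m n = of_int (\<bar>m\<bar> + \<bar>n\<bar>) * Km m n + mv Km (%l. Km l n) m"

lemma KS2_rapid: "\<exists>\<kappa>'. rapid_mat \<kappa>' KS2"
  unfolding KS2_def[abs_def] using rapid_mat_add[OF rapid_mat_poly[OF Krapid] rapid_mat_prod(1)[OF Krapid Krapid]] by blast

lemma coords_S2:
  assumes f: "smooth_per f"
  shows "coords (%th. Lam_w b (Lam_w b f) th - D_w b (D_w b f) th) = mv KS2 (coords f)"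
proof
  fix m
  let ?x = "coords f"
  have xr: "rapid_seq ?x" by (rule coords_rapid[OF f])
  have xn: "rapid_seq (%n. of_int \<bar>n\<bar> * ?x n)"
    by (rule rapid_seq_poly_mult[where C=1 and N=1]) (auto simp: xr br_def)
  obtain B B' where B: "!!n. norm (?x n) <= B" and B': "!!n. norm (of_int \<bar>n\<bar> * ?x n) <= B'"
    using rapid_seq_bounded[OF xr] rapid_seq_bounded[OF xn] by metis
  have "rapid_seq (mv Km ?x)" by (rule rapid_seq_mv[OF Krapid B])
  then obtain C where C: "!!n. norm (mv Km ?x n) <= C" using rapid_seq_bounded by blast
  have abs2: "complex_of_int \<bar>m\<bar> * of_int \<bar>m\<bar> = of_int m * of_int m" by (simp flip: of_int_mult)
  have "coords (%th. Lam_w b (Lam_w b f) th - D_w b (D_w b f) th) m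
    = of_int \<bar>m\<bar> * (of_int \<bar>m\<bar> * ?x m + mv Km ?x m) + mv Km (coords (Lam_w b f)) m - of_int m * (of_int m * ?x m)"
    by (simp add: coords_diff Lam_w_smooth D_w_smooth f coords_Lam_w coords_D_w del: of_int_abs)
  also have "coords (Lam_w b f) = (%n. of_int \<bar>n\<bar> * ?x n + mv Km ?x n)"
    by (rule ext) (rule coords_Lam_w[OF f])
  also have "mv Km (%n. of_int \<bar>n\<bar> * ?x n + mv Km ?x n) m = mv Km (%n. of_int \<bar>n\<bar> * ?x n) m + mv Km (mv Km ?x) m"
    unfolding mv_def[of Km "%n. _ n + _ n"] distrib_left mv_def[of Km "%n. of_int \<bar>n\<bar> * ?x n"] mv_def[of Km "mv Km ?x"]
    by (rule infsum_add[OF mv_summable[OF Krapid B'] mv_summable[OF Krapid C]])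
  also have "of_int \<bar>m\<bar> * (of_int \<bar>m\<bar> * ?x m + mv Km ?x m) + (mv Km (%n. of_int \<bar>n\<bar> * ?x n) m + mv Km (mv Km ?x) m) - of_int m * (of_int m * ?x m)
    = of_int \<bar>m\<bar> * mv Km ?x m + mv Km (%n. of_int \<bar>n\<bar> * ?x n) m + mv Km (mv Km ?x) m"
    unfolding distrib_left mult.assoc[symmetric] abs2 by simp
  also have "mv Km (mv Km ?x) m = mv (%m n. mv Km (%l. Km l n) m) ?x m"
    by (simp only: rapid_mat_prod(2)[OF Krapid Krapid B])
  also have "of_int \<bar>m\<bar> * mv Km ?x m + mv Km (%n. of_int \<bar>n\<bar> * ?x n) m = infsum (%n. of_int (\<bar>m\<bar> + \<bar>n\<bar>) * Km m n * ?x n) UNIV"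
  proof -
    have "((%n. of_int \<bar>m\<bar> * (Km m n * ?x n) + Km m n * (of_int \<bar>n\<bar> * ?x n)) has_sum (of_int \<bar>m\<bar> * mv Km ?x m + mv Km (%n. of_int \<bar>n\<bar> * ?x n) m)) UNIV"
      unfolding mv_def by (intro has_sum_add has_sum_cmult_right has_sum_infsum mv_summable[OF Krapid B] mv_summable[OF Krapid B'])
    from infsumI[OF this] show ?thesis by (simp add: algebra_simps)
  qed
  also have "... + mv (%m n. mv Km (%l. Km l n) m) ?x m = mv KS2 ?x m"
    unfolding mv_def[of KS2] mv_def[of "%m n. mv Km (%l. Km l n) m"] KS2_def distrib_right
    by (rule infsum_add[symmetric, OF mv_summable[OF rapid_mat_poly[OF Krapid] B] mv_summable[OF rapid_mat_prod(1)[OF Krapid Krapid] B]])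
  finally show "coords (%th. Lam_w b (Lam_w b f) th - D_w b (D_w b f) th) m = mv KS2 ?x m" .
qed

end

section \<open>Diagonal entries at the eigenfunctions\<close>

context eigen_wcoord
begin

definition w0 :: "nat => cfun" where "w0 k = (%th. ww (\<psi> k) th - fc (ww (\<psi> k)) 0 * E 0 th)"

text \<open>By \<open>Lam_vv\<close> this is \<open>Lam (ww (\<psi> k))\<close> divided by
  \<open>\<nu> k\<close>. It therefore has mean zero, so the Hilbert transform is an involution on
  it, and by \<open>Dop_vv\<close> it also gives the derivative of
  \<open>ww (\<psi> k)\<close>.\<close>

definition vv :: "nat => cfun" where "vv k = (%th. of_real (\<sigma> th) * w0 k th)"

lemma w0_smooth: "smooth_per (w0 k)"
  unfolding w0_def by (intro smooth_per_diff smooth_per_scale ww_smooth \<psi>_smooth E_smooth)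

lemma vv_smooth: "smooth_per (vv k)"
  unfolding vv_def by (rule sw_smooth[OF w0_smooth])

lemma fc_w0: "fc (w0 k) n = (if n = 0 then 0 else fc (ww (\<psi> k)) n)"
  unfolding w0_def by (subst fc_diff) (auto intro!: smooth_per_continuous smooth_per_scale ww_smooth \<psi>_smooth E_smooth simp: fc_scale fc_E)

lemma Lam_vv: "Lam (ww (\<psi> k)) = (%th. of_real (\<nu> k) * vv k th)"
  using P0_eig(2)[OF \<psi>_smooth \<psi>_ev] by (auto simp: vv_def w0_def E_0 mult_ac)

lemma fcoeff_vv_0: "fcoeff (vv k) 0 = 0"
proof -
  have "fcoeff (Lam (ww (\<psi> k))) 0 = of_real (\<nu> k) * fcoeff (vv k) 0"
    unfolding Lam_vv using idc.fc_scale[of "of_real (\<nu> k)" "vv k" 0] by (simp add: idc_fc)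
  then show ?thesis using \<nu>_pos[of k] by (simp add: fcoeff_Lam ww_smooth \<psi>_smooth)
qed

lemma Dop_vv: "Dop (ww (\<psi> k)) = (%th. of_real (\<nu> k) * Hilb (vv k) th)"
  unfolding Dop_Hilb_Lam[OF ww_smooth[OF \<psi>_smooth]] Lam_vv by (rule Hilb_scale[OF vv_smooth])

lemma \<Psi>_0: "\<nu> k \<noteq> 1 ==> \<Psi> k 0 = 0"
  using P0_eig(1)[OF \<psi>_smooth \<psi>_ev, of k] by (auto simp: coords_def)

text \<open>The common quantity to which the derivative of zeta, the commutator trace and, for the
  special \<open>g\<close>, the trace with \<open>KS2\<close> are all reduced.\<close>

definition dterm :: "(real => real) => nat => complex" where
  "dterm g k = l2inner (Hcomm g (vv k)) (vv k)"

lemma two_pi_split: "complex_of_real (sqrt (2 * pi)) * of_real (sqrt (2 * pi)) = 2 * pi"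
  by (simp flip: of_real_mult)

text \<open>One factor of \<open>Lam_w\<close>, respectively \<open>D_w\<close>, is moved to the
  other side. What remains is multiplication by \<open>b\<close>, evaluated at
  \<open>Lam (ww (\<psi> k))\<close> and at \<open>Dop (ww (\<psi> k))\<close>, each of which
  contributes a factor \<open>\<nu> k\<close>.\<close>

lemma S2_diag: "sip (mv KS2 (\<Psi> k)) (\<Psi> k) = (of_real (\<nu> k))\<^sup>2 *
  (l2inner (mulop (%th. of_real (b th)) (vv k)) (vv k) - l2inner (mulop (%th. of_real (b th)) (Hilb (vv k))) (Hilb (vv k)))"
proof -
  let ?f = "\<psi> k" and ?b = "mulop (%th. complex_of_real (b th))" and ?n = "complex_of_real (\<nu> k)"
  note s = Lam_w_smooth D_w_smooth \<psi>_smooth[of k] ww_smooth Lam_smooth Dop_smooth b_smooth smooth_mulop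
  have "sip (mv KS2 (\<Psi> k)) (\<Psi> k) = l2inner (%th. Lam_w b (Lam_w b ?f) th - D_w b (D_w b ?f) th) ?f"
    by (subst l2inner_sip) (auto intro!: smooth_per_diff s simp: coords_S2[OF \<psi>_smooth])
  also have "... = l2inner (Lam_w b (Lam_w b ?f)) ?f - l2inner (D_w b (D_w b ?f)) ?f"
    by (rule l2inner_diff_left) (intro s)+
  also have "l2inner (Lam_w b (Lam_w b ?f)) ?f = l2inner (ww (Lam_w b ?f)) (Lam (ww ?f))"
    unfolding Lam_w_inner by (rule Lam_sym) (intro s)+
  also have "... = ?n\<^sup>2 * l2inner (?b (vv k)) (vv k)"
    unfolding ww_Lam_w Lam_vv l2inner_scale_right l2inner_mulop_real[of b] l2inner_scale_left by (simp add: power2_eq_square)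
  also have "l2inner (D_w b (D_w b ?f)) ?f = l2inner (Dop (ww (D_w b ?f))) (ww ?f)"
    unfolding l2inner_def D_w_def[of b "D_w b ?f"] ww_def mulop_def by (simp add: cnj_rq mult_ac)
  also have "... = l2inner (ww (D_w b ?f)) (Dop (ww ?f))" by (rule Dop_sym) (intro s)+
  also have "... = ?n\<^sup>2 * l2inner (?b (Hilb (vv k))) (Hilb (vv k))"
    unfolding ww_D_w Dop_vv l2inner_scale_right l2inner_mulop_real[of b] l2inner_scale_left by (simp add: power2_eq_square)
  finally show ?thesis by (simp add: right_diff_distrib)
qed

context
  fixes g :: "real => real"
  assumes g: "smooth_per (%t. complex_of_real (g t))"
begin

definition "Q0 m n = (if m = 0 \<or> n = 0 then 0 else Qm g m n)"

text \<open>Row 0 is removed by the projection to the left of the commutator; column 0 stays, which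
  is the discrepancy with \<open>Q0\<close>.\<close>

definition "KS m n = (if m = 0 then 0 else Qm g m n)"

lemma Q0_diag: "sip (mv Q0 (\<Psi> k)) (\<Psi> k) = dterm g k"
proof -
  let ?r = "complex_of_real (sqrt (2 * pi))"
  have "mv Q0 (\<Psi> k) m * cnj (\<Psi> k m) = 2 * pi * (fc (Hcomm g (vv k)) m * cnj (fc (w0 k) m))" for m
  proof (cases "m = 0")
    case True
    then show ?thesis by (simp add: fc_w0 mv_def Q0_def)
  next
    case False
    have "mv Q0 (\<Psi> k) m = infsum (%n. ?r * (Qm g m n * fc (w0 k) n)) UNIV"
      unfolding mv_def by (rule infsum_cong) (use False in \<open>auto simp: Q0_def fc_w0 coords_def\<close>)
    also have "... = ?r * fc (Hcomm g (vv k)) m"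
      using infsumI[OF Hcomm_fc[OF g w0_smooth[of k], of m]] by (simp add: infsum_cmult_right' vv_def)
    finally show ?thesis using False two_pi_split by (simp add: fc_w0 coords_def mult.left_commute)
  qed
  then have "sip (mv Q0 (\<Psi> k)) (\<Psi> k) = 2 * pi * infsum (%m. fc (Hcomm g (vv k)) m * cnj (fc (w0 k) m)) UNIV"
    unfolding sip_def by (simp add: infsum_cmult_right')
  also have "... = dterm g k"
    using Hcomm_pair[OF g w0_smooth[of k] w0_smooth[of k]] by (simp add: vv_def[symmetric] dterm_def)
  finally show ?thesis .
qed

text \<open>The factors \<open>m\<close> and \<open>n\<close> turn the coordinates of the
  eigenfunction into those of its derivative along \<open>s\<close>, called \<open>y\<close>. By
  \<open>Dop_vv\<close>, \<open>\<sigma>\<close> times \<open>y\<close> is \<open>\<nu> k\<close>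
  times \<open>Hilb (vv k)\<close>, and \<open>Hcomm_Hilb\<close> removes both Hilbert transforms at
  the price of a sign.\<close>

lemma Ld_diag:
  assumes Ld: "!!m n. Ld m n = - \<i> * of_int m * of_int n * Qm g m n"
  shows "sip (mv Ld (\<Psi> k)) (\<Psi> k) = \<i> * (of_real (\<nu> k))\<^sup>2 * dterm g k"
proof -
  let ?r = "complex_of_real (sqrt (2 * pi))" and ?w = "ww (\<psi> k)"
  note ws = ww_smooth[OF \<psi>_smooth[of k]]
  define y where "y = syn (%n. of_int n * fc ?w n)"
  note yr = syn_fc_Dop(2)[OF ws]
  have ys: "smooth_per y" unfolding y_def by (rule syn_smooth[OF yr])
  have fy: "fc y n = of_int n * fc ?w n" for n unfolding y_def by (rule fc_syn[OF yr])
  have Dy: "(%th. of_real (\<sigma> th) * y th) = (%th. of_real (\<nu> k) * Hilb (vv k) th)"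
    unfolding Dop_vv[symmetric] syn_fc_Dop(1)[OF ws] y_def ..
  let ?F = "fc (Hcomm g (%th. of_real (\<sigma> th) * y th))"
  have "mv Ld (\<Psi> k) m * cnj (\<Psi> k m) = - \<i> * (2 * pi) * (?F m * cnj (fc y m))" for m
  proof -
    have "mv Ld (\<Psi> k) m = infsum (%n. (- \<i> * of_int m * ?r) * (Qm g m n * fc y n)) UNIV"
      unfolding mv_def by (rule infsum_cong) (simp add: Ld coords_def fy)
    also have "... = (- \<i> * of_int m * ?r) * ?F m"
      using infsumI[OF Hcomm_fc[OF g ys, of m]] by (simp only: infsum_cmult_right')
    finally have "mv Ld (\<Psi> k) m * cnj (\<Psi> k m) = - \<i> * (?r * ?r) * (?F m * cnj (fc y m))"
      by (simp add: fy coords_def mult_ac)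
    then show ?thesis unfolding two_pi_split .
  qed
  then have "sip (mv Ld (\<Psi> k)) (\<Psi> k) = - \<i> * (2 * pi) * infsum (%m. ?F m * cnj (fc y m)) UNIV"
    unfolding sip_def by (simp only: infsum_cmult_right')
  also have "... = - \<i> * l2inner (Hcomm g (%th. of_real (\<sigma> th) * y th)) (%th. of_real (\<sigma> th) * y th)"
    unfolding Hcomm_pair[OF g ys ys] by simp
  also have "... = - \<i> * ((of_real (\<nu> k))\<^sup>2 * l2inner (Hcomm g (Hilb (vv k))) (Hilb (vv k)))"
    unfolding Dy Hcomm_scale[OF g Hilb_smooth[OF vv_smooth]] l2inner_scale_left l2inner_scale_right by (simp add: power2_eq_square)
  also have "... = \<i> * (of_real (\<nu> k))\<^sup>2 * dterm g k"
    unfolding Hcomm_Hilb[OF g vv_smooth fcoeff_vv_0] dterm_def by simp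
  finally show ?thesis .
qed

text \<open>Off the axes the decay is inherited from \<open>Ld\<close>, since dividing by nonzero
  integers does no harm; column 0 consists of the coefficients of one smooth function.\<close>

lemma KS_rapid:
  assumes Ld: "!!m n. Ld m n = - \<i> * of_int m * of_int n * Qm g m n" and R: "rapid_mat \<kappa>' Ld"
  shows "\<exists>\<kappa>S. rapid_mat \<kappa>S KS"
proof -
  have "rapid_seq (%m. Qm g m 0)" unfolding Qm_def by (rule fc_rapid[OF Hcomm_smooth[OF g sE_smooth]])
  then obtain C where C: "!!N m. norm (Qm g m 0) <= C N / br m ^ N" unfolding rapid_seq_def by metis
  have "norm (KS m n) <= max (\<kappa>' N) (max 0 (C N)) / (br m ^ N * br n ^ N)" for N m n
  proof (cases "m = 0 \<or> n = 0")
    case True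
    have "norm (KS m 0) <= max (\<kappa>' N) (max 0 (C N)) / (br m ^ N * br 0 ^ N)"
    proof -
      have "norm (KS m 0) <= norm (Qm g m 0)" by (simp add: KS_def)
      also have "... <= C N / br m ^ N" by (rule C)
      also have "... <= max (\<kappa>' N) (max 0 (C N)) / br m ^ N" by (intro divide_right_mono) (auto simp: less_imp_le)
      finally show ?thesis by (simp add: br_def)
    qed
    then show ?thesis using True by (auto simp: KS_def less_imp_le le_max_iff_disj)
  next
    case False
    have "1 * norm (Qm g m n) <= norm (- \<i> * complex_of_int m * of_int n) * norm (Qm g m n)"
    proof (rule mult_right_mono)
      have "1 <= \<bar>real_of_int m\<bar>" "1 <= \<bar>real_of_int n\<bar>" using False by linarith+
      then have "1 * 1 <= \<bar>real_of_int m\<bar> * \<bar>real_of_int n\<bar>" by (intro mult_mono) auto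
      then show "1 <= norm (- \<i> * complex_of_int m * of_int n)" by (simp add: norm_mult)
    qed simp
    also have "... = norm (Ld m n)" unfolding Ld norm_mult ..
    also have "... <= \<kappa>' N / (br m ^ N * br n ^ N)" using R unfolding rapid_mat_def by blast
    also have "... <= max (\<kappa>' N) (max 0 (C N)) / (br m ^ N * br n ^ N)" by (intro divide_right_mono) (auto simp: less_imp_le)
    finally show ?thesis using False by (simp add: KS_def)
  qed
  then show ?thesis unfolding rapid_mat_def by (intro exI[of _ "%N. max (\<kappa>' N) (max 0 (C N))"] allI)
qed

text \<open>\<open>KS\<close> and \<open>Q0\<close> differ by a rank one matrix supported off the kernel direction; it contributes
  only through eigenfunctions with eigenvalue 1, hence its weighted trace is its plain trace, which is 0.\<close>

lemma KS_diag_sum: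
  assumes KS: "rapid_mat \<kappa>S KS"
  shows "infsum (%k. of_real (\<nu> k) powr w * sip (mv KS (\<Psi> k)) (\<Psi> k)) UNIV = infsum (%k. of_real (\<nu> k) powr w * dterm g k) UNIV"
proof -
  define q where "q = (%m. KS m 0)"
  have qr: "rapid_seq q"
    unfolding rapid_seq_def
  proof
    fix N
    have "norm (q m) <= \<kappa>S N / br m ^ N" for m
    proof -
      have "norm (KS m 0) <= \<kappa>S N / (br m ^ N * br 0 ^ N)" using KS unfolding rapid_mat_def by blast
      then show ?thesis by (simp add: q_def br_def)
    qed
    then show "\<exists>C. \<forall>m. norm (q m) <= C / br m ^ N" by blast
  qed
  have \<Psi>r: "rapid_seq (\<Psi> k)" for k by (rule coords_rapid[OF \<psi>_smooth])
  have Q0: "rapid_mat \<kappa>S Q0"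
    unfolding rapid_mat_def
  proof (intro allI)
    fix N m n
    have "norm (Q0 m n) <= norm (KS m n)" by (simp add: Q0_def KS_def)
    then show "norm (Q0 m n) <= \<kappa>S N / (br m ^ N * br n ^ N)" using KS unfolding rapid_mat_def by (meson order_trans)
  qed
  have "mv KS (\<Psi> k) = (%m. mv Q0 (\<Psi> k) m + \<Psi> k 0 * q m)" for k
  proof
    fix m
    have "((%n. Q0 m n * \<Psi> k n + (if n = 0 then \<Psi> k 0 * q m else 0)) has_sum (mv Q0 (\<Psi> k) m + \<Psi> k 0 * q m)) UNIV"
      unfolding mv_def
      by (intro has_sum_add has_sum_infsum mv_summable[OF Q0 \<Psi>_le_1] has_sum_finite_neutralI[where B="{0}"]) auto
    moreover have "Q0 m n * \<Psi> k n + (if n = 0 then \<Psi> k 0 * q m else 0) = KS m n * \<Psi> k n" for n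
      by (auto simp: Q0_def KS_def q_def)
    ultimately show "mv KS (\<Psi> k) m = mv Q0 (\<Psi> k) m + \<Psi> k 0 * q m" by (simp add: mv_def infsumI)
  qed
  then have sp: "sip (mv KS (\<Psi> k)) (\<Psi> k) = dterm g k + \<Psi> k 0 * sip q (\<Psi> k)" for k
    using sip_add_left[where x="mv Q0 (\<Psi> k)" and x'="%m. \<Psi> k 0 * q m" and y="\<Psi> k", OF rapid_seq_mv[OF Q0 \<Psi>_le_1] rapid_seq_scale[OF qr] \<Psi>r]
    by (simp add: sip_scale_left Q0_diag)
  \<comment> \<open>If \<open>\<nu> k\<close> differs from 1, the zero coordinate vanishes by
    \<open>\<Psi>_0\<close>; if it equals 1, the power is 1. Either way the weight disappears from
    the second term.\<close>
  have tm: "of_real (\<nu> k) powr w * sip (mv KS (\<Psi> k)) (\<Psi> k) = of_real (\<nu> k) powr w * dterm g k + sip q (\<Psi> k) * \<Psi> k 0" for k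
    using \<Psi>_0[of k] by (cases "\<nu> k = 1") (auto simp: sp algebra_simps)
  have "((%k. sip q (\<Psi> k) * cnj (sip (unit_seq 0) (\<Psi> k))) has_sum sip q (unit_seq 0)) UNIV"
    by (rule eigsys_polar[OF \<Psi>_eigsys qr rapid_seq_unit])
  then have r0: "((%k. sip q (\<Psi> k) * \<Psi> k 0) has_sum 0) UNIV"
    by (simp add: sip_unit_left sip_unit_right q_def KS_def)
  show ?thesis unfolding tm
  proof (cases "(%k. of_real (\<nu> k) powr w * dterm g k) summable_on UNIV")
    case True
    from infsumI[OF has_sum_add[OF has_sum_infsum[OF this] r0]]
    show "infsum (%k. of_real (\<nu> k) powr w * dterm g k + sip q (\<Psi> k) * \<Psi> k 0) UNIV = infsum (%k. of_real (\<nu> k) powr w * dterm g k) UNIV" by simp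
  next
    \<comment> \<open>Both infinite sums are 0 by default here, since adding a summable series
      cannot create convergence.\<close>
    case False
    have "\<not> (%k. of_real (\<nu> k) powr w * dterm g k + sip q (\<Psi> k) * \<Psi> k 0) summable_on UNIV"
    proof
      assume "(%k. of_real (\<nu> k) powr w * dterm g k + sip q (\<Psi> k) * \<Psi> k 0) summable_on UNIV"
      from infsum_diff(1)[OF this has_sum_imp_summable[OF r0]] show False using False by simp
    qed
    then show "infsum (%k. of_real (\<nu> k) powr w * dterm g k + sip q (\<Psi> k) * \<Psi> k 0) UNIV = infsum (%k. of_real (\<nu> k) powr w * dterm g k) UNIV"
      using False by (simp add: infsum_not_exists)
  qed
qed

definition "S1 f = (%u th. u th - P0 b u th) (mulop (rinvsqrt b) (Hcomm g (mulop (rinvsqrt b) f)))"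

lemma S1_smooth: "smooth_per f ==> smooth_per (S1 f)"
  unfolding S1_def P0_eq by (intro smooth_per_diff smooth_per_scale smooth_mulop ri_smooth Hcomm_smooth g)

lemma coords_S1:
  assumes f: "smooth_per f"
  shows "coords (S1 f) = mv KS (coords f)"
proof
  fix m
  define X where "X = mulop (rinvsqrt b) (Hcomm g (mulop (rinvsqrt b) f))"
  have Xs: "smooth_per X" unfolding X_def by (intro smooth_mulop ri_smooth Hcomm_smooth g f)
  have "mulop (rinvsqrt b) f = (%th. of_real (\<sigma> th) * ww f th)"
    by (auto simp: mulop_def ww_def rq_\<sigma>[symmetric] mult_ac)
  then have wX: "ww X = Hcomm g (%th. of_real (\<sigma> th) * ww f th)"
    unfolding X_def by (auto simp: ww_def mulop_def rq_ri mult.assoc[symmetric])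
  have cP: "coords (P0 b X) m = (if m = 0 then coords X 0 else 0)"
  proof -
    have "ww (P0 b X) = (%th. fc (ww X) 0 * E 0 th)"
      unfolding P0_eq by (auto simp: ww_def mulop_def E_0 rq_ri mult.left_commute)
    then show ?thesis by (simp add: coords_def fc_scale fc_E)
  qed
  have "coords (S1 f) m = coords X m - coords (P0 b X) m"
    unfolding S1_def X_def[symmetric] by (rule coords_diff[OF Xs]) (auto simp: P0_eq intro: smooth_per_scale ri_smooth)
  also have "... = mv KS (coords f) m"
  proof (cases "m = 0")
    case True
    then show ?thesis using cP by (simp add: mv_def KS_def)
  next
    case False
    have "coords X m = of_real (sqrt (2*pi)) * infsum (%n. Qm g m n * fc (ww f) n) UNIV"
      unfolding coords_def wX infsumI[OF Hcomm_fc[OF g ww_smooth[OF f]]] ..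
    also have "... = mv KS (coords f) m"
      unfolding mv_def infsum_cmult_right'[symmetric] by (rule infsum_cong) (use False in \<open>simp add: KS_def coords_def\<close>)
    finally show ?thesis using False cP by simp
  qed
  finally show "coords (S1 f) m = mv KS (coords f) m" .
qed

text \<open>For this \<open>g\<close> the commutator form is \<open>\<i>\<close> times the right
  side of \<open>Hilb_pair_identity\<close> with the weight as \<open>A\<close>; the left side of
  that identity is the bracket in \<open>S2_diag\<close>.\<close>

lemma S2_dterm:
  assumes gb: "(%th. complex_of_real (g th)) = (%th. \<i> * Hilb (%t. complex_of_real (b t)) th)"
  shows "sip (mv KS2 (\<Psi> k)) (\<Psi> k) = - \<i> * (of_real (\<nu> k))\<^sup>2 * dterm g k"
proof -
  let ?A = "%t. complex_of_real (b t)" and ?v = "vv k"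
  note s = Hilb_smooth smooth_mulop b_smooth vv_smooth
  have "mulop (%t. complex_of_real (g t)) u = (%th. \<i> * mulop (Hilb ?A) u th)" for u
    unfolding gb by (auto simp: mulop_def)
  then have "Hcomm g ?v = (%th. \<i> * (Hilb (mulop (Hilb ?A) ?v) th - mulop (Hilb ?A) (Hilb ?v) th))"
    unfolding Hcomm_def by (simp add: Hilb_scale s right_diff_distrib)
  then have "dterm g k = \<i> * (l2inner (Hilb (mulop (Hilb ?A) ?v)) ?v - l2inner (mulop (Hilb ?A) (Hilb ?v)) ?v)"
    unfolding dterm_def by (simp add: l2inner_scale_left l2inner_diff_left s)
  also have "... = \<i> * (l2inner (mulop ?A ?v) ?v - l2inner (mulop ?A (Hilb ?v)) (Hilb ?v))"
    unfolding Hilb_pair_identity[OF b_smooth vv_smooth fcoeff_vv_0] ..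
  finally have d: "dterm g k = \<i> * (l2inner (mulop ?A ?v) ?v - l2inner (mulop ?A (Hilb ?v)) (Hilb ?v))" .
  have ii: "- \<i> * q * (\<i> * x) = q * x" for q x :: complex
  proof -
    have "- \<i> * q * (\<i> * x) = - (\<i> * \<i>) * (q * x)" by (simp only: mult.left_commute mult.assoc minus_mult_left)
    then show ?thesis by simp
  qed
  show ?thesis unfolding S2_diag d ii ..
qed

lemma op_traces:
  assumes Ld: "!!m n. Ld m n = - \<i> * of_int m * of_int n * Qm g m n" and R: "rapid_mat \<kappa>' Ld"
    and op: "!!w f. op_pow A w f = (%th. infsum (%k. complex_of_real (\<nu> k) powr w * l2inner f (\<psi> k) * \<psi> k th) UNIV)"
  shows "op_trace (%f. op_pow A w (S1 f)) = infsum (%k. of_real (\<nu> k) powr w * dterm g k) UNIV"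
    and "(%th. complex_of_real (g th)) = (%th. \<i> * Hilb (%t. complex_of_real (b t)) th) ==>
      op_trace (%f. op_pow A w (%th. Lam_w b (Lam_w b f) th - D_w b (D_w b f) th))
      = infsum (%k. of_real (\<nu> k) powr w * (- \<i> * (of_real (\<nu> k))\<^sup>2 * dterm g k)) UNIV"
proof -
  obtain \<kappa>S where KS: "rapid_mat \<kappa>S KS" using KS_rapid[OF Ld R] by blast
  show "op_trace (%f. op_pow A w (S1 f)) = infsum (%k. of_real (\<nu> k) powr w * dterm g k) UNIV"
    unfolding KS_diag_sum[OF KS, symmetric] by (rule trace_formula[OF S1_smooth coords_S1 KS op])
  assume gb: "(%th. complex_of_real (g th)) = (%th. \<i> * Hilb (%t. complex_of_real (b t)) th)"
  obtain \<kappa>2 where K2: "rapid_mat \<kappa>2 KS2" using KS2_rapid by blast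
  show "op_trace (%f. op_pow A w (%th. Lam_w b (Lam_w b f) th - D_w b (D_w b f) th))
      = infsum (%k. of_real (\<nu> k) powr w * (- \<i> * (of_real (\<nu> k))\<^sup>2 * dterm g k)) UNIV"
    unfolding S2_dterm[OF gb, symmetric]
    by (rule trace_formula[where S="%f th. Lam_w b (Lam_w b f) th - D_w b (D_w b f) th", OF _ coords_S2 K2 op])
       (auto intro!: smooth_per_diff Lam_w_smooth D_w_smooth)
qed

end

end

section \<open>Differentiating the zeta function at parameter 0\<close>

lemma vector_derivative_quotientI:
  fixes f :: cfun
  assumes "((%y. (f y - f 0) / of_real y) \<longlongrightarrow> D) (at 0)"
  shows "(f has_vector_derivative D) (at 0)"
proof -
  have "((%y. norm ((f y - f 0) / of_real y - D)) \<longlongrightarrow> 0) (at 0)"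
    using tendsto_norm[OF tendsto_diff[OF assms tendsto_const[of D]]] by simp
  then have "((%y. norm (f y - f 0 - (y - 0) *\<^sub>R D) / norm (y - 0)) \<longlongrightarrow> 0) (at 0)"
  proof (rule Lim_transform_eventually)
    show "\<forall>\<^sub>F y in at 0. norm ((f y - f 0) / of_real y - D) = norm (f y - f 0 - (y - 0) *\<^sub>R D) / norm (y - 0)"
      using eventually_neq_at_within[of 0 0 UNIV]
    proof eventually_elim
      case (elim y)
      then have "(f y - f 0) / of_real y - D = (f y - f 0 - (y - 0) *\<^sub>R D) / of_real y"
        by (simp add: scaleR_conv_of_real diff_divide_distrib)
      then show ?case by (simp add: norm_divide)
    qed
  qed
  then show ?thesis unfolding has_vector_derivative_def has_derivative_iff_norm by (simp add: bounded_linear_scaleR_left)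
qed

context eigen_wcoord
begin

text \<open>The sums over \<open>k\<close>, \<open>m\<close>, \<open>n\<close> are merged into one
  series with a majorant \<open>W\<close> that depends on the matrices only through
  \<open>\<kappa>1\<close>. Growth in \<open>\<nu> k\<close> is absorbed by
  \<open>eigsys_weight_bound\<close>, whose powers of \<open>br\<close> the decay of order
  \<open>2 * P + 2\<close> repays with two to spare.\<close>

lemma diag_tendsto:
  fixes c :: "nat => complex"
  assumes c: "!!k. norm (c k) <= q * \<nu> k ^ (2 * P)" "q \<ge> 0"
    and D: "\<forall>\<^sub>F \<tau> in F. rapid_mat \<kappa>1 (D \<tau>)" and D0: "rapid_mat \<kappa>1 D0" and lim: "!!m n. ((%\<tau>. D \<tau> m n) \<longlongrightarrow> D0 m n) F"
  shows "((%\<tau>. infsum (%k. c k * sip (mv (D \<tau>) (\<Psi> k)) (\<Psi> k)) UNIV) \<longlongrightarrow> infsum (%k. c k * sip (mv D0 (\<Psi> k)) (\<Psi> k)) UNIV) F"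
proof -
  define f where "f = (%K (k, m, n). c k * (K m n * (\<Psi> k n * cnj (\<Psi> k m))))"
  let ?Q = "q * \<kappa>1 (2 * P + 2)" and ?e = "eig_const \<kappa> P"
  define W where "W = (%(k, m, n). ?Q * (\<nu> k ^ (2 * P) * (norm (\<Psi> k n) * norm (\<Psi> k m)) / (br m ^ (2 * P + 2) * br n ^ (2 * P + 2))))"
  have Q0: "?Q \<ge> 0" using c(2) rapid_mat_nonneg[OF D0] by simp
  have e0: "?e \<ge> 0" by (rule eig_const_nonneg) (rule rapid_mat_nonneg[OF Krapid])
  have W: "W summable_on UNIV"
  proof (rule nonneg_summable_pairI(1))
    show "W p \<ge> 0" for p unfolding W_def using Q0 \<nu>_pos by (auto simp: less_imp_le split: prod.split intro!: mult_nonneg_nonneg divide_nonneg_nonneg)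
    fix J :: "nat set" and L :: "(int \<times> int) set" assume fin: "finite J" "finite L"
    have le: "(\<Sum>k\<in>J. W (k, m, n)) <= ?Q * (2 * ?e) * (1 / (br m ^ 2 * br n ^ 2))" for m n
    proof -
      let ?a = "br m ^ (2 * P)" and ?b = "br n ^ (2 * P)"
      have "(\<Sum>k\<in>J. \<nu> k ^ (2 * P) * (norm (\<Psi> k n) * norm (\<Psi> k m))) <= (\<Sum>k\<in>J. \<nu> k ^ (2 * P) * (norm (\<Psi> k n))\<^sup>2 + \<nu> k ^ (2 * P) * (norm (\<Psi> k m))\<^sup>2)"
      proof (rule sum_mono)
        fix k
        have "norm (\<Psi> k n) * norm (\<Psi> k m) <= (norm (\<Psi> k n))\<^sup>2 + (norm (\<Psi> k m))\<^sup>2"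
          using sum_squares_bound[of "norm (\<Psi> k n)" "norm (\<Psi> k m)"] mult_nonneg_nonneg[OF norm_ge_zero norm_ge_zero, of "\<Psi> k n" "\<Psi> k m"]
          unfolding mult.assoc by linarith
        then show "\<nu> k ^ (2 * P) * (norm (\<Psi> k n) * norm (\<Psi> k m)) <= \<nu> k ^ (2 * P) * (norm (\<Psi> k n))\<^sup>2 + \<nu> k ^ (2 * P) * (norm (\<Psi> k m))\<^sup>2"
          unfolding distrib_left[symmetric] by (intro mult_left_mono) (use \<nu>_pos[of k] in auto)
      qed
      also have "... <= ?e * ?b + ?e * ?a"
        unfolding sum.distrib by (intro add_mono eigsys_weight_bound[OF \<Psi>_eigsys Krapid dref_le_br fin(1)])
      also have "... <= 2 * ?e * (?a * ?b)"
      proof -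
        have "?b <= ?a * ?b" "?a <= ?a * ?b"
          using mult_right_mono[OF br_power_ge_1[of m "2 * P"], of ?b] mult_left_mono[OF br_power_ge_1[of n "2 * P"], of ?a] by (auto simp: less_imp_le)
        then have "?e * ?b + ?e * ?a <= ?e * (?a * ?b) + ?e * (?a * ?b)" by (intro add_mono mult_left_mono e0)
        then show ?thesis by simp
      qed
      finally have S: "(\<Sum>k\<in>J. \<nu> k ^ (2 * P) * (norm (\<Psi> k n) * norm (\<Psi> k m))) <= 2 * ?e * (?a * ?b)" .
      have "(\<Sum>k\<in>J. W (k, m, n)) = ?Q * ((\<Sum>k\<in>J. \<nu> k ^ (2 * P) * (norm (\<Psi> k n) * norm (\<Psi> k m))) / (br m ^ (2 * P + 2) * br n ^ (2 * P + 2)))"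
        unfolding W_def by (simp only: prod.case sum_distrib_left[symmetric] sum_divide_distrib)
      also have "... <= ?Q * (2 * ?e * (?a * ?b) / (br m ^ (2 * P + 2) * br n ^ (2 * P + 2)))"
        by (intro mult_left_mono divide_right_mono S Q0) (simp add: less_imp_le)
      also have "... = ?Q * (2 * ?e) * (1 / (br m ^ 2 * br n ^ 2))" by (simp add: power_add power2_eq_square field_simps)
      finally show ?thesis .
    qed
    have "(\<Sum>k\<in>J. \<Sum>x\<in>L. W (k, x)) = (\<Sum>x\<in>L. \<Sum>k\<in>J. W (k, x))" by (rule sum.swap)
    also have "... <= (\<Sum>x\<in>L. ?Q * (2 * ?e) * (%(m,n). 1 / (br m ^ 2 * br n ^ 2)) x)"
      using le by (intro sum_mono) (auto split: prod.split)
    also have "... <= ?Q * (2 * ?e) * brsum\<^sup>2"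
      unfolding sum_distrib_left[symmetric] infsum_br_pair[symmetric] using Q0 e0 fin
      by (intro mult_left_mono finite_sum_le_infsum summable_br_pair) (auto simp: less_imp_le)
    finally show "(\<Sum>k\<in>J. \<Sum>x\<in>L. W (k, x)) <= ?Q * (2 * ?e) * brsum\<^sup>2" .
  qed
  have le: "norm (f K p) <= W p" if K: "rapid_mat \<kappa>1 K" for K p
  proof -
    obtain k m n where p: "p = (k, m, n)" by (cases p) auto
    have Kb: "norm (K m n) <= \<kappa>1 (2 * P + 2) / (br m ^ (2 * P + 2) * br n ^ (2 * P + 2))" using K unfolding rapid_mat_def by blast
    have "norm (f K p) <= (q * \<nu> k ^ (2 * P)) * (\<kappa>1 (2 * P + 2) / (br m ^ (2 * P + 2) * br n ^ (2 * P + 2)) * (norm (\<Psi> k n) * norm (\<Psi> k m)))"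
      unfolding f_def p prod.case norm_mult complex_mod_cnj
      by (intro mult_mono c(1) Kb) (use c(2) \<nu>_pos[of k] rapid_mat_nonneg[OF K] in \<open>auto simp: less_imp_le intro!: mult_nonneg_nonneg divide_nonneg_nonneg\<close>)
    then show ?thesis by (simp add: W_def p mult_ac)
  qed
  have eq: "infsum (f K) UNIV = infsum (%k. c k * sip (mv K (\<Psi> k)) (\<Psi> k)) UNIV" if K: "rapid_mat \<kappa>1 K" for K
  proof -
    have "f K summable_on UNIV \<times> UNIV" using norm_infsum_le_infsum(1)[OF W le[OF K]] by simp
    then have "infsum (f K) (UNIV \<times> UNIV) = infsum (%k. infsum (%x. f K (k, x)) UNIV) UNIV"
      by (intro infsum_Sigma_banach[symmetric]) (auto simp: case_prod_eta)
    also have "(%k. infsum (%x. f K (k, x)) UNIV) = (%k. c k * sip (mv K (\<Psi> k)) (\<Psi> k))"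
      unfolding sip_mv_pair(2)[OF K \<Psi>_le_1 \<Psi>_le_1] infsum_cmult_right'[symmetric] by (simp add: f_def case_prod_unfold)
    finally show ?thesis by simp
  qed
  have "((%\<tau>. infsum (%p. f (D \<tau>) p) UNIV) \<longlongrightarrow> infsum (f D0) UNIV) F"
  proof (rule tendsto_infsum_dominated[OF W])
    show "\<forall>\<^sub>F \<tau> in F. \<forall>p\<in>UNIV. norm (f (D \<tau>) p) <= W p" using D by eventually_elim (use le in blast)
    show "((%\<tau>. f (D \<tau>) p) \<longlongrightarrow> f D0 p) F" for p
      unfolding f_def by (cases p) (auto intro!: tendsto_intros lim)
  qed
  then have "((%\<tau>. infsum (f (D \<tau>)) UNIV) \<longlongrightarrow> infsum (%k. c k * sip (mv D0 (\<Psi> k)) (\<Psi> k)) UNIV) F"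
    unfolding eq[OF D0] by simp
  then show ?thesis
    by (rule Lim_transform_eventually) (rule eventually_mono[OF D], rule eq)
qed

end

context coord_family
begin

lemma Ld_rapid: "\<forall>\<tau>\<in>T. rapid_mat (%N. \<kappa> N * \<bar>\<tau>\<bar>) (%m n. KF \<tau> m n - KF 0 m n) ==> rapid_mat \<kappa> Ld"
  and quot_rapid: "\<forall>\<tau>\<in>T. rapid_mat (%N. \<kappa> N * \<bar>\<tau>\<bar>) (%m n. KF \<tau> m n - KF 0 m n) ==>
    \<forall>\<^sub>F \<tau> in at 0. rapid_mat \<kappa> (%m n. (KF \<tau> m n - KF 0 m n) / of_real \<tau>)"
proof -
  assume R: "\<forall>\<tau>\<in>T. rapid_mat (%N. \<kappa> N * \<bar>\<tau>\<bar>) (%m n. KF \<tau> m n - KF 0 m n)"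
  have "\<forall>\<^sub>F \<tau> in at 0. \<tau> \<in> T - {0}" by (rule eventually_at_in_open) (use T0 in auto)
  then show ev: "\<forall>\<^sub>F \<tau> in at 0. rapid_mat \<kappa> (%m n. (KF \<tau> m n - KF 0 m n) / of_real \<tau>)"
  proof eventually_elim
    case (elim \<tau>)
    show ?case unfolding rapid_mat_def
    proof (intro allI)
      fix N m n
      have "norm (KF \<tau> m n - KF 0 m n) <= \<kappa> N * \<bar>\<tau>\<bar> / (br m ^ N * br n ^ N)" using R elim unfolding rapid_mat_def by blast
      then have "norm (KF \<tau> m n - KF 0 m n) / \<bar>\<tau>\<bar> <= (\<kappa> N * \<bar>\<tau>\<bar> / (br m ^ N * br n ^ N)) / \<bar>\<tau>\<bar>" by (rule divide_right_mono) simp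
      then show "norm ((KF \<tau> m n - KF 0 m n) / of_real \<tau>) <= \<kappa> N / (br m ^ N * br n ^ N)"
        using elim by (simp add: norm_divide)
    qed
  qed
  show "rapid_mat \<kappa> Ld" unfolding rapid_mat_def
  proof (intro allI)
    fix N m n
    show "norm (Ld m n) <= \<kappa> N / (br m ^ N * br n ^ N)"
      by (rule Lim_norm_ubound[OF _ KF_limit]) (use ev in \<open>auto simp: rapid_mat_def elim!: eventually_mono\<close>)
  qed
qed

text \<open>By \<open>sd0\<close> the \<tau>-derivative of \<open>E n\<close> at 0 is
  \<open>- \<i>\<close> times \<open>g * X n\<close>. In |p| = sgn(p) p the factor \<open>p\<close>
  turns \<open>cf\<close> into coefficients of \<open>X\<close> and the sign becomes a Hilbert
  transform. Parseval then shows the commutator between \<open>X n\<close> and \<open>X m\<close>,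
  and \<open>X n\<close> is \<open>n\<close> times \<open>sE n\<close>.\<close>

lemma Ld_commutator:
  assumes g: "smooth_per (%t. complex_of_real (g t))" and sd0: "!!th. sd 0 th = - g th * \<sigma> 0 th"
  shows "Ld m n = - \<i> * of_int m * of_int n * coord.Qm (s 0) (\<sigma> 0) g m n"
proof -
  interpret C: coord "s 0" "\<sigma> 0" by (rule coord[OF T0])
  let ?g = "mulop (%t. complex_of_real (g t))"
  define X where "X = (%n. Dop (C.E n))"
  have Xs: "smooth_per (X n)" for n unfolding X_def by (rule Dop_smooth[OF C.E_smooth])
  have X: "X n = (%th. of_int n * C.sE n th)" for n
    unfolding X_def Dop_vder C.E_vder C.sE_def by (simp add: fun_eq_iff mult.assoc[symmetric])
  note sm = Xs smooth_mulop g Hilb_smooth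
  have fX: "of_int p * cf 0 n p = fcoeff (X n) p" for n p
    unfolding X_def fcoeff_Dop[OF C.E_smooth] cf_def e_def ..
  have cd: "cd 0 n p = - \<i> * fcoeff (?g (X n)) p" for n p
  proof -
    have "?g (X n) = (%th. - of_int n * (of_real (sd 0 th) * e 0 n th))"
      unfolding X C.sE_def mulop_def e_def sd0 by (simp add: fun_eq_iff)
    then have "fcoeff (?g (X n)) p = - of_int n * fcoeff (%th. of_real (sd 0 th) * e 0 n th) p"
      using idc.fc_scale[of "- of_int n"] by (simp add: idc_fc)
    then show ?thesis unfolding cd_def by simp
  qed
  have tm: "of_int \<bar>p\<bar> * (cd 0 n p * cnj (cf 0 m p) + cf 0 n p * cnj (cd 0 m p))
    = - \<i> * (fcoeff (Hilb (?g (X n))) p * cnj (fcoeff (X m) p) - fcoeff (Hilb (X n)) p * cnj (fcoeff (?g (X m)) p))" for p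
  proof -
    have a: "complex_of_int \<bar>p\<bar> = of_int (sgn p) * of_int p" by (metis abs_sgn mult.commute of_int_mult)
    have 1: "fcoeff (X m) p = of_int p * cf 0 m p" "fcoeff (Hilb (X n)) p = of_int (sgn p) * (of_int p * cf 0 n p)"
      "fcoeff (Hilb (?g (X n))) p = of_int (sgn p) * fcoeff (?g (X n)) p"
      by (simp_all add: fX fcoeff_Hilb sm)
    show ?thesis unfolding a cd 1 by (simp add: algebra_simps)
  qed
  have "((%p. - \<i> * (fcoeff (Hilb (?g (X n))) p * cnj (fcoeff (X m) p) - fcoeff (Hilb (X n)) p * cnj (fcoeff (?g (X m)) p)))
    has_sum - \<i> * (l2inner (Hilb (?g (X n))) (X m) / (2 * pi) - l2inner (Hilb (X n)) (?g (X m)) / (2 * pi))) UNIV"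
    by (intro has_sum_cmult_right has_sum_minus parseval_id smooth_per_continuous sm)
  then have "Ld m n = - \<i> * (l2inner (Hilb (?g (X n))) (X m) / (2 * pi) - l2inner (Hilb (X n)) (?g (X m)) / (2 * pi))"
    unfolding Ld_def tm by (rule infsumI)
  also have "... = - \<i> * (l2inner (Hcomm g (X n)) (X m) / (2 * pi))"
    unfolding Hcomm_def by (simp add: l2inner_diff_left sm l2inner_mulop_real diff_divide_distrib)
  also have "... = - \<i> * of_int m * of_int n * C.Qm g m n"
    unfolding X Hcomm_scale[OF g C.sE_smooth] l2inner_scale_left l2inner_scale_right C.Qm_def C.fc_l2 by simp
  finally show ?thesis .
qed

text \<open>All zeta functions of the family are compared with the single system
  \<open>\<psi>\<close>, \<open>\<nu>\<close>. The comparison has an error of order \<tau> squared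
  by \<open>G_first_order\<close>, and its linear part, divided by \<tau>, converges by
  \<open>diag_tendsto\<close>.\<close>

theorem zeta_derivative:
  assumes \<kappa>: "\<forall>\<tau>\<in>T. rapid_mat \<kappa> (KF \<tau>)" and b: "!!\<tau> th. \<tau> \<in> T ==> b \<tau> th = 1 / \<sigma> \<tau> th"
    and ew: "eigen_wcoord (s 0) (\<sigma> 0) (b 0) \<kappa> \<psi> \<nu> \<delta>'"
  shows "((%\<tau>. zeta_minus_2R (b \<tau>) z) has_vector_derivative
    infsum (%k. - z * of_real (\<nu> k) powr (- z - 1) * sip (mv Ld (wcoord.coords (s 0) (\<sigma> 0) (b 0) (\<psi> k))) (wcoord.coords (s 0) (\<sigma> 0) (b 0) (\<psi> k))) UNIV) (at 0)"
proof -
  interpret W: eigen_wcoord "s 0" "\<sigma> 0" "b 0" \<kappa> \<psi> \<nu> \<delta>' by (rule ew)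
  obtain C0 where C0: "!!\<tau> th. \<tau> \<in> T ==> norm (complex_of_real (\<sigma> \<tau> th)) <= C0" using sfam_bdd[OF \<sigma>_fam] by blast
  define C where "C = max 1 C0"
  have C: "\<sigma> \<tau> th <= C" "C > 0" if "\<tau> \<in> T" for \<tau> th using C0[OF that, of th] by (auto simp: C_def)
  have C': "C > 0" by (simp add: C_def)
  define d where "d = min \<delta>' (min 1 (1 / C))"
  have d: "0 < d" "d <= 1" "!!k. d <= \<nu> k"
    using W.\<delta> C' by (auto simp: d_def intro: min.coboundedI1)
  obtain \<kappa>1 where R: "\<forall>\<tau>\<in>T. rapid_mat (%N. \<kappa>1 N * \<bar>\<tau>\<bar>) (%m n. KF \<tau> m n - KF 0 m n)" using KF_diff_rapid by blast
  define cc where "cc = (%k. - z * complex_of_real (\<nu> k) powr (- z - 1))"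
  define L where "L = (%\<tau>. infsum (%k. cc k * sip (mv (%m n. KF \<tau> m n - KF 0 m n) (W.\<Psi> k)) (W.\<Psi> k)) UNIV)"
  define Z where "Z = (%z. infsum (%k. complex_of_real (\<nu> k) powr (- z)) UNIV - infsum (%n. complex_of_real (dref n) powr (- z)) UNIV)"
  obtain M :: nat where M: "\<bar>Re z\<bar> + 2 <= real M" using real_arch_simple by blast
  define A where "A = norm z * norm (z + 1) / d ^ (3 * (2 * M)) * (eig_const \<kappa> M * eig_const \<kappa> M * (\<kappa>1 2 * brsum\<^sup>2) * (\<kappa>1 (2 * M + 2) * brsum\<^sup>2))"
  have KF0: "KF 0 = W.Km" by (simp add: KF_def)
  \<comment> \<open>\<open>Z\<close> collects what does not depend on \<tau>. It represents
    convergent sums only for real part above 1, and is eliminated in \<open>est\<close> before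
    passing to the given \<open>z\<close>.\<close>
  have pair: "\<exists>G. G holomorphic_on UNIV \<and> (\<forall>z. Re z > 1 \<longrightarrow> zeta_minus_2R (b \<tau>) z = G z + Z z) \<and> zeta_minus_2R (b \<tau>) holomorphic_on UNIV \<and>
      norm (G z - L \<tau>) <= A * \<tau>\<^sup>2" if \<tau>: "\<tau> \<in> T" for \<tau>
  proof -
    have wc: "wcoord (s \<tau>) (\<sigma> \<tau>) (b \<tau>) \<kappa>"
      by (rule wcoord.intro[OF coord[OF \<tau>]], unfold_locales) (use \<kappa> \<tau> b in \<open>auto simp: KF_def\<close>)
    obtain \<Phi> :: "nat => int => complex" and \<mu> where es: "eigsys dref (KF \<tau>) \<Phi> \<mu>"
      and low: "!!C j. (!!th. \<sigma> \<tau> th <= C) ==> C > 0 ==> \<mu> j \<ge> min 1 (1 / C)"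
      and hol: "zeta_minus_2R (b \<tau>) holomorphic_on UNIV"
      and val: "!!z. Re z > 1 ==> zeta_minus_2R (b \<tau>) z = infsum (%j. complex_of_real (\<mu> j) powr (- z)) UNIV
        - infsum (%n. complex_of_real (dref n) powr (- z)) UNIV"
      using wcoord.zeta_wcoord[OF wc] unfolding KF_def by metis
    have dm: "d <= \<mu> j" for j using low[OF C[OF \<tau>], of j] by (simp add: d_def min.coboundedI2)
    have K0: "rapid_mat \<kappa> (KF 0)" and K: "rapid_mat \<kappa> (KF \<tau>)" using \<kappa> T0 \<tau> by auto
    have e0: "eigsys dref (KF 0) W.\<Psi> \<nu>" unfolding KF0 by (rule W.\<Psi>_eigsys)
    note sp = eigsys_spectral_pair[OF es K KF_herm[OF \<tau>] e0 K0 dref_le_br R[rule_format, OF \<tau>] d(1,2) dm d(3) W.\<nu>_summable]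
    interpret SP: spectral_pair \<mu> \<nu> "%j k. sip (W.\<Psi> k) (\<Phi> j)" d by (rule sp(1))
    have "zeta_minus_2R (b \<tau>) z = SP.G z + Z z" if "Re z > 1" for z
      using SP.summable_powr(2)[OF W.\<nu>_powr_summable[OF that]] val[OF that] by (simp add: Z_def algebra_simps)
    moreover have "norm (SP.G z - L \<tau>) <= A * \<tau>\<^sup>2"
    proof -
      have P: "\<bar>Re z\<bar> + 2 <= real (2 * M)" using M by simp
      have "norm (SP.G z - L \<tau>) <= norm z * norm (z + 1) / d ^ (3 * (2 * M))
        * infsum (%(j,k). (\<mu> j * \<nu> k) ^ (2 * M) * (\<mu> j - \<nu> k)\<^sup>2 * (norm (sip (W.\<Psi> k) (\<Phi> j)))\<^sup>2) UNIV"
        using SP.G_first_order[OF P] unfolding L_def cc_def sp(3) .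
      also have "... <= norm z * norm (z + 1) / d ^ (3 * (2 * M)) * (eig_const \<kappa> M * eig_const \<kappa> M * (\<kappa>1 2 * \<bar>\<tau>\<bar> * brsum\<^sup>2) * (\<kappa>1 (2 * M + 2) * \<bar>\<tau>\<bar> * brsum\<^sup>2))"
        by (intro mult_left_mono sp(2)) (use d in auto)
      also have "... = A * (\<bar>\<tau>\<bar> * \<bar>\<tau>\<bar>)" unfolding A_def by (simp add: mult_ac)
      finally show ?thesis by (simp add: power2_eq_square)
    qed
    ultimately show ?thesis using SP.G_holomorphic hol by blast
  qed
  define Ze where "Ze = (%\<tau>. zeta_minus_2R (b \<tau>) z)"
  have L0: "L 0 = 0" by (simp add: L_def mv_def sip_def)
  have est: "norm (Ze \<tau> - Ze 0 - L \<tau>) <= A * \<tau>\<^sup>2" if \<tau>: "\<tau> \<in> T" for \<tau>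
  proof -
    obtain G where G: "G holomorphic_on UNIV" "!!z. Re z > 1 ==> zeta_minus_2R (b \<tau>) z = G z + Z z" "zeta_minus_2R (b \<tau>) holomorphic_on UNIV"
      "norm (G z - L \<tau>) <= A * \<tau>\<^sup>2" using pair[OF \<tau>] by blast
    obtain H where H: "H holomorphic_on UNIV" "!!z. Re z > 1 ==> zeta_minus_2R (b 0) z = H z + Z z" "zeta_minus_2R (b 0) holomorphic_on UNIV"
      "norm (H z - L 0) <= A * 0\<^sup>2" using pair[OF T0] by blast
    \<comment> \<open>Both sides are entire and equal \<open>Z\<close> for real part above 1. The
      parameter 0 is treated like any other, because the system obtained there from
      \<open>zeta_wcoord\<close> need not be \<open>\<psi>\<close>, \<open>\<nu>\<close>; its error
      bound is 0 and forces \<open>H z = 0\<close>.\<close>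
    have "(%z. zeta_minus_2R (b \<tau>) z - G z) z = (%z. zeta_minus_2R (b 0) z - H z) z"
      by (rule entire_eqI) (auto intro!: holomorphic_intros G(1,3) H(1,3) simp: G(2) H(2))
    moreover have "H z = 0" using H(4) by (simp add: L0)
    ultimately show ?thesis using G(4) by (simp add: Ze_def algebra_simps)
  qed
  define D where "D = infsum (%k. cc k * sip (mv Ld (W.\<Psi> k)) (W.\<Psi> k)) UNIV"
  have Llim: "((%\<tau>. L \<tau> / of_real \<tau>) \<longlongrightarrow> D) (at 0)"
  proof -
    have Re: "\<bar>Re (- z - 1)\<bar> <= real M" using M by simp
    have cb: "norm (cc k) <= (norm z / \<delta>' ^ (3 * M)) * \<nu> k ^ (2 * M)" for k
      unfolding cc_def norm_mult using mult_left_mono[OF W.\<nu>_powr_le[OF Re, of k], of "norm z"] by simp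
    have "((%\<tau>. infsum (%k. cc k * sip (mv (%m n. (KF \<tau> m n - KF 0 m n) / of_real \<tau>) (W.\<Psi> k)) (W.\<Psi> k)) UNIV) \<longlongrightarrow> D) (at 0)"
      unfolding D_def
      by (rule W.diag_tendsto[OF cb _ quot_rapid[OF R] Ld_rapid[OF R] KF_limit]) (use W.\<delta> in auto)
    moreover have "infsum (%k. cc k * sip (mv (%m n. (KF \<tau> m n - KF 0 m n) / of_real \<tau>) (W.\<Psi> k)) (W.\<Psi> k)) UNIV = L \<tau> / of_real \<tau>" for \<tau>
    proof -
      have "mv (%m n. (KF \<tau> m n - KF 0 m n) / of_real \<tau>) x = (%m. (1 / of_real \<tau>) * mv (%m n. KF \<tau> m n - KF 0 m n) x m)" for x
        unfolding mv_def infsum_cmult_right'[symmetric] by simp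
      then show ?thesis unfolding L_def by (simp add: sip_scale_left mult.left_commute[of "cc _"] infsum_cmult_right' divide_inverse mult.commute[of _ "inverse (of_real \<tau>)"])
    qed
    ultimately show ?thesis by (simp only:)
  qed
  have "((%\<tau>. (Ze \<tau> - Ze 0) / of_real \<tau>) \<longlongrightarrow> D) (at 0)"
  proof -
    have "((%\<tau>. (Ze \<tau> - Ze 0 - L \<tau>) / of_real \<tau>) \<longlongrightarrow> 0) (at 0)"
    proof (rule Lim_null_comparison)
      have "\<forall>\<^sub>F \<tau> in at 0. \<tau> \<in> T - {0}" by (rule eventually_at_in_open) (use T0 in auto)
      then show "\<forall>\<^sub>F \<tau> in at 0. norm ((Ze \<tau> - Ze 0 - L \<tau>) / of_real \<tau>) <= A * \<bar>\<tau>\<bar>"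
      proof eventually_elim
        case (elim \<tau>)
        then have "norm (Ze \<tau> - Ze 0 - L \<tau>) / \<bar>\<tau>\<bar> <= A * \<tau>\<^sup>2 / \<bar>\<tau>\<bar>" using est[of \<tau>] by (intro divide_right_mono) auto
        then show ?case using elim by (simp add: norm_divide power2_eq_square abs_if split: if_splits)
      qed
      show "((%\<tau>. A * \<bar>\<tau>\<bar>) \<longlongrightarrow> 0) (at 0)" by (auto intro!: tendsto_eq_intros)
    qed
    from tendsto_add[OF this Llim] show ?thesis by (simp add: diff_divide_distrib)
  qed
  then show ?thesis unfolding D_def Ze_def cc_def by (rule vector_derivative_quotientI)
qed

end

section \<open>Arc length coordinates of a family of weights\<close>

text \<open>The primitive that vanishes at 0, on the whole line: integrals over empty intervals are
  0, so at most one of the two terms contributes.\<close>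

definition ip :: "(real => real) => real => real" where
  "ip f th = integral {0..th} f - integral {th..0} f"

lemma ip_pos: "th \<ge> 0 ==> ip f th = integral {0..th} f"
  by (cases "th = 0") (auto simp: ip_def)

lemma ip_deriv:
  assumes f: "continuous_on UNIV f"
  shows "(ip f has_real_derivative f th) (at th)"
proof -
  define R where "R = \<bar>th\<bar> + 1"
  have cf: "continuous_on S f" for S by (rule continuous_on_subset[OF f]) simp
  have "((%x. integral {-R..x} f) has_real_derivative f th) (at th within {-R..R})"
    by (rule integral_has_real_derivative[OF cf]) (auto simp: R_def)
  then have "((%x. integral {-R..x} f) has_real_derivative f th) (at th)"
    by (subst (asm) at_within_interior) (auto simp: R_def)
  from DERIV_diff[OF this DERIV_const[of "integral {-R..0} f"]]
  have "((%x. integral {-R..x} f - integral {-R..0} f) has_real_derivative f th) (at th)" by simp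
  then show ?thesis
  proof (rule has_field_derivative_transform_within_open[where S="{-R<..<R}"])
    fix x assume x: "x \<in> {-R<..<R}"
    show "integral {-R..x} f - integral {-R..0} f = ip f x"
    proof (cases "x \<ge> 0")
      case True
      then have "integral {-R..0} f + integral {0..x} f = integral {-R..x} f"
        by (intro Henstock_Kurzweil_Integration.integral_combine integrable_continuous_interval cf) (auto simp: R_def)
      then show ?thesis using ip_pos[OF True, of f] by simp
    next
      case False
      then have "integral {-R..x} f + integral {x..0} f = integral {-R..0} f"
        using x by (intro Henstock_Kurzweil_Integration.integral_combine integrable_continuous_interval cf) auto
      then show ?thesis using False by (simp add: ip_def)
    qed
  qed (auto simp: R_def)
qed

lemma ip_period:
  assumes f: "continuous_on UNIV f" and per: "!!th. f (th + 2 * pi) = f th"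
  shows "ip f (th + 2 * pi) = ip f th + integral {0..2*pi} f"
proof -
  have "((%th. ip f (th + 2 * pi) - ip f th) has_real_derivative 0) (at th)" for th
    using DERIV_diff[OF DERIV_shift[THEN iffD1, OF ip_deriv[OF f, of "th + 2 * pi"]] ip_deriv[OF f, of th]] by (simp add: per)
  then have "ip f (th + 2 * pi) - ip f th = ip f (0 + 2 * pi) - ip f 0"
    using DERIV_isconst_all[of "%th. ip f (th + 2 * pi) - ip f th" th 0] by blast
  then show ?thesis by (simp add: ip_pos)
qed

lemma continuous_on_lipschitz_second:
  fixes F :: "real => real => real"
  assumes 1: "!!y. y \<in> B ==> continuous_on A (%x. F x y)" and 2: "!!x y y'. x \<in> A ==> \<bar>F x y - F x y'\<bar> <= C * \<bar>y - y'\<bar>"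
  shows "continuous_on (A \<times> B) (%(x, y). F x y)"
  unfolding continuous_on_def
proof
  fix p assume p: "p \<in> A \<times> B"
  obtain x0 y0 where p0: "p = (x0, y0)" by (cases p)
  let ?S = "A \<times> B"
  have c1: "continuous_on ?S (%q. F (fst q) y0)"
    by (rule continuous_on_compose2[OF 1 continuous_on_fst[OF continuous_on_id]]) (use p p0 in auto)
  have l1: "((%q. F (fst q) y0) \<longlongrightarrow> F x0 y0) (at p within ?S)"
    using c1 p unfolding continuous_on_def by (auto simp: p0)
  have "((%q. (case q of (x, y) => F x y) - F x0 y0) \<longlongrightarrow> 0) (at p within ?S)"
  proof (rule Lim_null_comparison)
    show "\<forall>\<^sub>F q in at p within ?S. norm ((case q of (x, y) => F x y) - F x0 y0) <= C * \<bar>snd q - y0\<bar> + \<bar>F (fst q) y0 - F x0 y0\<bar>"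
      unfolding eventually_at_filter
    proof (rule always_eventually, intro allI impI)
      fix q assume "q \<in> ?S"
      then have "\<bar>F (fst q) (snd q) - F (fst q) y0\<bar> <= C * \<bar>snd q - y0\<bar>" by (intro 2) auto
      then show "norm ((case q of (x, y) => F x y) - F x0 y0) <= C * \<bar>snd q - y0\<bar> + \<bar>F (fst q) y0 - F x0 y0\<bar>"
        unfolding case_prod_beta real_norm_def by linarith
    qed
    have "((%q. C * \<bar>snd q - y0\<bar> + \<bar>F (fst q) y0 - F x0 y0\<bar>) \<longlongrightarrow> C * \<bar>snd p - y0\<bar> + \<bar>F x0 y0 - F x0 y0\<bar>) (at p within ?S)"
      by (intro tendsto_intros l1)
    then show "((%q. C * \<bar>snd q - y0\<bar> + \<bar>F (fst q) y0 - F x0 y0\<bar>) \<longlongrightarrow> 0) (at p within ?S)" by (simp add: p0)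
  qed
  then show "((%(x, y). F x y) \<longlongrightarrow> (case p of (x, y) => F x y)) (at p within ?S)"
    by (subst Lim_null) (simp add: p0)
qed

locale weight_family =
  fixes \<epsilon> :: real and \<alpha> :: "real => real => real"
  assumes eps: "\<epsilon> > 0" and smooth: "smooth2_on ({-\<epsilon><..<\<epsilon>} \<times> UNIV) \<alpha>"
    and per: "!!\<tau> th. \<tau> \<in> {-\<epsilon><..<\<epsilon>} ==> \<alpha> \<tau> (th + 2 * pi) = \<alpha> \<tau> th"
    and pos: "!!\<tau> th. \<tau> \<in> {-\<epsilon><..<\<epsilon>} ==> \<alpha> \<tau> th > 0"
    and nrm: "!!\<tau>. \<tau> \<in> {-\<epsilon><..<\<epsilon>} ==> integral {0..2*pi} (%th. 1 / \<alpha> \<tau> th) = 2 * pi"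
begin

abbreviation "I \<equiv> {-\<epsilon><..<\<epsilon>}"
text \<open>Half of the parameter interval: its closure lies inside \<open>I\<close>, so compactness
  gives bounds uniform in \<tau>.\<close>

abbreviation "T \<equiv> {-(\<epsilon>/2)<..<\<epsilon>/2}"
abbreviation "D ws \<equiv> pds ws \<alpha>"

lemma TI: "\<tau> \<in> T ==> \<tau> \<in> I"
  using eps by auto

lemma D_cont: "continuous_on (I \<times> UNIV) (%(t, x). D ws t x)"
  using smooth unfolding smooth2_on_def by blast

lemma D_1: "t \<in> I ==> ((%s. D ws s x) has_real_derivative D (ws @ [True]) t x) (at t)"
  using smooth unfolding smooth2_on_def by (auto simp: pds_def pd1_def DERIV_deriv_iff_real_differentiable)

lemma D_2: "t \<in> I ==> (D ws t has_real_derivative D (ws @ [False]) t x) (at x)"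
  using smooth unfolding smooth2_on_def by (auto simp: pds_def pd2_def DERIV_deriv_iff_real_differentiable)

lemma D_per: "t \<in> I ==> D ws t (x + 2 * pi) = D ws t x"
proof (induction ws arbitrary: t x rule: rev_induct)
  case Nil
  then show ?case by (simp add: pds_def per)
next
  case (snoc w ws)
  show ?case
  proof (cases w)
    case True
    have "((%s. D ws s x) has_real_derivative D (ws @ [True]) t (x + 2 * pi)) (at t)"
      by (rule has_field_derivative_transform_within_open[OF D_1[OF snoc.prems], where S=I]) (use snoc in auto)
    then show ?thesis using DERIV_unique[OF _ D_1[OF snoc.prems]] True by simp
  next
    case False
    have "((%y. D ws t (y + 2 * pi)) has_real_derivative D (ws @ [False]) t (x + 2 * pi)) (at x)"
      using D_2[OF snoc.prems, of ws "x + 2 * pi"] DERIV_shift by blast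
    then have "(D ws t has_real_derivative D (ws @ [False]) t (x + 2 * pi)) (at x)" by (simp add: snoc.IH[OF snoc.prems])
    then show ?thesis using DERIV_unique[OF _ D_2[OF snoc.prems]] False by simp
  qed
qed

lemma bounded_family:
  assumes c: "continuous_on (I \<times> UNIV) (%(t, x). F t x :: real)" and p: "!!t x. t \<in> I ==> F t (x + 2 * pi) = F t x"
  shows "\<exists>C. \<forall>\<tau>\<in>T. \<forall>th. \<bar>F \<tau> th\<bar> <= C"
proof -
  have "compact ((%(t, x). F t x) ` ({-(\<epsilon>/2)..\<epsilon>/2} \<times> {0..2*pi}))"
    by (intro compact_continuous_image continuous_on_subset[OF c] compact_Times) (use eps in auto)
  from compact_imp_bounded[OF this]
  obtain C where C: "!!t x. t \<in> {-(\<epsilon>/2)..\<epsilon>/2} ==> x \<in> {0..2*pi} ==> \<bar>F t x\<bar> <= C"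
    unfolding bounded_iff by fastforce
  have "\<bar>F \<tau> th\<bar> <= C" if \<tau>: "\<tau> \<in> T" for \<tau> th
  proof -
    obtain th' k where th': "th' \<in> {0..<2*pi}" "th = th' + of_int k * (2 * pi)" using period_reduce by blast
    have "F \<tau> th = F \<tau> th'" unfolding th'(2) by (rule periodic_int) (rule p[OF TI[OF \<tau>]])
    then show ?thesis using C[of \<tau> th'] \<tau> th'(1) by auto
  qed
  then show ?thesis by blast
qed

lemma D_sfam: "sfam T (%\<tau> th. complex_of_real (D ws \<tau> th))"
proof -
  have "kb n T (%\<tau> th. complex_of_real (D ws \<tau> th))" for n
  proof (induction n arbitrary: ws)
    case 0
    then show ?case using bounded_family[OF D_cont D_per, of ws] by simp
  next
    case (Suc n)
    have d: "((%th. complex_of_real (D ws \<tau> th)) has_vector_derivative of_real (D (ws @ [False]) \<tau> th)) (at th)" if "\<tau> \<in> T" for \<tau> th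
      by (intro has_vector_derivative_of_real D_2 TI[OF that])
    have "kb n T (%\<tau>. vder (%th. complex_of_real (D ws \<tau> th))) = kb n T (%\<tau> th. complex_of_real (D (ws @ [False]) \<tau> th))"
      by (rule kb_cong) (auto intro!: vder_eqI d)
    then show ?case using bounded_family[OF D_cont D_per, of ws] Suc differentiableI_vector[OF d] by simp
  qed
  then show ?thesis by (auto simp: sfam_def D_per TI)
qed

lemma D_Nil: "D [] = \<alpha>"
  by (simp add: pds_def)

abbreviation "\<sigma> \<tau> th \<equiv> 1 / \<alpha> \<tau> th"
text \<open>Minus the \<tau>-derivative of \<open>\<sigma>\<close>, see
  \<open>\<sigma>_deriv\<close>.\<close>

abbreviation "\<rho> \<tau> th \<equiv> D [True] \<tau> th * (\<sigma> \<tau> th * \<sigma> \<tau> th)"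

lemma \<sigma>_cont: "continuous_on (I \<times> UNIV) (%(t, x). \<sigma> t x)"
  using D_cont[of "[]"] pos unfolding D_Nil by (auto simp: case_prod_unfold less_imp_neq[symmetric] intro!: continuous_intros)

lemma \<rho>_cont: "continuous_on (I \<times> UNIV) (%(t, x). \<rho> t x)"
  using continuous_on_mult[OF D_cont[of "[True]"] continuous_on_mult[OF \<sigma>_cont \<sigma>_cont]] by (simp add: case_prod_unfold)

lemma \<sigma>_per: "\<tau> \<in> I ==> \<sigma> \<tau> (th + 2 * pi) = \<sigma> \<tau> th"
  by (simp add: per)

lemma slice_cont:
  assumes "continuous_on (I \<times> UNIV) (%(t, x). F t x :: real)" "\<tau> \<in> I"
  shows "continuous_on S (F \<tau>)"
proof -
  have "continuous_on S (%x. (%(t, x). F t x) (\<tau>, x))"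
    by (rule continuous_on_compose2[OF assms(1)]) (use assms(2) in \<open>auto intro!: continuous_intros\<close>)
  then show ?thesis by simp
qed

lemma \<alpha>_bounds: obtains c c' where "c > 0" "c' > 0" "!!\<tau> th. \<tau> \<in> T ==> c <= \<sigma> \<tau> th" "!!\<tau> th. \<tau> \<in> T ==> c' <= \<alpha> \<tau> th"
proof -
  obtain C where C: "!!\<tau> th. \<tau> \<in> T ==> \<bar>\<alpha> \<tau> th\<bar> <= C" using bounded_family[OF D_cont[of "[]"] D_per] unfolding D_Nil by blast
  obtain B where B: "!!\<tau> th. \<tau> \<in> T ==> \<bar>\<sigma> \<tau> th\<bar> <= B" using bounded_family[OF \<sigma>_cont \<sigma>_per] by blast
  have T0: "0 \<in> T" using eps by simp
  have "C > 0" using C[OF T0, of 0] pos[OF TI[OF T0], of 0] by linarith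
  moreover have "B > 0"
  proof -
    have "0 < \<sigma> 0 0" using pos[OF TI[OF T0], of 0] by simp
    then show ?thesis using B[OF T0, of 0] by linarith
  qed
  moreover have "1 / C <= \<sigma> \<tau> th" "1 / B <= \<alpha> \<tau> th" if "\<tau> \<in> T" for \<tau> th
    using C[OF that, of th] B[OF that, of th] pos[OF TI[OF that], of th] \<open>C > 0\<close> \<open>B > 0\<close> by (auto simp: field_simps)
  ultimately show ?thesis using that[of "1 / C" "1 / B"] by simp
qed

lemma \<sigma>_sfam: "sfam T (%\<tau> th. complex_of_real (\<sigma> \<tau> th))"
proof -
  obtain c c' where "c' > 0" "!!\<tau> th. \<tau> \<in> T ==> c' <= \<alpha> \<tau> th" using \<alpha>_bounds by metis
  then have "sfam T (%\<tau> th. 1 / complex_of_real (\<alpha> \<tau> th))"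
    by (intro sfam_inverse[OF D_sfam[of "[]", unfolded D_Nil]]) (auto intro: order_trans[OF _ abs_ge_self])
  then show ?thesis by simp
qed

lemma \<rho>_sfam: "sfam T (%\<tau> th. complex_of_real (\<rho> \<tau> th))"
  unfolding of_real_mult by (intro sfam_mult D_sfam \<sigma>_sfam)

lemma \<sigma>_deriv: "\<tau> \<in> I ==> ((%\<tau>. \<sigma> \<tau> th) has_real_derivative - \<rho> \<tau> th) (at \<tau>)"
  using DERIV_inverse'[OF D_1[of \<tau> "[]" th]] pos[of \<tau> th] unfolding D_Nil by (simp add: divide_inverse mult_ac)

lemma integral_\<sigma>_deriv:
  assumes "\<tau> \<in> I"
  shows "((%\<tau>. integral {a..b} (\<sigma> \<tau>)) has_real_derivative - integral {a..b} (\<rho> \<tau>)) (at \<tau>)"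
proof -
  have "((%\<tau>. integral (cbox a b) (\<sigma> \<tau>)) has_field_derivative integral (cbox a b) (%th. - \<rho> \<tau> th)) (at \<tau> within I)"
  proof (rule leibniz_rule_field_derivative[where fx="%\<tau> th. - \<rho> \<tau> th"])
    show "((%\<tau>. \<sigma> \<tau> t) has_field_derivative - \<rho> \<tau> t) (at \<tau> within I)" if "\<tau> \<in> I" for \<tau> t
      by (rule has_field_derivative_at_within[OF \<sigma>_deriv[OF that]])
    show "\<sigma> \<tau> integrable_on cbox a b" if "\<tau> \<in> I" for \<tau>
      using integrable_continuous_interval[OF slice_cont[OF \<sigma>_cont that]] by simp
    show "continuous_on (I \<times> cbox a b) (%(\<tau>, t). - \<rho> \<tau> t)"
    proof -
      have "continuous_on (I \<times> cbox a b) (%(t, x). \<rho> t x)" by (rule continuous_on_subset[OF \<rho>_cont]) auto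
      from continuous_on_minus[OF this] show ?thesis by (simp add: case_prod_unfold)
    qed
  qed (use assms in auto)
  then show ?thesis using assms by (simp add: at_within_open[OF _ open_greaterThanLessThan] integral_minus)
qed

text \<open>The normalisation keeps the integral of \<open>\<sigma>\<close> over a period constant
  in \<tau>. This is what makes \<open>sd\<close> periodic.\<close>

lemma integral_\<rho>: "\<tau> \<in> I ==> integral {0..2*pi} (\<rho> \<tau>) = 0"
proof -
  assume \<tau>: "\<tau> \<in> I"
  have "((%\<tau>. 2 * pi) has_real_derivative - integral {0..2*pi} (\<rho> \<tau>)) (at \<tau>)"
    by (rule has_field_derivative_transform_within_open[OF integral_\<sigma>_deriv[OF \<tau>], where S=I]) (use \<tau> nrm in auto)
  then show ?thesis using DERIV_unique[OF _ DERIV_const[of "2 * pi"]] by fastforce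
qed

text \<open>The summand \<open>\<tau> * k\<close> only rotates the arc length parameter and leaves
  \<open>\<sigma>\<close> unchanged. It adjusts the one constant of integration that
  \<open>sd_0\<close> needs.\<close>

definition s :: "real => real => real => real" where "s k \<tau> th = ip (\<sigma> \<tau>) th - \<tau> * k"
definition sd :: "real => real => real => real" where "sd k \<tau> th = - ip (\<rho> \<tau>) th - k"

lemma s_deriv2: "\<tau> \<in> I ==> (s k \<tau> has_real_derivative \<sigma> \<tau> th) (at th)"
  unfolding s_def using DERIV_diff[OF ip_deriv[OF slice_cont[OF \<sigma>_cont]] DERIV_const] by fastforce

lemma sd_deriv2: "\<tau> \<in> I ==> (sd k \<tau> has_real_derivative - \<rho> \<tau> th) (at th)"
  unfolding sd_def using DERIV_diff[OF DERIV_minus[OF ip_deriv[OF slice_cont[OF \<rho>_cont]]] DERIV_const] by fastforce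

lemma sd_per: "\<tau> \<in> I ==> sd k \<tau> (th + 2 * pi) = sd k \<tau> th"
proof -
  assume \<tau>: "\<tau> \<in> I"
  have p: "\<rho> \<tau> (th + 2 * pi) = \<rho> \<tau> th" for th using D_per[OF \<tau>] per[OF \<tau>] by simp
  show ?thesis unfolding sd_def ip_period[OF slice_cont[OF \<rho>_cont \<tau>] p] integral_\<rho>[OF \<tau>] by simp
qed

lemma real_lipschitz:
  assumes "!!th. (f has_real_derivative f' th) (at th)" "!!th. \<bar>f' th\<bar> <= C"
  shows "\<bar>f x - f y :: real\<bar> <= C * \<bar>x - y\<bar>"
  using vector_mean_value_bound[of UNIV f f' C x y] assms by (simp add: has_real_derivative_iff_has_vector_derivative)

theorem coord_family_s: obtains c where "coord_family (\<epsilon>/2) (s k) \<sigma> (sd k) c"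
proof -
  obtain c where c: "c > 0" "!!\<tau> th. \<tau> \<in> T ==> c <= \<sigma> \<tau> th" using \<alpha>_bounds by metis
  obtain B where B: "!!\<tau> th. \<tau> \<in> T ==> \<bar>\<sigma> \<tau> th\<bar> <= B" using bounded_family[OF \<sigma>_cont \<sigma>_per] by blast
  obtain R where R: "!!\<tau> th. \<tau> \<in> T ==> \<bar>- \<rho> \<tau> th\<bar> <= R"
    using bounded_family[OF \<rho>_cont] D_per \<sigma>_per unfolding abs_minus_cancel by metis
  have sT: "((%\<tau>. s k \<tau> th) has_real_derivative sd k \<tau> th) (at \<tau>)" if "\<tau> \<in> T" "th \<in> {0..2*pi}" for \<tau> th
    using DERIV_diff[OF integral_\<sigma>_deriv[OF TI[OF that(1)], of 0 th] DERIV_cmult_right[OF DERIV_ident, of k]] that(2)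
    by (simp add: s_def sd_def ip_pos)
  have sd_c: "continuous_on T (%\<tau>. sd k \<tau> th)" if "th \<in> {0..2*pi}" for th
  proof -
    have "continuous_on T (%\<tau>. integral (cbox 0 th) (\<rho> \<tau>))"
      by (rule integral_continuous_on_param) (rule continuous_on_subset[OF \<rho>_cont], use TI in auto)
    then show ?thesis using that by (simp add: sd_def ip_pos continuous_intros)
  qed
  have sd_lip: "\<bar>sd k \<tau> th - sd k \<tau> th'\<bar> <= R * \<bar>th - th'\<bar>" if "\<tau> \<in> T" for \<tau> th th'
    by (rule real_lipschitz[OF sd_deriv2[OF TI[OF that]] R[OF that]])
  \<comment> \<open>Joint continuity comes from continuity in \<tau> for fixed theta and a Lipschitz
    bound in theta that is uniform in \<tau>.\<close>
  have sdc: "continuous_on (T \<times> {0..2*pi}) (%(\<tau>, th). sd k \<tau> th)"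
    by (rule continuous_on_lipschitz_second[OF sd_c sd_lip])
  have s_c: "continuous_on T (%\<tau>. s k \<tau> th)" if "th \<in> {0..2*pi}" for th
    using sT[OF _ that] DERIV_isCont by (intro continuous_at_imp_continuous_on) blast
  have s_lip: "\<bar>s k \<tau> th - s k \<tau> th'\<bar> <= B * \<bar>th - th'\<bar>" if "\<tau> \<in> T" for \<tau> th th'
    by (rule real_lipschitz[OF s_deriv2[OF TI[OF that]] B[OF that]])
  have sd_sfam: "sfam T (%\<tau> th. complex_of_real (sd k \<tau> th))"
  proof -
    obtain C where C: "!!\<tau>. \<tau> \<in> T ==> \<bar>sd k \<tau> 0\<bar> <= C" by (auto simp: sd_def ip_pos)
    have bd: "\<bar>sd k \<tau> th\<bar> <= C + R * (2 * pi)" if \<tau>: "\<tau> \<in> T" for \<tau> th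
    proof -
      obtain th' j where th': "th' \<in> {0..<2*pi}" "th = th' + of_int j * (2 * pi)" using period_reduce by blast
      have "sd k \<tau> th = sd k \<tau> th'" unfolding th'(2) by (rule periodic_int) (rule sd_per[OF TI[OF \<tau>]])
      moreover have "\<bar>sd k \<tau> th' - sd k \<tau> 0\<bar> <= R * (2 * pi)"
      proof -
        have "R \<ge> 0" using R[OF \<tau>, of 0] by linarith
        then have "R * \<bar>th' - 0\<bar> <= R * (2 * pi)" using th'(1) by (intro mult_left_mono) auto
        then show ?thesis using sd_lip[OF \<tau>, of th' 0] by linarith
      qed
      ultimately show ?thesis using C[OF \<tau>] by linarith
    qed
    show ?thesis
    proof (rule sfam_ode[where C="C + R * (2 * pi)" and k=0 and F="%\<tau> th. (-1) * complex_of_real (\<rho> \<tau> th)"])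
      show "\<forall>\<tau>\<in>T. \<forall>th. norm (complex_of_real (sd k \<tau> th)) <= C + R * (2 * pi)" using bd by simp
      show "\<forall>\<tau>\<in>T. \<forall>th. complex_of_real (sd k \<tau> (th + 2 * pi)) = complex_of_real (sd k \<tau> th)" by (simp add: sd_per TI)
      show "((%th. complex_of_real (sd k \<tau> th)) has_vector_derivative (-1) * complex_of_real (\<rho> \<tau> th) * complex_of_real (sd k \<tau> th) ^ 0) (at th)"
        if "\<tau> \<in> T" for \<tau> th
      proof -
        have "((%th. complex_of_real (sd k \<tau> th)) has_vector_derivative of_real (- \<rho> \<tau> th)) (at th)"
          by (rule has_vector_derivative_of_real[OF sd_deriv2[OF TI[OF that]]])
        then show ?thesis by simp
      qed
      show "sfam T (%\<tau> th. (-1) * complex_of_real (\<rho> \<tau> th))"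
        by (rule sfam_mult[OF sfam_const[where C=1] \<rho>_sfam]) simp
    qed
  qed
  have "coord_family (\<epsilon>/2) (s k) \<sigma> (sd k) c"
  proof (rule coord_family.intro)
    show "\<epsilon> / 2 > 0" using eps by simp
    show "coord (s k \<tau>) (\<sigma> \<tau>)" if "\<tau> \<in> T" for \<tau>
    proof
      show "(s k \<tau> has_real_derivative \<sigma> \<tau> th) (at th)" for th by (rule s_deriv2[OF TI[OF that]])
      show "s k \<tau> (th + 2 * pi) = s k \<tau> th + 2 * pi" for th
        using ip_period[OF slice_cont[OF \<sigma>_cont TI[OF that]] \<sigma>_per[OF TI[OF that]], of th] nrm[OF TI[OF that]] by (simp add: s_def)
      show "\<sigma> \<tau> th > 0" for th using pos[OF TI[OF that]] by simp
      show "smooth_per (%th. complex_of_real (\<sigma> \<tau> th))" by (rule sfam_smooth[OF \<sigma>_sfam that])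
    qed
    show "continuous_on (T \<times> {0..2*pi}) (%(\<tau>, th). s k \<tau> th)"
      by (rule continuous_on_lipschitz_second[OF s_c s_lip])
  qed (use c sT sdc sd_sfam \<sigma>_sfam in auto)
  then show ?thesis by (rule that)
qed

text \<open>\<open>eq\<close> divided by the square of the weight says that
  \<open>g / \<alpha> 0\<close> has derivative \<open>\<rho> 0\<close>. It differs from
  \<open>ip (\<rho> 0)\<close> by a constant, namely its value at 0, which is the chosen
  \<open>k\<close>.\<close>

lemma sd_0:
  assumes g: "!!th. (g has_real_derivative g' th) (at th)" and a: "!!th. (\<alpha> 0 has_real_derivative a' th) (at th)"
    and eq: "!!th. \<alpha> 0 th * g' th - a' th * g th = D [True] 0 th"
  shows "sd (g 0 / \<alpha> 0 0) 0 th = - g th * \<sigma> 0 th"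
proof -
  have I0: "0 \<in> I" using eps by simp
  let ?f = "%th. ip (\<rho> 0) th - g th / \<alpha> 0 th"
  have "(?f has_real_derivative 0) (at th)" for th
  proof -
    have nz: "\<alpha> 0 th \<noteq> 0" using pos[OF I0, of th] by simp
    have z: "\<rho> 0 th - (g' th * \<alpha> 0 th - g th * a' th) / (\<alpha> 0 th * \<alpha> 0 th) = 0"
      unfolding eq[symmetric] using nz by (simp add: field_simps)
    show ?thesis using DERIV_diff[OF ip_deriv[OF slice_cont[OF \<rho>_cont I0], of th] DERIV_divide[OF g a nz]] unfolding z .
  qed
  then have "?f th = ?f 0" using DERIV_isconst_all[of ?f th 0] by blast
  then show ?thesis by (simp add: sd_def ip_pos)
qed

end

theorem theorem4p1:
  fixes \<epsilon> :: real and a g :: "real \<Rightarrow> real" and \<alpha> :: "real \<Rightarrow> real \<Rightarrow> real"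
  assumes eps: "\<epsilon> > 0"
    and a_smooth: "smooth_per (\<lambda>\<theta>. complex_of_real (a \<theta>))"
    and a_pos: "\<forall>\<theta>. a \<theta> > 0"
    and \<alpha>_smooth: "smooth2_on ({-\<epsilon><..<\<epsilon>} \<times> UNIV) \<alpha>"
    and \<alpha>_per: "\<forall>\<tau>\<in>{-\<epsilon><..<\<epsilon>}. \<forall>\<theta>. \<alpha> \<tau> (\<theta> + 2 * pi) = \<alpha> \<tau> \<theta>"
    and \<alpha>_0: "\<alpha> 0 = a"
    and \<alpha>_pos: "\<forall>\<tau>\<in>{-\<epsilon><..<\<epsilon>}. \<forall>\<theta>. \<alpha> \<tau> \<theta> > 0"
    and \<alpha>_norm: "\<forall>\<tau>\<in>{-\<epsilon><..<\<epsilon>}. integral {0..2*pi} (\<lambda>\<theta>. 1 / \<alpha> \<tau> \<theta>) = 2 * pi"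
    and g_smooth: "smooth_per (\<lambda>\<theta>. complex_of_real (g \<theta>))"
    and g_eq: "\<forall>\<theta>. a \<theta> * deriv g \<theta> - deriv a \<theta> * g \<theta> = deriv (\<lambda>\<tau>. \<alpha> \<tau> \<theta>) 0"
    and g_mean: "integral {0..2*pi} g = 0"
  shows "(\<forall>z. ((\<lambda>\<tau>. zeta_minus_2R (\<alpha> \<tau>) z) has_vector_derivative
             (- \<i> * z * op_trace (\<lambda>f.
                op_pow (\<lambda>h \<theta>. Lam_w a h \<theta> + P0 a h \<theta>) (1 - z)
                  ((\<lambda>u \<theta>. u \<theta> - P0 a u \<theta>)
                    (mulop (rinvsqrt a)
                      ((\<lambda>v \<theta>. Hilb (mulop (\<lambda>t. complex_of_real (g t)) v) \<theta>
                            - mulop (\<lambda>t. complex_of_real (g t)) (Hilb v) \<theta>)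
                        (mulop (rinvsqrt a) f))))))) (at 0))
         \<and> ((\<lambda>\<theta>. complex_of_real (g \<theta>)) = (\<lambda>\<theta>. \<i> * Hilb (\<lambda>t. complex_of_real (a t)) \<theta>) \<longrightarrow>
            (\<forall>z. ((\<lambda>\<tau>. zeta_minus_2R (\<alpha> \<tau>) z) has_vector_derivative
               (z * op_trace (\<lambda>f.
                  op_pow (\<lambda>h \<theta>. Lam_w a h \<theta> + P0 a h \<theta>) (- z - 1)
                    (\<lambda>\<theta>. Lam_w a (Lam_w a f) \<theta> - D_w a (D_w a f) \<theta>)))) (at 0)))"
proof -
  interpret W: weight_family \<epsilon> \<alpha>
    by unfold_locales (use eps \<alpha>_smooth \<alpha>_per \<alpha>_pos \<alpha>_norm in auto)
  define k where "k = g 0 / a 0"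
  obtain c0 where cfam: "coord_family (\<epsilon>/2) (W.s k) W.\<sigma> (W.sd k) c0" by (rule W.coord_family_s)
  interpret F: coord_family "\<epsilon>/2" "W.s k" W.\<sigma> "W.sd k" c0 by (rule cfam)
  obtain \<kappa> where \<kappa>: "\<forall>\<tau>\<in>F.T. rapid_mat \<kappa> (F.KF \<tau>)" using F.KF_rapid by blast
  have sd0: "W.sd k 0 \<theta> = - g \<theta> * W.\<sigma> 0 \<theta>" for \<theta>
    unfolding k_def \<alpha>_0[symmetric]
    by (rule W.sd_0[OF smooth_per_real_deriv(1)[OF g_smooth] smooth_per_real_deriv(1)[OF a_smooth, folded \<alpha>_0]])
       (use g_eq in \<open>simp add: \<alpha>_0 pds_def pd1_def\<close>)
  note Ld = F.Ld_commutator[OF g_smooth sd0]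
  obtain \<kappa>1 where "\<forall>\<tau>\<in>F.T. rapid_mat (\<lambda>N. \<kappa>1 N * \<bar>\<tau>\<bar>) (\<lambda>m n. F.KF \<tau> m n - F.KF 0 m n)" using F.KF_diff_rapid by blast
  note LdR = F.Ld_rapid[OF this]
  have wc: "wcoord (W.s k 0) (W.\<sigma> 0) a \<kappa>"
    by (rule wcoord.intro[OF F.coord[OF F.T0]], unfold_locales) (use \<kappa> F.T0 in \<open>auto simp: F.KF_def \<alpha>_0\<close>)
  interpret C: wcoord "W.s k 0" "W.\<sigma> 0" a \<kappa> by (rule wc)
  let ?A = "\<lambda>h \<theta>. Lam_w a h \<theta> + P0 a h \<theta>"
  obtain C0 where C0: "\<And>\<theta>. W.\<sigma> 0 \<theta> \<le> C0" "C0 > 0" using C.\<sigma>_bdd by blast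
  define d where "d = min 1 (1 / C0)"
  have d: "0 < d" "d \<le> 1" using C0 by (auto simp: d_def)
  have low: "d \<le> \<nu> k" if eb: "eigenbasis ?A \<psi> \<nu>" for \<psi> \<nu> k
  proof -
    have "smooth_per (\<psi> k)" "?A (\<psi> k) = (\<lambda>\<theta>. of_real (\<nu> k) * \<psi> k \<theta>)" "l2inner (\<psi> k) (\<psi> k) = 1"
      using eb unfolding eigenbasis_def by auto
    from C.P0_eig_lower[OF this C0] show ?thesis unfolding d_def .
  qed
  \<comment> \<open>The very choice made inside \<open>op_pow\<close>, so that trace and derivative
    are computed in the same eigenbasis. The positivity demanded there follows from the gap
    \<open>d\<close>.\<close>
  define p where "p = (SOME p. eigenbasis ?A (fst p) (snd p) \<and> (\<forall>k. snd p k > 0))"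
  have p: "eigenbasis ?A (fst p) (snd p)"
  proof -
    obtain \<phi> l where "eigenbasis (Lam_w a) \<phi> l" using C.eigenbasis_exists by blast
    from C.eigenbasis_P0(1)[OF this] obtain \<mu> where \<mu>: "eigenbasis ?A \<phi> \<mu>" by blast
    have "\<mu> k > 0" for k using low[OF \<mu>, of k] d(1) by linarith
    then have "eigenbasis ?A (fst (\<phi>, \<mu>)) (snd (\<phi>, \<mu>)) \<and> (\<forall>k. snd (\<phi>, \<mu>) k > 0)" using \<mu> by simp
    then have "eigenbasis ?A (fst p) (snd p) \<and> (\<forall>k. snd p k > 0)" unfolding p_def by (rule someI)
    then show ?thesis by blast
  qed
  define \<psi> where "\<psi> = fst p"
  define \<nu> where "\<nu> = snd p"
  have eb: "eigenbasis ?A \<psi> \<nu>" unfolding \<psi>_def \<nu>_def by (rule p)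
  have op: "op_pow ?A w f = (\<lambda>\<theta>. infsum (\<lambda>k. complex_of_real (\<nu> k) powr w * l2inner f (\<psi> k) * \<psi> k \<theta>) UNIV)" for w f
    unfolding op_pow_def p_def[symmetric] \<psi>_def \<nu>_def Let_def ..
  interpret E: eigen_wcoord "W.s k 0" "W.\<sigma> 0" a \<kappa> \<psi> \<nu> d
    by (rule eigen_wcoord.intro[OF wc], unfold_locales) (use eb d low[OF eb] in auto)
  have ew: "eigen_wcoord (W.s k 0) (W.\<sigma> 0) (\<alpha> 0) \<kappa> \<psi> \<nu> d" using E.eigen_wcoord_axioms unfolding \<alpha>_0 .
  \<comment> \<open>The square of \<open>\<nu> k\<close> from \<open>Ld_diag\<close> raises the
    exponent \<open>- z - 1\<close> of the first order term to \<open>1 - z\<close>, the exponent in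
    the first trace.\<close>
  have powr: "complex_of_real (\<nu> k) powr (- z - 1) * (of_real (\<nu> k))\<^sup>2 = of_real (\<nu> k) powr (1 - z)" for k z
  proof -
    have nz: "complex_of_real (\<nu> k) \<noteq> 0" using E.\<nu>_pos[of k] by simp
    have "complex_of_real (\<nu> k) powr (- z - 1) * of_real (\<nu> k) powr 2 = of_real (\<nu> k) powr ((- z - 1) + 2)"
      by (rule powr_add[symmetric])
    then show ?thesis using nz by (simp add: algebra_simps)
  qed
  have der: "((\<lambda>\<tau>. zeta_minus_2R (\<alpha> \<tau>) z) has_vector_derivative - \<i> * z * infsum (\<lambda>k. of_real (\<nu> k) powr (1 - z) * E.dterm g k) UNIV) (at 0)" for z
  proof -
    have "((\<lambda>\<tau>. zeta_minus_2R (\<alpha> \<tau>) z) has_vector_derivative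
      infsum (\<lambda>k. - z * of_real (\<nu> k) powr (- z - 1) * sip (mv F.Ld (E.\<Psi> k)) (E.\<Psi> k)) UNIV) (at 0)"
      using F.zeta_derivative[where b=\<alpha> and z=z, OF \<kappa> _ ew] unfolding \<alpha>_0 by simp
    moreover have "- z * of_real (\<nu> k) powr (- z - 1) * sip (mv F.Ld (E.\<Psi> k)) (E.\<Psi> k) = - \<i> * z * (of_real (\<nu> k) powr (1 - z) * E.dterm g k)" for k
      unfolding E.Ld_diag[OF g_smooth Ld] powr[symmetric] by simp
    ultimately show ?thesis by (simp only: infsum_cmult_right')
  qed
  note tr = E.op_traces[OF g_smooth Ld LdR op]
  have S1: "(\<lambda>u \<theta>. u \<theta> - P0 a u \<theta>) (mulop (rinvsqrt a)
      ((\<lambda>v \<theta>. Hilb (mulop (\<lambda>t. complex_of_real (g t)) v) \<theta> - mulop (\<lambda>t. complex_of_real (g t)) (Hilb v) \<theta>)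
        (mulop (rinvsqrt a) f))) = E.S1 g f" for f
    unfolding E.S1_def[OF g_smooth] Hcomm_def ..
  show ?thesis
  proof (intro conjI allI impI)
    fix z
    show "((\<lambda>\<tau>. zeta_minus_2R (\<alpha> \<tau>) z) has_vector_derivative
             (- \<i> * z * op_trace (\<lambda>f.
                op_pow (\<lambda>h \<theta>. Lam_w a h \<theta> + P0 a h \<theta>) (1 - z)
                  ((\<lambda>u \<theta>. u \<theta> - P0 a u \<theta>)
                    (mulop (rinvsqrt a)
                      ((\<lambda>v \<theta>. Hilb (mulop (\<lambda>t. complex_of_real (g t)) v) \<theta>
                            - mulop (\<lambda>t. complex_of_real (g t)) (Hilb v) \<theta>)
                        (mulop (rinvsqrt a) f))))))) (at 0)"
      unfolding S1 tr(1) by (rule der)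
  next
    fix z
    assume gb: "(\<lambda>\<theta>. complex_of_real (g \<theta>)) = (\<lambda>\<theta>. \<i> * Hilb (\<lambda>t. complex_of_real (a t)) \<theta>)"
    \<comment> \<open>Here the square of \<open>\<nu> k\<close> comes from the traced operator
      itself, so the exponent in the trace stays at \<open>- z - 1\<close>, and its factor
      \<open>- \<i>\<close> accounts for the different prefactor.\<close>
    have tm: "complex_of_real (\<nu> k) powr (- z - 1) * (- \<i> * (of_real (\<nu> k))\<^sup>2 * E.dterm g k) = - \<i> * (of_real (\<nu> k) powr (1 - z) * E.dterm g k)" for k
      unfolding powr[symmetric] by simp
    show "((\<lambda>\<tau>. zeta_minus_2R (\<alpha> \<tau>) z) has_vector_derivative
               (z * op_trace (\<lambda>f.
                  op_pow (\<lambda>h \<theta>. Lam_w a h \<theta> + P0 a h \<theta>) (- z - 1)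
                    (\<lambda>\<theta>. Lam_w a (Lam_w a f) \<theta> - D_w a (D_w a f) \<theta>)))) (at 0)"
      unfolding tr(2)[OF gb] tm infsum_cmult_right' using der[of z] by (simp add: mult.left_commute mult.assoc)
  qed
qed

end
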